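(* Let $T$ be a finite alphabet. If a language $L\subseteq T^*$ is the string language of some string abstract categorial grammar $G=(\Sigma,Str_T,\phi,S)$, then $L=L(G')$ for some linear logic grammar $G'$ over the alphabet $T$.
   Context: Linear $\lambda$-calculus. Linear implicational types over a set $N$ of atomic types: atoms, and $A\multimap B$ for types $A,B$. Linear $\lambda$-terms over variables $X$ and constants $C$: variables, constants, applications $(ts)$ with $t,s$ having disjoint free variables, and abstractions $\lambda x.t$ where $x$ occurs free in $t$ exactly once. Typing judgements $x_1:A_1,\dots,x_n:A_n\vdash t:A$ ($x_i$ distinct) are derived by: $x:A\vdash x:A$; from $\Gamma\vdash t:A\multimap B$ and $\Delta\vdash s:A$ infer $\Gamma,\Delta\vdash (ts):B$; from $\Gamma,x:A,\Delta\vdash t:B$ infer $\Gamma,\Delta\vdash\lambda x.t:A\multimap B$. A linear signature $\Sigma=(N,C,\mathfrak T)$ consists of finite sets $N$ of atomic types and $C$ of constants and a type $\mathfrak T(c)$ for each $c\in C$; $\Gamma\vdash_\Sigma t:A$ means derivable using additionally the axioms $\vdash c:\mathfrak T(c)$. A map of signatures $\phi:\Sigma_1\to\Sigma_2$ consists of a map $F$ on types with $F(A\multimap B)=F(A)\multimap F(B)$ and a map $G$ from constants of $\Sigma_1$ to terms with $\vdash_{\Sigma_2}G(c):F(\mathfrak T_1(c))$, extended to terms by $G(x)=x$, $G(ts)=G(t)G(s)$, $G(\lambda x.t)=\lambda x.G(t)$; write $\phi$ for both. An abstract categorial grammar (ACG) is $G=(\Sigma_{abstr},\Sigma_{obj},\phi,S)$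 with linear signatures, a map $\phi:\Sigma_{abstr}\to\Sigma_{obj}$ and an atomic type $S$ of $\Sigma_{abstr}$. The string signature $Str_T$ has one atomic type $O$, constants $T$, and $\mathfrak T(c)=O\multimap O$ for all $c\in T$; write $str=O\multimap O$. For $a_1\dots a_n\in T^*$ let $\rho(a_1\dots a_n)=\lambda x.a_1(\dots(a_n x)\dots)$. A string ACG is an ACG with $\Sigma_{obj}=Str_T$; its string language is $L(G)=\{w\in T^*:\rho(w)\text{ is }\beta\eta\text{-equivalent to }\phi(t)\text{ for some closed }t\text{ with }\vdash_{\Sigma}t:S\}$. Linear logic grammars (LLG). (Cowordisms.) A boundary $X$ is a natural number $|X|$ with a subset $X_l\subseteq\{1,\dots,|X|\}$ of left endpoints; $X_r$ is its complement. $X\otimes Y$: $|X\otimes Y|=|X|+|Y|$, $(X\otimes Y)_l=X_l\cup\{|X|+i:i\in Y_l\}$; $\mathbf 1$ has cardinality $0$; $X^\perp$: $|X^\perp|=|X|$, $(X^\perp)_l=\{|X|+1-i:i\in X_r\}$. A regular multiword with boundary $X$ over $T$ is a perfect matching of $\{1,\dots,|X|\}$ by edges $(i,w,j)$, $w\in T^*$, each from a left endpoint $i$ to a right endpoint $j$; a multiword also carries a finite multiset of cyclic words (its singular part) and is regular if this is empty. A cowordism $\sigma:X\to Y$ is a multiword with boundary $Y\otimes X^\perp$ (vertex $|Y|+|X|+1-i$ representing vertex $i$ of $X$). Composition glues vertex $i$ of $\sigma:X\to Y$ to vertex $|Z|+|Y|+1-i$ of $\tau:Y\to Z$, concatenating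 labels along paths and collecting closed cycles as cyclic words; $\mathrm{id}_X$ consists of $\epsilon$-labelled edges joining $i$ and $2|X|+1-i$. (Logic.) LL formulas over positive literals $N$: literals $P,P^\perp$ combined by $\otimes,\wp$, with De Morgan negation; rules Id $\vdash A^\perp,A$, Cut, Exchange, $\wp$ (from $\vdash\Gamma,A,B$ infer $\vdash\Gamma,A\wp B$), $\otimes$ (from $\vdash\Gamma,A$ and $\vdash B,\Delta$ infer $\vdash\Gamma,A\otimes B,\Delta$). With boundaries $[P]$ for literals, $[A\otimes B]=[A]\otimes[B]$, $[A^\perp]=[A]^\perp$, $[A_1,\dots,A_n]=[A_n]\otimes\dots\otimes[A_1]$; derivations are interpreted as multiwords with boundary $[\Gamma]$: Id as $\mathrm{id}_{[A]}$, Ex by permuting vertex blocks, $\wp$ trivially, $\otimes$ as the union of multiwords with blocks arranged as $[\Delta]\otimes[A]\otimes[B]\otimes[\Gamma]$, Cut by gluing the $[A]$ block of one premise to the $[A]^\perp$ block of the other (order-reversingly) as in composition. An LLG $G'=(N,T,Lex,S)$ has finite $N$ of literals with boundaries, a finite lexicon $Lex$ of pairs $\sigma/\vdash\Gamma$ ($\sigma$ a multiword with boundary $[\Gamma]$), and $S\in N$ with $[S]$ having one left and one right endpoint; $\sigma/\vdash\Gamma$ is derivable if some LL derivation of $\vdash\Gamma$ from lexicon sequents (interpreted by their cowordisms) has interpretation $\sigma$; $L(G')$ is the set of labels $w$ of the single edge of regular $\sigma$ with $\sigma/\vdash S$ derivable. *)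

theory Defs
  imports Main "HOL-Library.Multiset"
begin

section \<open>Linear \<open>\<lambda>\<close>-calculus\<close>

datatype 'n ltype = Atom 'n | Limp "'n ltype" "'n ltype"  (infixr \<open>-\<circ>\<close> 65)

definition types :: "'n set \<Rightarrow> 'n ltype set" where
  "types N = {A. set_ltype A \<subseteq> N}"

text \<open>
  Terms are in de Bruijn notation, so that they are taken up to \<open>\<alpha>\<close>-equivalence. The
  variables \<open>Var i\<close> that are free in a term play the role of named variables.
\<close>

datatype 'c lterm = Var nat | Const 'c | App "'c lterm" "'c lterm" | Abs "'c lterm"

primrec lift :: "'c lterm \<Rightarrow> nat \<Rightarrow> 'c lterm" where
  "lift (Var i) k = (if i < k then Var i else Var (Suc i))"
| "lift (Const c) k = Const c"
| "lift (App t s) k = App (lift t k) (lift s k)"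
| "lift (Abs t) k = Abs (lift t (Suc k))"

primrec subst :: "'c lterm \<Rightarrow> 'c lterm \<Rightarrow> nat \<Rightarrow> 'c lterm" where
  "subst (Var i) u k = (if k < i then Var (i - 1) else if i = k then u else Var i)"
| "subst (Const c) u k = Const c"
| "subst (App t s) u k = App (subst t u k) (subst s u k)"
| "subst (Abs t) u k = Abs (subst t (lift u 0) (Suc k))"

inductive beta_eta :: "'c lterm \<Rightarrow> 'c lterm \<Rightarrow> bool" where
  beta: "beta_eta (App (Abs t) s) (subst t s 0)"
| eta: "beta_eta (Abs (App (lift t 0) (Var 0))) t"
| appL: "beta_eta t t' \<Longrightarrow> beta_eta (App t s) (App t' s)"
| appR: "beta_eta s s' \<Longrightarrow> beta_eta (App t s) (App t s')"
| abs: "beta_eta t t' \<Longrightarrow> beta_eta (Abs t) (Abs t')"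

definition beta_eta_equiv :: "'c lterm \<Rightarrow> 'c lterm \<Rightarrow> bool" where
  "beta_eta_equiv = equivclp beta_eta"

primrec occurrences :: "'c lterm \<Rightarrow> nat \<Rightarrow> nat" where
  "occurrences (Var i) x = (if i = x then 1 else 0)"
| "occurrences (Const c) x = 0"
| "occurrences (App t s) x = occurrences t x + occurrences s x"
| "occurrences (Abs t) x = occurrences t (Suc x)"

primrec linear_term :: "'c lterm \<Rightarrow> bool" where
  "linear_term (Var i) = True"
| "linear_term (Const c) = True"
| "linear_term (App t s) = (linear_term t \<and> linear_term s \<and>
     (\<forall>x. occurrences t x = 0 \<or> occurrences s x = 0))"
| "linear_term (Abs t) = (linear_term t \<and> occurrences t 0 = 1)"

record ('n, 'c) signature =
  atoms :: "'n set"
  constants :: "'c set"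
  ctype :: "'c \<Rightarrow> 'n ltype"

definition linear_signature :: "('n, 'c) signature \<Rightarrow> bool" where
  "linear_signature \<Sigma> \<longleftrightarrow> finite (atoms \<Sigma>) \<and> finite (constants \<Sigma>) \<and>
     (\<forall>c \<in> constants \<Sigma>. ctype \<Sigma> c \<in> types (atoms \<Sigma>))"

type_synonym 'n ctxt = "(nat \<times> 'n ltype) list"

definition shift_ctxt :: "'n ctxt \<Rightarrow> 'n ctxt" where
  "shift_ctxt \<Gamma> = map (\<lambda>(x, A). (Suc x, A)) \<Gamma>"

text \<open>
  In the rule \<open>abs\<close> the abstracted variable has index 0 in the body, where all the other
  variables are shifted by one; it may stand at any place of the context.
\<close>

inductive typing :: "('n, 'c) signature \<Rightarrow> 'n ctxt \<Rightarrow> 'c lterm \<Rightarrow> 'n ltype \<Rightarrow> bool"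
  for \<Sigma> :: "('n, 'c) signature" where
  var: "A \<in> types (atoms \<Sigma>) \<Longrightarrow> typing \<Sigma> [(x, A)] (Var x) A"
| const: "c \<in> constants \<Sigma> \<Longrightarrow> typing \<Sigma> [] (Const c) (ctype \<Sigma> c)"
| app: "typing \<Sigma> \<Gamma> t (A -\<circ> B) \<Longrightarrow> typing \<Sigma> \<Delta> s A \<Longrightarrow> distinct (map fst (\<Gamma> @ \<Delta>)) \<Longrightarrow>
     typing \<Sigma> (\<Gamma> @ \<Delta>) (App t s) B"
| abs: "typing \<Sigma> (shift_ctxt \<Gamma> @ (0, A) # shift_ctxt \<Delta>) t B \<Longrightarrow>
     typing \<Sigma> (\<Gamma> @ \<Delta>) (Abs t) (A -\<circ> B)"

lemma count_list_shift_ctxt: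
  "count_list (map fst (shift_ctxt \<Gamma>)) (Suc x) = count_list (map fst \<Gamma>) x"
  "count_list (map fst (shift_ctxt \<Gamma>)) 0 = 0"
  by (induction \<Gamma>) (auto simp: shift_ctxt_def)

text \<open>Only linear terms are typable.\<close>

lemma typing_linear:
  assumes "typing \<Sigma> \<Gamma> t A"
  shows "linear_term t" and "occurrences t x = count_list (map fst \<Gamma>) x"
proof -
  have "linear_term t \<and> (\<forall>x. occurrences t x = count_list (map fst \<Gamma>) x)"
    using assms
  proof induction
    case (app \<Gamma> t A B \<Delta> s)
    have "count_list (map fst \<Gamma>) x = 0 \<or> count_list (map fst \<Delta>) x = 0" for x
      using app.hyps(3) by (auto simp: count_list_0_iff)
    with app.IH show ?case by simp
  qed (simp_all add: count_list_shift_ctxt)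
  then show "linear_term t" and "occurrences t x = count_list (map fst \<Gamma>) x" by auto
qed

section \<open>Abstract categorial grammars\<close>

text \<open>
  No lifting is needed below a binder, since the images of constants under a map of
  signatures are closed terms.
\<close>

primrec map_constants :: "('c \<Rightarrow> 'd lterm) \<Rightarrow> 'c lterm \<Rightarrow> 'd lterm" where
  "map_constants g (Var i) = Var i"
| "map_constants g (Const c) = g c"
| "map_constants g (App t s) = App (map_constants g t) (map_constants g s)"
| "map_constants g (Abs t) = Abs (map_constants g t)"

definition signature_map ::
    "('n, 'c) signature \<Rightarrow> ('m, 'd) signature \<Rightarrow>
     ('n ltype \<Rightarrow> 'm ltype) \<Rightarrow> ('c \<Rightarrow> 'd lterm) \<Rightarrow> bool" where
  "signature_map \<Sigma>\<^sub>1 \<Sigma>\<^sub>2 F g \<longleftrightarrow>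
     (\<forall>A \<in> types (atoms \<Sigma>\<^sub>1). F A \<in> types (atoms \<Sigma>\<^sub>2)) \<and>
     (\<forall>A \<in> types (atoms \<Sigma>\<^sub>1). \<forall>B \<in> types (atoms \<Sigma>\<^sub>1). F (A -\<circ> B) = F A -\<circ> F B) \<and>
     (\<forall>c \<in> constants \<Sigma>\<^sub>1. typing \<Sigma>\<^sub>2 [] (g c) (F (ctype \<Sigma>\<^sub>1 c)))"

record ('n, 'c, 'm, 'd) acg =
  abstr :: "('n, 'c) signature"
  obj :: "('m, 'd) signature"
  type_map :: "'n ltype \<Rightarrow> 'm ltype"
  const_map :: "'c \<Rightarrow> 'd lterm"
  acg_start :: 'n

definition is_acg :: "('n, 'c, 'm, 'd) acg \<Rightarrow> bool" where
  "is_acg G \<longleftrightarrow> linear_signature (abstr G) \<and> linear_signature (obj G) \<and>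
     signature_map (abstr G) (obj G) (type_map G) (const_map G) \<and>
     acg_start G \<in> atoms (abstr G)"

datatype str_atom = Str_O

definition Str :: "'t set \<Rightarrow> (str_atom, 't) signature" where
  "Str T = \<lparr>atoms = {Str_O}, constants = T, ctype = (\<lambda>_. Atom Str_O -\<circ> Atom Str_O)\<rparr>"

definition rho :: "'t list \<Rightarrow> 't lterm" where
  "rho w = Abs (foldr (\<lambda>a t. App (Const a) t) w (Var 0))"

definition string_acg :: "'t set \<Rightarrow> ('n, 'c, str_atom, 't) acg \<Rightarrow> bool" where
  "string_acg T G \<longleftrightarrow> is_acg G \<and> obj G = Str T"

definition acg_language :: "('n, 'c, str_atom, 't) acg \<Rightarrow> 't list set" where
  "acg_language G = {w \<in> lists (constants (obj G)).
     \<exists>t. typing (abstr G) [] t (Atom (acg_start G)) \<and>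
         beta_eta_equiv (rho w) (map_constants (const_map G) t)}"

section \<open>Multiwords and cowordisms\<close>

text \<open>
  A boundary \<open>X\<close> is encoded by the list, of length \<open>|X|\<close>, whose entry for the vertex \<open>i\<close> is
  \<open>True\<close> iff \<open>i\<close> is a left endpoint. Vertices are numbered from 1.
\<close>

type_synonym boundary = "bool list"

definition left_ends :: "boundary \<Rightarrow> nat set" where
  "left_ends X = {i \<in> {1..length X}. X ! (i - 1)}"

definition right_ends :: "boundary \<Rightarrow> nat set" where
  "right_ends X = {1..length X} - left_ends X"

definition btensor :: "boundary \<Rightarrow> boundary \<Rightarrow> boundary" where
  "btensor X Y = X @ Y"

definition bdual :: "boundary \<Rightarrow> boundary" where
  "bdual X = rev (map Not X)"

lemma length_btensor: "length (btensor X Y) = length X + length Y"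
  by (simp add: btensor_def)

lemma left_ends_btensor:
  "left_ends (btensor X Y) = left_ends X \<union> {length X + i | i. i \<in> left_ends Y}"
proof (rule set_eqI)
  fix k
  show "k \<in> left_ends (btensor X Y) \<longleftrightarrow>
      k \<in> left_ends X \<union> {length X + i | i. i \<in> left_ends Y}"
  proof (cases "k \<le> length X")
    case True
    then show ?thesis by (auto simp: left_ends_def btensor_def nth_append)
  next
    case False
    then obtain i where "k = length X + i" "1 \<le> i"
      by (metis add_diff_inverse_nat less_imp_le less_one not_le zero_less_diff)
    then show ?thesis by (auto simp: left_ends_def btensor_def nth_append)
  qed
qed

lemma length_bdual: "length (bdual X) = length X"
  by (simp add: bdual_def)

lemma left_ends_bdual:
  "left_ends (bdual X) = {length X + 1 - i | i. i \<in> right_ends X}"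
proof (rule set_eqI)
  fix k
  have "k \<in> left_ends (bdual X) \<longleftrightarrow> k \<in> {1..length X} \<and> length X + 1 - k \<in> right_ends X"
    by (auto simp: left_ends_def right_ends_def bdual_def rev_nth)
  also have "\<dots> \<longleftrightarrow> (\<exists>i. k = length X + 1 - i \<and> i \<in> right_ends X)"
  proof
    assume "k \<in> {1..length X} \<and> length X + 1 - k \<in> right_ends X"
    then show "\<exists>i. k = length X + 1 - i \<and> i \<in> right_ends X"
      by (intro exI[of _ "length X + 1 - k"]) auto
  qed (auto simp: right_ends_def)
  finally show "k \<in> left_ends (bdual X) \<longleftrightarrow> k \<in> {length X + 1 - i | i. i \<in> right_ends X}"
    by simp
qed

text \<open>A cyclic word is the set of all rotations of a word.\<close>

definition cyclic_word :: "'a list \<Rightarrow> 'a list set" where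
  "cyclic_word w = {rotate n w | n. True}"

type_synonym ('v, 't) edge = "'v \<times> 't list \<times> 'v"

abbreviation source :: "('v, 't) edge \<Rightarrow> 'v" where "source e \<equiv> fst e"
abbreviation label :: "('v, 't) edge \<Rightarrow> 't list" where "label e \<equiv> fst (snd e)"
abbreviation target :: "('v, 't) edge \<Rightarrow> 'v" where "target e \<equiv> snd (snd e)"

record 't mword =
  edges :: "(nat, 't) edge set"
  singular :: "'t list set multiset"

definition multiword :: "'t set \<Rightarrow> boundary \<Rightarrow> 't mword \<Rightarrow> bool" where
  "multiword T X \<sigma> \<longleftrightarrow>
     (\<forall>e \<in> edges \<sigma>. source e \<in> left_ends X \<and> label e \<in> lists T \<and> target e \<in> right_ends X) \<and>
     (\<forall>v \<in> {1..length X}. \<exists>!e. e \<in> edges \<sigma> \<and> (source e = v \<or> target e = v)) \<and>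
     (\<forall>c. c \<in># singular \<sigma> \<longrightarrow> (\<exists>w \<in> lists T. c = cyclic_word w))"

definition regular :: "'t mword \<Rightarrow> bool" where
  "regular \<sigma> \<longleftrightarrow> singular \<sigma> = {#}"

definition relabel :: "('u \<Rightarrow> 'v) \<Rightarrow> ('u, 't) edge set \<Rightarrow> ('v, 't) edge set" where
  "relabel f E = (\<lambda>(u, w, v). (f u, w, f v)) ` E"

definition id_mword :: "boundary \<Rightarrow> 't mword" where
  "id_mword X = \<lparr>edges = {(i, [], 2 * length X + 1 - i) | i. i \<in> left_ends (btensor X (bdual X))},
     singular = {#}\<rparr>"

text \<open>
  To glue two multiwords, their edges are put into one graph in which the pairs of glued
  vertices have become the nodes \<open>Inner i\<close>, and the vertices of the result are \<open>Outer i\<close>.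
\<close>

datatype node = Outer nat | Inner nat

inductive glue_path :: "(node, 't) edge set \<Rightarrow> node \<Rightarrow> 't list \<Rightarrow> node \<Rightarrow> bool"
  for E :: "(node, 't) edge set" where
  single: "(u, w, v) \<in> E \<Longrightarrow> glue_path E u w v"
| step: "(u, w, Inner k) \<in> E \<Longrightarrow> glue_path E (Inner k) w' v \<Longrightarrow> glue_path E u (w @ w') v"

definition is_cycle :: "('v, 't) edge set \<Rightarrow> ('v, 't) edge list \<Rightarrow> bool" where
  "is_cycle E es \<longleftrightarrow> es \<noteq> [] \<and> set es \<subseteq> E \<and> distinct (map source es) \<and>
     map target es = rotate1 (map source es)"

text \<open>
  A closed cycle, having no preferred starting node, is a cyclic word of edges; each one
  contributes one cyclic word, which does not depend on the chosen starting node.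
\<close>

definition cycles :: "('v, 't) edge set \<Rightarrow> ('v, 't) edge list set set" where
  "cycles E = {cyclic_word es | es. is_cycle E es}"

definition cycle_label :: "('v, 't) edge list set \<Rightarrow> 't list set" where
  "cycle_label C = cyclic_word (concat (map label (SOME es. es \<in> C)))"

definition glue :: "(node, 't) edge set \<Rightarrow> 't mword" where
  "glue E = \<lparr>edges = {(i, w, j) | i w j. glue_path E (Outer i) w (Outer j)},
     singular = image_mset cycle_label (mset_set (cycles E))\<rparr>"

text \<open>
  The composition of \<open>\<sigma> : X \<rightarrow> Y\<close> and \<open>\<tau> : Y \<rightarrow> Z\<close>, where \<open>m = |Y|\<close> and \<open>n = |Z|\<close>. The
  vertices of \<open>\<sigma>\<close> from \<open>m + 1\<close> on and the vertices of \<open>\<tau>\<close> up to \<open>n\<close> are the vertices of the result.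
\<close>

definition compose :: "nat \<Rightarrow> nat \<Rightarrow> 't mword \<Rightarrow> 't mword \<Rightarrow> 't mword" where
  "compose n m \<tau> \<sigma> =
     (let E = relabel (\<lambda>v. if v \<le> m then Inner v else Outer (n + (v - m))) (edges \<sigma>) \<union>
              relabel (\<lambda>v. if v \<le> n then Outer v else Inner (n + m + 1 - v)) (edges \<tau>)
      in \<lparr>edges = edges (glue E), singular = singular \<sigma> + singular \<tau> + singular (glue E)\<rparr>)"

section \<open>Linear logic grammars\<close>

datatype 'n fm = Pos 'n | Neg 'n | Tensor "'n fm" "'n fm" | Par "'n fm" "'n fm"

definition formulas :: "'n set \<Rightarrow> 'n fm set" where
  "formulas N = {A. set_fm A \<subseteq> N}"

primrec dual :: "'n fm \<Rightarrow> 'n fm" where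
  "dual (Pos P) = Neg P"
| "dual (Neg P) = Pos P"
| "dual (Tensor A B) = Par (dual A) (dual B)"
| "dual (Par A B) = Tensor (dual A) (dual B)"

text \<open>
  The clause for \<open>Par\<close> is forced by \<open>[A\<^sup>\<bottom>] = [A]\<^sup>\<bottom>\<close>, as \<open>(X\<^sup>\<bottom> \<otimes> Y\<^sup>\<bottom>)\<^sup>\<bottom> = Y \<otimes> X\<close>.
\<close>

primrec fm_boundary :: "('n \<Rightarrow> boundary) \<Rightarrow> 'n fm \<Rightarrow> boundary" where
  "fm_boundary b (Pos P) = b P"
| "fm_boundary b (Neg P) = bdual (b P)"
| "fm_boundary b (Tensor A B) = btensor (fm_boundary b A) (fm_boundary b B)"
| "fm_boundary b (Par A B) = btensor (fm_boundary b B) (fm_boundary b A)"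

lemma fm_boundary_dual: "fm_boundary b (dual A) = bdual (fm_boundary b A)"
  by (induction A) (simp_all add: btensor_def bdual_def rev_map comp_def)

primrec seq_boundary :: "('n \<Rightarrow> boundary) \<Rightarrow> 'n fm list \<Rightarrow> boundary" where
  "seq_boundary b [] = []"
| "seq_boundary b (A # \<Gamma>) = btensor (seq_boundary b \<Gamma>) (fm_boundary b A)"

record ('n, 't) llg =
  literals :: "'n set"
  lit_boundary :: "'n \<Rightarrow> boundary"
  alphabet :: "'t set"
  lexicon :: "('t mword \<times> 'n fm list) set"
  llg_start :: 'n

definition is_llg :: "('n, 't) llg \<Rightarrow> bool" where
  "is_llg G \<longleftrightarrow> finite (literals G) \<and> finite (alphabet G) \<and> finite (lexicon G) \<and>
     (\<forall>(\<sigma>, \<Gamma>) \<in> lexicon G. set \<Gamma> \<subseteq> formulas (literals G) \<and>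
        multiword (alphabet G) (seq_boundary (lit_boundary G) \<Gamma>) \<sigma>) \<and>
     llg_start G \<in> literals G \<and>
     card (left_ends (lit_boundary G (llg_start G))) = 1 \<and>
     card (right_ends (lit_boundary G (llg_start G))) = 1"

text \<open>
  \<open>exchange_mword d b a\<close> maps the blocks \<open>[\<Delta>] \<otimes> [B] \<otimes> [A] \<otimes> [\<Gamma>]\<close> to \<open>[\<Delta>] \<otimes> [A] \<otimes> [B] \<otimes> [\<Gamma>]\<close>
  and \<open>tensor_mword d a b\<close> maps \<open>[A] \<otimes> [\<Gamma>]\<close> and \<open>[\<Delta>] \<otimes> [B]\<close> to \<open>[\<Delta>] \<otimes> [A] \<otimes> [B] \<otimes> [\<Gamma>]\<close>,
  where \<open>d\<close>, \<open>a\<close>, \<open>b\<close> are the sizes of \<open>[\<Delta>]\<close>, \<open>[A]\<close>, \<open>[B]\<close>.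
\<close>

definition exchange_mword :: "nat \<Rightarrow> nat \<Rightarrow> nat \<Rightarrow> 't mword \<Rightarrow> 't mword" where
  "exchange_mword d b a \<sigma> =
     \<lparr>edges = relabel (\<lambda>v. if v \<le> d then v
                           else if v \<le> d + b then v + a
                           else if v \<le> d + b + a then v - b
                           else v) (edges \<sigma>),
      singular = singular \<sigma>\<rparr>"

definition tensor_mword :: "nat \<Rightarrow> nat \<Rightarrow> nat \<Rightarrow> 't mword \<Rightarrow> 't mword \<Rightarrow> 't mword" where
  "tensor_mword d a b \<sigma> \<tau> =
     \<lparr>edges = relabel (\<lambda>v. if v \<le> a then d + v else d + b + v) (edges \<sigma>) \<union>
              relabel (\<lambda>v. if v \<le> d then v else a + v) (edges \<tau>),
      singular = singular \<sigma> + singular \<tau>\<rparr>"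

inductive derivable :: "('n, 't) llg \<Rightarrow> 't mword \<Rightarrow> 'n fm list \<Rightarrow> bool"
  for G :: "('n, 't) llg" where
  lex: "(\<sigma>, \<Gamma>) \<in> lexicon G \<Longrightarrow> derivable G \<sigma> \<Gamma>"
| ident: "A \<in> formulas (literals G) \<Longrightarrow>
     derivable G (id_mword (fm_boundary (lit_boundary G) A)) [dual A, A]"
| cut: "derivable G \<sigma> (\<Gamma> @ [A]) \<Longrightarrow> derivable G \<tau> (dual A # \<Delta>) \<Longrightarrow>
     derivable G
       (compose (length (seq_boundary (lit_boundary G) \<Delta>))
          (length (fm_boundary (lit_boundary G) A)) \<tau> \<sigma>)
       (\<Gamma> @ \<Delta>)"
| exchange: "derivable G \<sigma> (\<Gamma> @ [A, B] @ \<Delta>) \<Longrightarrow>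
     derivable G
       (exchange_mword (length (seq_boundary (lit_boundary G) \<Delta>))
          (length (fm_boundary (lit_boundary G) B))
          (length (fm_boundary (lit_boundary G) A)) \<sigma>)
       (\<Gamma> @ [B, A] @ \<Delta>)"
| par: "derivable G \<sigma> (\<Gamma> @ [A, B]) \<Longrightarrow> derivable G \<sigma> (\<Gamma> @ [Par A B])"
| tensor: "derivable G \<sigma> (\<Gamma> @ [A]) \<Longrightarrow> derivable G \<tau> (B # \<Delta>) \<Longrightarrow>
     derivable G
       (tensor_mword (length (seq_boundary (lit_boundary G) \<Delta>))
          (length (fm_boundary (lit_boundary G) A))
          (length (fm_boundary (lit_boundary G) B)) \<sigma> \<tau>)
       (\<Gamma> @ [Tensor A B] @ \<Delta>)"

definition llg_language :: "('n, 't) llg \<Rightarrow> 't list set" where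
  "llg_language G = {w. \<exists>\<sigma> i j. derivable G \<sigma> [Pos (llg_start G)] \<and> regular \<sigma> \<and>
     edges \<sigma> = {(i, w, j)}}"

end

theory Submission
  imports Defs
begin

text \<open>
  Terms over the string signature are interpreted as graphs by a logical relation: a graph on the
  boundary of an object type computes a term if plugging in graphs that compute the arguments gives
  a graph that computes the result, and at type \<open>O \<multimap> O\<close> the single edge labelled \<open>w\<close> computes exactly
  the terms equivalent to \<open>\<rho> w\<close>. Confluence of \<open>\<beta>\<eta>\<close>-reduction separates the \<open>\<rho> w\<close>.

  The lexicon of the grammar consists of the graphs of the images of the abstract constants, with
  \<open>A \<multimap> B\<close> read as \<open>A\<^sup>\<bottom> \<wp> B\<close>. Natural deduction is simulated in linear logic, so abstract terms
  yield derivable multiwords. Conversely, the set of graphs of abstract terms serves as the pole of a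
  phase model in which every derivable multiword is valid. Validity of a multiword of \<open>\<turnstile> S\<close> says that
  it is the graph of a closed abstract term of type \<open>S\<close>. The model thus replaces cut elimination for
  sequents with lexicon axioms.

  The atom \<open>S\<close> must have the boundary of \<open>O \<multimap> O\<close>. If \<open>\<phi> S\<close> is any other type, then no nonempty word
  can arise, and the language has a trivial grammar.
\<close>

text \<open>Only regular multiwords count for the language of a grammar, so completeness must also
  show that no cut closes a cycle. Acyclicity concerns open terms, and closing them by plugging in
  arguments would need an inhabitant of every object type, which the linear calculus does not
  supply. The reading \<open>fl = False\<close> of the logical relation repairs this: it keeps the
  acyclicity clauses and lets the empty graph inhabit every type. Glued vertices are shared names
  instead of positions. Composition is then union followed by hiding the shared names, and
  successive hidings merge and commute; the numbering of vertices matters only where multiwords are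
  placed on names. The elements of the phase model carry the variables and the result of a term
  besides their interface, because validity must produce a typable term. A fresh variable and a
  fresh result, linked to the interface by identities, serve as test elements; gluing with them
  recovers the term.\<close>

section \<open>De Bruijn terms, parallel reduction and confluence\<close>

lemma lift_lift: "i \<le> k \<Longrightarrow> lift (lift t i) (Suc k) = lift (lift t k) i"
  by (induction t arbitrary: i k) auto

lemma lift_subst: "j \<le> i \<Longrightarrow> lift (subst t s j) i = subst (lift t (Suc i)) (lift s i) j"
  by (induction t arbitrary: i j s) (simp_all add: diff_Suc lift_lift split: nat.split)

lemma lift_subst_lt: "i \<le> j \<Longrightarrow> lift (subst t s j) i = subst (lift t i) (lift s i) (Suc j)"
  by (induction t arbitrary: i j s) (auto simp: lift_lift)

lemma subst_lift [simp]: "subst (lift t k) s k = t"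
  by (induction t arbitrary: k s) simp_all

lemma subst_subst:
  "i \<le> j \<Longrightarrow> subst (subst t (lift v i) (Suc j)) (subst u v j) i = subst (subst t u i) v j"
  by (induction t arbitrary: i j u v)
    (simp_all add: diff_Suc lift_lift [symmetric] lift_subst_lt split: nat.split)

lemma lift_inj [simp]: "lift t k = lift s k \<longleftrightarrow> t = s"
  by (metis subst_lift)

text \<open>A term in the range of two lifts omits both indices, so it can be lowered at both:
  together with \<open>lift_lift\<close>, lifts form a pullback square. This recognises an eta-redex
  that has itself been lifted.\<close>

lemma lift_eq_lift:
  "j \<le> k \<Longrightarrow> lift t (Suc k) = lift r j \<Longrightarrow> \<exists>q. t = lift q j \<and> r = lift q k"
proof (induction t arbitrary: r j k)
  case (Var i)
  show ?case
  proof (cases r)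
    case r: (Var l)
    show ?thesis
    proof (cases "l < j")
      case True
      then show ?thesis using Var r by (intro exI[of _ "Var l"]) (auto split: if_splits)
    next
      case False
      then show ?thesis using Var r by (intro exI[of _ "Var (if l \<le> k then l else l - 1)"]) (auto split: if_splits)
    qed
  qed (use Var in \<open>auto split: if_splits\<close>)
next
  case (Const c)
  then show ?case by (cases r) (auto split: if_splits intro: exI[of _ "Const c"])
next
  case (App t1 t2)
  obtain r1 r2 where r: "r = App r1 r2" "lift t1 (Suc k) = lift r1 j" "lift t2 (Suc k) = lift r2 j"
    using App.prems by (cases r) (auto split: if_splits)
  with App obtain q1 q2 where "t1 = lift q1 j" "r1 = lift q1 k" "t2 = lift q2 j" "r2 = lift q2 k"
    by meson
  then show ?case using r by (intro exI[of _ "App q1 q2"]) simp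
next
  case (Abs t)
  obtain r1 where r: "r = Abs r1" "lift t (Suc (Suc k)) = lift r1 (Suc j)"
    using Abs.prems by (cases r) (auto split: if_splits)
  with Abs.IH[of "Suc j" "Suc k" r1] Abs.prems obtain q where "t = lift q (Suc j)" "r1 = lift q (Suc k)"
    by auto
  then show ?case using r by (intro exI[of _ "Abs q"]) simp
qed

text \<open>Parallel reduction in the style of Tait and Martin-Loef, for beta and eta together.
  Contracting several redexes at once gives it the diamond property that single steps lack.\<close>

inductive par :: "'c lterm \<Rightarrow> 'c lterm \<Rightarrow> bool" where
  var: "par (Var i) (Var i)"
| const: "par (Const c) (Const c)"
| app: "par t t' \<Longrightarrow> par s s' \<Longrightarrow> par (App t s) (App t' s')"
| abs: "par t t' \<Longrightarrow> par (Abs t) (Abs t')"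
| beta: "par t t' \<Longrightarrow> par s s' \<Longrightarrow> par (App (Abs t) s) (subst t' s' 0)"
| eta: "par t t' \<Longrightarrow> par (Abs (App (lift t 0) (Var 0))) t'"

inductive_cases par_VarE: "par (Var i) u"
inductive_cases par_ConstE: "par (Const c) u"

lemma par_AppE:
  assumes "par (App t s) u"
  obtains (app) t' s' where "u = App t' s'" "par t t'" "par s s'"
    | (beta) r r' s' where "t = Abs r" "u = subst r' s' 0" "par r r'" "par s s'"
  using assms by (cases rule: par.cases) auto

lemma par_AbsE:
  assumes "par (Abs t) u"
  obtains (abs) t' where "u = Abs t'" "par t t'"
    | (eta) r where "t = App (lift r 0) (Var 0)" "par r u"
  using assms by (cases rule: par.cases) auto

lemma par_refl [simp]: "par t t"
  by (induction t) (auto intro: par.intros)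

lemma beta_eta_imp_par: "beta_eta t s \<Longrightarrow> par t s"
  by (induction rule: beta_eta.induct) (auto intro: par.intros)

lemma par_lift: "par t t' \<Longrightarrow> par (lift t k) (lift t' k)"
proof (induction arbitrary: k rule: par.induct)
  case (beta t t' s s')
  then show ?case using par.beta[of "lift t (Suc k)" "lift t' (Suc k)" "lift s k" "lift s' k"]
    by (simp add: lift_subst)
next
  case (eta t t')
  then show ?case using par.eta[of "lift t k"] by (simp add: lift_lift)
qed (auto intro: par.intros)

lemma par_subst: "par t t' \<Longrightarrow> par s s' \<Longrightarrow> par (subst t s k) (subst t' s' k)"
proof (induction arbitrary: k s s' rule: par.induct)
  case (abs t t')
  then show ?case by (simp add: par.abs par_lift)
next
  case (beta t t' u u')
  have "par (subst t (lift s 0) (Suc k)) (subst t' (lift s' 0) (Suc k))"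
    using beta par_lift by blast
  moreover have "par (subst u s k) (subst u' s' k)" using beta by blast
  ultimately show ?case using par.beta by (fastforce simp: subst_subst[symmetric])
next
  case (eta t t')
  then show ?case using par.eta[of "subst t s k" "subst t' s' k"] by (simp add: lift_subst_lt)
qed (auto intro: par.intros)

text \<open>Reduction creates no free variables, so an omitted index stays omitted. Thus the side
  condition of eta survives a reduction of the body.\<close>

lemma par_lift_inv: "par (lift t k) u \<Longrightarrow> \<exists>t'. u = lift t' k \<and> par t t'"
proof (induction "lift t k" u arbitrary: t k rule: par.induct)
  case (var i)
  then show ?case by (intro exI[of _ t]) simp
next
  case (const c)
  then show ?case by (intro exI[of _ t]) simp
next
  case (app a a' b b')
  then obtain t1 t2 where t: "t = App t1 t2" "a = lift t1 k" "b = lift t2 k"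
    by (cases t) (auto split: if_splits)
  obtain t1' t2' where "a' = lift t1' k" "par t1 t1'" "b' = lift t2' k" "par t2 t2'"
    using app.hyps(2)[OF t(2)] app.hyps(4)[OF t(3)] by blast
  then show ?case using t by (intro exI[of _ "App t1' t2'"]) (auto intro: par.intros)
next
  case (abs a a')
  then obtain t1 where t: "t = Abs t1" "a = lift t1 (Suc k)"
    by (cases t) (auto split: if_splits)
  obtain t1' where "a' = lift t1' (Suc k)" "par t1 t1'"
    using abs.hyps(2)[OF t(2)] by blast
  then show ?case using t by (intro exI[of _ "Abs t1'"]) (auto intro: par.intros)
next
  case (beta a a' b b')
  then obtain t0 t2 where t0: "t = App t0 t2" "Abs a = lift t0 k" "b = lift t2 k"
    by (cases t) (auto split: if_splits)
  then obtain t1 where t: "t0 = Abs t1" "a = lift t1 (Suc k)"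
    by (cases t0) (auto split: if_splits)
  obtain t1' t2' where "a' = lift t1' (Suc k)" "par t1 t1'" "b' = lift t2' k" "par t2 t2'"
    using beta.hyps(2)[OF t(2)] beta.hyps(4)[OF t0(3)] by blast
  then show ?case using t t0 by (intro exI[of _ "subst t1' t2' 0"]) (auto intro: par.intros simp: lift_subst)
next
  case (eta r r')
  then obtain t1 where t1: "t = Abs t1" "App (lift r 0) (Var 0) = lift t1 (Suc k)"
    by (cases t) (auto split: if_splits)
  then obtain t2 t3 where t2: "t1 = App t2 t3" "lift r 0 = lift t2 (Suc k)" "Var 0 = lift t3 (Suc k)"
    by (cases t1) (auto split: if_splits)
  then have t3: "t3 = Var 0" by (cases t3) (auto split: if_splits)
  \<comment> \<open>The eta-redex omits index 0 and, being lifted, also \<open>Suc k\<close>;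
    lowering at both leaves an eta-redex before the lift.\<close>
  obtain q where q: "t2 = lift q 0" "r = lift q k" using lift_eq_lift[of 0 k t2 r] t2 by auto
  obtain q' where "r' = lift q' k" "par q q'" using eta.hyps(2)[OF q(2)] by blast
  then show ?case using t1(1) t2(1) t3 q(1) by (intro exI[of _ q']) (simp add: par.eta)
qed

lemma size_lift [simp]: "size (lift t k) = size t"
  by (induction t arbitrary: k) auto

lemma lift_eq_Abs: "lift r k = Abs q \<Longrightarrow> \<exists>q'. r = Abs q' \<and> q = lift q' (Suc k)"
  by (cases r) (auto split: if_splits)

lemma subst_lift_Var: "subst (lift t (Suc k)) (Var k) k = t"
  by (induction t arbitrary: k) auto

text \<open>A reduction of the body of an eta-redex reduces the contracted term itself: the only
  redex that is created by the trailing variable is a renaming.\<close>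

lemma par_eta_bodyE:
  assumes "par (App (lift r 0) (Var 0)) x"
  obtains (app) r' where "x = App (lift r' 0) (Var 0)" "par r r'"
    | (beta) q q' where "r = Abs q" "x = q'" "par q q'"
  using assms
proof (cases rule: par_AppE)
  case (app t' s')
  then show ?thesis using par_lift_inv[of r 0 t'] that(1) by (auto elim: par_VarE)
next
  case (beta t t' s')
  then obtain q where q: "r = Abs q" "t = lift q (Suc 0)" using lift_eq_Abs by blast
  then obtain q' where "t' = lift q' (Suc 0)" "par q q'" using par_lift_inv beta by blast
  then show ?thesis using that(2) beta q by (auto elim!: par_VarE simp: subst_lift_Var)
qed

text \<open>The induction is on size because the contractum of an eta-redex is a subterm only up to
  a lift, and because one overlap of beta with eta is resolved by the hypothesis for a smaller term
  that is not a subterm at all.\<close>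

lemma par_diamond: "par t a \<Longrightarrow> par t b \<Longrightarrow> \<exists>c. par a c \<and> par b c"
proof (induction "size t" arbitrary: t a b rule: less_induct)
  case less
  note IH = less.hyps
  \<comment> \<open>The critical pair of a reduction under the abstraction against eta.\<close>
  have abs_eta: "\<exists>c. par (Abs x) c \<and> par r'' c"
    if t: "t = Abs (App (lift r 0) (Var 0))" and x: "par (App (lift r 0) (Var 0)) x" and r: "par r r''"
    for r x r''
    using x
  proof (cases rule: par_eta_bodyE)
    case (app r')
    with IH[of r r' r''] t r obtain c where "par r' c" "par r'' c" by auto
    with app show ?thesis by (auto intro: par.intros)
  next
    case (beta q q')
    with IH[of r "Abs q'" r''] t r show ?thesis by (auto intro: par.intros)
  qed
  \<comment> \<open>The critical pair of the application congruence against beta; the reduct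
    \<open>x\<close> of the function may itself arise by eta.\<close>
  have app_beta: "\<exists>c. par (App x s1) c \<and> par (subst t2 s2 0) c"
    if t: "t = App (Abs t0) s" and x: "par (Abs t0) x" and s1: "par s s1" and t2: "par t0 t2" and s2: "par s s2"
    for t0 s x s1 t2 s2
  proof -
    obtain s3 where s3: "par s1 s3" "par s2 s3" using IH[of s s1 s2] t s1 s2 by auto
    from x show ?thesis
    proof (cases rule: par_AbsE)
      case (abs t1)
      with IH[of t0 t1 t2] t t2 obtain t3 where "par t1 t3" "par t2 t3" by auto
      then show ?thesis using abs s3 by (auto intro!: par.beta par_subst)
    next
      case (eta r)
      from t2[unfolded eta] show ?thesis
      proof (cases rule: par_eta_bodyE)
        case (app r2)
        with IH[of r x r2] t eta obtain r3 where "par x r3" "par r2 r3" by auto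
        then show ?thesis using app s3 by (auto intro!: par.app)
      next
        case (beta q q')
        \<comment> \<open>The body has contracted to \<open>q'\<close> by a mere renaming, so both
          sides are reducts of \<open>App (Abs q) s\<close>, the smaller term obtained by
          contracting the eta-redex first.\<close>
        have "par (App (Abs q) s) (App x s1)" using eta beta s1 by (auto intro: par.app)
        moreover have "par (App (Abs q) s) (subst t2 s2 0)" using beta s2 by (auto intro: par.beta)
        ultimately show ?thesis using IH[of "App (Abs q) s"] t eta beta by auto
      qed
    qed
  qed
  show ?case using less.prems(1)
  proof (cases rule: par.cases)
    case (var i)
    with less.prems show ?thesis by (metis par_VarE par_refl)
  next
    case (const c)
    with less.prems show ?thesis by (metis par_ConstE par_refl)
  next
    case (app t1 t1' s1 s1')
    from less.prems(2)[unfolded app(1)] show ?thesis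
    proof (cases rule: par_AppE)
      case 1: (app t1'' s1'')
      with IH[of t1 t1' t1''] IH[of s1 s1' s1''] app obtain c d
        where "par t1' c" "par t1'' c" "par s1' d" "par s1'' d" by auto
      with app 1 show ?thesis by (auto intro: par.intros)
    next
      case 2: (beta t0 t0' s0')
      with app app_beta[of t0 s1 t1' s1' t0' s0'] show ?thesis by auto
    qed
  next
    case (abs t1 t1')
    from less.prems(2)[unfolded abs(1)] show ?thesis
    proof (cases rule: par_AbsE)
      case 1: (abs t1'')
      with IH[of t1 t1' t1''] abs show ?thesis by (auto intro: par.intros)
    next
      case 2: (eta r)
      with abs abs_eta show ?thesis by auto
    qed
  next
    case (beta t1 t1' s1 s1')
    from less.prems(2)[unfolded beta(1)] show ?thesis
    proof (cases rule: par_AppE)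
      case 1: (app t1'' s1'')
      with app_beta[of t1 s1 t1'' s1'' t1' s1'] beta show ?thesis by auto
    next
      case 2: (beta t0 t0' s0')
      with IH[of t1 t1' t0'] IH[of s1 s1' s0'] beta obtain c d
        where "par t1' c" "par t0' c" "par s1' d" "par s0' d" by auto
      with beta 2 show ?thesis by (auto intro: par_subst)
    qed
  next
    case (eta r)
    from less.prems(2)[unfolded eta(1)] show ?thesis
    proof (cases rule: par_AbsE)
      case 1: (abs x)
      with abs_eta[of r x a] eta show ?thesis by auto
    next
      case 2: (eta r')
      with IH[of r a b] eta show ?thesis by auto
    qed
  qed
qed

lemma par_strip: "par\<^sup>*\<^sup>* t a \<Longrightarrow> par t b \<Longrightarrow> \<exists>c. par a c \<and> par\<^sup>*\<^sup>* b c"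
proof (induction arbitrary: b rule: rtranclp_induct)
  case (step y z)
  then obtain c where c: "par y c" "par\<^sup>*\<^sup>* b c" by blast
  with par_diamond[OF step(2) c(1)] show ?case by (meson rtranclp.rtrancl_into_rtrancl)
qed auto

text \<open>Church-Rosser: a forward link of the zigzag is crossed by the strip lemma, a backward
  link is prepended to the reduction already found.\<close>

lemma beta_eta_equiv_join: "beta_eta_equiv t s \<Longrightarrow> \<exists>u. par\<^sup>*\<^sup>* t u \<and> par\<^sup>*\<^sup>* s u"
  unfolding beta_eta_equiv_def
proof (induction rule: equivclp_induct)
  case (step y z)
  then obtain u where u: "par\<^sup>*\<^sup>* t u" "par\<^sup>*\<^sup>* y u" by blast
  from step(2) consider "par y z" | "par z y" using beta_eta_imp_par by blast
  then show ?case
  proof cases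
    case 1
    from par_strip[OF u(2) 1] u show ?thesis by (meson rtranclp.rtrancl_into_rtrancl)
  next
    case 2
    then show ?thesis using u by (meson converse_rtranclp_into_rtranclp)
  qed
qed auto

section \<open>The terms that represent words\<close>

definition word_term :: "'t list \<Rightarrow> 't lterm \<Rightarrow> 't lterm" where
  "word_term w t = foldr (\<lambda>a t. App (Const a) t) w t"

lemma word_term_simps [simp]:
  "word_term [] t = t" "word_term (a # w) t = App (Const a) (word_term w t)"
  "word_term (v @ w) t = word_term v (word_term w t)"
  by (simp_all add: word_term_def)

lemma rho_word_term: "rho w = Abs (word_term w (Var 0))"
  by (simp add: rho_def word_term_def)

lemma par_word_term: "par (word_term w (Var i)) u \<Longrightarrow> u = word_term w (Var i)"
  by (induction w arbitrary: u) (auto elim!: par_VarE par_ConstE par_AppE)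

text \<open>\<open>rho w\<close> is beta-normal, and it is an eta-redex only for a one-letter word,
  where it has the form \<open>\<lambda>x. a x\<close>; hence the second alternative.\<close>

lemma par_rho: "par (rho w) u \<Longrightarrow> u = rho w \<or> (\<exists>a. w = [a] \<and> u = Const a)"
proof -
  assume "par (rho w) u"
  then have "par (Abs (word_term w (Var 0))) u" by (simp add: rho_word_term)
  then show ?thesis
  proof (cases rule: par_AbsE)
    case (abs t')
    then show ?thesis using par_word_term by (auto simp: rho_word_term)
  next
    case (eta t)
    then obtain a w' where w: "w = a # w'" "Const a = lift t 0" "word_term w' (Var 0) = Var 0"
      by (cases w) auto
    then have "w' = []" by (cases w') auto
    moreover have "t = Const a" using w by (cases t) (auto split: if_splits)
    ultimately show ?thesis using eta w by (auto elim: par_ConstE)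
  qed
qed

lemma pars_rho: "par\<^sup>*\<^sup>* (rho w) u \<Longrightarrow> u = rho w \<or> (\<exists>a. w = [a] \<and> u = Const a)"
  by (induction rule: rtranclp_induct) (auto dest: par_rho elim: par_ConstE)

lemma word_term_inj: "word_term w (Var i) = word_term v (Var i) \<Longrightarrow> w = v"
proof (induction w arbitrary: v)
  case Nil
  then show ?case by (cases v) auto
next
  case (Cons a w)
  then show ?case by (cases v) auto
qed

text \<open>The possible reducts, \<open>rho w\<close> itself or a single constant, determine the
  word, so a common reduct forces equality.\<close>

lemma rho_beta_eta_inj: "beta_eta_equiv (rho w) (rho v) \<Longrightarrow> w = v"
proof -
  assume "beta_eta_equiv (rho w) (rho v)"
  then obtain u where "par\<^sup>*\<^sup>* (rho w) u" "par\<^sup>*\<^sup>* (rho v) u" using beta_eta_equiv_join by blast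
  from this[THEN pars_rho] show ?thesis by (auto simp: rho_word_term dest: word_term_inj)
qed

section \<open>Simple typing and the type of a nonempty word\<close>

text \<open>Linearity is dropped and the context is a total environment, so that subject reduction
  needs no splitting of contexts. Linear typings embed by \<open>typing_imp_stype\<close>.\<close>

inductive stype :: "('c \<Rightarrow> 'n ltype) \<Rightarrow> (nat \<Rightarrow> 'n ltype) \<Rightarrow> 'c lterm \<Rightarrow> 'n ltype \<Rightarrow> bool"
  for \<tau> :: "'c \<Rightarrow> 'n ltype" where
  var: "stype \<tau> e (Var i) (e i)"
| const: "stype \<tau> e (Const c) (\<tau> c)"
| app: "stype \<tau> e t (A -\<circ> B) \<Longrightarrow> stype \<tau> e s A \<Longrightarrow> stype \<tau> e (App t s) B"
| abs: "stype \<tau> (case_nat A e) t B \<Longrightarrow> stype \<tau> e (Abs t) (A -\<circ> B)"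

inductive_simps stype_simps [simp]:
  "stype \<tau> e (Var i) A" "stype \<tau> e (Const c) A" "stype \<tau> e (App t s) A" "stype \<tau> e (Abs t) A"

lemma stype_lift:
  "(\<And>i. e' (if i < k then i else Suc i) = e i) \<Longrightarrow> stype \<tau> e' (lift t k) A \<longleftrightarrow> stype \<tau> e t A"
proof (induction t arbitrary: e e' k A)
  case (Var i)
  show ?case using Var[of i] by auto
next
  case (Abs t)
  have "stype \<tau> (case_nat C e') (lift t (Suc k)) B \<longleftrightarrow> stype \<tau> (case_nat C e) t B" for C B
  proof (rule Abs.IH)
    fix i
    show "case_nat C e' (if i < Suc k then i else Suc i) = case_nat C e i"
      using Abs.prems[of "i - 1"] by (cases i) (auto split: if_splits)
  qed
  then show ?case by simp
next
  case (App t s)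
  show ?case using App.IH(1)[of e' k e, OF App.prems] App.IH(2)[of e' k e, OF App.prems] by simp
qed simp

lemma stype_lift0 [simp]: "stype \<tau> (case_nat A e) (lift t 0) B \<longleftrightarrow> stype \<tau> e t B"
  by (rule stype_lift) simp

lemma stype_subst:
  "stype \<tau> e' t B \<Longrightarrow> e' k = A \<Longrightarrow> (\<And>i. i < k \<Longrightarrow> e' i = e i) \<Longrightarrow> (\<And>i. k < i \<Longrightarrow> e' i = e (i - 1)) \<Longrightarrow>
    stype \<tau> e s A \<Longrightarrow> stype \<tau> e (subst t s k) B"
proof (induction t arbitrary: e e' k s B)
  case (Abs t)
  then obtain C D where B: "B = C -\<circ> D" and t: "stype \<tau> (case_nat C e') t D" by auto
  have "stype \<tau> (case_nat C e) (subst t (lift s 0) (Suc k)) D"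
    by (rule Abs.IH[OF t]) (use Abs.prems in \<open>auto split: nat.split\<close>)
  then show ?case using B by simp
next
  case (App t1 t2)
  from App.prems(1) obtain C where "stype \<tau> e' t1 (C -\<circ> B)" "stype \<tau> e' t2 C" by auto
  with App.IH(1)[OF _ App.prems(2-5)] App.IH(2)[OF _ App.prems(2-5)] show ?case by auto
qed auto

lemma stype_par: "par t t' \<Longrightarrow> stype \<tau> e t A \<Longrightarrow> stype \<tau> e t' A"
proof (induction arbitrary: e A rule: par.induct)
  case (beta t t' s s')
  then obtain B where "stype \<tau> (case_nat B e) t A" "stype \<tau> e s B" by auto
  with beta.IH show ?case by (intro stype_subst[where e' = "case_nat B e" and A = B]) (auto split: nat.split)
next
  case (eta t t')
  then show ?case by auto
next
  case (app t t' s s')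
  then show ?case by (meson stype_simps(3))
qed auto

lemma stype_pars: "par\<^sup>*\<^sup>* t t' \<Longrightarrow> stype \<tau> e t A \<Longrightarrow> stype \<tau> e t' A"
  by (induction rule: rtranclp_induct) (auto intro: stype_par)

lemma typing_imp_stype:
  "typing \<Sigma> \<Gamma> t A \<Longrightarrow> (\<And>x B. (x, B) \<in> set \<Gamma> \<Longrightarrow> e x = B) \<Longrightarrow> stype (ctype \<Sigma>) e t A"
proof (induction arbitrary: e rule: typing.induct)
  case (app \<Gamma> t A B \<Delta> s)
  then show ?case by (auto intro!: exI[of _ A])
next
  case (abs \<Gamma> A \<Delta> t B)
  have "stype (ctype \<Sigma>) (case_nat A e) t B"
    by (rule abs.IH) (use abs.prems in \<open>auto simp: shift_ctxt_def\<close>)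
  then show ?case by simp
qed auto

lemma stype_word_term:
  "stype (\<lambda>_. A -\<circ> A) e (word_term w (Var 0)) B \<Longrightarrow> w \<noteq> [] \<Longrightarrow> e 0 = A \<and> B = A"
proof (induction w arbitrary: B)
  case (Cons a w)
  then show ?case by (cases w) auto
qed simp

text \<open>Typing passes down to the common reduct, which contains a letter, and the letter fixes
  the type. The empty word is different: the identity has every type
  \<open>A -\<circ> A\<close>.\<close>

lemma rho_equiv_typed:
  assumes "beta_eta_equiv (rho w) u" and "typing (Str T) [] u A" and "w \<noteq> []"
  shows "A = Atom Str_O -\<circ> Atom Str_O"
proof -
  obtain v where v: "par\<^sup>*\<^sup>* (rho w) v" "par\<^sup>*\<^sup>* u v" using beta_eta_equiv_join[OF assms(1)] by blast
  have "stype (ctype (Str T)) e u A" for e using typing_imp_stype[OF assms(2)] by simp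
  then have "stype (\<lambda>_. Atom Str_O -\<circ> Atom Str_O) e v A" for e
    using stype_pars[OF v(2), of _ e A] by (simp add: Str_def)
  from this[of "\<lambda>_. A"] pars_rho[OF v(1)] assms(3) show ?thesis by (auto simp: rho_word_term dest!: stype_word_term)
qed

section \<open>Gluing of graphs with named vertices\<close>

definition verts :: "('v, 't) edge set \<Rightarrow> 'v set" where
  "verts E = source ` E \<union> target ` E"

lemma verts_simps [simp]: "verts {} = {}" "verts (E \<union> F) = verts E \<union> verts F"
  "verts (insert e E) = insert (source e) (insert (target e) (verts E))"
  by (auto simp: verts_def)

lemma vertsI: "(u, w, v) \<in> E \<Longrightarrow> u \<in> verts E" "(u, w, v) \<in> E \<Longrightarrow> v \<in> verts E"
  by (force simp: verts_def)+

lemma verts_UN: "verts (\<Union>i\<in>I. E i) = (\<Union>i\<in>I. verts (E i))"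
  by (auto simp: verts_def)

inductive path :: "'v set \<Rightarrow> ('v, 't) edge set \<Rightarrow> 'v \<Rightarrow> 't list \<Rightarrow> 'v \<Rightarrow> bool"
  for K :: "'v set" and E :: "('v, 't) edge set" where
  single: "(u, w, v) \<in> E \<Longrightarrow> path K E u w v"
| step: "(u, w, k) \<in> E \<Longrightarrow> k \<in> K \<Longrightarrow> path K E k w' v \<Longrightarrow> path K E u (w @ w') v"

text \<open>Gluing by names: two graphs that are to be composed share the vertices \<open>K\<close>,
  and their composition is the union with \<open>K\<close> hidden. Only the inner vertices of a path
  have to lie in \<open>K\<close>; closed cycles inside \<open>K\<close> vanish and are accounted
  for by \<open>no_cycle\<close>.\<close>

definition hide :: "'v set \<Rightarrow> ('v, 't) edge set \<Rightarrow> ('v, 't) edge set" where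
  "hide K E = {(u, w, v). path K E u w v \<and> u \<notin> K \<and> v \<notin> K}"

lemma path_trans: "path K E u w k \<Longrightarrow> k \<in> K \<Longrightarrow> path K E k w' v \<Longrightarrow> path K E u (w @ w') v"
  by (induction rule: path.induct) (auto intro: path.intros)

lemma path_mono: "path K E u w v \<Longrightarrow> K \<subseteq> K' \<Longrightarrow> E \<subseteq> E' \<Longrightarrow> path K' E' u w v"
  by (induction rule: path.induct) (auto intro: path.intros)

lemma path_source: "path K E u w v \<Longrightarrow> u \<in> source ` E"
  by (cases rule: path.cases) force+

lemma path_target: "path K E u w v \<Longrightarrow> v \<in> target ` E"
  by (induction rule: path.induct) force+

lemma hide_source: "source ` hide K E \<subseteq> source ` E - K"
  by (auto simp: hide_def dest: path_source)

lemma hide_target: "target ` hide K E \<subseteq> target ` E - K"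
  by (auto simp: hide_def dest: path_target)

lemma verts_hide: "verts (hide K E) \<subseteq> verts E - K"
  using hide_source[of K E] hide_target[of K E] unfolding verts_def by blast

lemma path_hide_imp: "path K (hide K' E) u w v \<Longrightarrow> path (K \<union> K') E u w v"
proof (induction rule: path.induct)
  case (single u w v)
  then show ?case by (auto simp: hide_def intro: path_mono)
next
  case (step u w k w' v)
  then have "path (K \<union> K') E u w k" by (auto simp: hide_def intro: path_mono)
  then show ?case using step by (blast intro: path_trans)
qed

text \<open>Cuts a path at its first inner vertex outside \<open>K'\<close>, if there is
  one.\<close>

lemma path_Un_split: "path (K \<union> K') E u w v \<Longrightarrow>
    path K' E u w v \<or> (\<exists>w1 w2 k. k \<in> K - K' \<and> w = w1 @ w2 \<and> path K' E u w1 k \<and> path (K \<union> K') E k w2 v)"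
proof (induction rule: path.induct)
  case (single u w v)
  then show ?case by (auto intro: path.intros)
next
  case (step u w k w' v)
  show ?case
  proof (cases "k \<in> K'")
    case True
    from step.IH show ?thesis
    proof (elim disjE exE conjE)
      assume "path K' E k w' v"
      then show ?thesis using step True by (auto intro: path.intros)
    next
      fix w1 w2 k1 assume a: "k1 \<in> K - K'" "w' = w1 @ w2" "path K' E k w1 k1" "path (K \<union> K') E k1 w2 v"
      then have "path K' E u (w @ w1) k1" using step True by (auto intro: path.intros)
      then show ?thesis using a by (metis append.assoc)
    qed
  next
    case False
    then show ?thesis using step by (metis Diff_iff Un_iff path.single)
  qed
qed

lemma path_imp_hide:
  assumes "path (K \<union> K') E u w v" and "u \<notin> K'" and "v \<notin> K'"
  shows "path K (hide K' E) u w v"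
proof -
  \<comment> \<open>A tail of the path may start inside \<open>K'\<close>, where it is not yet a
    path of the hidden graph. The second conjunct keeps its unfinished segment through
    \<open>K'\<close> apart, to be completed once the start of the segment is reached.\<close>
  have "path (K \<union> K') E u w v \<Longrightarrow> v \<notin> K' \<Longrightarrow>
      (u \<notin> K' \<longrightarrow> path K (hide K' E) u w v) \<and>
      (u \<in> K' \<longrightarrow> path K' E u w v \<or> (\<exists>w1 w2 k. k \<in> K - K' \<and> w = w1 @ w2 \<and> path K' E u w1 k \<and> path K (hide K' E) k w2 v))"
    for u w v
  proof (induction rule: path.induct)
    case (single u w v)
    then show ?case by (auto simp: hide_def intro: path.intros)
  next
    case (step u w k w' v)
    show ?case
    proof (cases "k \<in> K'")
      case True
      with step consider "path K' E k w' v" | w1 w2 k1 where "k1 \<in> K - K'" "w' = w1 @ w2" "path K' E k w1 k1" "path K (hide K' E) k1 w2 v"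
        by blast
      then show ?thesis
      proof cases
        case 1
        then have "path K' E u (w @ w') v" using step True by (auto intro: path.intros)
        then show ?thesis using step.prems by (auto simp: hide_def intro: path.intros)
      next
        case 2
        then have p: "path K' E u (w @ w1) k1" using step True by (auto intro: path.intros)
        show ?thesis
        proof (cases "u \<in> K'")
          case True
          then show ?thesis using 2 p by (metis append.assoc)
        next
          case False
          then have "(u, w @ w1, k1) \<in> hide K' E" using p 2 by (auto simp: hide_def)
          then have "path K (hide K' E) u ((w @ w1) @ w2) v" using 2 by (blast intro: path.step)
          then show ?thesis using False 2 by simp
        qed
      qed
    next
      case False
      then have k: "path K (hide K' E) k w' v" "k \<in> K" using step by auto
      show ?thesis
      proof (cases "u \<in> K'")
        case True
        then show ?thesis using k step False by (metis DiffI path.single)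
      next
        case False
        then have "(u, w, k) \<in> hide K' E" using step \<open>k \<notin> K'\<close> by (auto simp: hide_def intro: path.single)
        then show ?thesis using k False by (blast intro: path.step)
      qed
    qed
  qed
  then show ?thesis using assms by blast
qed

lemma hide_hide: "hide K (hide K' E) = hide (K \<union> K') E"
proof -
  have "u \<notin> K'" "v \<notin> K'" if "path K (hide K' E) u w v" for u w v
    using path_source[OF that] path_target[OF that] hide_source[of K' E] hide_target[of K' E] by auto
  then show ?thesis unfolding hide_def[of K] hide_def[of "K \<union> K'"]
    by (auto dest: path_hide_imp intro: path_imp_hide)
qed

lemma path_Un_disjoint:
  "path K (E \<union> F) u w v \<Longrightarrow> K \<inter> verts F = {} \<Longrightarrow> path K E u w v \<or> (u, w, v) \<in> F"
proof (induction rule: path.induct)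
  case (step u w k w' v)
  then have "(u, w, k) \<in> E" by (auto dest: vertsI)
  moreover have "(k, w', v) \<notin> F" using step by (auto dest: vertsI)
  ultimately show ?case using step by (auto intro: path.intros)
qed (auto intro: path.intros)

lemma hide_Un_disjoint: "K \<inter> verts F = {} \<Longrightarrow> hide K (E \<union> F) = hide K E \<union> F"
  unfolding hide_def
  by (auto dest: path_Un_disjoint vertsI intro: path.intros path_mono)

lemma hide_disjoint: "K \<inter> verts F = {} \<Longrightarrow> hide K F = F"
  using hide_Un_disjoint[of K F "{}"] by (auto simp: hide_def elim: path.cases)

text \<open>Gluing is associative because gluing successively along two vertex sets is gluing along
  their union.\<close>

lemma hide_Un_nested:
  "K' \<inter> verts F = {} \<Longrightarrow> hide K (hide K' E \<union> F) = hide (K \<union> K') (E \<union> F)"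
  by (metis hide_Un_disjoint hide_hide)

lemma hide_empty [simp]: "hide {} E = E"
  by (simp add: hide_disjoint)

text \<open>Closed walks instead of the simple cycles of \<open>is_cycle\<close>, because walks are
  easily carried through hiding and relabelling; \<open>cycle_path\<close> makes the
  connection.\<close>

definition no_cycle :: "'v set \<Rightarrow> ('v, 't) edge set \<Rightarrow> bool" where
  "no_cycle K E \<longleftrightarrow> (\<forall>k\<in>K. \<forall>w. \<not> path K E k w k)"

lemma no_cycle_mono: "no_cycle K E \<Longrightarrow> K' \<subseteq> K \<Longrightarrow> E' \<subseteq> E \<Longrightarrow> no_cycle K' E'"
  unfolding no_cycle_def by (meson path_mono subsetD)

lemma no_cycle_hide: "no_cycle (K \<union> K') E \<Longrightarrow> no_cycle K (hide K' E)"
  unfolding no_cycle_def by (auto dest: path_hide_imp)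

lemma no_cycle_UnI:
  assumes "no_cycle K' E" and "no_cycle K (hide K' E)"
  shows "no_cycle (K \<union> K') E"
  unfolding no_cycle_def
proof (intro ballI allI notI)
  fix k w assume k: "k \<in> K \<union> K'" and p: "path (K \<union> K') E k w k"
  have *: False if "k \<in> K - K'" "path (K \<union> K') E k w k" for k w
    using that assms(2) path_imp_hide[of K K' E k w k] by (auto simp: no_cycle_def)
  show False
  proof (cases "k \<in> K'")
    case False
    then show ?thesis using * k p by blast
  next
    case True
    then have "\<not> path K' E k w k" using assms(1) by (auto simp: no_cycle_def)
    \<comment> \<open>The cycle leaves \<open>K'\<close> at \<open>k1\<close>. Rotated to start
      there, it is a cycle that \<open>hide K' E\<close> still sees.\<close>
    then obtain w1 w2 k1 where k1: "k1 \<in> K - K'" "path K' E k w1 k1" "path (K \<union> K') E k1 w2 k"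
      using path_Un_split[OF p] by blast
    then have "path (K \<union> K') E k w1 k1" by (auto intro: path_mono)
    then have "path (K \<union> K') E k1 (w2 @ w1) k1" using k1 True by (blast intro: path_trans)
    then show ?thesis using * k1 by blast
  qed
qed

lemma no_cycle_Un_disjoint:
  assumes "no_cycle K E" and "K \<inter> verts F = {}"
  shows "no_cycle K (E \<union> F)"
  unfolding no_cycle_def
proof (intro ballI allI notI)
  fix k w assume "k \<in> K" "path K (E \<union> F) k w k"
  then show False using path_Un_disjoint[of K E F k w k] assms by (auto simp: no_cycle_def dest: vertsI)
qed

lemma no_cycle_Un2:
  assumes "no_cycle K1 E1" "no_cycle K2 E2" and "K1 \<inter> verts E2 = {}" "K2 \<inter> verts E1 = {}"
  shows "no_cycle (K1 \<union> K2) (E1 \<union> E2)"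
proof (rule no_cycle_UnI)
  show "no_cycle K2 (E1 \<union> E2)" using no_cycle_Un_disjoint[OF assms(2,4)] by (simp add: Un_commute)
  have "hide K2 (E1 \<union> E2) = E1 \<union> hide K2 E2"
    using hide_Un_disjoint[OF assms(4), of E2] by (simp add: Un_commute)
  then show "no_cycle K1 (hide K2 (E1 \<union> E2))"
    using no_cycle_Un_disjoint[OF assms(1), of "hide K2 E2"] assms(3) verts_hide[of K2 E2] by auto
qed

lemma relabel_simps [simp]: "relabel f {} = {}" "relabel f (E \<union> F) = relabel f E \<union> relabel f F"
  "relabel f (insert (u, w, v) E) = insert (f u, w, f v) (relabel f E)"
  by (simp_all add: relabel_def image_Un)

lemma relabelI: "(u, w, v) \<in> E \<Longrightarrow> (f u, w, f v) \<in> relabel f E"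
  by (force simp: relabel_def)

lemma relabelE:
  assumes "(a, w, b) \<in> relabel f E"
  obtains u v where "a = f u" "b = f v" "(u, w, v) \<in> E"
  using assms by (auto simp: relabel_def)

lemma source_relabel: "source ` relabel f E = f ` source ` E"
  by (force simp: relabel_def image_image case_prod_beta)

lemma target_relabel: "target ` relabel f E = f ` target ` E"
  by (force simp: relabel_def image_image case_prod_beta)

lemma verts_relabel: "verts (relabel f E) = f ` verts E"
  by (simp add: verts_def source_relabel target_relabel image_Un)

lemma relabel_relabel: "relabel f (relabel g E) = relabel (f \<circ> g) E"
  by (simp add: relabel_def image_image case_prod_beta)

lemma relabel_cong: "(\<And>v. v \<in> verts E \<Longrightarrow> f v = g v) \<Longrightarrow> relabel f E = relabel g E"
  unfolding relabel_def by (rule image_cong) (auto dest: vertsI)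

lemma relabel_id: "(\<And>v. v \<in> verts E \<Longrightarrow> f v = v) \<Longrightarrow> relabel f E = E"
  using relabel_cong[of E f id] by (simp add: relabel_def case_prod_beta)

lemma path_relabel: "path K E u w v \<Longrightarrow> path (f ` K) (relabel f E) (f u) w (f v)"
  by (induction rule: path.induct) (auto intro: path.intros relabelI)

lemma path_relabel_inv:
  assumes "inj_on f (K \<union> verts E)"
  shows "path (f ` K) (relabel f E) a w b \<Longrightarrow>
    \<exists>u v. a = f u \<and> b = f v \<and> path K E u w v"
proof (induction rule: path.induct)
  case (single u w v)
  then show ?case by (auto elim!: relabelE intro: path.single)
next
  case (step a w k w' b)
  obtain u k1 where e: "a = f u" "k = f k1" "(u, w, k1) \<in> E" using step(1) by (auto elim: relabelE)
  obtain k2 v where p: "k = f k2" "b = f v" "path K E k2 w' v" using step.IH by blast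
  obtain k3 where k3: "k = f k3" "k3 \<in> K" using step(2) by blast
  have "k1 \<in> verts E" "k2 \<in> verts E" using e p path_source[OF p(3)] by (auto simp: verts_def dest: vertsI)
  then have "k1 = k2" "k1 = k3" using assms e p k3 by (auto simp: inj_on_def)
  then show ?case using e p k3 by (blast intro: path.step)
qed

lemma relabel_hide:
  assumes "inj_on f (K \<union> verts E)"
  shows "relabel f (hide K E) = hide (f ` K) (relabel f E)"
proof (rule set_eqI, clarify)
  fix a w b
  show "(a, w, b) \<in> relabel f (hide K E) \<longleftrightarrow> (a, w, b) \<in> hide (f ` K) (relabel f E)"
  proof
    assume "(a, w, b) \<in> relabel f (hide K E)"
    then obtain u v where uv: "a = f u" "b = f v" "path K E u w v" "u \<notin> K" "v \<notin> K"
      by (auto elim!: relabelE simp: hide_def)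
    moreover have "u \<in> verts E" "v \<in> verts E" using path_source[OF uv(3)] path_target[OF uv(3)] by (auto simp: verts_def)
    ultimately have "a \<notin> f ` K" "b \<notin> f ` K" using assms by (auto simp: inj_on_def)
    then show "(a, w, b) \<in> hide (f ` K) (relabel f E)" using uv path_relabel by (auto simp: hide_def)
  next
    assume "(a, w, b) \<in> hide (f ` K) (relabel f E)"
    then show "(a, w, b) \<in> relabel f (hide K E)"
      using path_relabel_inv[OF assms, of a w b] by (auto simp: hide_def intro!: relabelI)
  qed
qed

lemma no_cycle_relabel:
  assumes "inj_on f (K \<union> verts E)" and "no_cycle K E"
  shows "no_cycle (f ` K) (relabel f E)"
  unfolding no_cycle_def
proof (intro ballI allI notI)
  fix a w assume "a \<in> f ` K" "path (f ` K) (relabel f E) a w a"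
  then obtain k u v where p: "k \<in> K" "a = f k" "a = f u" "a = f v" "path K E u w v"
    using path_relabel_inv[OF assms(1)] by (metis imageE)
  then have "u \<in> verts E" "v \<in> verts E" using path_source path_target by (fastforce simp: verts_def)+
  then have "u = k" "v = k" using p assms by (auto simp: inj_on_def)
  then show False using p assms(2) by (auto simp: no_cycle_def)
qed

section \<open>Boundaries and identity links\<close>

text \<open>A vertex list \<open>xs\<close> carrying the boundary \<open>X\<close>: the left endpoints may only be sources and
  the right endpoints only targets.\<close>

definition Lset :: "boundary \<Rightarrow> 'v list \<Rightarrow> 'v set" where
  "Lset X xs = {xs ! i | i. i < length xs \<and> X ! i}"

definition Rset :: "boundary \<Rightarrow> 'v list \<Rightarrow> 'v set" where
  "Rset X xs = {xs ! i | i. i < length xs \<and> \<not> X ! i}"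

definition pol :: "boundary \<Rightarrow> 'v list \<Rightarrow> ('v, 't) edge set \<Rightarrow> bool" where
  "pol X xs E \<longleftrightarrow> Lset X xs \<inter> target ` E = {} \<and> Rset X xs \<inter> source ` E = {}"

lemma LR_set: "Lset X xs \<union> Rset X xs = set xs"
  unfolding Lset_def Rset_def set_conv_nth by blast

lemma Lset_sub: "Lset X xs \<subseteq> set xs" and Rset_sub: "Rset X xs \<subseteq> set xs"
  using LR_set[of X xs] by auto

lemma LR_disjoint: "distinct xs \<Longrightarrow> Lset X xs \<inter> Rset X xs = {}"
  by (auto simp: Lset_def Rset_def nth_eq_iff_index_eq)

lemma Lset_append: "length X = length xs \<Longrightarrow> Lset (X @ Y) (xs @ ys) = Lset X xs \<union> Lset Y ys"
  and Rset_append: "length X = length xs \<Longrightarrow> Rset (X @ Y) (xs @ ys) = Rset X xs \<union> Rset Y ys"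
proof -
  have *: "{(xs @ ys) ! i | i. i < length (xs @ ys) \<and> P ((X @ Y) ! i)} =
      {xs ! i | i. i < length xs \<and> P (X ! i)} \<union> {ys ! i | i. i < length ys \<and> P (Y ! i)}" (is "?A = ?B \<union> ?C")
    if "length X = length xs" for P
  proof (intro equalityI subsetI)
    fix v assume "v \<in> ?A"
    then obtain i where i: "v = (xs @ ys) ! i" "i < length (xs @ ys)" "P ((X @ Y) ! i)" by blast
    show "v \<in> ?B \<union> ?C"
    proof (cases "i < length xs")
      case True
      then show ?thesis using i that by (auto simp: nth_append)
    next
      case False
      then have "v = ys ! (i - length xs)" "i - length xs < length ys" "P (Y ! (i - length xs))"
        using i that by (auto simp: nth_append)
      then show ?thesis by blast
    qed
  next
    fix v assume "v \<in> ?B \<union> ?C"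
    then show "v \<in> ?A"
    proof
      assume "v \<in> ?B"
      then obtain i where "v = xs ! i" "i < length xs" "P (X ! i)" by blast
      then show ?thesis using that by (intro CollectI exI[of _ i]) (auto simp: nth_append)
    next
      assume "v \<in> ?C"
      then obtain i where "v = ys ! i" "i < length ys" "P (Y ! i)" by blast
      then show ?thesis using that by (intro CollectI exI[of _ "length xs + i"]) (auto simp: nth_append)
    qed
  qed
  show "length X = length xs \<Longrightarrow> Lset (X @ Y) (xs @ ys) = Lset X xs \<union> Lset Y ys"
    using *[of "\<lambda>b. b"] by (simp add: Lset_def)
  show "length X = length xs \<Longrightarrow> Rset (X @ Y) (xs @ ys) = Rset X xs \<union> Rset Y ys"
    using *[of Not] by (simp add: Rset_def)
qed

lemma bdual_nth: "i < length X \<Longrightarrow> bdual X ! i = (\<not> X ! (length X - Suc i))"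
  by (simp add: bdual_def rev_nth)

lemma Lset_rev: "length X = length xs \<Longrightarrow> Lset (bdual X) (rev xs) = Rset X xs"
  and Rset_rev: "length X = length xs \<Longrightarrow> Rset (bdual X) (rev xs) = Lset X xs"
proof -
  have *: "{rev xs ! i | i. i < length (rev xs) \<and> P (bdual X ! i)} = {xs ! i | i. i < length xs \<and> P (\<not> X ! i)}" (is "?A = ?B")
    if "length X = length xs" for P
  proof (intro equalityI subsetI)
    fix v assume "v \<in> ?A"
    then obtain i where "v = rev xs ! i" "i < length xs" "P (bdual X ! i)" by auto
    then show "v \<in> ?B" using that
      by (intro CollectI exI[of _ "length xs - Suc i"]) (auto simp: bdual_nth rev_nth)
  next
    fix v assume "v \<in> ?B"
    then obtain i where "v = xs ! i" "i < length xs" "P (\<not> X ! i)" by auto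
    then show "v \<in> ?A" using that
      by (intro CollectI exI[of _ "length xs - Suc i"]) (auto simp: bdual_nth rev_nth Suc_diff_Suc)
  qed
  show "length X = length xs \<Longrightarrow> Lset (bdual X) (rev xs) = Rset X xs"
    using *[of "\<lambda>b. b"] by (simp add: Lset_def Rset_def)
  show "length X = length xs \<Longrightarrow> Rset (bdual X) (rev xs) = Lset X xs"
    using *[of Not] by (simp add: Lset_def Rset_def)
qed

lemma Lset_Not: "length X = length xs \<Longrightarrow> Lset (map Not X) xs = Rset X xs"
  and Rset_Not: "length X = length xs \<Longrightarrow> Rset (map Not X) xs = Lset X xs"
  by (auto simp: Lset_def Rset_def)

lemma Lset_map: "Lset X (map f xs) = f ` Lset X xs" and Rset_map: "Rset X (map f xs) = f ` Rset X xs"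
  unfolding Lset_def Rset_def setcompr_eq_image image_image by (rule image_cong; simp)+

lemma pol_mono: "pol X xs E \<Longrightarrow> source ` F \<subseteq> source ` E \<Longrightarrow> target ` F \<subseteq> target ` E \<Longrightarrow> pol X xs F"
  unfolding pol_def by (metis (no_types) Int_mono order_refl subset_empty)

lemma pol_Un [simp]: "pol X xs (E \<union> F) \<longleftrightarrow> pol X xs E \<and> pol X xs F"
  unfolding pol_def image_Un Int_Un_distrib Un_empty by auto

lemma pol_hide: "pol X xs E \<Longrightarrow> pol X xs (hide K E)"
  using hide_source[of K E] hide_target[of K E] by (elim pol_mono) auto

lemma pol_disjoint: "set xs \<inter> verts E = {} \<Longrightarrow> pol X xs E"
  using Lset_sub[of X xs] Rset_sub[of X xs] unfolding pol_def verts_def disjoint_iff by (metis UnI1 UnI2 subsetD)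

lemma pol_append:
  "length X = length xs \<Longrightarrow> pol (X @ Y) (xs @ ys) E \<longleftrightarrow> pol X xs E \<and> pol Y ys E"
  unfolding pol_def by (auto simp: Lset_append Rset_append Int_Un_distrib2)

lemma pol_rev: "length X = length xs \<Longrightarrow> pol (bdual X) (rev xs) E \<longleftrightarrow> pol (map Not X) xs E"
  unfolding pol_def by (simp add: Lset_rev Rset_rev Lset_Not Rset_Not)

lemma pol_relabel:
  assumes "inj_on f (set xs \<union> verts E)" "pol X xs E"
  shows "pol X (map f xs) (relabel f E)"
  unfolding pol_def Lset_map Rset_map source_relabel target_relabel
proof (intro conjI)
  have "f ` Lset X xs \<inter> f ` target ` E = f ` (Lset X xs \<inter> target ` E)"
    by (rule inj_on_image_Int[OF assms(1), symmetric]) (use Lset_sub[of X xs] in \<open>auto simp: verts_def\<close>)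
  then show "f ` Lset X xs \<inter> f ` target ` E = {}" using assms(2) by (simp add: pol_def)
  have "f ` Rset X xs \<inter> f ` source ` E = f ` (Rset X xs \<inter> source ` E)"
    by (rule inj_on_image_Int[OF assms(1), symmetric]) (use Rset_sub[of X xs] in \<open>auto simp: verts_def\<close>)
  then show "f ` Rset X xs \<inter> f ` source ` E = {}" using assms(2) by (simp add: pol_def)
qed

text \<open>A graph with the right polarity at \<open>K = set xs\<close> has no edges inside \<open>K\<close> that could be chained.\<close>

lemma no_cycle_pol:
  assumes "pol X xs E"
  shows "no_cycle (set xs) E"
  unfolding no_cycle_def
proof (intro ballI allI notI)
  fix k w assume "k \<in> set xs" "path (set xs) E k w k"
  then have "k \<in> source ` E" "k \<in> target ` E" "k \<in> Lset X xs \<union> Rset X xs"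
    using path_source path_target LR_set by (metis, metis, metis)
  then show False using assms by (auto simp: pol_def)
qed

text \<open>The identity cowordism on names. Here \<open>us\<close> carries the boundary
  \<open>X\<close> and \<open>vs\<close> the opposite polarity, both in the same order; the reversal
  of a dual block is left to the place where the list is formed.\<close>

definition idg :: "boundary \<Rightarrow> 'v list \<Rightarrow> 'v list \<Rightarrow> ('v, 't) edge set" where
  "idg X us vs = (\<lambda>i. if X ! i then (us ! i, [], vs ! i) else (vs ! i, [], us ! i)) ` {..<length X}"

lemma idgE:
  assumes "(a, w, b) \<in> idg X us vs"
  obtains i where "i < length X" "X ! i" "a = us ! i" "b = vs ! i" "w = []"
    | i where "i < length X" "\<not> X ! i" "a = vs ! i" "b = us ! i" "w = []"
  using assms unfolding idg_def by (auto split: if_splits)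

lemma idgI: "i < length X \<Longrightarrow> X ! i \<Longrightarrow> (us ! i, [], vs ! i) \<in> idg X us vs"
  "i < length X \<Longrightarrow> \<not> X ! i \<Longrightarrow> (vs ! i, [], us ! i) \<in> idg X us vs"
  unfolding idg_def by force+

lemma idg_Not: "idg (map Not X) us vs = idg X vs us"
  unfolding idg_def by (rule image_cong) auto

lemma source_idg:
  assumes "length us = length X" "length vs = length X"
  shows "source ` idg X us vs = Lset X us \<union> Rset X vs"
proof -
  have "source ` idg X us vs = (\<lambda>i. if X ! i then us ! i else vs ! i) ` {..<length X}"
    unfolding idg_def image_image by (rule image_cong) auto
  also have "\<dots> = (!) us ` {i. i < length X \<and> X ! i} \<union> (!) vs ` {i. i < length X \<and> \<not> X ! i}"
    by (force split: if_splits)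
  finally show ?thesis using assms by (simp add: Lset_def Rset_def setcompr_eq_image)
qed

lemma target_idg:
  assumes "length us = length X" "length vs = length X"
  shows "target ` idg X us vs = Rset X us \<union> Lset X vs"
proof -
  have "target ` idg X us vs = (\<lambda>i. if X ! i then vs ! i else us ! i) ` {..<length X}"
    unfolding idg_def image_image by (rule image_cong) auto
  also have "\<dots> = (!) us ` {i. i < length X \<and> \<not> X ! i} \<union> (!) vs ` {i. i < length X \<and> X ! i}"
    by (force split: if_splits)
  finally show ?thesis using assms by (simp add: Lset_def Rset_def setcompr_eq_image)
qed

lemma verts_idg [simp]:
  "length us = length X \<Longrightarrow> length vs = length X \<Longrightarrow> verts (idg X us vs) = set us \<union> set vs"
  unfolding verts_def using source_idg[of us X vs] target_idg[of us X vs] LR_set[of X us] LR_set[of X vs] by auto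

lemma pol_idg:
  assumes "length us = length X" "length vs = length X" "distinct us" "distinct vs" "set us \<inter> set vs = {}"
  shows "pol X us (idg X us vs)" "pol (map Not X) vs (idg X us vs)"
proof -
  have "Lset X us \<inter> Rset X us = {}" "Lset X vs \<inter> Rset X vs = {}"
    using assms LR_disjoint by auto
  moreover have "(Lset X us \<union> Rset X us) \<inter> (Lset X vs \<union> Rset X vs) = {}"
    using assms by (simp add: LR_set)
  ultimately show "pol X us (idg X us vs)" "pol (map Not X) vs (idg X us vs)"
    using assms(1,2) by (auto simp: pol_def source_idg target_idg Lset_Not Rset_Not)
qed

lemma relabel_idg:
  assumes "length us = length X" "length vs = length X"
  shows "relabel f (idg X us vs) = idg X (map f us) (map f vs)"
  unfolding relabel_def idg_def image_image by (rule image_cong) (use assms in auto)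

lemma idg_append:
  assumes "length us = length X" "length vs = length X"
  shows "idg (X @ Y) (us @ us') (vs @ vs') = idg X us vs \<union> idg Y us' vs'"
proof -
  have *: "{..<length (X @ Y)} = {..<length X} \<union> (\<lambda>i. length X + i) ` {..<length Y}"
  proof (rule set_eqI)
    fix i show "i \<in> {..<length (X @ Y)} \<longleftrightarrow> i \<in> {..<length X} \<union> (\<lambda>i. length X + i) ` {..<length Y}"
      by (cases "i < length X") (auto simp: image_iff intro: bexI[of _ "i - length X"])
  qed
  show ?thesis unfolding idg_def * image_Un image_image
    by (intro arg_cong2[where f = "(\<union>)"] image_cong) (use assms in \<open>auto simp: nth_append\<close>)
qed

lemma idg_rev:
  assumes "length us = length X" "length vs = length X"
  shows "idg (bdual X) (rev us) (rev vs) = (idg X vs us :: ('v, 't) edge set)"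
proof -
  have "(\<lambda>i. length X - Suc i) ` {..<length X} = {..<length X}"
  proof (intro equalityI subsetI)
    fix i assume "i \<in> {..<length X}"
    then show "i \<in> (\<lambda>i. length X - Suc i) ` {..<length X}"
      by (intro image_eqI[of _ _ "length X - Suc i"]) auto
  qed auto
  then have "(idg X vs us :: ('v, 't) edge set) = (\<lambda>i. if X ! i then (vs ! i, [], us ! i) else (us ! i, [], vs ! i)) ` (\<lambda>i. length X - Suc i) ` {..<length X}"
    by (simp add: idg_def)
  also have "\<dots> = idg (bdual X) (rev us) (rev vs)"
    unfolding idg_def image_image length_bdual
    by (rule image_cong) (use assms in \<open>auto simp: bdual_nth rev_nth\<close>)
  finally show ?thesis by simp
qed

text \<open>The unit law of composition. Polarity lets an edge of \<open>E\<close> end in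
  \<open>us\<close> only at right endpoints and start there only at left ones, while links lead into
  left endpoints and out of right ones. So a path between visible vertices is one edge of
  \<open>E\<close> with at most one link before and one link after it.\<close>

lemma hide_idg:
  assumes len: "length us = length X" "length vs = length X" and d: "distinct us"
    and pol: "pol X us E" and disj: "set vs \<inter> (set us \<union> verts E) = {}"
    and f: "map f us = vs" "\<And>v. v \<in> verts E - set us \<Longrightarrow> f v = v"
  shows "hide (set us) (E \<union> idg X vs us) = relabel f E"
proof -
  let ?I = "idg X vs us"
  have fi: "f (us ! i) = vs ! i" if "i < length X" for i using f(1) len that by (metis nth_map)
  have LR: "Lset X us \<inter> Rset X us = {}" using LR_disjoint[OF d] .
  have notus: "a \<notin> set us" if "i < length X" "a = vs ! i" for a i
    using that disj len by (metis IntI Un_iff empty_iff nth_mem)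
  have inL: "us ! i \<in> Lset X us" if "i < length X" "X ! i" for i using that len by (auto simp: Lset_def)
  have inR: "us ! i \<in> Rset X us" if "i < length X" "\<not> X ! i" for i using that len by (auto simp: Rset_def)
  have tR: "k \<in> Rset X us" if "(a, w, k) \<in> E" "k \<in> set us" for a w k
    using that pol LR_set[of X us] by (force simp: pol_def)
  have sL: "a \<in> Lset X us" if "(a, w, k) \<in> E" "a \<in> set us" for a w k
    using that pol LR_set[of X us] by (force simp: pol_def)
  have usE: "f v \<notin> set us" if "v \<in> verts E" for v
  proof (cases "v \<in> set us")
    case True
    then have "f v \<in> set vs" using f(1) by auto
    then show ?thesis using disj by blast
  qed (use f(2) that in auto)
  \<comment> \<open>The cases are what remains of such a path: only the final link, an edge of
    \<open>E\<close> with its final link, or everything.\<close>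
  have main: "(a \<in> Rset X us \<longrightarrow> w = [] \<and> b = f a) \<and> (a \<in> Lset X us \<longrightarrow> (\<exists>v. (a, w, v) \<in> E \<and> b = f v)) \<and>
      (a \<notin> set us \<longrightarrow> (\<exists>u v. (u, w, v) \<in> E \<and> a = f u \<and> b = f v))"
    if "path (set us) (E \<union> ?I) a w b" "b \<notin> set us" for a w b
    using that
  proof (induction rule: path.induct)
    case (single a w b)
    from single(1) show ?case
    proof
      assume e: "(a, w, b) \<in> E"
      then have "f b = b" using f(2) single(2) by (auto dest: vertsI)
      moreover have "a \<notin> set us \<longrightarrow> f a = a" using f(2) e by (auto dest: vertsI)
      moreover have "a \<notin> Rset X us" using sL[OF e] LR Rset_sub[of X us] by blast
      ultimately show ?thesis using e by metis
    next
      assume "(a, w, b) \<in> ?I"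
      then show ?thesis
      proof (cases rule: idgE)
        case (1 i)
        then show ?thesis using single(2) len by auto
      next
        case (2 i)
        then have "a \<in> Rset X us" using inR by auto
        then show ?thesis using 2 fi LR Rset_sub[of X us] by auto
      qed
    qed
  next
    case (step a w k w' b)
    from step(1) show ?case
    proof
      assume e: "(a, w, k) \<in> E"
      then have "w' = []" "b = f k" using tR step by auto
      moreover have "a \<notin> set us \<longrightarrow> f a = a" using f(2) e by (auto dest: vertsI)
      moreover have "a \<notin> Rset X us" using sL[OF e] LR Rset_sub[of X us] by blast
      ultimately show ?thesis using e by (metis append_Nil2)
    next
      assume "(a, w, k) \<in> ?I"
      then show ?thesis
      proof (cases rule: idgE)
        case (1 i)
        then obtain v where "(k, w', v) \<in> E" "b = f v" using step inL by blast
        moreover have "a = f k" using 1 fi by simp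
        ultimately show ?thesis using 1 notus[of i a] Lset_sub[of X us] Rset_sub[of X us] by auto
      next
        case (2 i)
        then show ?thesis using step(2) notus by blast
      qed
    qed
  qed
  show ?thesis
  proof (rule set_eqI, clarify)
    fix a w b
    show "(a, w, b) \<in> hide (set us) (E \<union> ?I) \<longleftrightarrow> (a, w, b) \<in> relabel f E"
    proof
      assume "(a, w, b) \<in> hide (set us) (E \<union> ?I)"
      then show "(a, w, b) \<in> relabel f E" using main[of a w b] by (auto simp: hide_def intro: relabelI)
    next
      assume "(a, w, b) \<in> relabel f E"
      then obtain u v where uv: "a = f u" "b = f v" "(u, w, v) \<in> E" by (auto elim: relabelE)
      have nin: "a \<notin> set us" "b \<notin> set us" using uv usE by (auto dest: vertsI)
      have pv: "path (set us) (E \<union> ?I) u w b"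
      proof (cases "v \<in> set us")
        case True
        then obtain i where i: "i < length X" "v = us ! i" "\<not> X ! i"
          using tR[OF uv(3)] len by (auto simp: Rset_def)
        then have "(v, [], b) \<in> ?I" using idgI(2)[of i X us vs] uv fi by auto
        then have "path (set us) (E \<union> ?I) u (w @ []) b" using uv True by (blast intro: path.intros)
        then show ?thesis by simp
      next
        case False
        then have "b = v" using f(2) uv by (auto dest: vertsI)
        then show ?thesis using uv by (auto intro: path.single)
      qed
      have "path (set us) (E \<union> ?I) a w b"
      proof (cases "u \<in> set us")
        case True
        then obtain i where i: "i < length X" "u = us ! i" "X ! i"
          using sL[OF uv(3)] len by (auto simp: Lset_def)
        then have "(a, [], u) \<in> ?I" using idgI(1)[of i X vs us] uv fi by auto
        then have "path (set us) (E \<union> ?I) a ([] @ w) b" using pv True by (blast intro: path.intros)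
        then show ?thesis by simp
      next
        case False
        then have "a = u" using f(2) uv by (auto dest: vertsI)
        then show ?thesis using pv by simp
      qed
      then show "(a, w, b) \<in> hide (set us) (E \<union> ?I)" using nin by (simp add: hide_def)
    qed
  qed
qed

text \<open>A total involution instead of a partial renaming: being a bijection on all vertices, it
  meets the injectivity conditions of the relabelling lemmas for every graph.\<close>

definition swap_lists :: "'v list \<Rightarrow> 'v list \<Rightarrow> 'v \<Rightarrow> 'v" where
  "swap_lists us vs v = (case map_of (zip (us @ vs) (vs @ us)) v of None \<Rightarrow> v | Some v' \<Rightarrow> v')"

lemma swap_lists_other: "length us = length vs \<Longrightarrow> v \<notin> set us \<union> set vs \<Longrightarrow> swap_lists us vs v = v"
  by (auto simp: swap_lists_def split: option.split dest: map_of_SomeD set_zip_leftD)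

lemma swap_lists_map:
  assumes "distinct (us @ vs)" "length us = length vs"
  shows "map (swap_lists us vs) us = vs" "map (swap_lists us vs) vs = us"
proof -
  have *: "swap_lists us vs ((us @ vs) ! i) = (vs @ us) ! i" if "i < length (us @ vs)" for i
    unfolding swap_lists_def using map_of_zip_nth[of "us @ vs" "vs @ us" i] assms that by simp
  show "map (swap_lists us vs) us = vs"
  proof (intro nth_equalityI)
    fix i assume "i < length (map (swap_lists us vs) us)"
    then show "map (swap_lists us vs) us ! i = vs ! i"
      using *[of i] assms by (auto simp: nth_append)
  qed (use assms in simp)
  show "map (swap_lists us vs) vs = us"
  proof (intro nth_equalityI)
    fix i assume "i < length (map (swap_lists us vs) vs)"
    then show "map (swap_lists us vs) vs ! i = us ! i"
      using *[of "length us + i"] assms by (auto simp: nth_append)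
  qed (use assms in simp)
qed

lemma swap_lists_swap_lists:
  assumes "distinct (us @ vs)" "length us = length vs"
  shows "swap_lists us vs (swap_lists us vs v) = v"
proof (cases "v \<in> set us \<union> set vs")
  case True
  then consider i where "i < length us" "v = us ! i" | i where "i < length vs" "v = vs ! i"
    by (auto simp: in_set_conv_nth)
  then show ?thesis
    by cases (metis assms nth_map swap_lists_map)+
qed (simp add: swap_lists_other assms)

lemma bij_swap_lists: "distinct (us @ vs) \<Longrightarrow> length us = length vs \<Longrightarrow> bij (swap_lists us vs)"
  by (rule o_bij[of "swap_lists us vs"]) (auto simp: swap_lists_swap_lists)

lemma hide_idg_swap:
  assumes "length us = length X" "length vs = length X" "distinct us" "distinct vs"
    and "pol X us E" "set vs \<inter> (set us \<union> verts E) = {}"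
  shows "hide (set us) (E \<union> idg X vs us) = relabel (swap_lists us vs) E"
proof (rule hide_idg)
  have d: "distinct (us @ vs)" using assms by auto
  show "map (swap_lists us vs) us = vs" by (rule swap_lists_map) (use d assms in auto)
  fix v assume "v \<in> verts E - set us"
  then show "swap_lists us vs v = v" using assms by (intro swap_lists_other) auto
qed (use assms in auto)

lemma fresh_list: 
  assumes "finite (V :: nat set)"
  obtains xs :: "nat list" where "length xs = n" "distinct xs" "set xs \<inter> V = {}"
proof -
  obtain m where m: "\<forall>v\<in>V. v < m" using assms finite_nat_set_iff_bounded by blast
  show ?thesis by (rule that[of "[m..<m + n]"]) (use m in \<open>auto simp: disjoint_iff dest: leD\<close>)
qed

section \<open>Simultaneous substitution, equivalence of terms, boundaries of object types\<close>

text \<open>All free variables are replaced at once, since the fundamental lemma of the logical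
  relation is about open terms.\<close>

primrec psubst :: "(nat \<Rightarrow> 'c lterm) \<Rightarrow> 'c lterm \<Rightarrow> 'c lterm" where
  "psubst \<theta> (Var i) = \<theta> i"
| "psubst \<theta> (Const c) = Const c"
| "psubst \<theta> (App t s) = App (psubst \<theta> t) (psubst \<theta> s)"
| "psubst \<theta> (Abs t) = Abs (psubst (case_nat (Var 0) (\<lambda>i. lift (\<theta> i) 0)) t)"

lemma subst_psubst: "subst (psubst \<theta> t) s k = psubst (\<lambda>i. subst (\<theta> i) s k) t"
proof (induction t arbitrary: \<theta> s k)
  case (Abs t)
  have "(\<lambda>i. subst (case_nat (Var 0) (\<lambda>i. lift (\<theta> i) 0) i) (lift s 0) (Suc k)) =
      case_nat (Var 0) (\<lambda>i. lift (subst (\<theta> i) s k) 0)"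
    by (rule ext) (auto split: nat.split simp: lift_subst_lt)
  then show ?case using Abs by simp
qed auto

lemma subst_psubst_up:
  "subst (psubst (case_nat (Var 0) (\<lambda>i. lift (\<theta> i) 0)) t) s 0 = psubst (case_nat s \<theta>) t"
  unfolding subst_psubst by (rule arg_cong[where f = "\<lambda>\<theta>. psubst \<theta> t"]) (auto split: nat.split)

lemma psubst_id: "(\<And>x. occurrences t x \<noteq> 0 \<Longrightarrow> \<theta> x = Var x) \<Longrightarrow> psubst \<theta> t = t"
proof (induction t arbitrary: \<theta>)
  case (Abs t)
  have "psubst (case_nat (Var 0) (\<lambda>i. lift (\<theta> i) 0)) t = t"
    by (rule Abs.IH) (use Abs.prems in \<open>auto split: nat.split\<close>)
  then show ?case by simp
next
  case (App t s)
  have "psubst \<theta> t = t" "psubst \<theta> s = s" by (rule App.IH; use App.prems in simp)+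
  then show ?case by simp
qed auto

lemma lift_id: "(\<And>x. k \<le> x \<Longrightarrow> occurrences t x = 0) \<Longrightarrow> lift t k = t"
proof (induction t arbitrary: k)
  case (Abs t)
  have "lift t (Suc k) = t"
  proof (rule Abs.IH)
    fix x assume "Suc k \<le> x"
    then show "occurrences t x = 0" using Abs.prems[of "x - 1"] by (cases x) auto
  qed
  then show ?case by simp
next
  case (App t s)
  have "lift t k = t" "lift s k = s" by (rule App.IH; use App.prems in simp)+
  then show ?case by simp
next
  case (Var i)
  then show ?case by (metis lift.simps(1) not_le occurrences.simps(1) one_neq_zero)
qed auto

lemma map_constants_Const [simp]: "map_constants Const t = t"
  by (induction t) auto

lemma typing_closed: "typing \<Sigma> [] t A \<Longrightarrow> occurrences t x = 0"
  by (simp add: typing_linear)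

abbreviation eqv (infix \<open>\<approx>\<close> 50) where "t \<approx> s \<equiv> beta_eta_equiv t s"

lemma eqv_refl [simp]: "t \<approx> t"
  by (simp add: beta_eta_equiv_def)

lemma eqv_sym: "t \<approx> s \<Longrightarrow> s \<approx> t"
  unfolding beta_eta_equiv_def by (rule equivclp_sym)

lemma eqv_trans: "t \<approx> s \<Longrightarrow> s \<approx> u \<Longrightarrow> t \<approx> u"
  unfolding beta_eta_equiv_def by (rule equivclp_trans)

lemma beta_eta_eqv: "beta_eta t s \<Longrightarrow> t \<approx> s"
  unfolding beta_eta_equiv_def by (rule r_into_equivclp)

lemma eqv_cong:
  assumes "\<And>t t'. beta_eta t t' \<Longrightarrow> beta_eta (f t) (f t')"
  shows "t \<approx> t' \<Longrightarrow> f t \<approx> f t'"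
  unfolding beta_eta_equiv_def
proof (induction rule: equivclp_induct)
  case (step y z)
  then have "beta_eta (f y) (f z) \<or> beta_eta (f z) (f y)" using assms by blast
  with step.IH show ?case by (meson equivclp_into_equivclp)
qed simp

lemma eqv_appL: "t \<approx> t' \<Longrightarrow> App t s \<approx> App t' s"
  by (rule eqv_cong[of "\<lambda>t. App t s"]) (auto intro: beta_eta.appL)

lemma eqv_appR: "s \<approx> s' \<Longrightarrow> App t s \<approx> App t s'"
  by (rule eqv_cong[of "\<lambda>s. App t s"]) (auto intro: beta_eta.appR)

lemma eqv_abs: "t \<approx> t' \<Longrightarrow> Abs t \<approx> Abs t'"
  by (rule eqv_cong[of Abs]) (auto intro: beta_eta.abs)

text \<open>Relates an applied abstraction to its body under the extended substitution; this closes
  the abstraction case of the fundamental lemma.\<close>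

lemma eqv_psubst_beta: "App (psubst \<theta> (Abs t)) s \<approx> psubst (case_nat s \<theta>) t"
  using beta_eta_eqv[OF beta_eta.beta, of "psubst (case_nat (Var 0) (\<lambda>i. lift (\<theta> i) 0)) t" s]
  by (simp add: subst_psubst_up)

text \<open>Chosen to agree with the boundary of \<open>Par (dual A) B\<close>. An atom is one left
  endpoint, so \<open>O -\<circ> O\<close> has a left and a right vertex, and the graph of a string
  is one edge from the first to the second.\<close>

primrec tbd :: "str_atom ltype \<Rightarrow> boundary" where
  "tbd (Atom a) = [True]"
| "tbd (A -\<circ> B) = tbd B @ bdual (tbd A)"

primrec ext :: "('n \<Rightarrow> 'm ltype) \<Rightarrow> 'n ltype \<Rightarrow> 'm ltype" where
  "ext h (Atom p) = h p"
| "ext h (A -\<circ> B) = ext h A -\<circ> ext h B"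

lemma length_tbd_pos [simp]: "0 < length (tbd A)"
  by (induction A) auto

lemma length_bdual' [simp]: "length (bdual X) = length X"
  by (rule length_bdual)

section \<open>A logical relation between graphs and terms\<close>

text \<open>
  The vertex \<open>None\<close> stands for a free variable of type \<open>O\<close>. For \<open>fl = True\<close> the relation says that
  the graph computes the term. For \<open>fl = False\<close> the terms are irrelevant, every type is
  inhabited by the empty graph, and the relation says that no closed cycles arise.
\<close>

definition wfg :: "boundary \<Rightarrow> nat option list \<Rightarrow> (nat option, 't) edge set \<Rightarrow> bool" where
  "wfg X xs E \<longleftrightarrow> pol X xs E \<and> verts E \<subseteq> insert None (set xs)"

primrec lr :: "bool \<Rightarrow> str_atom ltype \<Rightarrow> nat option list \<Rightarrow> (nat option, 't) edge set \<Rightarrow> 't lterm \<Rightarrow> bool" where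
  "lr fl (Atom a) xs E u \<longleftrightarrow> wfg [True] xs E \<and>
     (fl \<longrightarrow> (\<exists>x w. xs = [x] \<and> E = {(x, w, None)} \<and> u \<approx> word_term w (Var 0)))"
| "lr fl (A -\<circ> B) xs E u \<longleftrightarrow> wfg (tbd (A -\<circ> B)) xs E \<and>
     (\<forall>F s. lr fl A (rev (drop (length (tbd B)) xs)) F s \<longrightarrow>
        (fl \<or> no_cycle (set (drop (length (tbd B)) xs)) (E \<union> F)) \<and>
        lr fl B (take (length (tbd B)) xs) (hide (set (drop (length (tbd B)) xs)) (E \<union> F)) (App u s))"

lemma lr_wfg: "lr fl A xs E u \<Longrightarrow> wfg (tbd A) xs E"
  by (cases A) auto

lemma lr_eqv: "lr fl A xs E u \<Longrightarrow> u \<approx> u' \<Longrightarrow> lr fl A xs E u'"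
proof (induction A arbitrary: xs E u u')
  case (Atom a)
  then show ?case using eqv_trans[OF eqv_sym] by auto
next
  case (Limp A B)
  then show ?case using eqv_appL by (fastforce simp del: tbd.simps)
qed

lemma wfg_relabel:
  assumes "bij f" "f None = None" "wfg X xs E"
  shows "wfg X (map f xs) (relabel f E)"
proof -
  have "inj_on f (set xs \<union> verts E)" using assms(1) by (meson bij_def inj_on_subset subset_UNIV)
  then have "pol X (map f xs) (relabel f E)" using assms(3) pol_relabel by (auto simp: wfg_def)
  moreover have "f ` verts E \<subseteq> f ` insert None (set xs)" using assms(3) by (intro image_mono) (auto simp: wfg_def)
  ultimately show ?thesis using assms(2) by (simp add: wfg_def verts_relabel)
qed

lemma relabel_inv:
  assumes "bij f"
  shows "relabel f (relabel (inv f) E) = E" "relabel (inv f) (relabel f E) = E"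
  unfolding relabel_relabel using assms by (auto intro!: relabel_id simp: bij_def surj_f_inv_f)

lemma lr_relabel:
  assumes "bij f" "f None = None" "lr fl A xs E u"
  shows "lr fl A (map f xs) (relabel f E) u"
  using assms
proof (induction A arbitrary: f xs E u)
  case (Atom a)
  have "wfg [True] (map f xs) (relabel f E)" using Atom wfg_relabel[of f "[True]" xs E] by simp
  then show ?case using Atom by auto
next
  case (Limp A B)
  let ?n = "length (tbd B)"
  have inj: "inj_on f S" for S using Limp.prems(1) by (meson bij_def inj_on_subset subset_UNIV)
  have "(fl \<or> no_cycle (set (drop ?n (map f xs))) (relabel f E \<union> F)) \<and>
        lr fl B (take ?n (map f xs)) (hide (set (drop ?n (map f xs))) (relabel f E \<union> F)) (App u s)"
    if F: "lr fl A (rev (drop ?n (map f xs))) F s" for F s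
  proof -
    \<comment> \<open>Arguments occur contravariantly: an argument graph on the renamed vertices is
      pulled back along the inverse.\<close>
    let ?F = "relabel (inv f) F"
    have "inv f None = None" using Limp.prems by (metis bij_def inv_f_f)
    then have "lr fl A (map (inv f) (rev (drop ?n (map f xs)))) ?F s"
      using Limp.IH(1)[of "inv f"] F Limp.prems(1) bij_imp_bij_inv by blast
    moreover have "map (inv f) (rev (drop ?n (map f xs))) = rev (drop ?n xs)"
      using Limp.prems(1) by (simp add: rev_map drop_map bij_def)
    ultimately have *: "fl \<or> no_cycle (set (drop ?n xs)) (E \<union> ?F)"
        "lr fl B (take ?n xs) (hide (set (drop ?n xs)) (E \<union> ?F)) (App u s)"
      using Limp.prems(3) by auto
    have "fl \<or> no_cycle (set (drop ?n (map f xs))) (relabel f E \<union> F)"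
      using *(1) no_cycle_relabel[OF inj, of "set (drop ?n xs)" "E \<union> ?F"] by (auto simp: drop_map relabel_inv(1)[OF Limp.prems(1)])
    moreover have "lr fl B (take ?n (map f xs)) (hide (set (drop ?n (map f xs))) (relabel f E \<union> F)) (App u s)"
      using Limp.IH(2)[OF Limp.prems(1,2) *(2)] relabel_hide[OF inj, of "set (drop ?n xs)" "E \<union> ?F"]
      by (simp add: drop_map take_map relabel_inv(1)[OF Limp.prems(1)])
    ultimately show ?thesis by blast
  qed
  moreover have "wfg (tbd (A -\<circ> B)) (map f xs) (relabel f E)"
    using Limp.prems wfg_relabel lr_wfg by blast
  ultimately show ?case by simp
qed

text \<open>By polarity the argument graph cannot be chained at its own vertices, and
  \<open>E\<close> does not touch them, so no cycle closes. Edges at \<open>None\<close> have to be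
  allowed because hiding an argument can leave them behind.\<close>

lemma lr_empty:
  assumes "verts E \<subseteq> {None}" "None \<notin> set xs" "distinct xs" "length xs = length (tbd A)"
  shows "lr False A xs E u"
  using assms
proof (induction A arbitrary: xs E u)
  case (Atom a)
  then show ?case by (auto simp: wfg_def intro!: pol_disjoint)
next
  case (Limp A B xs E u)
  let ?n = "length (tbd B)" and ?bs = "take (length (tbd B)) xs" and ?as = "drop (length (tbd B)) xs"
  have "no_cycle (set ?as) (E \<union> F) \<and> lr False B ?bs (hide (set ?as) (E \<union> F)) (App u s)"
    if F: "lr False A (rev ?as) F s" for F s
  proof
    have wf: "pol (tbd A) (rev ?as) F" "verts F \<subseteq> insert None (set ?as)"
      using lr_wfg[OF F] by (auto simp: wfg_def)
    have "pol (tbd A) (rev ?as) E" using Limp.prems by (intro pol_disjoint) (auto dest: in_set_dropD)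
    then show "no_cycle (set ?as) (E \<union> F)" using no_cycle_pol[of "tbd A" "rev ?as" "E \<union> F"] wf by simp
    show "lr False B ?bs (hide (set ?as) (E \<union> F)) (App u s)"
      using wf Limp.prems verts_hide[of "set ?as" "E \<union> F"] by (intro Limp.IH(2)) (auto dest: in_set_takeD)
  qed
  moreover have "wfg (tbd (A -\<circ> B)) xs E" using Limp.prems by (auto simp: wfg_def intro!: pol_disjoint)
  ultimately show ?case by simp
qed

lemma path_restrict:
  "path K E u w v \<Longrightarrow> u \<in> K \<Longrightarrow> v \<in> K \<Longrightarrow> path K {e \<in> E. source e \<in> K \<and> target e \<in> K} u w v"
  by (induction rule: path.induct) (auto intro: path.intros)

text \<open>A closed walk through \<open>K\<close> never leaves \<open>K\<close>, so it uses only
  edges with both ends there.\<close>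

lemma no_cycle_restrict: "no_cycle K {e \<in> E. source e \<in> K \<and> target e \<in> K} \<Longrightarrow> no_cycle K E"
  unfolding no_cycle_def using path_restrict by fast

lemma hide_Un2:
  assumes "K1 \<inter> verts E2 = {}" "K2 \<inter> verts E1 = {}"
  shows "hide (K1 \<union> K2) (E1 \<union> E2) = hide K1 E1 \<union> hide K2 E2"
proof -
  have "hide (K1 \<union> K2) (E1 \<union> E2) = hide K1 (hide K2 (E2 \<union> E1))" by (simp add: hide_hide Un_commute)
  also have "\<dots> = hide K1 (E1 \<union> hide K2 E2)"
    using hide_Un_disjoint[OF assms(2), of E2] by (simp add: Un_commute)
  also have "\<dots> = hide K1 E1 \<union> hide K2 E2"
    using assms(1) verts_hide[of K2 E2] by (intro hide_Un_disjoint) auto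
  finally show ?thesis .
qed

section \<open>Matchings\<close>

definition matching :: "'t set \<Rightarrow> 'v set \<Rightarrow> 'v set \<Rightarrow> ('v, 't) edge set \<Rightarrow> bool" where
  "matching T L R E \<longleftrightarrow> (\<forall>(u, w, v) \<in> E. u \<in> L \<and> v \<in> R \<and> w \<in> lists T) \<and>
     (\<forall>u \<in> L. \<exists>!e. e \<in> E \<and> source e = u) \<and> (\<forall>v \<in> R. \<exists>!e. e \<in> E \<and> target e = v)"

text \<open>Labels are reversed along with the edges, so that labels of paths are reversed as well.
  The target half of a matching then follows from the source half.\<close>

definition revg :: "('v, 't) edge set \<Rightarrow> ('v, 't) edge set" where
  "revg E = (\<lambda>(u, w, v). (v, rev w, u)) ` E"

lemma in_revg: "(u, w, v) \<in> revg E \<longleftrightarrow> (v, rev w, u) \<in> E"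
  by (force simp: revg_def)

lemma revg_revg [simp]: "revg (revg E) = E"
  by (auto simp: in_revg)

lemma path_revg_imp: "path K E u w v \<Longrightarrow> path K (revg E) v (rev w) u"
proof (induction rule: path.induct)
  case (single u w v)
  then show ?case by (auto intro: path.single simp: in_revg)
next
  case (step u w k w' v)
  then have "path K (revg E) k (rev w) u" by (auto intro: path.single simp: in_revg)
  then show ?case using step path_trans by fastforce
qed

lemma path_revg: "path K (revg E) u w v \<longleftrightarrow> path K E v (rev w) u"
  using path_revg_imp[of K E v "rev w" u] path_revg_imp[of K "revg E" u w v] by auto

lemma hide_revg: "hide K (revg E) = revg (hide K E)"
  by (auto simp: hide_def path_revg in_revg)

lemma no_cycle_revg: "no_cycle K E \<Longrightarrow> no_cycle K (revg E)"
  by (auto simp: no_cycle_def path_revg)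

lemma matching_revg: "matching T L R E \<Longrightarrow> matching T R L (revg E)"
proof -
  assume m: "matching T L R E"
  have *: "(\<exists>!e. e \<in> revg E \<and> P (source e) (target e)) \<longleftrightarrow> (\<exists>!e. e \<in> E \<and> P (target e) (source e))" for P
  proof
    assume "\<exists>!e. e \<in> revg E \<and> P (source e) (target e)"
    then obtain e where e: "e \<in> revg E" "P (source e) (target e)"
      and u: "\<And>e'. e' \<in> revg E \<and> P (source e') (target e') \<Longrightarrow> e' = e" by blast
    show "\<exists>!e. e \<in> E \<and> P (target e) (source e)"
    proof (rule ex1I[of _ "(target e, rev (label e), source e)"])
      show "(target e, rev (label e), source e) \<in> E \<and> P (target (target e, rev (label e), source e)) (source (target e, rev (label e), source e))"
        using e by (cases e) (simp add: in_revg)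
      fix e' assume "e' \<in> E \<and> P (target e') (source e')"
      then have "(target e', rev (label e'), source e') = e"
        using u[of "(target e', rev (label e'), source e')"] by (cases e') (simp add: in_revg)
      then show "e' = (target e, rev (label e), source e)" by auto
    qed
  next
    assume "\<exists>!e. e \<in> E \<and> P (target e) (source e)"
    then obtain e where e: "e \<in> E" "P (target e) (source e)"
      and u: "\<And>e'. e' \<in> E \<and> P (target e') (source e') \<Longrightarrow> e' = e" by blast
    show "\<exists>!e. e \<in> revg E \<and> P (source e) (target e)"
    proof (rule ex1I[of _ "(target e, rev (label e), source e)"])
      show "(target e, rev (label e), source e) \<in> revg E \<and> P (source (target e, rev (label e), source e)) (target (target e, rev (label e), source e))"
        using e by (simp add: in_revg)
      fix e' assume a: "e' \<in> revg E \<and> P (source e') (target e')"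
      then have "(target e', rev (label e'), source e') = e"
        using u[of "(target e', rev (label e'), source e')"] by (cases e') (simp add: in_revg)
      then show "e' = (target e, rev (label e), source e)" by auto
    qed
  qed
  have "\<forall>(u, w, v) \<in> revg E. u \<in> R \<and> v \<in> L \<and> w \<in> lists T"
  proof clarify
    fix u w v assume "(u, w, v) \<in> revg E"
    then have "v \<in> L" "u \<in> R" "rev w \<in> lists T" using m by (auto simp: in_revg matching_def)
    then show "u \<in> R \<and> v \<in> L \<and> w \<in> lists T" by (simp add: in_lists_conv_set)
  qed
  moreover have "\<exists>!e. e \<in> revg E \<and> source e = v" if "v \<in> R" for v
    using m that *[of "\<lambda>a b. a = v"] by (auto simp: matching_def)
  moreover have "\<exists>!e. e \<in> revg E \<and> target e = u" if "u \<in> L" for u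
    using m that *[of "\<lambda>a b. b = u"] by (auto simp: matching_def)
  ultimately show ?thesis unfolding matching_def by (intro conjI ballI) blast+
qed

lemma matching_unique_source: "matching T L R E \<Longrightarrow> (u, w, v) \<in> E \<Longrightarrow> (u, w', v') \<in> E \<Longrightarrow> w = w' \<and> v = v'"
  unfolding matching_def by (metis (mono_tags, lifting) case_prodD fst_conv snd_conv)

lemma matching_Un:
  assumes "matching T L R E" "matching T L' R' E'" "L \<inter> L' = {}" "R \<inter> R' = {}"
  shows "matching T (L \<union> L') (R \<union> R') (E \<union> E')"
proof -
  have s: "source e \<in> L" "target e \<in> R" if "e \<in> E" for e using assms(1) that by (auto simp: matching_def)
  have s': "source e \<in> L'" "target e \<in> R'" if "e \<in> E'" for e using assms(2) that by (auto simp: matching_def)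
  have a1: "\<exists>!e. e \<in> E \<union> E' \<and> source e = u" if "u \<in> L" for u
  proof -
    from that have "\<exists>!e. e \<in> E \<and> source e = u" using assms by (auto simp: matching_def)
    moreover have "e \<notin> E'" if "source e = u" for e using s'(1)[of e] that \<open>u \<in> L\<close> assms(3) by blast
    ultimately show ?thesis by blast
  qed
  have a2: "\<exists>!e. e \<in> E \<union> E' \<and> source e = u" if "u \<in> L'" for u
  proof -
    from that have "\<exists>!e. e \<in> E' \<and> source e = u" using assms by (auto simp: matching_def)
    moreover have "e \<notin> E" if "source e = u" for e using s(1)[of e] that \<open>u \<in> L'\<close> assms(3) by blast
    ultimately show ?thesis by blast
  qed
  have a3: "\<exists>!e. e \<in> E \<union> E' \<and> target e = u" if "u \<in> R" for u
  proof -
    from that have "\<exists>!e. e \<in> E \<and> target e = u" using assms by (auto simp: matching_def)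
    moreover have "e \<notin> E'" if "target e = u" for e using s'(2)[of e] that \<open>u \<in> R\<close> assms(4) by blast
    ultimately show ?thesis by blast
  qed
  have a4: "\<exists>!e. e \<in> E \<union> E' \<and> target e = u" if "u \<in> R'" for u
  proof -
    from that have "\<exists>!e. e \<in> E' \<and> target e = u" using assms by (auto simp: matching_def)
    moreover have "e \<notin> E" if "target e = u" for e using s(2)[of e] that \<open>u \<in> R'\<close> assms(4) by blast
    ultimately show ?thesis by blast
  qed
  have a5: "\<forall>(u, w, v) \<in> E \<union> E'. u \<in> L \<union> L' \<and> v \<in> R \<union> R' \<and> w \<in> lists T"
    using assms by (auto simp: matching_def)
  show ?thesis unfolding matching_def
    by (intro conjI a5; intro ballI; erule UnE; (rule a1 a2 a3 a4, assumption))
qed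

text \<open>Starting from \<open>u\<close>, the unique outgoing edges determine the walk, which
  gives uniqueness. It must leave \<open>K\<close> because \<open>K\<close> is finite and carries no
  cycle, which gives existence.\<close>

lemma matching_hide_source:
  assumes m: "matching T (L \<union> K) (R \<union> K) E" and fin: "finite K" and nc: "no_cycle K E"
    and u: "u \<in> L" and LK: "L \<inter> K = {}"
  shows "\<exists>!e. e \<in> hide K E \<and> source e = u"
proof -
  let ?r = "{(k', k). k \<in> K \<and> k' \<in> K \<and> (\<exists>w. (k, w, k') \<in> E)}"
  have out: "\<exists>w v. (u, w, v) \<in> E" if "u \<in> L \<union> K" for u
  proof -
    obtain e where "e \<in> E" "source e = u" using m \<open>u \<in> L \<union> K\<close> unfolding matching_def by (metis (no_types, lifting))
    then show ?thesis by (metis prod.collapse)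
  qed
  have tr: "(a, b) \<in> ?r\<^sup>+ \<Longrightarrow> \<exists>w. path K E b w a \<and> a \<in> K \<and> b \<in> K" for a b
  proof (induction rule: trancl_induct)
    case (base y)
    then show ?case by (auto intro: path.single)
  next
    case (step y z)
    then show ?case by (auto intro: path.step)
  qed
  \<comment> \<open>Finiteness and acyclicity make the successor relation inside \<open>K\<close>
    well-founded, so the exit from \<open>K\<close> is found by well-founded induction.\<close>
  have "acyclic ?r" using tr nc unfolding acyclic_def no_cycle_def by blast
  moreover have "finite ?r" by (rule finite_subset[of _ "K \<times> K"]) (use fin in auto)
  ultimately have wf: "wf ?r" using finite_acyclic_wf by blast
  have "k \<in> K \<longrightarrow> (\<exists>w v. path K E k w v \<and> v \<notin> K)" for k
  proof (induction k rule: wf_induct_rule[OF wf])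
    case (1 k)
    show ?case
    proof
      assume "k \<in> K"
      then obtain w v where e: "(k, w, v) \<in> E" using out by blast
      show "\<exists>w v. path K E k w v \<and> v \<notin> K"
      proof (cases "v \<in> K")
        case True
        then obtain w' v' where "path K E v w' v'" "v' \<notin> K" using 1[of v] e \<open>k \<in> K\<close> by blast
        then show ?thesis using e True by (blast intro: path.step)
      next
        case False
        then show ?thesis using e by (blast intro: path.single)
      qed
    qed
  qed note inner = this
  have ex: "\<exists>w v. path K E u w v \<and> v \<notin> K"
  proof -
    obtain w v where e: "(u, w, v) \<in> E" using out u by blast
    show ?thesis
    proof (cases "v \<in> K")
      case True
      then obtain w' v' where "path K E v w' v'" "v' \<notin> K" using inner by blast
      then show ?thesis using e True by (blast intro: path.step)
    next
      case False
      then show ?thesis using e by (blast intro: path.single)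
    qed
  qed
  have un: "path K E a w v \<Longrightarrow> v \<notin> K \<Longrightarrow> path K E a w' v' \<Longrightarrow> v' \<notin> K \<Longrightarrow> w = w' \<and> v = v'" for a w v w' v'
  proof (induction arbitrary: w' v' rule: path.induct)
    case (single a w v)
    from single(3) show ?case
      by (cases rule: path.cases) (use single matching_unique_source[OF m] in blast)+
  next
    case (step a w k w1 v)
    from step.prems(2) show ?case
    proof (cases rule: path.cases)
      case single
      then show ?thesis using step matching_unique_source[OF m] by blast
    next
      case 2: (step w2 k2 w3)
      then have "w = w2" "k = k2" using step(1) matching_unique_source[OF m] by blast+
      then show ?thesis using step.IH[of w3 v'] step.prems 2 by auto
    qed
  qed
  from ex obtain w v where p: "path K E u w v" "v \<notin> K" by blast
  show ?thesis
  proof (rule ex1I[of _ "(u, w, v)"])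
    show "(u, w, v) \<in> hide K E \<and> source (u, w, v) = u" using p u LK by (auto simp: hide_def)
    fix e assume "e \<in> hide K E \<and> source e = u"
    then have "path K E u (label e) (target e)" "target e \<notin> K" by (auto simp: hide_def)
    then show "e = (u, w, v)" using un[OF p] \<open>e \<in> hide K E \<and> source e = u\<close> by (cases e) auto
  qed
qed

lemma path_label:
  "path K E u w v \<Longrightarrow> (\<And>u w v. (u, w, v) \<in> E \<Longrightarrow> w \<in> lists T) \<Longrightarrow> w \<in> lists T"
  by (induction rule: path.induct) (fastforce simp del: in_lists_conv_set)+

lemma matching_hide:
  assumes m: "matching T (L \<union> K) (R \<union> K) E" and fin: "finite K" and nc: "no_cycle K E"
    and LK: "L \<inter> K = {}" and RK: "R \<inter> K = {}"
  shows "matching T L R (hide K E)"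
  unfolding matching_def
proof (intro conjI ballI)
  fix e assume e: "e \<in> hide K E"
  obtain u w v where uwv: "e = (u, w, v)" by (cases e)
  then have p: "path K E u w v" "u \<notin> K" "v \<notin> K" using e by (auto simp: hide_def)
  have "u \<in> source ` E" "v \<in> target ` E" using path_source[OF p(1)] path_target[OF p(1)] by auto
  then have "u \<in> L \<union> K" "v \<in> R \<union> K" using m by (auto simp: matching_def)
  moreover have "w \<in> lists T" by (rule path_label[OF p(1)]) (use m in \<open>auto simp: matching_def\<close>)
  ultimately show "case e of (u, w, v) \<Rightarrow> u \<in> L \<and> v \<in> R \<and> w \<in> lists T" using p uwv by auto
next
  fix u assume "u \<in> L"
  then show "\<exists>!e. e \<in> hide K E \<and> source e = u" using matching_hide_source[OF m fin nc _ LK] by blast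
next
  fix v assume v: "v \<in> R"
  have "\<exists>!e. e \<in> hide K (revg E) \<and> source e = v"
    using matching_hide_source[OF matching_revg[OF m] fin no_cycle_revg[OF nc] v RK] .
  then obtain e where e: "e \<in> hide K (revg E)" "source e = v"
    and u: "\<And>e'. e' \<in> hide K (revg E) \<Longrightarrow> source e' = v \<Longrightarrow> e' = e" by blast
  show "\<exists>!e. e \<in> hide K E \<and> target e = v"
  proof (rule ex1I[of _ "(target e, rev (label e), source e)"])
    show "(target e, rev (label e), source e) \<in> hide K E \<and> target (target e, rev (label e), source e) = v"
      using e by (cases e) (simp add: hide_revg in_revg)
    fix e' assume "e' \<in> hide K E \<and> target e' = v"
    then have "(target e', rev (label e'), source e') = e"
      using u[of "(target e', rev (label e'), source e')"] by (cases e') (simp add: hide_revg in_revg)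
    then show "e' = (target e, rev (label e), source e)" by auto
  qed
qed

section \<open>The graph of a linear term\<close>

text \<open>Moves the numbered vertices of a multiword to names. Vertices are counted from 1 and
  lists from 0, whence \<open>i - 1\<close>.\<close>

definition place :: "'v list \<Rightarrow> (nat, 't) edge set \<Rightarrow> ('v, 't) edge set" where
  "place vs E = relabel (\<lambda>i. vs ! (i - 1)) E"

lemma relabel_place:
  assumes "verts E \<subseteq> {1..length vs}"
  shows "relabel f (place vs E) = place (map f vs) E"
  unfolding place_def relabel_relabel
proof (rule relabel_cong)
  fix v assume "v \<in> verts E"
  then have "v - 1 < length vs" using assms by (cases v) auto
  then show "(f \<circ> (\<lambda>i. vs ! (i - 1))) v = map f vs ! (v - 1)" by simp
qed

lemma verts_place: "verts E \<subseteq> {1..length vs} \<Longrightarrow> verts (place vs E) \<subseteq> set vs"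
  by (force simp: place_def verts_relabel)

type_synonym 'n gctxt = "nat \<Rightarrow> ('n ltype \<times> nat list) option"

definition cv :: "'n gctxt \<Rightarrow> nat set" where
  "cv \<Gamma> = (\<Union>(A, ys)\<in>ran \<Gamma>. set ys)"

lemma cv_empty [simp]: "cv Map.empty = {}"
  by (simp add: cv_def)

lemma cv_single [simp]: "cv [x \<mapsto> (A, ys)] = set ys"
  by (simp add: cv_def)

lemma cv_single' [simp]: "cv (\<lambda>a. if a = x then Some (A, ys) else None) = set ys"
  using cv_single[of x A ys] by (simp add: fun_upd_def)

lemma dom_single' [simp]: "dom (\<lambda>a. if a = x then Some p else None) = {x}"
  by (auto split: if_splits)

lemma cv_add: "dom \<Gamma> \<inter> dom \<Delta> = {} \<Longrightarrow> cv (\<Gamma> ++ \<Delta>) = cv \<Gamma> \<union> cv \<Delta>"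
  by (simp add: cv_def ran_map_add)

lemma ran_case_nat: "ran (case_nat (Some a) \<Gamma>) = insert a (ran \<Gamma>)"
proof (intro equalityI subsetI)
  fix p assume "p \<in> ran (case_nat (Some a) \<Gamma>)"
  then obtain x where "case_nat (Some a) \<Gamma> x = Some p" by (auto simp: ran_def)
  then show "p \<in> insert a (ran \<Gamma>)" by (cases x) (auto simp: ran_def)
next
  fix p assume "p \<in> insert a (ran \<Gamma>)"
  then consider "p = a" | x where "\<Gamma> x = Some p" by (auto simp: ran_def)
  then show "p \<in> ran (case_nat (Some a) \<Gamma>)"
  proof cases
    case 1
    then show ?thesis by (auto intro: ranI[of _ 0])
  next
    case 2
    then show ?thesis by (auto intro: ranI[of _ "Suc x"])
  qed
qed

lemma cv_case_nat [simp]: "cv (case_nat (Some (A, ys)) \<Gamma>) = set ys \<union> cv \<Gamma>"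
  by (simp add: cv_def ran_case_nat)

lemma cvI: "\<Gamma> x = Some (A, ys) \<Longrightarrow> set ys \<subseteq> cv \<Gamma>"
  by (force simp: cv_def ran_def)

lemma dom_case_nat: "dom (case_nat (Some a) \<Gamma>) = insert 0 (Suc ` dom \<Gamma>)"
proof (rule set_eqI)
  fix x show "x \<in> dom (case_nat (Some a) \<Gamma>) \<longleftrightarrow> x \<in> insert 0 (Suc ` dom \<Gamma>)"
    by (cases x) auto
qed

definition inits :: "nat \<Rightarrow> nat list" where "inits n = [1..<Suc n]"

lemma inits_simps [simp]: "length (inits n) = n" "distinct (inits n)" "set (inits n) = {1..n}"
  "i < n \<Longrightarrow> inits n ! i = Suc i"
  by (auto simp: inits_def simp del: upt_Suc)

lemma place_inits: "verts E \<subseteq> {1..n} \<Longrightarrow> place (inits n) E = E"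
  unfolding place_def
proof (rule relabel_id)
  fix v assume "verts E \<subseteq> {1..n}" "v \<in> verts E"
  then have "1 \<le> v" "v \<le> n" by auto
  then show "inits n ! (v - 1) = v" by simp
qed

lemma matching_verts: "matching T L R E \<Longrightarrow> verts E \<subseteq> L \<union> R"
  by (auto simp: matching_def verts_def)

lemma matching_pol: "matching T L R E \<Longrightarrow> L \<inter> R = {} \<Longrightarrow> Lset X xs \<subseteq> L \<Longrightarrow> Rset X xs \<subseteq> R \<Longrightarrow> pol X xs E"
  unfolding pol_def matching_def by fastforce

lemma matching_ex1:
  assumes "matching T L R E"
  shows "u \<in> L \<Longrightarrow> \<exists>!e. e \<in> E \<and> source e = u" "v \<in> R \<Longrightarrow> \<exists>!e. e \<in> E \<and> target e = v"
  using assms by (simp_all add: matching_def)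

lemma matching_relabel:
  assumes m: "matching T L R E" and inj: "inj_on f (L \<union> R)"
  shows "matching T (f ` L) (f ` R) (relabel f E)"
  unfolding matching_def
proof (intro conjI ballI)
  have v: "u \<in> L" "v \<in> R" "w \<in> lists T" if "(u, w, v) \<in> E" for u w v using m that by (auto simp: matching_def)
  fix e assume "e \<in> relabel f E"
  then obtain u w v where "e = (f u, w, f v)" "(u, w, v) \<in> E" by (auto simp: relabel_def)
  then show "case e of (u, w, v) \<Rightarrow> u \<in> f ` L \<and> v \<in> f ` R \<and> w \<in> lists T" using v by auto
next
  fix a assume "a \<in> f ` L"
  then obtain u where u: "u \<in> L" "a = f u" by blast
  have "\<exists>!e. e \<in> E \<and> source e = u" by (rule matching_ex1(1)[OF m u(1)])
  then obtain e where e0: "e \<in> E \<and> source e = u" "\<forall>e'. e' \<in> E \<and> source e' = u \<longrightarrow> e' = e" by (rule ex1E)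
  note e = conjunct1[OF e0(1)] conjunct2[OF e0(1)] e0(2)[rule_format, OF conjI]
  show "\<exists>!e. e \<in> relabel f E \<and> source e = a"
  proof (rule ex1I[of _ "(f u, label e, f (target e))"])
    show "(f u, label e, f (target e)) \<in> relabel f E \<and> source (f u, label e, f (target e)) = a"
      using relabelI[of "source e" "label e" "target e" E f] e(1,2) u by auto
    fix e' assume "e' \<in> relabel f E \<and> source e' = a"
    then obtain u' w v where e': "e' = (f u', w, f v)" "(u', w, v) \<in> E" "f u' = f u" by (auto simp: relabel_def u)
    then have "u' \<in> L" using m by (auto simp: matching_def)
    then have "u' = u" using inj_onD[OF inj e'(3)] u by blast
    then show "e' = (f u, label e, f (target e))" using e(3)[of "(u', w, v)"] e' by auto
  qed
next
  fix a assume "a \<in> f ` R"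
  then obtain u where u: "u \<in> R" "a = f u" by blast
  have "\<exists>!e. e \<in> E \<and> target e = u" by (rule matching_ex1(2)[OF m u(1)])
  then obtain e where e0: "e \<in> E \<and> target e = u" "\<forall>e'. e' \<in> E \<and> target e' = u \<longrightarrow> e' = e" by (rule ex1E)
  note e = conjunct1[OF e0(1)] conjunct2[OF e0(1)] e0(2)[rule_format, OF conjI]
  show "\<exists>!e. e \<in> relabel f E \<and> target e = a"
  proof (rule ex1I[of _ "(f (source e), label e, f u)"])
    show "(f (source e), label e, f u) \<in> relabel f E \<and> target (f (source e), label e, f u) = a"
      using relabelI[of "source e" "label e" "target e" E f] e(1,2) u by auto
    fix e' assume "e' \<in> relabel f E \<and> target e' = a"
    then obtain u' w v where e': "e' = (f u', w, f v)" "(u', w, v) \<in> E" "f v = f u" by (auto simp: relabel_def u)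
    then have "v \<in> R" using m by (auto simp: matching_def)
    then have "v = u" using inj_onD[OF inj e'(3)] u by blast
    then show "e' = (f (source e), label e, f u)" using e(3)[of "(u', w, v)"] e' by auto
  qed
qed

lemma matching_idg:
  fixes us vs :: "'v list" and T :: "'t set"
  assumes "length us = length X" "length vs = length X" "distinct (us @ vs)"
  shows "matching T (Lset X us \<union> Rset X vs) (Rset X us \<union> Lset X vs) (idg X us vs)"
proof -
  let ?E = "idg X us vs :: ('v, 't) edge set"
  have inj: "us ! i = us ! j \<longleftrightarrow> i = j" "vs ! i = vs ! j \<longleftrightarrow> i = j" "us ! i \<noteq> vs ! j" "vs ! j \<noteq> us ! i"
    if "i < length X" "j < length X" for i j
    using assms that by (auto simp: nth_eq_iff_index_eq) (metis IntI empty_iff nth_mem)+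
  have us: "e = e'" if "e \<in> ?E" "e' \<in> ?E" "source e = source e'" for e e'
    using that inj by (auto simp: idg_def split: if_splits)
  have ut: "e = e'" if "e \<in> ?E" "e' \<in> ?E" "target e = target e'" for e e'
    using that inj by (auto simp: idg_def split: if_splits)
  have src: "source ` ?E = Lset X us \<union> Rset X vs" by (rule source_idg[OF assms(1,2)])
  have tgt: "target ` ?E = Rset X us \<union> Lset X vs" by (rule target_idg[OF assms(1,2)])
  show ?thesis unfolding matching_def
  proof (intro conjI ballI)
    fix e assume e: "e \<in> ?E"
    have "source e \<in> source ` ?E" using e by (rule imageI)
    moreover have "target e \<in> target ` ?E" using e by (rule imageI[of e])
    moreover from e have "label e = []" by (auto simp: idg_def split: if_splits)
    ultimately show "case e of (u, w, v) \<Rightarrow> u \<in> Lset X us \<union> Rset X vs \<and> v \<in> Rset X us \<union> Lset X vs \<and> w \<in> lists T"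
      using src tgt by (cases e) auto
  next
    fix u assume "u \<in> Lset X us \<union> Rset X vs"
    then have "u \<in> source ` ?E" using src by simp
    then show "\<exists>!e. e \<in> ?E \<and> source e = u" using us by blast
  next
    fix u assume "u \<in> Rset X us \<union> Lset X vs"
    then have "u \<in> target ` ?E" using tgt by simp
    then show "\<exists>!e. e \<in> ?E \<and> target e = u" using ut by blast
  qed
qed

text \<open>
  Atoms of \<open>\<Sigma>\<close> are mapped by \<open>h\<close> to object types, and \<open>\<kappa> c\<close> is the graph of the constant \<open>c\<close>.
\<close>

locale nets =
  fixes \<Sigma> :: "('n, 'c) signature" and h :: "'n \<Rightarrow> str_atom ltype"
    and \<kappa> :: "'c \<Rightarrow> (nat, 't) edge set" and T :: "'t set"
  assumes kappa: "c \<in> constants \<Sigma> \<Longrightarrow>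
      matching T (Lset (tbd (ext h (ctype \<Sigma> c))) (inits (length (tbd (ext h (ctype \<Sigma> c))))))
                 (Rset (tbd (ext h (ctype \<Sigma> c))) (inits (length (tbd (ext h (ctype \<Sigma> c)))))) (\<kappa> c)"
    and ctype_types: "c \<in> constants \<Sigma> \<Longrightarrow> ctype \<Sigma> c \<in> types (atoms \<Sigma>)"
begin

abbreviation tb :: "'n ltype \<Rightarrow> boundary" where "tb A \<equiv> tbd (ext h A)"

lemma verts_kappa: "c \<in> constants \<Sigma> \<Longrightarrow> verts (\<kappa> c) \<subseteq> {1..length (tb (ctype \<Sigma> c))}"
  using matching_verts[OF kappa] LR_set by (metis inits_simps(3))

text \<open>
  \<open>net \<Gamma> E t A zs\<close>: \<open>E\<close> is the graph of the term \<open>t\<close> of type \<open>A\<close> in the context \<open>\<Gamma>\<close>. The vertices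
  of the output type are \<open>zs\<close>, and a variable \<open>x\<close> of type \<open>B\<close> with \<open>\<Gamma> x = Some (B, ys)\<close> owns the
  vertices \<open>ys\<close>.
\<close>

inductive net :: "'n gctxt \<Rightarrow> (nat, 't) edge set \<Rightarrow> 'c lterm \<Rightarrow> 'n ltype \<Rightarrow> nat list \<Rightarrow> bool" where
  var: "A \<in> types (atoms \<Sigma>) \<Longrightarrow> length ys = length (tb A) \<Longrightarrow> length zs = length (tb A) \<Longrightarrow>
     distinct (zs @ ys) \<Longrightarrow> net [x \<mapsto> (A, ys)] (idg (tb A) zs ys) (Var x) A zs"
| const: "c \<in> constants \<Sigma> \<Longrightarrow> length zs = length (tb (ctype \<Sigma> c)) \<Longrightarrow> distinct zs \<Longrightarrow>
     net Map.empty (place zs (\<kappa> c)) (Const c) (ctype \<Sigma> c) zs"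
| app: "net \<Gamma> E t (A -\<circ> B) (zs @ rev as) \<Longrightarrow> net \<Delta> F s A as \<Longrightarrow> dom \<Gamma> \<inter> dom \<Delta> = {} \<Longrightarrow>
     (cv \<Gamma> \<union> set zs) \<inter> cv \<Delta> = {} \<Longrightarrow> net (\<Gamma> ++ \<Delta>) (hide (set as) (E \<union> F)) (App t s) B zs"
| abs: "net (case_nat (Some (A, ys)) \<Gamma>) E t B zs \<Longrightarrow> net \<Gamma> E (Abs t) (A -\<circ> B) (zs @ rev ys)"

definition ok_ctxt :: "'n gctxt \<Rightarrow> bool" where
  "ok_ctxt \<Gamma> \<longleftrightarrow> finite (dom \<Gamma>) \<and>
     (\<forall>x A ys. \<Gamma> x = Some (A, ys) \<longrightarrow> A \<in> types (atoms \<Sigma>) \<and> length ys = length (tb A) \<and> distinct ys) \<and>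
     (\<forall>x A ys y B zs. \<Gamma> x = Some (A, ys) \<longrightarrow> \<Gamma> y = Some (B, zs) \<longrightarrow> x \<noteq> y \<longrightarrow> set ys \<inter> set zs = {})"

lemma ok_ctxt_case_nat:
  assumes "ok_ctxt (case_nat (Some (A, ys)) \<Gamma>)"
  shows "ok_ctxt \<Gamma>" "A \<in> types (atoms \<Sigma>)" "length ys = length (tb A)" "distinct ys" "set ys \<inter> cv \<Gamma> = {}"
proof -
  let ?G = "case_nat (Some (A, ys)) \<Gamma>"
  have ok: "?G x = Some (A, ys) \<Longrightarrow> A \<in> types (atoms \<Sigma>) \<and> length ys = length (tb A) \<and> distinct ys"
    "?G x = Some (A, ys) \<Longrightarrow> ?G y = Some (B, zs) \<Longrightarrow> x \<noteq> y \<Longrightarrow> set ys \<inter> set zs = {}" for x A ys y B zs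
    using assms unfolding ok_ctxt_def by blast+
  have "finite (Suc ` dom \<Gamma>)" using assms by (simp add: ok_ctxt_def dom_case_nat)
  then have "finite (dom \<Gamma>)" by (simp add: finite_image_iff)
  then show "ok_ctxt \<Gamma>" unfolding ok_ctxt_def
  proof (intro conjI allI impI)
    fix x A ys assume "\<Gamma> x = Some (A, ys)"
    then show "A \<in> types (atoms \<Sigma>)" "length ys = length (tb A)" "distinct ys" using ok(1)[of "Suc x" A ys] by simp_all
  next
    fix x A ys y B zs assume "\<Gamma> x = Some (A, ys)" "\<Gamma> y = Some (B, zs)" "x \<noteq> y"
    then show "set ys \<inter> set zs = {}" using ok(2)[of "Suc x" A ys "Suc y" B zs] by simp
  qed
  show "A \<in> types (atoms \<Sigma>)" "length ys = length (tb A)" "distinct ys" using ok(1)[of 0 A ys] by simp_all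
  have "set ys \<inter> set zs = {}" if "\<Gamma> x = Some (B, zs)" for x B zs
    using ok(2)[of 0 A ys "Suc x" B zs] that by simp
  then show "set ys \<inter> cv \<Gamma> = {}" by (force simp: cv_def ran_def)
qed

lemma ok_ctxt_add:
  assumes "ok_ctxt \<Gamma>" "ok_ctxt \<Delta>" "dom \<Gamma> \<inter> dom \<Delta> = {}" "cv \<Gamma> \<inter> cv \<Delta> = {}"
  shows "ok_ctxt (\<Gamma> ++ \<Delta>)"
proof -
  have *: "\<Gamma> x = Some a \<or> \<Delta> x = Some a" if "(\<Gamma> ++ \<Delta>) x = Some a" for x a
    using that by (auto simp: map_add_Some_iff)
  show ?thesis unfolding ok_ctxt_def
  proof (intro conjI allI impI)
    show "finite (dom (\<Gamma> ++ \<Delta>))" using assms by (simp add: ok_ctxt_def)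
  next
    fix x A ys assume "(\<Gamma> ++ \<Delta>) x = Some (A, ys)"
    from *[OF this] show "A \<in> types (atoms \<Sigma>)" "length ys = length (tb A)" "distinct ys"
      using assms(1,2) by (auto simp: ok_ctxt_def)
  next
    fix x A ys y B zs
    assume a: "(\<Gamma> ++ \<Delta>) x = Some (A, ys)" "(\<Gamma> ++ \<Delta>) y = Some (B, zs)" "x \<noteq> y"
    consider "\<Gamma> x = Some (A, ys)" "\<Gamma> y = Some (B, zs)" | "\<Delta> x = Some (A, ys)" "\<Delta> y = Some (B, zs)"
      | "\<Gamma> x = Some (A, ys)" "\<Delta> y = Some (B, zs)" | "\<Delta> x = Some (A, ys)" "\<Gamma> y = Some (B, zs)"
      using *[OF a(1)] *[OF a(2)] by blast
    then show "set ys \<inter> set zs = {}"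
    proof cases
      case 1
      then show ?thesis using assms(1) a(3) unfolding ok_ctxt_def by blast
    next
      case 2
      then show ?thesis using assms(2) a(3) unfolding ok_ctxt_def by blast
    qed (use assms(4) cvI in \<open>blast, blast\<close>)
  qed
qed

lemma net_ok: "net \<Gamma> E t A zs \<Longrightarrow>
  ok_ctxt \<Gamma> \<and> A \<in> types (atoms \<Sigma>) \<and> length zs = length (tb A) \<and> distinct zs \<and> set zs \<inter> cv \<Gamma> = {} \<and>
  verts E \<subseteq> set zs \<union> cv \<Gamma>"
proof (induction rule: net.induct)
  case (var A ys zs x)
  then show ?case by (auto simp: ok_ctxt_def)
next
  case (const c zs)
  then show ?case using verts_place[of "\<kappa> c" zs] verts_kappa[of c] ctype_types by (auto simp: ok_ctxt_def)
next
  case (app \<Gamma> E t A B zs as \<Delta> F s)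
  then show ?case using ok_ctxt_add[of \<Gamma> \<Delta>] verts_hide[of "set as" "E \<union> F"]
    by (auto simp: cv_add types_def)
next
  case (abs A ys \<Gamma> E t B zs)
  then show ?case using ok_ctxt_case_nat[of A ys \<Gamma>] by (auto simp: types_def)
qed

text \<open>A variable is an input, so its vertices carry the polarity opposite to its type, but in
  the order of the type itself: hence \<open>map Not\<close> instead of
  \<open>bdual\<close>.\<close>

lemma net_pol: "net \<Gamma> E t A zs \<Longrightarrow>
  pol (tb A) zs E \<and> (\<forall>x B ys. \<Gamma> x = Some (B, ys) \<longrightarrow> pol (map Not (tb B)) ys E)"
proof (induction rule: net.induct)
  case (var A ys zs x)
  then show ?case using pol_idg[of zs "tb A" ys] by (auto split: if_splits)
next
  case (const c zs)
  let ?X = "tb (ctype \<Sigma> c)"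
  have inj: "inj_on (\<lambda>i. zs ! (i - 1)) {1..length ?X}"
    using const by (auto simp: inj_on_def nth_eq_iff_index_eq)
  have "map (\<lambda>i. zs ! (i - 1)) (inits (length ?X)) = zs"
    using const by (auto intro!: nth_equalityI)
  moreover have "pol ?X (inits (length ?X)) (\<kappa> c)"
    by (rule matching_pol[OF kappa[OF const(1)]]) (simp_all add: LR_disjoint)
  ultimately show ?case
    using pol_relabel[of "\<lambda>i. zs ! (i - 1)" "inits (length ?X)" "\<kappa> c" ?X] inj verts_kappa[OF const(1)]
    by (auto simp: place_def Un_absorb2)
next
  case (app \<Gamma> E t A B zs as \<Delta> F s)
  note ok = net_ok[OF app(1)] net_ok[OF app(2)]
  have zs: "length zs = length (tb B)" "length as = length (tb A)" using ok by auto
  have "pol (tb B) zs E" using app.IH(1) zs by (simp add: pol_append)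
  moreover have "pol (tb B) zs F" using ok app(4) by (intro pol_disjoint) auto
  moreover have c: "pol (map Not (tb C)) ys (E \<union> F)" if "(\<Gamma> ++ \<Delta>) x = Some (C, ys)" for x C ys
  proof -
    from that consider "\<Gamma> x = Some (C, ys)" | "\<Delta> x = Some (C, ys)" by (auto simp: map_add_Some_iff)
    then show ?thesis
    proof cases
      case 1
      then have "pol (map Not (tb C)) ys E" using app.IH(1) by blast
      moreover have "pol (map Not (tb C)) ys F"
        using ok app(4) cvI[of \<Gamma> x C ys, OF 1] by (intro pol_disjoint) (simp, blast)
      ultimately show ?thesis by simp
    next
      case 2
      then have "pol (map Not (tb C)) ys F" using app.IH(2) by blast
      moreover have "pol (map Not (tb C)) ys E"
        using ok app(4) cvI[of \<Delta> x C ys, OF 2] by (intro pol_disjoint) (simp, blast)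
      ultimately show ?thesis by simp
    qed
  qed
  ultimately show ?case
    by (intro conjI allI impI pol_hide) (simp, rule c)
next
  case (abs A ys \<Gamma> E t B zs)
  have ok: "length zs = length (tb B)" "length ys = length (tb A)"
    using net_ok[OF abs(1)] ok_ctxt_case_nat[of A ys \<Gamma>] by auto
  have "pol (map Not (tb C)) us E" if "case_nat (Some (A, ys)) \<Gamma> x = Some (C, us)" for x C us
    using abs.IH that by blast
  from this[of 0] this[of "Suc _"] show ?case using abs.IH ok by (auto simp: pol_append pol_rev)
qed

definition ctxt_graph :: "'n gctxt \<Rightarrow> (nat \<Rightarrow> 'e set) \<Rightarrow> 'e set" where
  "ctxt_graph \<Gamma> a = (\<Union>x\<in>dom \<Gamma>. a x)"

lemma ctxt_graph_add: "ctxt_graph (\<Gamma> ++ \<Delta>) a = ctxt_graph \<Gamma> a \<union> ctxt_graph \<Delta> a"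
  by (auto simp: ctxt_graph_def)

lemma ctxt_graph_case_nat: "ctxt_graph (case_nat (Some p) \<Gamma>) (case_nat F a) = F \<union> ctxt_graph \<Gamma> a"
  by (simp add: ctxt_graph_def dom_case_nat)

lemma verts_ctxt_graph:
  assumes "\<And>x A ys. \<Gamma> x = Some (A, ys) \<Longrightarrow> lr fl (ext h A) (map Some ys) (a x) (\<theta> x)"
  shows "verts (ctxt_graph \<Gamma> a) \<subseteq> insert None (Some ` cv \<Gamma>)"
proof -
  have "verts (a x) \<subseteq> insert None (Some ` cv \<Gamma>)" if "x \<in> dom \<Gamma>" for x
  proof -
    obtain A ys where x: "\<Gamma> x = Some (A, ys)" using \<open>x \<in> dom \<Gamma>\<close> by auto
    have "verts (a x) \<subseteq> insert None (Some ` set ys)" using lr_wfg[OF assms[OF x]] by (simp add: wfg_def)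
    then show ?thesis using image_mono[OF cvI[of \<Gamma> x A ys, OF x], of Some] by blast
  qed
  then show ?thesis by (auto simp: ctxt_graph_def verts_UN)
qed

lemma inj_Some [simp]: "inj_on Some S"
  by (simp add: inj_on_def)

lemma pol_Some: "pol X xs E \<Longrightarrow> pol X (map Some xs) (relabel Some E)"
  by (rule pol_relabel) auto

text \<open>The fundamental lemma of the logical relation: plugging related graphs into the
  variables gives a graph related to the substituted term. Acyclicity is a conjunct of its own
  because \<open>hide\<close> erases closed cycles without trace, so it cannot be read off the
  resulting graph.\<close>

lemma net_lr:
  fixes g :: "'c \<Rightarrow> 't lterm"
  assumes const: "\<And>c zs. c \<in> constants \<Sigma> \<Longrightarrow> length zs = length (tb (ctype \<Sigma> c)) \<Longrightarrow> distinct zs \<Longrightarrow>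
      lr fl (ext h (ctype \<Sigma> c)) (map Some zs) (relabel Some (place zs (\<kappa> c))) (g c)"
    and closed: "\<And>c x. c \<in> constants \<Sigma> \<Longrightarrow> occurrences (g c) x = 0"
  shows "net \<Gamma> E t A zs \<Longrightarrow> (\<And>x A ys. \<Gamma> x = Some (A, ys) \<Longrightarrow> lr fl (ext h A) (map Some ys) (a x) (\<theta> x)) \<Longrightarrow>
    (fl \<or> no_cycle (Some ` cv \<Gamma>) (relabel Some E \<union> ctxt_graph \<Gamma> a)) \<and>
    lr fl (ext h A) (map Some zs) (hide (Some ` cv \<Gamma>) (relabel Some E \<union> ctxt_graph \<Gamma> a))
      (psubst \<theta> (map_constants g t))"
proof (induction arbitrary: a \<theta> rule: net.induct)
  case (var A ys zs x)
  let ?ys = "map Some ys" and ?zs = "map Some zs"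
  have l: "lr fl (ext h A) ?ys (a x) (\<theta> x)" using var.prems[of x] by simp
  have wf: "pol (tb A) ?ys (a x)" "verts (a x) \<subseteq> insert None (set ?ys)"
    using lr_wfg[OF l] by (auto simp: wfg_def)
  have E: "relabel Some (idg (tb A) zs ys) = idg (tb A) ?zs ?ys" using var by (simp add: relabel_idg)
  have d: "distinct (?ys @ ?zs)" using var by (auto simp: distinct_map)
  \<comment> \<open>Every link has an end among \<open>zs\<close>, so the edges inside
    \<open>ys\<close> all belong to the argument graph, whose polarity excludes chains.\<close>
  have "no_cycle (set ?ys) {e \<in> a x \<union> idg (tb A) ?zs ?ys. source e \<in> set ?ys \<and> target e \<in> set ?ys}"
  proof (rule no_cycle_mono[OF no_cycle_pol[OF wf(1)]])
    have "\<not> (source e \<in> set ?ys \<and> target e \<in> set ?ys)" if "e \<in> idg (tb A) ?zs ?ys" for e :: "(nat option, 't) edge"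
    proof -
      have "source e \<in> set ?zs \<or> target e \<in> set ?zs" using that var by (auto simp: idg_def split: if_splits)
      then show ?thesis using d by auto
    qed
    then show "{e \<in> a x \<union> idg (tb A) ?zs ?ys. source e \<in> set ?ys \<and> target e \<in> set ?ys} \<subseteq> a x" by blast
  qed simp
  then have "no_cycle (set ?ys) (a x \<union> idg (tb A) ?zs ?ys)" by (rule no_cycle_restrict)
  moreover have "hide (set ?ys) (a x \<union> idg (tb A) ?zs ?ys) = relabel (swap_lists ?ys ?zs) (a x)"
    by (rule hide_idg_swap) (use var wf d in auto)
  moreover have "lr fl (ext h A) (map (swap_lists ?ys ?zs) ?ys) (relabel (swap_lists ?ys ?zs) (a x)) (\<theta> x)"
    by (rule lr_relabel[OF bij_swap_lists _ l]) (use d var in \<open>auto intro!: swap_lists_other\<close>)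
  moreover have "map (swap_lists ?ys ?zs) ?ys = ?zs" by (rule swap_lists_map) (use d var in auto)
  ultimately show ?case by (simp add: E ctxt_graph_def Un_commute)
next
  case (const c zs)
  have "psubst \<theta> (g c) = g c" by (rule psubst_id) (use closed const in auto)
  then show ?case using assms(1)[OF const(1-3)] by (simp add: ctxt_graph_def no_cycle_def)
next
  case (app \<Gamma> E t A B zs as \<Delta> F s)
  let ?X1 = "ctxt_graph \<Gamma> a" and ?X2 = "ctxt_graph \<Delta> a"
  let ?K1 = "Some ` cv \<Gamma>" and ?K2 = "Some ` cv \<Delta>" and ?K = "Some ` set as"
  let ?G1 = "relabel Some E \<union> ?X1" and ?G2 = "relabel Some F \<union> ?X2"
  have ok1: "set (zs @ rev as) \<inter> cv \<Gamma> = {}" "verts E \<subseteq> set (zs @ rev as) \<union> cv \<Gamma>" using net_ok[OF app(1)] by auto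
  have ok2: "set as \<inter> cv \<Delta> = {}" "verts F \<subseteq> set as \<union> cv \<Delta>" "length as = length (tb A)" using net_ok[OF app(2)] by auto
  have len: "length zs = length (tb B)" using net_ok[OF app(1)] ok2 by auto
  have p1: "\<Gamma> x = Some (A, ys) \<Longrightarrow> lr fl (ext h A) (map Some ys) (a x) (\<theta> x)" for x A ys
    using app.prems[of x A ys] app(3) by (auto simp: map_add_Some_iff)
  have p2: "\<Delta> x = Some (A, ys) \<Longrightarrow> lr fl (ext h A) (map Some ys) (a x) (\<theta> x)" for x A ys
    using app.prems[of x A ys] by (auto simp: map_add_Some_iff)
  have v1: "verts ?X1 \<subseteq> insert None ?K1" using verts_ctxt_graph[of \<Gamma> fl a \<theta>] p1 by blast
  have v2: "verts ?X2 \<subseteq> insert None ?K2" using verts_ctxt_graph[of \<Delta> fl a \<theta>] p2 by blast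
  have vG1: "verts ?G1 \<subseteq> insert None (Some ` (set zs \<union> set as \<union> cv \<Gamma>))" using v1 ok1 by (auto simp: verts_relabel)
  have vG2: "verts ?G2 \<subseteq> insert None (Some ` (set as \<union> cv \<Delta>))" using v2 ok2 by (auto simp: verts_relabel)
  have d1: "?K1 \<inter> verts ?G2 = {}" using vG2 ok1 app(4) by auto
  have d2: "?K2 \<inter> verts ?G1 = {}" using vG1 ok2 app(4) by auto
  note IH1 = app.IH(1)[of a \<theta>, OF p1] and IH2 = app.IH(2)[of a \<theta>, OF p2]
  have "drop (length (tb B)) (map Some (zs @ rev as)) = map Some (rev as)"
    "take (length (tb B)) (map Some (zs @ rev as)) = map Some zs" using len by auto
  then have lr: "fl \<or> no_cycle ?K (hide ?K1 ?G1 \<union> hide ?K2 ?G2)"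
    "lr fl (ext h B) (map Some zs) (hide ?K (hide ?K1 ?G1 \<union> hide ?K2 ?G2))
       (App (psubst \<theta> (map_constants g t)) (psubst \<theta> (map_constants g s)))"
    using IH1 IH2 by (auto simp: rev_map)
  have eq: "hide ?K1 ?G1 \<union> hide ?K2 ?G2 = hide (?K1 \<union> ?K2) (?G1 \<union> ?G2)"
    by (rule hide_Un2[OF d1 d2, symmetric])
  have dX: "?K \<inter> verts (?X1 \<union> ?X2) = {}" using v1 v2 ok1 ok2 by auto
  have SE: "relabel Some (hide (set as) (E \<union> F)) = hide ?K (relabel Some E \<union> relabel Some F)"
    by (simp add: relabel_hide)
  have G: "relabel Some (hide (set as) (E \<union> F)) \<union> ctxt_graph (\<Gamma> ++ \<Delta>) a = hide ?K (?G1 \<union> ?G2)"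
    unfolding SE ctxt_graph_add using hide_Un_disjoint[OF dX, of "relabel Some E \<union> relabel Some F"]
    by (simp add: Un_ac)
  have cv: "Some ` cv (\<Gamma> ++ \<Delta>) = ?K1 \<union> ?K2" using app(3) by (simp add: cv_add image_Un)
  have "fl \<or> no_cycle (?K1 \<union> ?K2) (hide ?K (?G1 \<union> ?G2))"
  proof (cases fl)
    case False
    \<comment> \<open>The induction hypotheses exclude cycles through context vertices, and the
      function clause of the relation excludes those through argument vertices once the context is
      hidden. Together no cycle is left, and the vertices may be hidden in the other order.\<close>
    have "no_cycle (?K \<union> (?K1 \<union> ?K2)) (?G1 \<union> ?G2)"
    proof (rule no_cycle_UnI)
      show "no_cycle (?K1 \<union> ?K2) (?G1 \<union> ?G2)"
        using IH1 IH2 False d1 d2 by (intro no_cycle_Un2) auto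
      show "no_cycle ?K (hide (?K1 \<union> ?K2) (?G1 \<union> ?G2))" using lr(1) False eq by simp
    qed
    then show ?thesis using no_cycle_hide[of "?K1 \<union> ?K2" ?K "?G1 \<union> ?G2"] by (simp add: Un_commute)
  qed simp
  moreover have "hide ?K (hide (?K1 \<union> ?K2) (?G1 \<union> ?G2)) = hide (?K1 \<union> ?K2) (hide ?K (?G1 \<union> ?G2))"
    unfolding hide_hide by (simp add: Un_commute)
  ultimately show ?case using lr(2) unfolding G cv eq by simp
next
  case (abs A ys \<Gamma> E t B zs)
  let ?X = "ctxt_graph \<Gamma> a" and ?K = "Some ` cv \<Gamma>" and ?Y = "set (map Some ys)"
  let ?E = "relabel Some E"
  have ok: "length zs = length (tb B)" "length ys = length (tb A)" "set ys \<inter> cv \<Gamma> = {}" "distinct ys"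
      "set zs \<inter> (set ys \<union> cv \<Gamma>) = {}" "verts E \<subseteq> set zs \<union> (set ys \<union> cv \<Gamma>)"
    using net_ok[OF abs(1)] ok_ctxt_case_nat[of A ys \<Gamma>] by auto
  have v: "verts ?X \<subseteq> insert None ?K" using verts_ctxt_graph[of \<Gamma> fl a \<theta>] abs.prems by blast
  have IH: "(fl \<or> no_cycle (?Y \<union> ?K) (?E \<union> ?X \<union> F)) \<and>
      lr fl (ext h B) (map Some zs) (hide (?Y \<union> ?K) (?E \<union> ?X \<union> F)) (psubst (case_nat s \<theta>) (map_constants g t))"
    if F: "lr fl (ext h A) (map Some ys) F s" for F s
  proof -
    have "lr fl (ext h C) (map Some us) (case_nat F a x) (case_nat s \<theta> x)"
      if "case_nat (Some (A, ys)) \<Gamma> x = Some (C, us)" for x C us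
      using that F abs.prems by (cases x) auto
    from abs.IH[of "case_nat F a" "case_nat s \<theta>", OF this] show ?thesis by (simp add: ctxt_graph_case_nat image_Un Un_ac)
  qed
  have "pol (tb (A -\<circ> B)) (zs @ rev ys) E" using net_pol[OF net.abs[OF abs(1)]] by blast
  then have "pol (tb (A -\<circ> B)) (map Some (zs @ rev ys)) ?E" by (rule pol_Some)
  moreover have "pol (tb (A -\<circ> B)) (map Some (zs @ rev ys)) ?X" using v ok by (intro pol_disjoint) auto
  moreover have "verts ?E \<subseteq> Some ` (set zs \<union> (set ys \<union> cv \<Gamma>))"
    unfolding verts_relabel by (rule image_mono[OF ok(6)])
  ultimately have "wfg (tb (A -\<circ> B)) (map Some (zs @ rev ys)) (hide ?K (?E \<union> ?X))"
  proof -
    assume p: "pol (tb (A -\<circ> B)) (map Some (zs @ rev ys)) ?E" "pol (tb (A -\<circ> B)) (map Some (zs @ rev ys)) ?X"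
      and vE: "verts ?E \<subseteq> Some ` (set zs \<union> (set ys \<union> cv \<Gamma>))"
    have "verts (hide ?K (?E \<union> ?X)) \<subseteq> (Some ` (set zs \<union> (set ys \<union> cv \<Gamma>)) \<union> insert None ?K) - ?K"
      using verts_hide[of ?K "?E \<union> ?X"] vE v unfolding verts_simps by blast
    also have "\<dots> \<subseteq> insert None (set (map Some (zs @ rev ys)))" by auto
    finally show ?thesis using p unfolding wfg_def by (blast intro: pol_hide pol_Un[THEN iffD2])
  qed
  moreover have "(fl \<or> no_cycle ?Y (hide ?K (?E \<union> ?X) \<union> F)) \<and>
      lr fl (ext h B) (map Some zs) (hide ?Y (hide ?K (?E \<union> ?X) \<union> F)) (App (psubst \<theta> (map_constants g (Abs t))) s)"
    if F: "lr fl (ext h A) (map Some ys) F s" for F s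
  proof -
    have "verts F \<subseteq> insert None ?Y" using lr_wfg[OF F] by (simp add: wfg_def)
    then have KF: "?K \<inter> verts F = {}" using ok by auto
    have "hide ?K (?E \<union> ?X) \<union> F = hide ?K (?E \<union> ?X \<union> F)" using hide_Un_disjoint[OF KF] by simp
    then have "fl \<or> no_cycle ?Y (hide ?K (?E \<union> ?X) \<union> F)" using IH[OF F] no_cycle_hide by metis
    moreover have "lr fl (ext h B) (map Some zs) (hide ?Y (hide ?K (?E \<union> ?X) \<union> F)) (psubst (case_nat s \<theta>) (map_constants g t))"
      using IH[OF F] by (simp add: hide_Un_nested[OF KF])
    ultimately show ?thesis
      using lr_eqv[OF _ eqv_sym[OF eqv_psubst_beta[of \<theta> "map_constants g t" s]]] by simp
  qed
  moreover have "fl \<or> no_cycle ?K (?E \<union> ?X)"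
  proof (cases fl)
    case False
    \<comment> \<open>Acyclicity before the bound variable is supplied comes from feeding it the
      empty graph. The term \<open>Var 0\<close> is a dummy, as terms play no part in this reading
      of the relation.\<close>
    have "lr False (ext h A) (map Some ys) {} (Var 0 :: 't lterm)" by (rule lr_empty) (use ok in \<open>auto simp: distinct_map\<close>)
    then have "no_cycle (?Y \<union> ?K) (?E \<union> ?X)" using IH[of "{}" "Var 0"] False by simp
    then show ?thesis using no_cycle_mono by blast
  qed simp
  ultimately show ?case using ok by (simp add: rev_map)
qed

end

section \<open>Renaming, and the passage between typings and graphs\<close>

lemma map_of_shift_ctxt [simp]:
  "map_of (shift_ctxt \<Gamma>) (Suc x) = map_of \<Gamma> x" "map_of (shift_ctxt \<Gamma>) 0 = None"
  by (induction \<Gamma>) (auto simp: shift_ctxt_def)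

lemma typing_distinct: "typing \<Sigma> \<Gamma> t A \<Longrightarrow> distinct (map fst \<Gamma>)"
proof (induction rule: typing.induct)
  case (abs \<Gamma> A \<Delta> t B)
  have "map fst (shift_ctxt L) = map Suc (map fst L)" for L :: "'a ctxt"
    by (induction L) (auto simp: shift_ctxt_def)
  then have "distinct (map Suc (map fst \<Gamma> @ map fst \<Delta>))" using abs.IH by auto
  then show ?case using distinct_map[of Suc "map fst \<Gamma> @ map fst \<Delta>"] by simp
qed auto

text \<open>Renames variables along an injection and keeps their vertices; \<open>mapc\<close> keeps
  the variables and renames their vertices.\<close>

definition renc :: "(nat \<Rightarrow> nat) \<Rightarrow> 'n gctxt \<Rightarrow> 'n gctxt" where
  "renc f \<Gamma> = (\<lambda>y. if y \<in> range f then \<Gamma> (inv f y) else None)"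

lemma renc_apply: "inj f \<Longrightarrow> renc f \<Gamma> (f x) = \<Gamma> x"
  by (simp add: renc_def)

lemma renc_eqI: "inj f \<Longrightarrow> (\<And>x. \<Gamma>' (f x) = \<Gamma> x) \<Longrightarrow> (\<And>y. y \<notin> range f \<Longrightarrow> \<Gamma>' y = None) \<Longrightarrow> renc f \<Gamma> = \<Gamma>'"
  by (rule ext) (auto simp: renc_def)

lemma dom_renc: "inj f \<Longrightarrow> dom (renc f \<Gamma>) = f ` dom \<Gamma>"
  by (auto simp: renc_def dom_def image_iff inj_eq split: if_splits)

lemma ran_renc: "inj f \<Longrightarrow> ran (renc f \<Gamma>) = ran \<Gamma>"
  unfolding ran_def by (auto simp: renc_def split: if_splits) (metis inv_f_f rangeI)

lemma cv_renc: "inj f \<Longrightarrow> cv (renc f \<Gamma>) = cv \<Gamma>"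
  by (simp add: cv_def ran_renc)

definition mapc :: "(nat \<Rightarrow> nat) \<Rightarrow> 'n gctxt \<Rightarrow> 'n gctxt" where
  "mapc f \<Gamma> = (\<lambda>x. map_option (\<lambda>(A, ys). (A, map f ys)) (\<Gamma> x))"

lemma dom_mapc [simp]: "dom (mapc f \<Gamma>) = dom \<Gamma>"
  by (auto simp: mapc_def)

lemma ran_mapc: "ran (mapc f \<Gamma>) = (\<lambda>(A, ys). (A, map f ys)) ` ran \<Gamma>"
  by (force simp: mapc_def ran_def)

lemma cv_mapc: "cv (mapc f \<Gamma>) = f ` cv \<Gamma>"
  by (auto simp: cv_def ran_mapc case_prod_beta)

context nets
begin

text \<open>A graph does not show the names of variables. The renamed term is only asserted to
  exist, because later arguments record which typed vertex lists occur and not which index owns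
  them.\<close>

lemma net_renc: "net \<Gamma> E t A zs \<Longrightarrow> inj f \<Longrightarrow> \<exists>t'. net (renc f \<Gamma>) E t' A zs"
proof (induction arbitrary: f rule: net.induct)
  case (var A ys zs x)
  have "renc f [x \<mapsto> (A, ys)] = [f x \<mapsto> (A, ys)]"
    by (rule renc_eqI) (use var in \<open>auto simp: inj_eq\<close>)
  then show ?case using net.var[OF var(1-4)] by metis
next
  case (const c zs)
  show ?case using net.const[OF const(1-3)] by (auto simp: renc_def)
next
  case (app \<Gamma> E t A B zs as \<Delta> F s)
  then obtain t' s' where n: "net (renc f \<Gamma>) E t' (A -\<circ> B) (zs @ rev as)" "net (renc f \<Delta>) F s' A as" by blast
  have d: "dom (renc f \<Gamma>) \<inter> dom (renc f \<Delta>) = {}"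
    using app.hyps(3) image_Int[OF app.prems, of "dom \<Gamma>" "dom \<Delta>"] by (simp add: dom_renc[OF app.prems])
  have c: "(cv (renc f \<Gamma>) \<union> set zs) \<inter> cv (renc f \<Delta>) = {}"
    using app.hyps(4) by (simp add: cv_renc[OF app.prems])
  have eq: "renc f (\<Gamma> ++ \<Delta>) = renc f \<Gamma> ++ renc f \<Delta>"
    by (rule ext) (simp add: renc_def map_add_def)
  show ?case unfolding eq by (rule exI, rule net.app[OF n d c])
next
  case (abs A ys \<Gamma> E t B zs)
  let ?f = "case_nat 0 (\<lambda>x. Suc (f x))"
  have inj: "inj ?f"
  proof (rule injI)
    fix x y assume "?f x = ?f y"
    then show "x = y" using inj_eq[OF abs.prems] by (cases x; cases y) auto
  qed
  then obtain t' where "net (renc ?f (case_nat (Some (A, ys)) \<Gamma>)) E t' B zs" using abs.IH by blast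
  moreover have "renc ?f (case_nat (Some (A, ys)) \<Gamma>) = case_nat (Some (A, ys)) (renc f \<Gamma>)"
  proof (rule renc_eqI[OF inj])
    fix x show "case_nat (Some (A, ys)) (renc f \<Gamma>) (?f x) = case_nat (Some (A, ys)) \<Gamma> x"
      using abs.prems by (cases x) (auto simp: renc_apply)
  next
    fix y assume y: "y \<notin> range ?f"
    then obtain y' where y': "y = Suc y'" by (cases y) (auto intro: range_eqI[of _ _ 0])
    have "y' \<notin> range f"
    proof
      assume "y' \<in> range f"
      then obtain x where "y' = f x" by blast
      then have "y = ?f (Suc x)" using y' by simp
      then show False using y by blast
    qed
    then show "case_nat (Some (A, ys)) (renc f \<Gamma>) y = None" using y' by (simp add: renc_def)
  qed
  ultimately show ?case using net.abs by metis
qed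

lemma net_mapc: "net \<Gamma> E t A zs \<Longrightarrow> bij f \<Longrightarrow> net (mapc f \<Gamma>) (relabel f E) t A (map f zs)"
proof (induction rule: net.induct)
  case (var A ys zs x)
  have "mapc f [x \<mapsto> (A, ys)] = [x \<mapsto> (A, map f ys)]" by (rule ext) (simp add: mapc_def)
  moreover have "distinct (map f zs @ map f ys)"
  proof -
    have "distinct (map f (zs @ ys))" using var by (simp only: distinct_map) (meson bij_def inj_on_subset subset_UNIV)
    then show ?thesis by simp
  qed
  ultimately show ?case using net.var[of A "map f ys" "map f zs" x] var
    by (simp add: relabel_idg del: fun_upd_apply)
next
  case (const c zs)
  have "relabel f (place zs (\<kappa> c)) = place (map f zs) (\<kappa> c)"
    by (rule relabel_place) (use verts_kappa const in auto)
  moreover have "distinct (map f zs)" using const by (simp add: distinct_map) (meson bij_def inj_on_subset subset_UNIV)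
  ultimately show ?case using net.const[of c "map f zs"] const by (simp add: mapc_def)
next
  case (app \<Gamma> E t A B zs as \<Delta> F s)
  have inj: "inj_on f S" for S using app.prems by (meson bij_def inj_on_subset subset_UNIV)
  have "mapc f (\<Gamma> ++ \<Delta>) = mapc f \<Gamma> ++ mapc f \<Delta>"
    by (rule ext) (simp add: mapc_def map_add_def split: option.split)
  moreover have "relabel f (hide (set as) (E \<union> F)) = hide (set (map f as)) (relabel f E \<union> relabel f F)"
    using relabel_hide[OF inj, of "set as" "E \<union> F"] by simp
  moreover have "(cv (mapc f \<Gamma>) \<union> set (map f zs)) \<inter> cv (mapc f \<Delta>) = {}"
  proof -
    have "f ` (cv \<Gamma> \<union> set zs) \<inter> f ` cv \<Delta> = f ` ((cv \<Gamma> \<union> set zs) \<inter> cv \<Delta>)"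
      using inj by (metis image_Int)
    then show ?thesis using app(4) by (simp add: cv_mapc image_Un)
  qed
  ultimately show ?case
    using net.app[of "mapc f \<Gamma>" "relabel f E" t A B "map f zs" "map f as" "mapc f \<Delta>" "relabel f F" s] app
    by (simp add: rev_map)
next
  case (abs A ys \<Gamma> E t B zs)
  have "mapc f (case_nat (Some (A, ys)) \<Gamma>) = case_nat (Some (A, map f ys)) (mapc f \<Gamma>)"
    by (rule ext) (simp add: mapc_def split: nat.split)
  then show ?case using net.abs[of A "map f ys" "mapc f \<Gamma>" "relabel f E" t B "map f zs"] abs by (simp add: rev_map)
qed

text \<open>Graph contexts are unordered. A list can nevertheless be found, since the abstraction
  rule of \<open>typing\<close> accepts the bound variable at any place and so the list may be split
  wherever index 0 occurs.\<close>

lemma net_typing: "net \<Gamma> E t A zs \<Longrightarrow>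
  \<exists>L. typing \<Sigma> L t A \<and> (\<forall>x. map_of L x = map_option fst (\<Gamma> x))"
proof (induction rule: net.induct)
  case (var A ys zs x)
  then show ?case by (intro exI[of _ "[(x, A)]"]) (auto intro: typing.var)
next
  case (const c zs)
  then show ?case by (intro exI[of _ "[]"]) (auto intro: typing.const)
next
  case (app \<Gamma> E t A B zs as \<Delta> F s)
  then obtain L M where L: "typing \<Sigma> L t (A -\<circ> B)" "\<forall>x. map_of L x = map_option fst (\<Gamma> x)"
    and M: "typing \<Sigma> M s A" "\<forall>x. map_of M x = map_option fst (\<Delta> x)" by blast
  have dL: "fst ` set L = dom \<Gamma>" using L(2) dom_map_of_conv_image_fst[of L] by (auto simp: dom_def)
  have dM: "fst ` set M = dom \<Delta>" using M(2) dom_map_of_conv_image_fst[of M] by (auto simp: dom_def)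
  have "distinct (map fst (L @ M))"
    using typing_distinct[OF L(1)] typing_distinct[OF M(1)] app(3) dL dM by auto
  then have "typing \<Sigma> (L @ M) (App t s) B" using typing.app[OF L(1) M(1)] by simp
  moreover have "map_of (L @ M) x = map_option fst ((\<Gamma> ++ \<Delta>) x)" for x
    using L(2) M(2) app(3) by (cases "\<Gamma> x"; cases "\<Delta> x") (auto simp: map_add_def dom_def)
  ultimately show ?case by blast
next
  case (abs A ys \<Gamma> E t B zs)
  then obtain L where L: "typing \<Sigma> L t B" "\<forall>x. map_of L x = map_option fst (case_nat (Some (A, ys)) \<Gamma> x)" by blast
  then have "map_of L 0 = Some A" by simp
  then obtain L1 L2 where L12: "L = L1 @ (0, A) # L2" using split_list[OF map_of_SomeD] by metis
  define dn :: "'n ctxt \<Rightarrow> 'n ctxt" where "dn = map (\<lambda>(x, A). (x - 1, A))"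
  have sh: "shift_ctxt (dn M) = M" if "0 \<notin> fst ` set M" for M
    using that by (induction M) (auto simp: dn_def shift_ctxt_def)
  have "0 \<notin> fst ` set L1" "0 \<notin> fst ` set L2" using typing_distinct[OF L(1)] L12 by auto
  then have sh12: "L1 = shift_ctxt (dn L1)" "L2 = shift_ctxt (dn L2)" using sh by simp_all
  then have "typing \<Sigma> (dn L1 @ dn L2) (Abs t) (A -\<circ> B)"
    using L(1) L12 by (intro typing.abs) simp
  moreover have "map_of (dn L1 @ dn L2) x = map_option fst (\<Gamma> x)" for x
  proof -
    have "map_of (dn L1 @ dn L2) x = map_of (shift_ctxt (dn L1) @ (0, A) # shift_ctxt (dn L2)) (Suc x)"
      by (simp add: map_add_def split: option.split)
    then show ?thesis using L(2) L12 sh12 by simp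
  qed
  ultimately show ?case by blast
qed

definition named :: "(nat \<Rightarrow> nat list) \<Rightarrow> 'n ctxt \<Rightarrow> 'n gctxt" where
  "named n \<Gamma> = (\<lambda>x. map_option (\<lambda>A. (A, n x)) (map_of \<Gamma> x))"

text \<open>The vertices of the output and of the variables are prescribed from outside; only the
  interface between function and argument is chosen fresh.\<close>

lemma typing_net:
  "typing \<Sigma> \<Gamma> t A \<Longrightarrow> length zs = length (tb A) \<Longrightarrow> distinct zs \<Longrightarrow>
    (\<And>x B. (x, B) \<in> set \<Gamma> \<Longrightarrow> length (n x) = length (tb B) \<and> distinct (n x) \<and> set (n x) \<inter> set zs = {}) \<Longrightarrow>
    (\<And>x y. x \<in> fst ` set \<Gamma> \<Longrightarrow> y \<in> fst ` set \<Gamma> \<Longrightarrow> x \<noteq> y \<Longrightarrow> set (n x) \<inter> set (n y) = {}) \<Longrightarrow>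
    \<exists>E. net (named n \<Gamma>) E t A zs"
proof (induction arbitrary: n zs rule: typing.induct)
  case (var A x)
  have "named n [(x, A)] = [x \<mapsto> (A, n x)]" by (rule ext) (simp add: named_def)
  then show ?case using net.var[of A "n x" zs x] var by (auto simp: Int_commute simp del: fun_upd_apply)
next
  case (const c)
  have "named n [] = Map.empty" by (rule ext) (simp add: named_def)
  then show ?case using net.const[of c zs] const by auto
next
  case (app \<Gamma> t A B \<Delta> s)
  have cv: "cv (named n L) = (\<Union>x\<in>fst ` set L. set (n x))" for L
    unfolding cv_def named_def ran_def
    by (auto simp: dom_map_of_conv_image_fst[symmetric] dom_def)
  have d: "dom (named n L) = fst ` set L" for L
    unfolding named_def by (auto simp: dom_map_of_conv_image_fst[symmetric])
  let ?V = "set zs \<union> (\<Union>x\<in>fst ` set (\<Gamma> @ \<Delta>). set (n x))"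
  obtain as where as: "length as = length (tb A)" "distinct as" "set as \<inter> ?V = {}"
    by (rule fresh_list[of ?V]) auto
  have dis: "fst ` set \<Gamma> \<inter> fst ` set \<Delta> = {}" using app(3) by auto
  have "\<exists>E. net (named n \<Gamma>) E t (A -\<circ> B) (zs @ rev as)"
  proof (rule app.IH(1))
    fix x C assume x: "(x, C) \<in> set \<Gamma>"
    then have "set (n x) \<inter> set as = {}" using as(3) by force
    then show "length (n x) = length (tb C) \<and> distinct (n x) \<and> set (n x) \<inter> set (zs @ rev as) = {}"
      using app.prems(3)[of x C] x by auto
  next
    fix x y assume "x \<in> fst ` set \<Gamma>" "y \<in> fst ` set \<Gamma>" "x \<noteq> y"
    then show "set (n x) \<inter> set (n y) = {}" using app.prems(4)[of x y] by auto
  qed (use as app.prems(1,2) in auto)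
  moreover have "\<exists>F. net (named n \<Delta>) F s A as"
  proof (rule app.IH(2))
    fix x C assume x: "(x, C) \<in> set \<Delta>"
    then have "set (n x) \<inter> set as = {}" using as(3) by force
    then show "length (n x) = length (tb C) \<and> distinct (n x) \<and> set (n x) \<inter> set as = {}"
      using app.prems(3)[of x C] x by auto
  next
    fix x y assume "x \<in> fst ` set \<Delta>" "y \<in> fst ` set \<Delta>" "x \<noteq> y"
    then show "set (n x) \<inter> set (n y) = {}" using app.prems(4)[of x y] by auto
  qed (use as app.prems(1,2) in auto)
  ultimately obtain E F where EF: "net (named n \<Gamma>) E t (A -\<circ> B) (zs @ rev as)" "net (named n \<Delta>) F s A as" by blast
  have "named n (\<Gamma> @ \<Delta>) = named n \<Gamma> ++ named n \<Delta>"
  proof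
    fix x
    have "map_of \<Gamma> x = None \<or> map_of \<Delta> x = None" using dis by (auto simp: map_of_eq_None_iff)
    then show "named n (\<Gamma> @ \<Delta>) x = (named n \<Gamma> ++ named n \<Delta>) x"
      by (auto simp: named_def map_add_def split: option.split)
  qed
  moreover have "(cv (named n \<Gamma>) \<union> set zs) \<inter> cv (named n \<Delta>) = {}"
  proof -
    have "set (n x) \<inter> set (n y) = {}" if "x \<in> fst ` set \<Gamma>" "y \<in> fst ` set \<Delta>" for x y
      using app.prems(4)[of x y] that dis by (metis IntI Un_iff empty_iff image_Un set_append)
    moreover have "set zs \<inter> set (n y) = {}" if "y \<in> fst ` set \<Delta>" for y
      using app.prems(3) that by force
    ultimately show ?thesis unfolding cv by blast
  qed
  ultimately show ?case using net.app[OF EF] dis by (auto simp: d)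
next
  case (abs \<Gamma> A \<Delta> t B)
  \<comment> \<open>The output of an implication consists of the result vertices followed by the
    reversed argument vertices, which now go to the bound variable.\<close>
  define bs where "bs = take (length (tb B)) zs"
  define as where "as = rev (drop (length (tb B)) zs)"
  have zs: "zs = bs @ rev as" "length bs = length (tb B)" "length as = length (tb A)"
    using abs.prems(1) by (auto simp: bs_def as_def)
  let ?n = "case_nat as n"
  let ?L = "shift_ctxt \<Gamma> @ (0, A) # shift_ctxt \<Delta>"
  have mem: "(x, C) \<in> set ?L \<longleftrightarrow> x = 0 \<and> C = A \<or> (\<exists>y. x = Suc y \<and> (y, C) \<in> set (\<Gamma> @ \<Delta>))" for x C
    by (auto simp: shift_ctxt_def image_iff)
  have fs: "x \<in> fst ` set ?L \<longleftrightarrow> x = 0 \<or> (\<exists>y. x = Suc y \<and> y \<in> fst ` set (\<Gamma> @ \<Delta>))" for x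
    by (force simp: shift_ctxt_def image_iff)
  have "\<exists>E. net (named ?n ?L) E t B bs"
  proof (rule abs.IH)
    fix x C assume "(x, C) \<in> set ?L"
    then consider "x = 0" "C = A" | y where "x = Suc y" "(y, C) \<in> set (\<Gamma> @ \<Delta>)" unfolding mem by blast
    then show "length (?n x) = length (tb C) \<and> distinct (?n x) \<and> set (?n x) \<inter> set bs = {}"
    proof cases
      case 1
      then show ?thesis using zs abs.prems(2) by auto
    next
      case 2
      then show ?thesis using zs abs.prems(3)[of y C] by auto
    qed
  next
    fix x y assume xy: "x \<in> fst ` set ?L" "y \<in> fst ` set ?L" "x \<noteq> y"
    have asn: "set as \<inter> set (n z) = {}" if z: "z \<in> fst ` set (\<Gamma> @ \<Delta>)" for z
    proof -
      obtain C where "(z, C) \<in> set (\<Gamma> @ \<Delta>)" using z by (metis imageE prod.collapse)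
      then show ?thesis using abs.prems(3)[of z C] zs by auto
    qed
    show "set (?n x) \<inter> set (?n y) = {}"
      using xy(1,2) unfolding fs
    proof (elim disjE exE conjE)
      fix x' y' assume a: "x = Suc x'" "x' \<in> fst ` set (\<Gamma> @ \<Delta>)" "y = Suc y'" "y' \<in> fst ` set (\<Gamma> @ \<Delta>)"
      then show ?thesis using xy(3) abs.prems(4)[of x' y'] by auto
    qed (use xy(3) asn in auto)
  qed (use zs abs.prems(2) in auto)
  then obtain E where E: "net (named ?n ?L) E t B bs" ..
  have "named ?n ?L = case_nat (Some (A, as)) (named n (\<Gamma> @ \<Delta>))"
    by (rule ext) (auto simp: named_def map_add_def split: nat.split option.split)
  then show ?case using net.abs[of A as "named n (\<Gamma> @ \<Delta>)" E t B bs] E zs by auto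
qed

section \<open>Graphs of terms with anonymous variables\<close>

definition nv :: "('n ltype \<times> nat list) set \<Rightarrow> nat set" where
  "nv N = (\<Union>(A, ys)\<in>N. set ys)"

lemma nv_ran: "nv (ran \<Gamma>) = cv \<Gamma>"
  by (simp add: nv_def cv_def)

lemma nv_simps [simp]: "nv {} = {}" "nv (insert (A, ys) N) = set ys \<union> nv N" "nv (N \<union> M) = nv N \<union> nv M"
  by (auto simp: nv_def)

text \<open>The pole of the phase model. Variables are recorded by type and vertices only, so
  contexts are sets that can be united. Nothing is lost: distinct variables have disjoint nonempty
  vertex lists.\<close>

definition pole :: "('n ltype \<times> nat list) set \<Rightarrow> 'n ltype \<Rightarrow> nat list \<Rightarrow> (nat, 't) edge set \<Rightarrow> bool" where
  "pole N A zs E \<longleftrightarrow> (\<exists>\<Gamma> t. net \<Gamma> E t A zs \<and> ran \<Gamma> = N)"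

lemma pole_ok:
  assumes "pole N A zs E"
  shows "A \<in> types (atoms \<Sigma>)" "length zs = length (tb A)" "distinct zs" "set zs \<inter> nv N = {}"
    "verts E \<subseteq> set zs \<union> nv N" "finite (nv N)" "pol (tb A) zs E"
    "(B, ys) \<in> N \<Longrightarrow> B \<in> types (atoms \<Sigma>) \<and> length ys = length (tb B) \<and> distinct ys"
proof -
  obtain \<Gamma> t where net: "net \<Gamma> E t A zs" "ran \<Gamma> = N" using assms by (auto simp: pole_def)
  then have "nv N = cv \<Gamma>" using nv_ran by metis
  then show "A \<in> types (atoms \<Sigma>)" "length zs = length (tb A)" "distinct zs" "set zs \<inter> nv N = {}"
    "verts E \<subseteq> set zs \<union> nv N" "pol (tb A) zs E"
    using net_ok[OF net(1)] net_pol[OF net(1)] by auto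
  have "finite N" using net net_ok[OF net(1)] by (auto simp: ok_ctxt_def finite_ran)
  then show "finite (nv N)" by (auto simp: nv_def)
  assume "(B, ys) \<in> N"
  then show "B \<in> types (atoms \<Sigma>) \<and> length ys = length (tb B) \<and> distinct ys"
    using net_ok[OF net(1)] net(2) unfolding ok_ctxt_def ran_def by blast
qed

lemma pole_var:
  assumes "A \<in> types (atoms \<Sigma>)" "length ys = length (tb A)" "length zs = length (tb A)" "distinct (zs @ ys)"
  shows "pole {(A, ys)} A zs (idg (tb A) zs ys)"
  using net.var[OF assms, of 0] unfolding pole_def by (metis ran_empty ran_map_upd[of Map.empty 0] domIff dom_empty empty_iff)

lemma pole_const:
  assumes "c \<in> constants \<Sigma>" "length zs = length (tb (ctype \<Sigma> c))" "distinct zs"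
  shows "pole {} (ctype \<Sigma> c) zs (place zs (\<kappa> c))"
  using net.const[OF assms] unfolding pole_def by (metis ran_empty)

lemma pole_abs:
  assumes "pole (insert (A, ys) N) B zs E" "(A, ys) \<notin> N"
  shows "pole N (A -\<circ> B) (zs @ rev ys) E"
proof -
  obtain \<Gamma> t where net: "net \<Gamma> E t B zs" "ran \<Gamma> = insert (A, ys) N" using assms by (auto simp: pole_def)
  then obtain x where x: "\<Gamma> x = Some (A, ys)" by (auto simp: ran_def)
  \<comment> \<open>The variable to be abstracted becomes index 0 and all others move up, so that
    the binder captures exactly this one.\<close>
  let ?f = "\<lambda>y. if y = x then 0 else Suc y" and ?G = "\<Gamma>(x := None)"
  have inj: "inj ?f" by (auto simp: inj_on_def split: if_splits)
  have "renc ?f \<Gamma> = case_nat (Some (A, ys)) ?G"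
  proof (rule renc_eqI[OF inj])
    fix y show "case_nat (Some (A, ys)) ?G (?f y) = \<Gamma> y" using x by auto
  next
    fix y assume y: "y \<notin> range ?f"
    show "case_nat (Some (A, ys)) ?G y = None"
    proof (cases y)
      case 0
      then have "y = ?f x" by simp
      then have "y \<in> range ?f" by (rule range_eqI)
      with y show ?thesis by (rule notE)
    next
      case (Suc z)
      have "z = x"
      proof (rule ccontr)
        assume "z \<noteq> x"
        then have "y = ?f z" using Suc by simp
        then have "y \<in> range ?f" by (rule range_eqI)
        with y show False by (rule notE)
      qed
      then show ?thesis using Suc by simp
    qed
  qed
  then obtain t' where "net (case_nat (Some (A, ys)) ?G) E t' B zs" using net_renc[OF net(1) inj] by metis
  then have "net ?G E (Abs t') (A -\<circ> B) (zs @ rev ys)" by (rule net.abs)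
  moreover have "ran ?G = N"
  proof -
    have ok: "ok_ctxt \<Gamma>" using net_ok[OF net(1)] by blast
    have "length ys = length (tb A)" using ok x unfolding ok_ctxt_def by blast
    \<comment> \<open>Every boundary is nonempty, so two variables with the same vertex list would
      share vertices; the entry belongs to \<open>x\<close> alone.\<close>
    then have ne: "set ys \<noteq> {}" by (metis length_0_conv length_tbd_pos less_nat_zero_code set_empty)
    have "y = x" if "\<Gamma> y = Some (A, ys)" for y
      using ok x that ne unfolding ok_ctxt_def by (metis inf.idem)
    then have "(A, ys) \<notin> ran ?G" by (auto simp: ran_def split: if_splits)
    moreover have "ran ?G \<subseteq> ran \<Gamma>" by (auto simp: ran_def split: if_splits)
    moreover have "p \<in> ran ?G" if "p \<in> N" for p
    proof -
      have "p \<in> ran \<Gamma>" using \<open>p \<in> N\<close> net(2) by simp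
      then obtain y where y: "\<Gamma> y = Some p" by (auto simp: ran_def)
      then have "y \<noteq> x" using assms(2) x \<open>p \<in> N\<close> by auto
      then show ?thesis using y by (intro ranI[of _ y]) simp
    qed
    moreover have "R = N" if "(A, ys) \<notin> R" "R \<subseteq> insert (A, ys) N" "\<And>p. p \<in> N \<Longrightarrow> p \<in> R" for R
      using that by blast
    ultimately show ?thesis unfolding net(2) by simp
  qed
  ultimately show ?thesis unfolding pole_def by (intro exI conjI)
qed

lemma pole_app:
  assumes "pole N (A -\<circ> B) (zs @ rev as) E" "pole M A as F" "(nv N \<union> set zs) \<inter> nv M = {}"
  shows "pole (N \<union> M) B zs (hide (set as) (E \<union> F))"
proof -
  obtain \<Gamma> t where \<Gamma>: "net \<Gamma> E t (A -\<circ> B) (zs @ rev as)" "ran \<Gamma> = N" using assms by (auto simp: pole_def)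
  obtain \<Delta> s where \<Delta>: "net \<Delta> F s A as" "ran \<Delta> = M" using assms by (auto simp: pole_def)
  \<comment> \<open>Even indices for the function and odd ones for the argument keep their variables
    apart.\<close>
  let ?f = "\<lambda>n. 2 * n :: nat" and ?g = "\<lambda>n. Suc (2 * n)"
  have inj: "inj ?f" "inj ?g" by (auto simp: inj_on_def)
  obtain t' s' where n: "net (renc ?f \<Gamma>) E t' (A -\<circ> B) (zs @ rev as)" "net (renc ?g \<Delta>) F s' A as"
    using net_renc[OF \<Gamma>(1) inj(1)] net_renc[OF \<Delta>(1) inj(2)] by blast
  have d: "dom (renc ?f \<Gamma>) \<inter> dom (renc ?g \<Delta>) = {}"
    unfolding dom_renc[OF inj(1)] dom_renc[OF inj(2)] by auto presburger
  have "nv N = cv \<Gamma>" "nv M = cv \<Delta>" using nv_ran \<Gamma>(2) \<Delta>(2) by metis+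
  then have "net (renc ?f \<Gamma> ++ renc ?g \<Delta>) (hide (set as) (E \<union> F)) (App t' s') B zs"
    using net.app[OF n d] assms(3) by (simp add: cv_renc[OF inj(1)] cv_renc[OF inj(2)])
  moreover have "ran (renc ?f \<Gamma> ++ renc ?g \<Delta>) = N \<union> M"
    using \<Gamma>(2) \<Delta>(2) ran_map_add[OF d] by (simp add: ran_renc[OF inj(1)] ran_renc[OF inj(2)])
  ultimately show ?thesis unfolding pole_def by blast
qed

lemma pole_relabel:
  assumes "pole N A zs E" "bij f"
  shows "pole ((\<lambda>(A, ys). (A, map f ys)) ` N) A (map f zs) (relabel f E)"
proof -
  obtain \<Gamma> t where "net \<Gamma> E t A zs" "ran \<Gamma> = N" using assms by (auto simp: pole_def)
  then have "net (mapc f \<Gamma>) (relabel f E) t A (map f zs)" "ran (mapc f \<Gamma>) = (\<lambda>(A, ys). (A, map f ys)) ` N"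
    using net_mapc assms(2) ran_mapc by blast+
  then show ?thesis unfolding pole_def by blast
qed

end

section \<open>Graphs of terms are acyclic perfect matchings\<close>

lemma no_cycle_relabelD: "no_cycle (f ` K) (relabel f E) \<Longrightarrow> no_cycle K E"
  unfolding no_cycle_def using path_relabel by fast

text \<open>Gives each constant an object term that its graph computes, under both readings of the
  relation: \<open>fl = True\<close> yields words, \<open>fl = False\<close> yields
  acyclicity.\<close>

locale gnets = nets \<Sigma> h \<kappa> T
  for \<Sigma> :: "('n, 'c) signature" and h :: "'n \<Rightarrow> str_atom ltype"
    and \<kappa> :: "'c \<Rightarrow> (nat, 't) edge set" and T :: "'t set" +
  fixes g :: "'c \<Rightarrow> 't lterm"
  assumes kappa_lr: "c \<in> constants \<Sigma> \<Longrightarrow> length zs = length (tbd (ext h (ctype \<Sigma> c))) \<Longrightarrow> distinct zs \<Longrightarrow>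
      lr fl (ext h (ctype \<Sigma> c)) (map Some zs) (relabel Some (place zs (\<kappa> c))) (g c)"
    and g_closed: "c \<in> constants \<Sigma> \<Longrightarrow> occurrences (g c) x = 0"
begin

text \<open>All variables receive the empty graph, which inhabits every type when \<open>fl\<close>
  is false. The function clause of the relation then says that gluing along the argument closes no
  cycle.\<close>

lemma net_no_cycle:
  assumes t: "net \<Gamma> E t (A -\<circ> B) (zs @ rev as)" and s: "net \<Delta> F s A as"
  shows "no_cycle (set as) (E \<union> F)"
proof -
  let ?K = "Some ` set as"
  let ?H1 = "hide (Some ` cv \<Gamma>) (relabel Some E)" and ?H2 = "hide (Some ` cv \<Delta>) (relabel Some F)"
  have emp: "lr False (ext h C) (map Some ys) ({} :: (nat option, 't) edge set) (Var 0)"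
    if "ok_ctxt \<Gamma>" "\<Gamma> x = Some (C, ys)" for \<Gamma> :: "'n gctxt" and x C ys
    using that unfolding ok_ctxt_def by (intro lr_empty) (auto simp: distinct_map)
  have e: "ctxt_graph \<Gamma> (\<lambda>_. {}) = {}" for \<Gamma> :: "'n gctxt" by (simp add: ctxt_graph_def)
  note ok1 = net_ok[OF t] and ok2 = net_ok[OF s]
  have len: "length as = length (tb A)" "length zs = length (tb B)" using ok1 ok2 by auto
  have "lr False (ext h (A -\<circ> B)) (map Some (zs @ rev as)) ?H1 (psubst (\<lambda>_. Var 0) (map_constants g t))"
    using net_lr[of False g, OF kappa_lr g_closed t, of "\<lambda>_. {}" "\<lambda>_. Var 0"] emp[of \<Gamma>] ok1 by (simp add: e del: lr.simps ext.simps)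
  moreover have "lr False (ext h A) (map Some as) ?H2 (psubst (\<lambda>_. Var 0) (map_constants g s))"
    using net_lr[of False g, OF kappa_lr g_closed s, of "\<lambda>_. {}" "\<lambda>_. Var 0"] emp[of \<Delta>] ok2 by (simp add: e)
  ultimately have nc: "no_cycle ?K (?H1 \<union> ?H2)" using len by (auto simp: rev_map)
  \<comment> \<open>Only edges with both ends in \<open>as\<close> can lie on such a cycle. They
    avoid the context vertices and therefore survive in the graphs with hidden contexts.\<close>
  have "no_cycle ?K (relabel Some E \<union> relabel Some F)"
  proof (rule no_cycle_restrict, rule no_cycle_mono[OF nc])
    show "{e \<in> relabel Some E \<union> relabel Some F. source e \<in> ?K \<and> target e \<in> ?K} \<subseteq> ?H1 \<union> ?H2"
    proof
      fix e assume e: "e \<in> {e \<in> relabel Some E \<union> relabel Some F. source e \<in> ?K \<and> target e \<in> ?K}"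
      have "set as \<inter> cv \<Gamma> = {}" "set as \<inter> cv \<Delta> = {}" using ok1 ok2 by (simp_all add: Int_Un_distrib2)
      then have d: "?K \<inter> Some ` cv \<Gamma> = {}" "?K \<inter> Some ` cv \<Delta> = {}" by (simp_all add: image_Int[symmetric])
      obtain u w v where uwv: "e = (u, w, v)" by (cases e)
      have "u \<notin> Some ` cv \<Gamma>" "v \<notin> Some ` cv \<Gamma>" "u \<notin> Some ` cv \<Delta>" "v \<notin> Some ` cv \<Delta>"
        using d e unfolding uwv mem_Collect_eq fst_conv snd_conv by (metis disjoint_iff)+
      then show "e \<in> ?H1 \<union> ?H2" using e uwv by (auto simp: hide_def intro: path.single)
    qed
  qed simp
  then show ?thesis using no_cycle_relabelD[of Some "set as" "E \<union> F"] by simp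
qed

text \<open>The left endpoints contributed by the context. Variables have dual polarity, so these
  are the right endpoints of their types, and conversely for \<open>cR\<close>.\<close>

definition cL :: "'n gctxt \<Rightarrow> nat set" where "cL \<Gamma> = (\<Union>(B, ys)\<in>ran \<Gamma>. Rset (tb B) ys)"
definition cR :: "'n gctxt \<Rightarrow> nat set" where "cR \<Gamma> = (\<Union>(B, ys)\<in>ran \<Gamma>. Lset (tb B) ys)"

lemma cL_sub: "cL \<Gamma> \<subseteq> cv \<Gamma>" and cR_sub: "cR \<Gamma> \<subseteq> cv \<Gamma>"
  using Lset_sub Rset_sub by (fastforce simp: cL_def cR_def cv_def)+

lemma net_matching: "net \<Gamma> E t A zs \<Longrightarrow> matching T (Lset (tb A) zs \<union> cL \<Gamma>) (Rset (tb A) zs \<union> cR \<Gamma>) E"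
proof (induction rule: net.induct)
  case (var A ys zs x)
  have "ran [x \<mapsto> (A, ys)] = {(A, ys)}" by simp
  then have "cL [x \<mapsto> (A, ys)] = Rset (tb A) ys" "cR [x \<mapsto> (A, ys)] = Lset (tb A) ys"
    unfolding cL_def cR_def by simp_all
  then show ?case using matching_idg[of zs "tb A" ys T] var by (simp del: fun_upd_apply)
next
  case (const c zs)
  let ?n = "length (tb (ctype \<Sigma> c))"
  have "cL Map.empty = {}" "cR Map.empty = {}" by (simp_all add: cL_def cR_def)
  moreover have "map (\<lambda>i. zs ! (i - 1)) (inits ?n) = zs"
    using const by (auto intro!: nth_equalityI)
  moreover have "inj_on (\<lambda>i. zs ! (i - 1)) {1..?n}"
    using const by (auto simp: inj_on_def nth_eq_iff_index_eq)
  moreover have "Lset (tb (ctype \<Sigma> c)) (inits ?n) \<union> Rset (tb (ctype \<Sigma> c)) (inits ?n) = {1..?n}"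
    by (simp add: LR_set)
  ultimately show ?case using matching_relabel[OF kappa[OF const(1)], of "\<lambda>i. zs ! (i - 1)"]
    by (simp add: place_def Lset_map[symmetric] Rset_map[symmetric])
next
  case (app \<Gamma> E t A B zs as \<Delta> F s)
  note ok1 = net_ok[OF app(1)] and ok2 = net_ok[OF app(2)]
  have len: "length as = length (tb A)" "length zs = length (tb B)" using ok1 ok2 by auto
  have m1: "matching T (Lset (tb B) zs \<union> Rset (tb A) as \<union> cL \<Gamma>) (Rset (tb B) zs \<union> Lset (tb A) as \<union> cR \<Gamma>) E"
    using app.IH(1) len by (simp add: Lset_append Rset_append Lset_rev Rset_rev)
  have dA: "Lset (tb A) as \<inter> Rset (tb A) as = {}" using ok2 by (intro LR_disjoint) auto
  have sub: "Lset (tb A) as \<subseteq> set as" "Rset (tb A) as \<subseteq> set as" "Lset (tb B) zs \<subseteq> set zs" "Rset (tb B) zs \<subseteq> set zs"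
    "cL \<Gamma> \<subseteq> cv \<Gamma>" "cL \<Delta> \<subseteq> cv \<Delta>" "cR \<Gamma> \<subseteq> cv \<Gamma>" "cR \<Delta> \<subseteq> cv \<Delta>"
    by (rule Lset_sub Rset_sub cL_sub cR_sub)+
  have dis: "set zs \<inter> set as = {}" "set as \<inter> cv \<Gamma> = {}" "set as \<inter> cv \<Delta> = {}" "set zs \<inter> cv \<Gamma> = {}"
    "set zs \<inter> cv \<Delta> = {}" "cv \<Gamma> \<inter> cv \<Delta> = {}" using ok1 ok2 app(4) by auto
  have "matching T ((Lset (tb B) zs \<union> Rset (tb A) as \<union> cL \<Gamma>) \<union> (Lset (tb A) as \<union> cL \<Delta>))
      ((Rset (tb B) zs \<union> Lset (tb A) as \<union> cR \<Gamma>) \<union> (Rset (tb A) as \<union> cR \<Delta>)) (E \<union> F)"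
    by (rule matching_Un[OF m1 app.IH(2)]) (use sub dis dA in blast)+
  \<comment> \<open>At each vertex of \<open>as\<close> one graph has a source and the other a
    target, so \<open>as\<close> joins both sides of the matching, as \<open>matching_hide\<close>
    requires.\<close>
  moreover have "(Lset (tb B) zs \<union> Rset (tb A) as \<union> cL \<Gamma>) \<union> (Lset (tb A) as \<union> cL \<Delta>) = (Lset (tb B) zs \<union> cL \<Gamma> \<union> cL \<Delta>) \<union> set as"
    "(Rset (tb B) zs \<union> Lset (tb A) as \<union> cR \<Gamma>) \<union> (Rset (tb A) as \<union> cR \<Delta>) = (Rset (tb B) zs \<union> cR \<Gamma> \<union> cR \<Delta>) \<union> set as"
    using LR_set[of "tb A" as] by blast+
  ultimately have m: "matching T ((Lset (tb B) zs \<union> cL \<Gamma> \<union> cL \<Delta>) \<union> set as) ((Rset (tb B) zs \<union> cR \<Gamma> \<union> cR \<Delta>) \<union> set as) (E \<union> F)"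
    by simp
  have "matching T (Lset (tb B) zs \<union> cL \<Gamma> \<union> cL \<Delta>) (Rset (tb B) zs \<union> cR \<Gamma> \<union> cR \<Delta>) (hide (set as) (E \<union> F))"
    by (rule matching_hide[OF m _ net_no_cycle[OF app(1,2)]]) (use sub dis in blast)+
  moreover have "cL (\<Gamma> ++ \<Delta>) = cL \<Gamma> \<union> cL \<Delta>" "cR (\<Gamma> ++ \<Delta>) = cR \<Gamma> \<union> cR \<Delta>"
    using ran_map_add[OF app(3)] by (simp_all add: cL_def cR_def)
  ultimately show ?case by (simp add: Un_ac)
next
  case (abs A ys \<Gamma> E t B zs)
  have "length zs = length (tb B)" "length ys = length (tb A)"
    using net_ok[OF abs(1)] ok_ctxt_case_nat[of A ys \<Gamma>] by auto
  moreover have "cL (case_nat (Some (A, ys)) \<Gamma>) = Rset (tb A) ys \<union> cL \<Gamma>" "cR (case_nat (Some (A, ys)) \<Gamma>) = Lset (tb A) ys \<union> cR \<Gamma>"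
    by (simp_all add: cL_def cR_def ran_case_nat)
  ultimately show ?case using abs.IH by (simp add: Lset_append Rset_append Lset_rev Rset_rev Un_ac)
qed

lemma net_occurrences: "net \<Gamma> E t A zs \<Longrightarrow> \<Gamma> x = None \<Longrightarrow> occurrences (map_constants g t) x = 0"
  by (induction arbitrary: x rule: net.induct) (auto simp: g_closed map_add_None split: if_splits)

lemma net_closed_lr:
  assumes "net Map.empty E t A zs"
  shows "lr fl (ext h A) (map Some zs) (relabel Some E) (map_constants g t)"
proof -
  have "lr fl (ext h A) (map Some zs) (relabel Some E) (psubst Var (map_constants g t))"
    using net_lr[of fl g, OF kappa_lr g_closed assms, of "\<lambda>_. {}" Var] by (simp add: ctxt_graph_def)
  then show ?thesis by (simp add: psubst_id)
qed

text \<open>At this type the matching is a single edge. Its label is compared with the term by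
  plugging in the bare edge to \<open>None\<close>, which computes the free variable
  \<open>Var 0\<close>.\<close>

lemma net_word:
  assumes net: "net Map.empty E t A [z0, z1]" and A: "ext h A = Atom Str_O -\<circ> Atom Str_O"
  shows "\<exists>w \<in> lists T. E = {(z0, w, z1)} \<and> map_constants g t \<approx> rho w"
proof -
  let ?u = "map_constants g t"
  have tA: "tb A = [True, False]" by (simp add: A bdual_def)
  have L: "Lset [True, False] [z0, z1] = {z0}" "Rset [True, False] [z0, z1] = {z1}"
    using Lset_append[of "[True]" "[z0]" "[False]" "[z1]"] Rset_append[of "[True]" "[z0]" "[False]" "[z1]"]
    by (auto simp: Lset_def Rset_def)
  have "cL Map.empty = {}" "cR Map.empty = {}" by (simp_all add: cL_def cR_def)
  then have m: "matching T {z0} {z1} E" using net_matching[OF net] unfolding tA L by simp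
  have "\<exists>!e. e \<in> E \<and> source e = z0" using matching_ex1(1)[OF m] by simp
  then obtain e where e: "e \<in> E \<and> source e = z0" "\<forall>e'. e' \<in> E \<and> source e' = z0 \<longrightarrow> e' = e" by (rule ex1E)
  have all: "source e' = z0 \<and> target e' = z1 \<and> label e' \<in> lists T" if "e' \<in> E" for e'
    using m that by (auto simp: matching_def)
  obtain w where w: "e = (z0, w, z1)" using all[of e] e(1) by (cases e) auto
  have "e' = e" if "e' \<in> E" for e'
    by (rule e(2)[rule_format, OF conjI[OF that conjunct1[OF all[OF that]]]])
  then have "E \<subseteq> {e}" by (intro subsetI) simp
  moreover have "e \<in> E" by (rule conjunct1[OF e(1)])
  ultimately have E: "E = {(z0, w, z1)}" unfolding w[symmetric] by (intro equalityI) simp_all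
  have wT: "w \<in> lists T" using all[of e] e(1) w by auto
  have z: "z0 \<noteq> z1" using net_ok[OF net] by simp
  let ?F = "{(Some z1, [], None)} :: (nat option, 't) edge set"
  have F: "lr True (Atom Str_O) [Some z1] ?F (Var 0)"
    by (auto simp: wfg_def pol_def Lset_def Rset_def)
  have "lr True (Atom Str_O) [Some z0] (hide {Some z1} (relabel Some E \<union> F)) (App ?u s)"
    if "lr True (Atom Str_O) [Some z1] F s" for F s
    using net_closed_lr[OF net, of True] that unfolding A lr.simps(2) by (simp del: lr.simps)
  from this[OF F] obtain w' where w': "hide {Some z1} (relabel Some E \<union> ?F) = {(Some z0, w', None)}"
    "App ?u (Var 0) \<approx> word_term w' (Var 0)" by auto
  have "path {Some z1} (relabel Some E \<union> ?F) (Some z0) (w @ []) None"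
    by (rule path.step[of _ _ "Some z1"]) (auto simp: E intro: path.single)
  then have "(Some z0, w, None) \<in> hide {Some z1} (relabel Some E \<union> ?F)" using z by (simp add: hide_def)
  then have "w' = w" using w' by simp
  \<comment> \<open>A closed term is its own lift, so \<open>Abs (App u (Var 0))\<close> is an
    eta-expansion of \<open>u\<close>, and the value at \<open>Var 0\<close> determines the
    term.\<close>
  have "lift ?u 0 = ?u" by (rule lift_id) (use net_occurrences[OF net] in simp)
  then have "beta_eta (Abs (App ?u (Var 0))) ?u" using beta_eta.eta[of ?u] by simp
  then have "?u \<approx> Abs (App ?u (Var 0))" using beta_eta_eqv eqv_sym by blast
  also have "\<dots> \<approx> rho w" using eqv_abs[OF w'(2)] \<open>w' = w\<close> by (simp add: rho_word_term)
  finally (eqv_trans) have "?u \<approx> rho w" .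
  then show ?thesis using E wT by blast
qed

end

section \<open>Placing the multiwords of a derivation on named vertices\<close>

lemma left_ends_inits: "left_ends X = Lset X (inits (length X))"
  and right_ends_inits: "right_ends X = Rset X (inits (length X))"
proof -
  show 1: "left_ends X = Lset X (inits (length X))"
  proof (rule set_eqI)
    fix i
    show "i \<in> left_ends X \<longleftrightarrow> i \<in> Lset X (inits (length X))"
    proof
      assume "i \<in> left_ends X"
      then show "i \<in> Lset X (inits (length X))"
        unfolding Lset_def left_ends_def by (intro CollectI exI[of _ "i - 1"]) auto
    next
      assume "i \<in> Lset X (inits (length X))"
      then obtain j where "i = inits (length X) ! j" "j < length X" "X ! j" unfolding Lset_def by auto
      then show "i \<in> left_ends X" by (simp add: left_ends_def)
    qed
  qed
  have "Lset X (inits (length X)) \<inter> Rset X (inits (length X)) = {}" by (rule LR_disjoint) simp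
  moreover have "Lset X (inits (length X)) \<union> Rset X (inits (length X)) = {1..length X}" by (simp add: LR_set)
  ultimately show "right_ends X = Rset X (inits (length X))" unfolding right_ends_def 1 by blast
qed

lemma map_place_inits: "length vs = n \<Longrightarrow> map (\<lambda>i. vs ! (i - 1)) (inits n) = vs"
  by (auto intro!: nth_equalityI)

text \<open>The polarity part of \<open>multiword\<close>. It suffices for placing derivable
  multiwords on names and for seeing that no vertex is both a source and a target.\<close>

definition gwf :: "boundary \<Rightarrow> (nat, 't) edge set \<Rightarrow> bool" where
  "gwf X E \<longleftrightarrow> source ` E \<subseteq> Lset X (inits (length X)) \<and> target ` E \<subseteq> Rset X (inits (length X))"

lemma gwf_verts: "gwf X E \<Longrightarrow> verts E \<subseteq> {1..length X}"
  using Lset_sub[of X "inits (length X)"] Rset_sub[of X "inits (length X)"]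
  unfolding gwf_def verts_def inits_simps by (meson Un_least order_trans)

lemma gwf_place:
  assumes "gwf X E" "length vs = length X"
  shows "source ` place vs E \<subseteq> Lset X vs" "target ` place vs E \<subseteq> Rset X vs"
proof -
  have "(\<lambda>i. vs ! (i - 1)) ` Lset X (inits (length X)) = Lset X vs" "(\<lambda>i. vs ! (i - 1)) ` Rset X (inits (length X)) = Rset X vs"
    using map_place_inits[of vs "length X"] assms(2) by (metis Lset_map, metis Rset_map)
  then show "source ` place vs E \<subseteq> Lset X vs" "target ` place vs E \<subseteq> Rset X vs"
    using assms(1) unfolding gwf_def place_def source_relabel target_relabel by (metis image_mono)+
qed

lemma multiword_gwf: "multiword T X \<sigma> \<Longrightarrow> gwf X (edges \<sigma>)"
  by (auto simp: multiword_def gwf_def left_ends_inits right_ends_inits)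

lemma matching_multiword:
  assumes m: "matching T (Lset X (inits (length X))) (Rset X (inits (length X))) E"
  shows "multiword T X \<lparr>edges = E, singular = {#}\<rparr>"
  unfolding multiword_def
proof (intro conjI ballI)
  fix v assume "v \<in> {1..length X}"
  then have "v \<in> Lset X (inits (length X)) \<union> Rset X (inits (length X))" by (simp add: LR_set)
  moreover have d: "Lset X (inits (length X)) \<inter> Rset X (inits (length X)) = {}" by (rule LR_disjoint) simp
  have s: "source e \<in> Lset X (inits (length X))" "target e \<in> Rset X (inits (length X))" if "e \<in> E" for e
    using m that by (auto simp: matching_def)
  ultimately consider "v \<in> Lset X (inits (length X))" "\<And>e. e \<in> E \<Longrightarrow> target e \<noteq> v"
    | "v \<in> Rset X (inits (length X))" "\<And>e. e \<in> E \<Longrightarrow> source e \<noteq> v"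
    using d by (metis IntI Un_iff empty_iff)
  then have "\<exists>!e. e \<in> E \<and> (source e = v \<or> target e = v)"
  proof cases
    case 1
    then have "(e \<in> E \<and> (source e = v \<or> target e = v)) = (e \<in> E \<and> source e = v)" for e by metis
    then show ?thesis using matching_ex1(1)[OF m 1(1)] by simp
  next
    case 2
    then have "(e \<in> E \<and> (source e = v \<or> target e = v)) = (e \<in> E \<and> target e = v)" for e by metis
    then show ?thesis using matching_ex1(2)[OF m 2(1)] by simp
  qed
  then show "\<exists>!e. e \<in> edges \<lparr>edges = E, singular = {#}\<rparr> \<and> (source e = v \<or> target e = v)" by simp
qed (use m in \<open>auto simp: matching_def left_ends_inits right_ends_inits\<close>)

lemma seq_boundary_append: "seq_boundary b (\<Gamma> @ \<Delta>) = seq_boundary b \<Delta> @ seq_boundary b \<Gamma>"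
  by (induction \<Gamma>) (auto simp: btensor_def)

lemma seq_boundary_simps [simp]:
  "seq_boundary b (A # \<Gamma>) = seq_boundary b \<Gamma> @ fm_boundary b A"
  "fm_boundary b (Tensor A B) = fm_boundary b A @ fm_boundary b B"
  "fm_boundary b (Par A B) = fm_boundary b B @ fm_boundary b A"
  by (simp_all add: btensor_def)

declare seq_boundary.simps(2) [simp del] fm_boundary.simps(3,4) [simp del]

lemma dual_dual [simp]: "dual (dual A) = A"
  by (induction A) auto

lemma length_fm_boundary_dual [simp]: "length (fm_boundary b (dual A)) = length (fm_boundary b A)"
  by (simp add: fm_boundary_dual)

lemma path_cong: "path K E u w v \<Longrightarrow> K \<inter> verts E \<subseteq> K' \<Longrightarrow> path K' E u w v"
  by (induction rule: path.induct) (auto intro: path.intros dest: vertsI)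

lemma hide_cong:
  assumes "K \<inter> verts E = K' \<inter> verts E"
  shows "hide K E = hide K' E"
proof -
  have "path K E u w v \<longleftrightarrow> path K' E u w v" for u w v
    using path_cong[of K E u w v K'] path_cong[of K' E u w v K] assms by blast
  moreover have "u \<in> K \<longleftrightarrow> u \<in> K'" "v \<in> K \<longleftrightarrow> v \<in> K'" if "path K E u w v" for u w v
    using path_source[OF that] path_target[OF that] assms unfolding verts_def by blast+
  ultimately show ?thesis unfolding hide_def by auto
qed

lemma glue_path_iff: "glue_path E u w v \<longleftrightarrow> path (range Inner) E u w v"
proof
  show "glue_path E u w v \<Longrightarrow> path (range Inner) E u w v"
    by (induction rule: glue_path.induct) (auto intro: path.intros)
  show "path (range Inner) E u w v \<Longrightarrow> glue_path E u w v"
    by (induction rule: path.induct) (auto intro: glue_path.intros)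
qed

lemma relabel_Outer_glue: "relabel Outer (edges (glue E)) = hide (range Inner) E"
proof (rule set_eqI, clarify)
  fix a w b
  have "a \<notin> range Inner \<longleftrightarrow> (\<exists>i. a = Outer i)" for a by (cases a) auto
  then show "(a, w, b) \<in> relabel Outer (edges (glue E)) \<longleftrightarrow> (a, w, b) \<in> hide (range Inner) E"
    by (auto simp: hide_def glue_def glue_path_iff relabel_def image_iff)
qed

definition cut_node1 :: "nat \<Rightarrow> nat \<Rightarrow> nat \<Rightarrow> node" where
  "cut_node1 n m v = (if v \<le> m then Inner v else Outer (n + (v - m)))"

definition cut_node2 :: "nat \<Rightarrow> nat \<Rightarrow> nat \<Rightarrow> node" where
  "cut_node2 n m v = (if v \<le> n then Outer v else Inner (n + m + 1 - v))"

lemma compose_alt: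
  "compose n m \<tau> \<sigma> = \<lparr>edges = edges (glue (relabel (cut_node1 n m) (edges \<sigma>) \<union> relabel (cut_node2 n m) (edges \<tau>))),
    singular = singular \<sigma> + singular \<tau> + singular (glue (relabel (cut_node1 n m) (edges \<sigma>) \<union> relabel (cut_node2 n m) (edges \<tau>)))\<rparr>"
  unfolding compose_def cut_node1_def[abs_def] cut_node2_def[abs_def] Let_def ..

text \<open>Turns a simple cycle, as counted by \<open>cycles\<close>, into a closed walk, as
  excluded by \<open>no_cycle\<close>: the edges are followed in order, and the last target is the
  first source.\<close>

lemma cycle_path:
  assumes "is_cycle E es" "source ` set es \<subseteq> K"
  shows "\<exists>k\<in>K. \<exists>w. path K E k w k"
proof -
  let ?n = "length es"
  have ne: "es \<noteq> []" and sub: "set es \<subseteq> E" and rot: "map target es = rotate1 (map source es)"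
    using assms(1) by (auto simp: is_cycle_def)
  have inE: "es ! i \<in> E" if "i < ?n" for i using sub nth_mem[OF that] by blast
  have next_node: "target (es ! i) = source (es ! (Suc i mod ?n))" if "i < ?n" for i
  proof -
    have "target (es ! i) = map target es ! i" using that by simp
    also have "\<dots> = map source es ! (Suc i mod ?n)" using that ne by (simp add: rot nth_rotate1)
    finally show ?thesis using that ne by simp
  qed
  have "\<exists>w. path K E (source (es ! 0)) w (target (es ! i))" if "i < ?n" for i
    using that
  proof (induction i)
    case 0
    have "(source (es ! 0), label (es ! 0), target (es ! 0)) \<in> E" using inE 0 by simp
    then show ?case by (blast intro: path.single)
  next
    case (Suc i)
    then obtain w where w: "path K E (source (es ! 0)) w (target (es ! i))" by auto
    have t: "target (es ! i) = source (es ! Suc i)" using next_node[of i] Suc.prems by simp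
    have "source (es ! Suc i) \<in> K" using assms(2) Suc.prems by auto
    moreover have "(source (es ! Suc i), label (es ! Suc i), target (es ! Suc i)) \<in> E"
      using inE Suc.prems by simp
    ultimately show ?case using path_trans[OF w] t by (metis path.single)
  qed
  from this[of "?n - 1"] have "\<exists>w. path K E (source (es ! 0)) w (target (es ! (?n - 1)))" using ne by simp
  moreover have "target (es ! (?n - 1)) = source (es ! 0)" using next_node[of "?n - 1"] ne by simp
  moreover have "source (es ! 0) \<in> K" using assms(2) ne by auto
  ultimately show ?thesis by auto
qed

text \<open>The bridge from numbered composition to gluing by names: \<open>as\<close> names the
  glued vertices, which \<open>\<sigma>\<close> lists forwards and \<open>\<tau>\<close> backwards.
  For regularity, a cycle visits only nodes that are both source and target; if these all lie in
  \<open>as\<close>, the absence of closed walks through \<open>as\<close> rules it out.\<close>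

lemma place_compose:
  assumes v1: "verts (edges \<sigma>) \<subseteq> {1..length as + length gs}" and v2: "verts (edges \<tau>) \<subseteq> {1..length ds + length as}"
    and d: "distinct (ds @ gs @ as)"
  shows "place (ds @ gs) (edges (compose (length ds) (length as) \<tau> \<sigma>)) =
      hide (set as) (place (as @ gs) (edges \<sigma>) \<union> place (ds @ rev as) (edges \<tau>))"
    and "no_cycle (set as) (place (as @ gs) (edges \<sigma>) \<union> place (ds @ rev as) (edges \<tau>)) \<Longrightarrow>
      source ` (place (as @ gs) (edges \<sigma>) \<union> place (ds @ rev as) (edges \<tau>)) \<inter>
      target ` (place (as @ gs) (edges \<sigma>) \<union> place (ds @ rev as) (edges \<tau>)) \<subseteq> set as \<Longrightarrow>
      singular \<sigma> = {#} \<Longrightarrow> singular \<tau> = {#} \<Longrightarrow> singular (compose (length ds) (length as) \<tau> \<sigma>) = {#}"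
proof -
  let ?n = "length ds" and ?m = "length as" and ?k = "length gs"
  let ?G = "relabel (cut_node1 ?n ?m) (edges \<sigma>) \<union> relabel (cut_node2 ?n ?m) (edges \<tau>)"
  let ?H = "place (as @ gs) (edges \<sigma>) \<union> place (ds @ rev as) (edges \<tau>)"
  \<comment> \<open>Sends the nodes of the gluing graph back to names; it is injective on the nodes
    that occur, so hiding commutes with it.\<close>
  define \<phi> where "\<phi> a = (case a of Inner i \<Rightarrow> as ! (i - 1) | Outer i \<Rightarrow> (ds @ gs) ! (i - 1))" for a
  let ?K = "Inner ` {1..?m}"
  let ?N = "?K \<union> Outer ` {1..?n + ?k}"
  have "relabel \<phi> (relabel (cut_node1 ?n ?m) (edges \<sigma>)) = place (as @ gs) (edges \<sigma>)"
    unfolding relabel_relabel place_def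
  proof (rule relabel_cong)
    fix v assume "v \<in> verts (edges \<sigma>)"
    then have "1 \<le> v" "v \<le> ?m + ?k" using v1 by auto
    moreover have "?n + (v - ?m) - 1 - ?n = v - 1 - ?m" "\<not> ?n + (v - ?m) - 1 < ?n" if "\<not> v \<le> ?m" using that by auto
    ultimately show "(\<phi> \<circ> cut_node1 ?n ?m) v = (as @ gs) ! (v - 1)"
      by (auto simp: \<phi>_def cut_node1_def nth_append)
  qed
  moreover have "relabel \<phi> (relabel (cut_node2 ?n ?m) (edges \<tau>)) = place (ds @ rev as) (edges \<tau>)"
    unfolding relabel_relabel place_def
  proof (rule relabel_cong)
    fix v assume "v \<in> verts (edges \<tau>)"
    then have v: "1 \<le> v" "v \<le> ?n + ?m" using v2 by auto
    have "rev as ! (v - 1 - ?n) = as ! (?n + ?m + 1 - v - 1)" if "\<not> v \<le> ?n"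
    proof -
      have "v - 1 - ?n < ?m" using v that by auto
      moreover have "?m - Suc (v - 1 - ?n) = ?n + ?m + 1 - v - 1" using v that by auto
      ultimately show ?thesis by (simp add: rev_nth)
    qed
    then show "(\<phi> \<circ> cut_node2 ?n ?m) v = (ds @ rev as) ! (v - 1)" using v
      by (auto simp: \<phi>_def cut_node2_def nth_append)
  qed
  ultimately have rG: "relabel \<phi> ?G = ?H" by simp
  have vG: "verts ?G \<subseteq> ?N"
  proof -
    have a: "cut_node1 ?n ?m v \<in> ?N" if "v \<in> {1..?m + ?k}" for v using that by (auto simp: cut_node1_def image_iff)
    have b: "cut_node2 ?n ?m v \<in> ?N" if "v \<in> {1..?n + ?m}" for v using that by (auto simp: cut_node2_def image_iff)
    show ?thesis unfolding verts_simps verts_relabel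
      by (intro Un_least image_subsetI a[OF subsetD[OF v1]] b[OF subsetD[OF v2]])
  qed
  have inj: "inj_on \<phi> ?N"
  proof (rule inj_onI)
    have ag: "as ! i \<noteq> (ds @ gs) ! j" if "i < ?m" "j < ?n + ?k" for i j
    proof -
      have "(ds @ gs) ! j \<in> set (ds @ gs)" using that by (intro nth_mem) simp
      moreover have "as ! i \<in> set as" using that by simp
      ultimately show ?thesis using d by auto
    qed
    fix a b assume a: "a \<in> ?N" "b \<in> ?N" "\<phi> a = \<phi> b"
    have dd: "distinct (ds @ gs)" "distinct as" using d by auto
    show "a = b"
    proof (cases a; cases b)
      fix i j assume ij: "a = Inner i" "b = Inner j"
      then have r: "1 \<le> i" "i \<le> ?m" "1 \<le> j" "j \<le> ?m" and e: "as ! (i - 1) = as ! (j - 1)"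
        using a by (auto simp: \<phi>_def)
      then have "i - 1 = j - 1" using nth_eq_iff_index_eq[OF dd(2), of "i - 1" "j - 1"] by linarith
      then show ?thesis using r ij by simp
    next
      fix i j assume ij: "a = Outer i" "b = Outer j"
      then have r: "1 \<le> i" "i \<le> ?n + ?k" "1 \<le> j" "j \<le> ?n + ?k" and e: "(ds @ gs) ! (i - 1) = (ds @ gs) ! (j - 1)"
        using a by (auto simp: \<phi>_def)
      then have "i - 1 < length (ds @ gs)" "j - 1 < length (ds @ gs)" by auto
      then have "i - 1 = j - 1" using nth_eq_iff_index_eq[OF dd(1)] e by blast
      then show ?thesis using r ij by simp
    next
      fix i j assume ij: "a = Inner i" "b = Outer j"
      then have r: "1 \<le> i" "i \<le> ?m" "1 \<le> j" "j \<le> ?n + ?k" and e: "as ! (i - 1) = (ds @ gs) ! (j - 1)"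
        using a by (auto simp: \<phi>_def)
      then have "i - 1 < ?m" "j - 1 < ?n + ?k" by auto
      then show ?thesis using ag e by blast
    next
      fix i j assume ij: "a = Outer i" "b = Inner j"
      then have r: "1 \<le> j" "j \<le> ?m" "1 \<le> i" "i \<le> ?n + ?k" and e: "as ! (j - 1) = (ds @ gs) ! (i - 1)"
        using a by (auto simp: \<phi>_def)
      then have "j - 1 < ?m" "i - 1 < ?n + ?k" by auto
      then show ?thesis using ag e by blast
    qed
  qed
  have injG: "inj_on \<phi> (?K \<union> verts ?G)" using inj by (rule inj_on_subset) (use vG in auto)
  have fK: "\<phi> ` ?K = set as"
  proof -
    have "\<phi> ` ?K = (\<lambda>i. as ! (i - 1)) ` set (inits ?m)" by (simp add: image_image \<phi>_def)
    also have "\<dots> = set (map (\<lambda>i. as ! (i - 1)) (inits ?m))" by simp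
    also have "\<dots> = set as" by (subst map_place_inits) simp_all
    finally show ?thesis .
  qed
  have hK: "hide (range Inner) ?G = hide ?K ?G"
    by (rule hide_cong) (use vG in auto)
  have "place (ds @ gs) (edges (glue ?G)) = relabel \<phi> (relabel Outer (edges (glue ?G)))"
    unfolding place_def relabel_relabel by (rule relabel_cong) (simp add: \<phi>_def)
  also have "\<dots> = hide (set as) ?H" unfolding relabel_Outer_glue hK relabel_hide[OF injG] fK rG ..
  finally show "place (ds @ gs) (edges (compose ?n ?m \<tau> \<sigma>)) = hide (set as) ?H" by (simp add: compose_alt)
  assume nc: "no_cycle (set as) ?H" and bip: "source ` ?H \<inter> target ` ?H \<subseteq> set as"
    and sing: "singular \<sigma> = {#}" "singular \<tau> = {#}"
  have "\<not> is_cycle ?G es" for es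
  proof
    assume c: "is_cycle ?G es"
    have "source ` set es = target ` set es"
    proof -
      have "set (map target es) = set (map source es)" using c by (simp only: is_cycle_def set_rotate1)
      then show ?thesis by simp
    qed
    then have st: "source ` set es \<subseteq> source ` ?G \<inter> target ` ?G" using c by (auto simp: is_cycle_def)
    \<comment> \<open>A node on a cycle is both a source and a target. Its name then lies in
      \<open>as\<close>, and by injectivity it is one of the glued nodes.\<close>
    have sK: "a \<in> ?K" if "a \<in> source ` ?G \<inter> target ` ?G" for a
    proof -
      have "\<phi> a \<in> source ` relabel \<phi> ?G \<inter> target ` relabel \<phi> ?G"
        using that unfolding source_relabel target_relabel by blast
      then have "\<phi> a \<in> \<phi> ` ?K" using bip fK rG by auto
      moreover have "a \<in> verts ?G" using that unfolding verts_def by (intro UnI1) (rule IntD1)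
      ultimately show ?thesis using inj_on_image_mem_iff[OF injG, of a ?K] by blast
    qed
    have "source ` set es \<subseteq> ?K" by (rule order_trans[OF st subsetI[OF sK]])
    from cycle_path[OF c this] obtain k w where "k \<in> ?K" "path ?K ?G k w k" by (elim bexE exE)
    moreover have "no_cycle ?K ?G" by (rule no_cycle_relabelD[of \<phi>]) (use nc fK rG in simp)
    ultimately show False by (auto simp: no_cycle_def)
  qed
  then have "cycles ?G = {}" by (auto simp: cycles_def)
  then show "singular (compose ?n ?m \<tau> \<sigma>) = {#}" using sing by (simp add: compose_alt glue_def)
qed

text \<open>The permutation of vertices by the rule and the permutation of the name blocks cancel,
  so exchange does not change the named graph.\<close>

lemma place_exchange:
  assumes "verts (edges \<sigma>) \<subseteq> {1..length ds + length bs + length as + length gs}"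
  shows "place (ds @ as @ bs @ gs) (edges (exchange_mword (length ds) (length bs) (length as) \<sigma>)) =
    place (ds @ bs @ as @ gs) (edges \<sigma>)"
  unfolding place_def exchange_mword_def mword.simps relabel_relabel
proof (rule relabel_cong)
  fix v assume "v \<in> verts (edges \<sigma>)"
  then have "1 \<le> v" using assms by auto
  then obtain k where k: "v = Suc k" by (cases v) auto
  show "((\<lambda>i. (ds @ as @ bs @ gs) ! (i - 1)) \<circ> (\<lambda>v. if v \<le> length ds then v
                           else if v \<le> length ds + length bs then v + length as
                           else if v \<le> length ds + length bs + length as then v - length bs
                           else v)) v = (ds @ bs @ as @ gs) ! (v - 1)"
  proof (cases "k < length ds")
    case True
    then show ?thesis by (simp add: k nth_append)
  next
    case False
    then obtain l where l: "k = length ds + l" by (metis le_Suc_ex not_less)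
    show ?thesis
    proof (cases "l < length bs")
      case True
      then show ?thesis by (simp add: k l nth_append)
    next
      case False
      then obtain m where m: "l = length bs + m" by (metis le_Suc_ex not_less)
      show ?thesis
      proof (cases "m < length as")
        case True
        then show ?thesis by (simp add: k l m nth_append)
      next
        case False
        then obtain j where "m = length as + j" by (metis le_Suc_ex not_less)
        then show ?thesis by (simp add: k l m nth_append)
      qed
    qed
  qed
qed

lemma place_tensor:
  assumes "verts (edges \<sigma>) \<subseteq> {1..length as + length gs}" "verts (edges \<tau>) \<subseteq> {1..length ds + length bs}"
  shows "place (ds @ as @ bs @ gs) (edges (tensor_mword (length ds) (length as) (length bs) \<sigma> \<tau>)) =
    place (as @ gs) (edges \<sigma>) \<union> place (ds @ bs) (edges \<tau>)"
proof -
  have "relabel (\<lambda>i. (ds @ as @ bs @ gs) ! (i - 1)) (relabel (\<lambda>v. if v \<le> length as then length ds + v else length ds + length bs + v) (edges \<sigma>)) = place (as @ gs) (edges \<sigma>)"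
    unfolding place_def relabel_relabel
  proof (rule relabel_cong)
    fix v assume "v \<in> verts (edges \<sigma>)"
    then have "1 \<le> v" using assms by auto
    then obtain k where "v = Suc k" by (cases v) auto
    then show "((\<lambda>i. (ds @ as @ bs @ gs) ! (i - 1)) \<circ> (\<lambda>v. if v \<le> length as then length ds + v else length ds + length bs + v)) v = (as @ gs) ! (v - 1)"
      by (cases "k < length as") (auto simp: nth_append)
  qed
  moreover have "relabel (\<lambda>i. (ds @ as @ bs @ gs) ! (i - 1)) (relabel (\<lambda>v. if v \<le> length ds then v else length as + v) (edges \<tau>)) = place (ds @ bs) (edges \<tau>)"
    unfolding place_def relabel_relabel
  proof (rule relabel_cong)
    fix v assume "v \<in> verts (edges \<tau>)"
    then have "1 \<le> v" and v: "v \<le> length ds + length bs" using assms by auto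
    then obtain k where k: "v = Suc k" by (cases v) auto
    show "((\<lambda>i. (ds @ as @ bs @ gs) ! (i - 1)) \<circ> (\<lambda>v. if v \<le> length ds then v else length as + v)) v = (ds @ bs) ! (v - 1)"
    proof (cases "k < length ds")
      case False
      then obtain l where "k = length ds + l" by (metis le_Suc_ex not_less)
      then show ?thesis using k v by (simp add: nth_append)
    qed (simp add: k nth_append)
  qed
  ultimately show ?thesis by (simp add: place_def tensor_mword_def)
qed

text \<open>In the identity, vertex \<open>i\<close> is joined to \<open>2n + 1 - i\<close>. Listing
  the second block backwards turns this into the pointwise link of \<open>zs\<close> and
  \<open>ys\<close>.\<close>

lemma place_id_mword:
  fixes zs ys :: "'v list"
  assumes "length zs = length X" "length ys = length X"
  shows "place (zs @ rev ys) (edges (id_mword X)) = (idg X zs ys :: ('v, 't) edge set)"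
proof -
  let ?n = "length X"
  have E: "edges (id_mword X :: 't mword) = (\<lambda>i. (i, [], 2 * ?n + 1 - i)) ` left_ends (X @ bdual X)"
    by (auto simp: id_mword_def btensor_def)
  show ?thesis
  proof (rule set_eqI, clarify)
    fix a :: 'v and w :: "'t list" and b
    show "(a, w, b) \<in> place (zs @ rev ys) (edges (id_mword X)) \<longleftrightarrow> (a, w, b) \<in> idg X zs ys"
    proof
      assume "(a, w, b) \<in> place (zs @ rev ys) (edges (id_mword X))"
      then obtain i where i: "i \<in> left_ends (X @ bdual X)" "w = []" "a = (zs @ rev ys) ! (i - 1)" "b = (zs @ rev ys) ! (2 * ?n + 1 - i - 1)"
        unfolding place_def E by (auto elim!: relabelE)
      have r: "1 \<le> i" "i \<le> 2 * ?n" "(X @ bdual X) ! (i - 1)" using i(1) by (auto simp: left_ends_def)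
      show "(a, w, b) \<in> idg X zs ys"
      proof (cases "i \<le> ?n")
        case True
        have "2 * ?n + 1 - i - 1 - ?n = ?n - i" "?n - Suc (?n - i) = i - 1" "\<not> 2 * ?n + 1 - i - 1 < ?n" "?n - i < ?n"
          and i1: "i - 1 < ?n" using True r by auto
        then have "a = zs ! (i - 1)" "b = ys ! (i - 1)" "X ! (i - 1)" using i r True assms by (auto simp: nth_append rev_nth)
        then show ?thesis using idgI(1)[OF i1, of zs ys] i(2) by simp
      next
        case False
        define j where "j = 2 * ?n - i"
        have j: "j < ?n" "i - 1 - ?n = ?n - Suc j" "?n - Suc (?n - Suc j) = j" "2 * ?n + 1 - i - 1 = j" "\<not> i - 1 < ?n" "?n - Suc j < ?n"
          using False r by (auto simp: j_def)
        then have "a = ys ! j" "b = zs ! j" "\<not> X ! j" using i r False assms by (auto simp: nth_append rev_nth bdual_nth)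
        then show ?thesis using idgI(2)[of j X ys zs] j(1) i(2) by auto
      qed
    next
      assume "(a, w, b) \<in> idg X zs ys"
      then show "(a, w, b) \<in> place (zs @ rev ys) (edges (id_mword X))"
      proof (cases rule: idgE)
        case (1 i)
        have n: "?n - Suc (?n - Suc i) = i" "2 * ?n + 1 - Suc i - 1 - ?n = ?n - Suc i" "\<not> 2 * ?n + 1 - Suc i - 1 < ?n" "?n - Suc i < ?n" using 1 by auto
        have "Suc i \<in> left_ends (X @ bdual X)" using 1 by (auto simp: left_ends_def nth_append)
        then have "((zs @ rev ys) ! (Suc i - 1), [], (zs @ rev ys) ! (2 * ?n + 1 - Suc i - 1)) \<in> place (zs @ rev ys) (edges (id_mword X :: 't mword))"
          unfolding place_def E by (intro relabelI) auto
        then show ?thesis using 1 n assms by (simp add: nth_append rev_nth)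
      next
        case (2 i)
        have n: "2 * ?n + 1 - (2 * ?n - i) - 1 = i" "2 * ?n - i - 1 - ?n = ?n - Suc i" "\<not> 2 * ?n - i - 1 < ?n" "?n - Suc (?n - Suc i) = i" "?n - Suc i < ?n" using 2 by auto
        have "2 * ?n - i \<in> left_ends (X @ bdual X)" using 2 n by (auto simp: left_ends_def nth_append bdual_nth)
        then have "((zs @ rev ys) ! (2 * ?n - i - 1), [], (zs @ rev ys) ! (2 * ?n + 1 - (2 * ?n - i) - 1)) \<in> place (zs @ rev ys) (edges (id_mword X :: 't mword))"
          unfolding place_def E by (intro relabelI) auto
        then show ?thesis using 2 n assms by (simp add: nth_append rev_nth)
      qed
    qed
  qed
qed

lemma gwf_placeI:
  assumes "verts E \<subseteq> {1..length X}" "distinct vs" "length vs = length X"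
    "source ` place vs E \<subseteq> Lset X vs" "target ` place vs E \<subseteq> Rset X vs"
  shows "gwf X E"
  unfolding gwf_def
proof (intro conjI subsetI)
  fix u assume u: "u \<in> source ` E"
  then have r: "u \<in> {1..length X}" using assms(1) unfolding verts_def by blast
  then have u1: "u - 1 < length vs" "inits (length X) ! (u - 1) = u" using assms(3) by auto
  have "vs ! (u - 1) \<in> Lset X vs" using assms(4) u unfolding place_def source_relabel by blast
  then have "X ! (u - 1)" using u1 assms(2) by (auto simp: Lset_def nth_eq_iff_index_eq)
  then show "u \<in> Lset X (inits (length X))" using u1 assms(3) by (force simp: Lset_def)
next
  fix u assume u: "u \<in> target ` E"
  then have r: "u \<in> {1..length X}" using assms(1) unfolding verts_def by blast
  then have u1: "u - 1 < length vs" "inits (length X) ! (u - 1) = u" using assms(3) by auto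
  have "vs ! (u - 1) \<in> Rset X vs" using assms(5) u unfolding place_def target_relabel by blast
  then have "\<not> X ! (u - 1)" using u1 assms(2) by (auto simp: Rset_def nth_eq_iff_index_eq)
  then show "u \<in> Rset X (inits (length X))" using u1 assms(3) by (force simp: Rset_def)
qed

lemma verts_compose:
  assumes "verts (edges \<sigma>) \<subseteq> {1..m + k}" and "verts (edges \<tau>) \<subseteq> {1..n + m}"
  shows "verts (edges (compose n m \<tau> \<sigma>)) \<subseteq> {1..n + k}"
proof -
  let ?G = "relabel (cut_node1 n m) (edges \<sigma>) \<union> relabel (cut_node2 n m) (edges \<tau>)"
  let ?N = "range Inner \<union> Outer ` {1..n + k}"
  have a: "cut_node1 n m v \<in> ?N" if "v \<in> {1..m + k}" for v using that by (auto simp: cut_node1_def image_iff)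
  have b: "cut_node2 n m v \<in> ?N" if "v \<in> {1..n + m}" for v using that by (auto simp: cut_node2_def image_iff)
  have "verts ?G \<subseteq> ?N" unfolding verts_simps verts_relabel
    by (intro Un_least image_subsetI a[OF subsetD[OF assms(1)]] b[OF subsetD[OF assms(2)]])
  moreover have "Outer ` verts (edges (glue ?G)) \<subseteq> verts ?G - range Inner"
    using verts_hide[of "range Inner" ?G] by (simp add: relabel_Outer_glue[symmetric] verts_relabel)
  ultimately have "Outer ` verts (edges (glue ?G)) \<subseteq> Outer ` {1..n + k}" by blast
  then show ?thesis by (auto simp: compose_alt image_iff)
qed

lemma distinct_blocks:
  obtains ds as bs gs :: "nat list" where "length ds = d" "length as = a" "length bs = b" "length gs = g"
    "distinct (ds @ as @ bs @ gs)"
  by (rule that[of "[0..<d]" "[d..<d+a]" "[d+a..<d+a+b]" "[d+a+b..<d+a+b+g]"]) auto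

lemma diff_aux: "A \<subseteq> (B \<union> C) - K \<Longrightarrow> B \<subseteq> K \<union> L \<Longrightarrow> C \<subseteq> K \<union> M \<Longrightarrow> A \<subseteq> M \<union> L"
  by blast

lemma disj_aux: "A \<subseteq> L \<Longrightarrow> B \<subseteq> R \<Longrightarrow> L \<inter> R = {} \<Longrightarrow> A \<inter> B = {}"
  by blast

lemma bip_aux:
  "A \<subseteq> K \<union> V \<Longrightarrow> B \<subseteq> K \<union> V \<Longrightarrow> C \<subseteq> K \<union> W \<Longrightarrow> D \<subseteq> K \<union> W \<Longrightarrow> V \<inter> W = {} \<Longrightarrow>
    A \<inter> B = {} \<Longrightarrow> C \<inter> D = {} \<Longrightarrow> (A \<union> C) \<inter> (B \<union> D) \<subseteq> K"
  by blast

section \<open>Derivable multiwords on named vertices\<close>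

locale lin_grammar =
  fixes G :: "('l, 't) llg"
  assumes llg: "is_llg G"
begin

abbreviation sb where "sb \<equiv> seq_boundary (lit_boundary G)"
abbreviation fb where "fb \<equiv> fm_boundary (lit_boundary G)"

text \<open>The rules that move vertices are checked on distinct names, where they become unions and
  hidings, and the result is carried back to vertex numbers by \<open>gwf_placeI\<close>.\<close>

lemma derivable_gwf: "derivable G \<sigma> \<Gamma> \<Longrightarrow> gwf (sb \<Gamma>) (edges \<sigma>)"
proof (induction rule: derivable.induct)
  case (lex \<sigma> \<Gamma>)
  then have "multiword (alphabet G) (sb \<Gamma>) \<sigma>" using llg by (auto simp: is_llg_def)
  then show ?case by (rule multiword_gwf)
next
  case (ident A)
  let ?n = "length (fb A)"
  obtain zs ys :: "nat list" where l: "length zs = ?n" "length ys = ?n" "distinct (zs @ ys)"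
    by (rule distinct_blocks[of ?n ?n 0 0]) auto
  have v: "verts (edges (id_mword (fb A))) \<subseteq> {1..length (fb A @ bdual (fb A))}"
    by (auto simp: verts_def id_mword_def btensor_def left_ends_def)
  have d: "distinct (zs @ rev ys)" using l by simp
  have "gwf (fb A @ bdual (fb A)) (edges (id_mword (fb A)))"
    by (rule gwf_placeI[OF v d]) (use l in \<open>simp_all add: place_id_mword source_idg target_idg Lset_append Rset_append Lset_rev Rset_rev\<close>)
  then show ?case by (simp add: fm_boundary_dual)
next
  case (cut \<sigma> \<Gamma> A \<tau> \<Delta>)
  let ?n = "length (sb \<Delta>)" and ?m = "length (fb A)" and ?k = "length (sb \<Gamma>)"
  obtain ds gs as :: "nat list" where l: "length ds = ?n" "length gs = ?k" "length as = ?m" "distinct (ds @ gs @ as)"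
    by (rule distinct_blocks[of ?n ?k ?m 0]) auto
  have g1: "gwf (fb A @ sb \<Gamma>) (edges \<sigma>)" using cut.IH(1) by (simp add: seq_boundary_append)
  have g2: "gwf (sb \<Delta> @ bdual (fb A)) (edges \<tau>)" using cut.IH(2) by (simp add: fm_boundary_dual)
  have v1: "verts (edges \<sigma>) \<subseteq> {1..?m + ?k}" using gwf_verts[OF g1] by simp
  have v2: "verts (edges \<tau>) \<subseteq> {1..?n + ?m}" using gwf_verts[OF g2] by simp
  have p: "place (ds @ gs) (edges (compose ?n ?m \<tau> \<sigma>)) =
      hide (set as) (place (as @ gs) (edges \<sigma>) \<union> place (ds @ rev as) (edges \<tau>))" (is "_ = hide _ (?P \<union> ?Q)")
    using place_compose(1)[of \<sigma> as gs \<tau> ds] l v1 v2 by simp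
  have s: "source ` ?P \<subseteq> set as \<union> Lset (sb \<Gamma>) gs" "target ` ?P \<subseteq> set as \<union> Rset (sb \<Gamma>) gs"
    using gwf_place[OF g1, of "as @ gs"] l Lset_sub[of "fb A" as] Rset_sub[of "fb A" as]
    by (auto simp: Lset_append Rset_append)
  have t: "source ` ?Q \<subseteq> set as \<union> Lset (sb \<Delta>) ds" "target ` ?Q \<subseteq> set as \<union> Rset (sb \<Delta>) ds"
    using gwf_place[OF g2, of "ds @ rev as"] l Lset_sub[of "fb A" as] Rset_sub[of "fb A" as]
    by (auto simp: Lset_append Rset_append Lset_rev Rset_rev)
  have "gwf (sb \<Delta> @ sb \<Gamma>) (edges (compose ?n ?m \<tau> \<sigma>))"
  proof (rule gwf_placeI[of _ _ "ds @ gs"])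
    show "verts (edges (compose ?n ?m \<tau> \<sigma>)) \<subseteq> {1..length (sb \<Delta> @ sb \<Gamma>)}"
      using verts_compose[OF v1 v2] by simp
    show "source ` place (ds @ gs) (edges (compose ?n ?m \<tau> \<sigma>)) \<subseteq> Lset (sb \<Delta> @ sb \<Gamma>) (ds @ gs)"
      unfolding p Lset_append[OF l(1)[symmetric]]
      by (rule diff_aux[OF hide_source[of _ "?P \<union> ?Q", unfolded image_Un] s(1) t(1)])
    show "target ` place (ds @ gs) (edges (compose ?n ?m \<tau> \<sigma>)) \<subseteq> Rset (sb \<Delta> @ sb \<Gamma>) (ds @ gs)"
      unfolding p Rset_append[OF l(1)[symmetric]]
      by (rule diff_aux[OF hide_target[of _ "?P \<union> ?Q", unfolded image_Un] s(2) t(2)])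
  qed (use l in auto)
  then show ?case by (simp add: seq_boundary_append)
next
  case (exchange \<sigma> \<Gamma> A B \<Delta>)
  let ?d = "length (sb \<Delta>)" and ?a = "length (fb A)" and ?b = "length (fb B)" and ?g = "length (sb \<Gamma>)"
  obtain ds as bs gs :: "nat list" where l: "length ds = ?d" "length as = ?a" "length bs = ?b" "length gs = ?g" "distinct (ds @ as @ bs @ gs)"
    by (rule distinct_blocks)
  have g: "gwf (sb \<Delta> @ fb B @ fb A @ sb \<Gamma>) (edges \<sigma>)" using exchange.IH by (simp add: seq_boundary_append)
  have v: "verts (edges \<sigma>) \<subseteq> {1..?d + ?b + ?a + ?g}" using gwf_verts[OF g] by (simp add: add.assoc)
  have p: "place (ds @ as @ bs @ gs) (edges (exchange_mword ?d ?b ?a \<sigma>)) = place (ds @ bs @ as @ gs) (edges \<sigma>)"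
    using place_exchange[of \<sigma> ds bs as gs] l v by simp
  have "gwf (sb \<Delta> @ fb A @ fb B @ sb \<Gamma>) (edges (exchange_mword ?d ?b ?a \<sigma>))"
  proof (rule gwf_placeI[of _ _ "ds @ as @ bs @ gs"])
    show "verts (edges (exchange_mword ?d ?b ?a \<sigma>)) \<subseteq> {1..length (sb \<Delta> @ fb A @ fb B @ sb \<Gamma>)}"
      unfolding exchange_mword_def mword.simps verts_relabel
    proof (rule image_subsetI)
      fix v' assume "v' \<in> verts (edges \<sigma>)"
      then have "1 \<le> v'" "v' \<le> ?d + ?b + ?a + ?g" using v by auto
      then show "(if v' \<le> ?d then v' else if v' \<le> ?d + ?b then v' + ?a else if v' \<le> ?d + ?b + ?a then v' - ?b else v')
          \<in> {1..length (sb \<Delta> @ fb A @ fb B @ sb \<Gamma>)}" by auto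
    qed
  qed (use l gwf_place[OF g, of "ds @ bs @ as @ gs"] in \<open>auto simp: p Lset_append Rset_append\<close>)
  then show ?case by (simp add: seq_boundary_append)
next
  case (par \<sigma> \<Gamma> A B)
  then show ?case by (simp add: seq_boundary_append)
next
  case (tensor \<sigma> \<Gamma> A \<tau> B \<Delta>)
  let ?d = "length (sb \<Delta>)" and ?a = "length (fb A)" and ?b = "length (fb B)" and ?g = "length (sb \<Gamma>)"
  obtain ds as bs gs :: "nat list" where l: "length ds = ?d" "length as = ?a" "length bs = ?b" "length gs = ?g" "distinct (ds @ as @ bs @ gs)"
    by (rule distinct_blocks)
  have g1: "gwf (fb A @ sb \<Gamma>) (edges \<sigma>)" using tensor.IH(1) by (simp add: seq_boundary_append)
  have g2: "gwf (sb \<Delta> @ fb B) (edges \<tau>)" using tensor.IH(2) by simp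
  have v1: "verts (edges \<sigma>) \<subseteq> {1..?a + ?g}" using gwf_verts[OF g1] by simp
  have v2: "verts (edges \<tau>) \<subseteq> {1..?d + ?b}" using gwf_verts[OF g2] by simp
  have p: "place (ds @ as @ bs @ gs) (edges (tensor_mword ?d ?a ?b \<sigma> \<tau>)) = place (as @ gs) (edges \<sigma>) \<union> place (ds @ bs) (edges \<tau>)"
    using place_tensor[of \<sigma> as gs \<tau> ds bs] l v1 v2 by simp
  have "gwf (sb \<Delta> @ fb A @ fb B @ sb \<Gamma>) (edges (tensor_mword ?d ?a ?b \<sigma> \<tau>))"
  proof (rule gwf_placeI[of _ _ "ds @ as @ bs @ gs"])
    show "verts (edges (tensor_mword ?d ?a ?b \<sigma> \<tau>)) \<subseteq> {1..length (sb \<Delta> @ fb A @ fb B @ sb \<Gamma>)}"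
      unfolding tensor_mword_def mword.simps verts_simps verts_relabel
    proof (intro Un_least image_subsetI)
      fix v' assume "v' \<in> verts (edges \<sigma>)"
      then have "1 \<le> v'" "v' \<le> ?a + ?g" using v1 by auto
      then show "(if v' \<le> ?a then ?d + v' else ?d + ?b + v') \<in> {1..length (sb \<Delta> @ fb A @ fb B @ sb \<Gamma>)}" by auto
    next
      fix v' assume "v' \<in> verts (edges \<tau>)"
      then have "1 \<le> v'" "v' \<le> ?d + ?b" using v2 by auto
      then show "(if v' \<le> ?d then v' else ?a + v') \<in> {1..length (sb \<Delta> @ fb A @ fb B @ sb \<Gamma>)}" by auto
    qed
  qed (use l gwf_place[OF g1, of "as @ gs"] gwf_place[OF g2, of "ds @ bs"] in \<open>auto simp: p image_Un Lset_append Rset_append\<close>)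
  then show ?case by (simp add: seq_boundary_append)
qed

text \<open>The blocks are concatenated backwards because the boundary of a sequent starts with its
  last formula.\<close>

definition vsD :: "('l fm \<times> nat list) list \<Rightarrow> nat list" where
  "vsD D = concat (rev (map snd D))"

lemma vsD_simps [simp]: "vsD [] = []" "vsD (x # D) = vsD D @ snd x" "vsD (D @ D') = vsD D' @ vsD D"
  by (simp_all add: vsD_def)

definition okD :: "('l fm \<times> nat list) list \<Rightarrow> bool" where
  "okD D \<longleftrightarrow> (\<forall>(A, xs)\<in>set D. length xs = length (fb A)) \<and> distinct (vsD D)"

lemma length_vsD: "okD D \<Longrightarrow> length (vsD D) = length (sb (map fst D))"
  unfolding okD_def by (induction D) auto

text \<open>\<open>nd D E\<close>: the sequent of the formulas in \<open>D\<close> has a regular derivation whose multiword is \<open>E\<close>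
  when each formula is given the vertices listed with it in \<open>D\<close>.\<close>

definition nd :: "('l fm \<times> nat list) list \<Rightarrow> (nat, 't) edge set \<Rightarrow> bool" where
  "nd D E \<longleftrightarrow> okD D \<and> (\<exists>\<sigma>. derivable G \<sigma> (map fst D) \<and> singular \<sigma> = {#} \<and> place (vsD D) (edges \<sigma>) = E)"

lemma nd_okD: "nd D E \<Longrightarrow> okD D"
  by (simp add: nd_def)

lemma derivable_verts: "derivable G \<sigma> \<Gamma> \<Longrightarrow> verts (edges \<sigma>) \<subseteq> {1..length (sb \<Gamma>)}"
  by (rule gwf_verts[OF derivable_gwf])

lemma nd_swap:
  assumes "nd (P @ x # y # Q) E"
  shows "nd (P @ y # x # Q) E"
proof -
  obtain A as B bs where xy: "x = (A, as)" "y = (B, bs)" by (cases x; cases y)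
  obtain \<sigma> where \<sigma>: "derivable G \<sigma> (map fst P @ [A, B] @ map fst Q)" "singular \<sigma> = {#}"
      "place (vsD Q @ bs @ as @ vsD P) (edges \<sigma>) = E" and ok: "okD (P @ x # y # Q)"
    using assms by (auto simp: nd_def xy)
  have okPQ: "okD P" "okD Q" using ok by (auto simp: okD_def)
  have l: "length bs = length (fb B)" "length as = length (fb A)" using ok by (auto simp: okD_def xy)
  let ?\<tau> = "exchange_mword (length (sb (map fst Q))) (length (fb B)) (length (fb A)) \<sigma>"
  have "verts (edges \<sigma>) \<subseteq> {1..length (vsD Q) + length bs + length as + length (vsD P)}"
    using derivable_verts[OF \<sigma>(1)] l by (simp add: seq_boundary_append length_vsD okPQ ac_simps)
  then have "place (vsD Q @ as @ bs @ vsD P) (edges ?\<tau>) = E"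
    using place_exchange[of \<sigma> "vsD Q" bs as "vsD P"] \<sigma>(3) l by (simp add: length_vsD okPQ)
  moreover have "derivable G ?\<tau> (map fst P @ [B, A] @ map fst Q)" by (rule derivable.exchange[OF \<sigma>(1)])
  moreover have "singular ?\<tau> = {#}" using \<sigma>(2) by (simp add: exchange_mword_def)
  moreover have "okD (P @ y # x # Q)" using ok by (auto simp: okD_def xy)
  ultimately show ?thesis unfolding nd_def by (intro conjI exI[of _ ?\<tau>]) (simp_all add: xy)
qed

lemma nd_move_right: "nd (P @ x # Q @ R) E \<Longrightarrow> nd (P @ Q @ x # R) E"
proof (induction Q arbitrary: P)
  case (Cons y Q)
  then have "nd (P @ y # x # (Q @ R)) E" using nd_swap[of P x y "Q @ R"] by simp
  then show ?case using Cons.IH[of "P @ [y]"] by simp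
qed simp

lemma nd_move_left: "nd (P @ Q @ x # R) E \<Longrightarrow> nd (P @ x # Q @ R) E"
proof (induction Q arbitrary: P)
  case (Cons y Q)
  then have "nd (P @ y # x # (Q @ R)) E" using Cons.IH[of "P @ [y]"] by simp
  then show ?case using nd_swap[of P y x "Q @ R"] by simp
qed simp

lemma nd_relabel:
  assumes "nd D E" "bij f"
  shows "nd (map (map_prod id (map f)) D) (relabel f E)"
proof -
  obtain \<sigma> where \<sigma>: "derivable G \<sigma> (map fst D)" "singular \<sigma> = {#}" "place (vsD D) (edges \<sigma>) = E" and ok: "okD D"
    using assms by (auto simp: nd_def)
  have vs: "vsD (map (map_prod id (map f)) D) = map f (vsD D)" by (induction D) auto
  have "distinct (map f (vsD D))" using ok assms(2) by (simp add: okD_def distinct_map) (meson bij_def inj_on_subset subset_UNIV)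
  then have "okD (map (map_prod id (map f)) D)" using ok unfolding okD_def vs by auto
  moreover have "place (map f (vsD D)) (edges \<sigma>) = relabel f E"
    using relabel_place[of "edges \<sigma>" "vsD D" f] derivable_verts[OF \<sigma>(1)] \<sigma>(3) length_vsD[OF ok] by simp
  ultimately show ?thesis using \<sigma> unfolding nd_def vs by (auto intro!: exI[of _ \<sigma>])
qed

lemma nd_ident:
  assumes "A \<in> formulas (literals G)" "length zs = length (fb A)" "length ys = length (fb A)" "distinct (zs @ ys)"
  shows "nd [(dual A, rev ys), (A, zs)] (idg (fb A) zs ys)"
  unfolding nd_def
proof (intro conjI exI)
  show "okD [(dual A, rev ys), (A, zs)]" using assms by (auto simp: okD_def)
  show "derivable G (id_mword (fb A)) (map fst [(dual A, rev ys), (A, zs)])" using derivable.ident[OF assms(1)] by simp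
  show "singular (id_mword (fb A)) = {#}" by (simp add: id_mword_def)
  show "place (vsD [(dual A, rev ys), (A, zs)]) (edges (id_mword (fb A))) = idg (fb A) zs ys"
    using place_id_mword[of zs "fb A" ys] assms by simp
qed

lemma nd_par: "nd (D @ [(A, as), (B, bs)]) E \<Longrightarrow> nd (D @ [(Par A B, bs @ as)]) E"
  unfolding nd_def by (auto simp: okD_def dest: derivable.par)

lemma nd_tensor:
  assumes "nd (D1 @ [(A, as)]) E" "nd ((B, bs) # D2) F" "distinct (vsD D2 @ as @ bs @ vsD D1)"
  shows "nd (D1 @ [(Tensor A B, as @ bs)] @ D2) (E \<union> F)"
proof -
  obtain \<sigma> where \<sigma>: "derivable G \<sigma> (map fst D1 @ [A])" "singular \<sigma> = {#}" "place (as @ vsD D1) (edges \<sigma>) = E" and ok1: "okD (D1 @ [(A, as)])"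
    using assms(1) by (auto simp: nd_def)
  obtain \<tau> where \<tau>: "derivable G \<tau> (B # map fst D2)" "singular \<tau> = {#}" "place (vsD D2 @ bs) (edges \<tau>) = F" and ok2: "okD ((B, bs) # D2)"
    using assms(2) by (auto simp: nd_def)
  have ok: "okD D1" "okD D2" and l: "length as = length (fb A)" "length bs = length (fb B)"
    using ok1 ok2 by (auto simp: okD_def)
  let ?\<rho> = "tensor_mword (length (sb (map fst D2))) (length (fb A)) (length (fb B)) \<sigma> \<tau>"
  have "place (vsD D2 @ as @ bs @ vsD D1) (edges ?\<rho>) = E \<union> F"
    using place_tensor[of \<sigma> as "vsD D1" \<tau> "vsD D2" bs] derivable_verts[OF \<sigma>(1)] derivable_verts[OF \<tau>(1)] l \<sigma>(3) \<tau>(3)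
    by (simp add: seq_boundary_append length_vsD ok)
  moreover have "derivable G ?\<rho> (map fst D1 @ [Tensor A B] @ map fst D2)" by (rule derivable.tensor[OF \<sigma>(1) \<tau>(1)])
  moreover have "singular ?\<rho> = {#}" using \<sigma>(2) \<tau>(2) by (simp add: tensor_mword_def)
  moreover have "okD (D1 @ [(Tensor A B, as @ bs)] @ D2)" using ok1 ok2 assms(3) by (auto simp: okD_def)
  ultimately show ?thesis unfolding nd_def by (intro conjI exI[of _ ?\<rho>]) simp_all
qed

text \<open>Both premises use the same names for the cut formula, so the cut is a gluing. The
  acyclicity hypothesis keeps the singular part empty.\<close>

lemma nd_cut:
  assumes "nd (D1 @ [(A, as)]) E" "nd ((dual A, rev as) # D2) F" "distinct (vsD D2 @ vsD D1 @ as)"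
    and nc: "no_cycle (set as) (E \<union> F)"
  shows "nd (D1 @ D2) (hide (set as) (E \<union> F))"
proof -
  obtain \<sigma> where \<sigma>: "derivable G \<sigma> (map fst D1 @ [A])" "singular \<sigma> = {#}" "place (as @ vsD D1) (edges \<sigma>) = E" and ok1: "okD (D1 @ [(A, as)])"
    using assms(1) by (auto simp: nd_def)
  obtain \<tau> where \<tau>: "derivable G \<tau> (dual A # map fst D2)" "singular \<tau> = {#}" "place (vsD D2 @ rev as) (edges \<tau>) = F" and ok2: "okD ((dual A, rev as) # D2)"
    using assms(2) by (auto simp: nd_def)
  have ok: "okD D1" "okD D2" and l: "length as = length (fb A)"
    using ok1 ok2 by (auto simp: okD_def)
  let ?\<rho> = "compose (length (sb (map fst D2))) (length (fb A)) \<tau> \<sigma>"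
  have v1: "verts (edges \<sigma>) \<subseteq> {1..length as + length (vsD D1)}"
    using derivable_verts[OF \<sigma>(1)] l by (simp add: seq_boundary_append length_vsD ok)
  have v2: "verts (edges \<tau>) \<subseteq> {1..length (vsD D2) + length as}"
    using derivable_verts[OF \<tau>(1)] l by (simp add: length_vsD ok)
  have le: "length (sb (map fst D2)) = length (vsD D2)" "length (fb A) = length as" using l length_vsD ok by auto
  have p: "place (vsD D2 @ vsD D1) (edges ?\<rho>) = hide (set as) (E \<union> F)"
    using place_compose(1)[OF v1 v2 assms(3)] \<sigma>(3) \<tau>(3) by (simp add: le)
  have s1: "source ` E \<subseteq> Lset (fb A @ sb (map fst D1)) (as @ vsD D1)" "target ` E \<subseteq> Rset (fb A @ sb (map fst D1)) (as @ vsD D1)"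
    using gwf_place[OF derivable_gwf[OF \<sigma>(1)], of "as @ vsD D1"] \<sigma>(3) l by (simp_all add: seq_boundary_append length_vsD ok)
  have s2: "source ` F \<subseteq> Lset (sb (map fst D2) @ fb (dual A)) (vsD D2 @ rev as)" "target ` F \<subseteq> Rset (sb (map fst D2) @ fb (dual A)) (vsD D2 @ rev as)"
    using gwf_place[OF derivable_gwf[OF \<tau>(1)], of "vsD D2 @ rev as"] \<tau>(3) l by (simp_all add: length_vsD ok)
  have dd: "distinct (as @ vsD D1)" "distinct (vsD D2 @ rev as)" "set (vsD D1) \<inter> set (vsD D2) = {}"
    using assms(3) by auto
  have d1: "source ` E \<inter> target ` E = {}" by (rule disj_aux[OF s1 LR_disjoint[OF dd(1)]])
  have d2: "source ` F \<inter> target ` F = {}" by (rule disj_aux[OF s2 LR_disjoint[OF dd(2)]])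
  have vE: "source ` E \<subseteq> set as \<union> set (vsD D1)" "target ` E \<subseteq> set as \<union> set (vsD D1)"
    using order_trans[OF s1(1) Lset_sub] order_trans[OF s1(2) Rset_sub] by simp_all
  have vF: "source ` F \<subseteq> set as \<union> set (vsD D2)" "target ` F \<subseteq> set as \<union> set (vsD D2)"
    using order_trans[OF s2(1) Lset_sub] order_trans[OF s2(2) Rset_sub] by (simp_all add: Un_commute)
  \<comment> \<open>Within one premise polarity forbids a vertex to be both source and target, and
    the two premises share only \<open>as\<close>.\<close>
  have "source ` (E \<union> F) \<inter> target ` (E \<union> F) \<subseteq> set as"
    unfolding image_Un by (rule bip_aux[OF vE vF dd(3) d1 d2])
  then have "singular ?\<rho> = {#}"
    using place_compose(2)[OF v1 v2 assms(3)] nc \<sigma>(2,3) \<tau>(2,3) by (simp add: le)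
  moreover have "derivable G ?\<rho> (map fst D1 @ map fst D2)" by (rule derivable.cut[OF \<sigma>(1) \<tau>(1)])
  moreover have "okD (D1 @ D2)" using ok1 ok2 assms(3) by (auto simp: okD_def)
  ultimately show ?thesis unfolding nd_def using p by (intro conjI exI[of _ ?\<rho>]) simp_all
qed

end

section \<open>The grammar of an abstract signature, and completeness\<close>

lemma swap_lists_commute:
  assumes "distinct (us @ vs)" "length us = length vs"
  shows "swap_lists vs us = swap_lists us vs"
proof
  fix v
  have d: "distinct (vs @ us)" using assms by auto
  show "swap_lists vs us v = swap_lists us vs v"
  proof (cases "v \<in> set us \<union> set vs")
    case True
    then consider i where "i < length us" "v = us ! i" | i where "i < length vs" "v = vs ! i"
      by (auto simp: in_set_conv_nth)
    then show ?thesis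
      by cases (metis assms d nth_map swap_lists_map)+
  qed (simp add: swap_lists_other assms)
qed

lemma relabel_swap_swap:
  assumes "distinct (us @ vs)" "length us = length vs"
  shows "relabel (swap_lists us vs) (relabel (swap_lists us vs) E) = E"
  unfolding relabel_relabel by (rule relabel_id) (simp add: swap_lists_swap_lists[OF assms])

lemma set_fm_dual [simp]: "set_fm (dual A) = set_fm A"
  by (induction A) auto

text \<open>The literals of the grammar are natural numbers, hence the injection \<open>e\<close>.
  Through \<open>hS\<close> the start literal gets one left and one right endpoint.\<close>

locale gram = gnets \<Sigma> h \<kappa> T g
  for \<Sigma> :: "('n, 'c) signature" and h :: "'n \<Rightarrow> str_atom ltype"
    and \<kappa> :: "'c \<Rightarrow> (nat, 't) edge set" and T :: "'t set" and g :: "'c \<Rightarrow> 't lterm" +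
  fixes e :: "'n \<Rightarrow> nat" and S :: 'n
  assumes finA: "finite (atoms \<Sigma>)" and finC: "finite (constants \<Sigma>)" and finT: "finite T"
    and inj_e: "inj_on e (atoms \<Sigma>)" and S: "S \<in> atoms \<Sigma>" and hS: "h S = Atom Str_O -\<circ> Atom Str_O"
begin

primrec fmt :: "'n ltype \<Rightarrow> nat fm" where
  "fmt (Atom p) = Pos (e p)"
| "fmt (A -\<circ> B) = Par (dual (fmt A)) (fmt B)"

definition dec :: "nat \<Rightarrow> 'n" where "dec = inv_into (atoms \<Sigma>) e"

text \<open>A literal receives the whole boundary of the object type of its atom, which may have
  many vertices; in this way \<open>fmt\<close> respects boundaries.\<close>

definition LG :: "(nat, 't) llg" where
  "LG = \<lparr>literals = e ` atoms \<Sigma>, lit_boundary = (\<lambda>n. tbd (h (dec n))), alphabet = T,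
     lexicon = (\<lambda>c. (\<lparr>edges = \<kappa> c, singular = {#}\<rparr>, [fmt (ctype \<Sigma> c)])) ` constants \<Sigma>, llg_start = e S\<rparr>"

lemma LG_simps [simp]: "literals LG = e ` atoms \<Sigma>" "lit_boundary LG = (\<lambda>n. tbd (h (dec n)))" "alphabet LG = T"
  "lexicon LG = (\<lambda>c. (\<lparr>edges = \<kappa> c, singular = {#}\<rparr>, [fmt (ctype \<Sigma> c)])) ` constants \<Sigma>" "llg_start LG = e S"
  by (simp_all add: LG_def)

lemma dec_e: "p \<in> atoms \<Sigma> \<Longrightarrow> dec (e p) = p"
  by (simp add: dec_def inv_into_f_f[OF inj_e])

lemma types_Limp: "A -\<circ> B \<in> types N \<longleftrightarrow> A \<in> types N \<and> B \<in> types N"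
  by (auto simp: types_def)

lemma fm_boundary_fmt: "A \<in> types (atoms \<Sigma>) \<Longrightarrow> fm_boundary (lit_boundary LG) (fmt A) = tb A"
  by (induction A) (auto simp: types_Limp fm_boundary_dual dec_e types_def)

lemma fmt_formulas: "A \<in> types (atoms \<Sigma>) \<Longrightarrow> fmt A \<in> formulas (literals LG)"
  by (induction A) (auto simp: types_def formulas_def)

lemma is_llg_LG: "is_llg LG"
  unfolding is_llg_def
proof (intro conjI)
  show "\<forall>(\<sigma>, \<Gamma>)\<in>lexicon LG. set \<Gamma> \<subseteq> formulas (literals LG) \<and> multiword (alphabet LG) (seq_boundary (lit_boundary LG) \<Gamma>) \<sigma>"
  proof clarify
    fix \<sigma> \<Gamma> assume "(\<sigma>, \<Gamma>) \<in> lexicon LG"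
    then obtain c where c: "c \<in> constants \<Sigma>" "\<sigma> = \<lparr>edges = \<kappa> c, singular = {#}\<rparr>" "\<Gamma> = [fmt (ctype \<Sigma> c)]" by auto
    have "multiword T (tb (ctype \<Sigma> c)) \<sigma>" unfolding c(2) by (rule matching_multiword[OF kappa[OF c(1)]])
    moreover have "seq_boundary (lit_boundary LG) \<Gamma> = tb (ctype \<Sigma> c)"
      unfolding c(3) using fm_boundary_fmt[OF ctype_types[OF c(1)]] by simp
    moreover have "set \<Gamma> \<subseteq> formulas (literals LG)" unfolding c(3) using fmt_formulas[OF ctype_types[OF c(1)]] by simp
    ultimately show "set \<Gamma> \<subseteq> formulas (literals LG) \<and> multiword (alphabet LG) (seq_boundary (lit_boundary LG) \<Gamma>) \<sigma>" by simp
  qed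
  have b: "lit_boundary LG (llg_start LG) = [True, False]" using S by (simp add: dec_e hS bdual_def)
  have "left_ends [True, False] = {1}" "right_ends [True, False] = {2}"
    by (auto simp: left_ends_def right_ends_def le_Suc_eq numeral_2_eq_2)
  then show "card (left_ends (lit_boundary LG (llg_start LG))) = 1" "card (right_ends (lit_boundary LG (llg_start LG))) = 1"
    unfolding b by simp_all
qed (use finA finC finT S in auto)

sublocale lin_grammar LG
  by unfold_locales (rule is_llg_LG)

text \<open>Hypotheses appear as dual formulas with reversed vertices. Abstraction moves its
  hypothesis next to the conclusion and uses the par rule. Application is a cut with
  \<open>Tensor (fmt A) (dual (fmt B))\<close>, which comes from the argument and an identity on
  \<open>B\<close>.\<close>

lemma net_nd: "net \<Gamma> E t A zs \<Longrightarrow>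
  \<exists>D. set D = (\<lambda>(B, ys). (dual (fmt B), rev ys)) ` ran \<Gamma> \<and> nd (D @ [(fmt A, zs)]) E"
proof (induction rule: net.induct)
  case (var A ys zs x)
  let ?D = "[(dual (fmt A), rev ys)]"
  have "nd (?D @ [(fmt A, zs)]) (idg (tb A) zs ys)"
    using nd_ident[OF fmt_formulas[OF var(1)], of zs ys] var by (simp add: fm_boundary_fmt del: LG_simps)
  moreover have "set ?D = (\<lambda>(B, ys). (dual (fmt B), rev ys)) ` ran [x \<mapsto> (A, ys)]"
    by (subst ran_map_upd) simp_all
  ultimately show ?case by blast
next
  case (const c zs)
  have "derivable LG \<lparr>edges = \<kappa> c, singular = {#}\<rparr> [fmt (ctype \<Sigma> c)]"
    by (rule derivable.lex) (use const in auto)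
  moreover have "okD [(fmt (ctype \<Sigma> c), zs)]"
    using const fm_boundary_fmt[OF ctype_types[OF const(1)]] by (simp add: okD_def del: LG_simps)
  ultimately have "nd [(fmt (ctype \<Sigma> c), zs)] (place zs (\<kappa> c))"
    unfolding nd_def by (intro conjI exI[of _ "\<lparr>edges = \<kappa> c, singular = {#}\<rparr>"]) simp_all
  then show ?case by (intro exI[of _ "[]"]) simp
next
  case (app \<Gamma> E t A B zs as \<Delta> F s)
  let ?img = "\<lambda>(B, ys :: nat list). (dual (fmt B), rev ys)"
  obtain D1 where D1: "set D1 = ?img ` ran \<Gamma>" "nd (D1 @ [(fmt (A -\<circ> B), zs @ rev as)]) E" using app.IH(1) by blast
  obtain D2 where D2: "set D2 = ?img ` ran \<Delta>" "nd (D2 @ [(fmt A, as)]) F" using app.IH(2) by blast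
  note ok1 = net_ok[OF app(1)] and ok2 = net_ok[OF app(2)]
  have ty: "A \<in> types (atoms \<Sigma>)" "B \<in> types (atoms \<Sigma>)" using ok1 by (simp_all add: types_Limp)
  have len: "length as = length (tb A)" "length zs = length (tb B)" using ok1 ok2 by auto
  have v1: "set (vsD D1) = cv \<Gamma>"
  proof -
    have "set (vsD D1) = (\<Union>p\<in>set D1. set (snd p))" by (auto simp: vsD_def)
    then show ?thesis unfolding D1(1) by (auto simp: cv_def)
  qed
  have v2: "set (vsD D2) = cv \<Delta>"
  proof -
    have "set (vsD D2) = (\<Union>p\<in>set D2. set (snd p))" by (auto simp: vsD_def)
    then show ?thesis unfolding D2(1) by (auto simp: cv_def)
  qed
  let ?V = "set zs \<union> set as \<union> set (vsD D1) \<union> set (vsD D2) \<union> verts E"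
  have "verts E \<subseteq> set zs \<union> set as \<union> cv \<Gamma>" using ok1 by auto
  then have fin: "finite ?V" using v1 by (metis List.finite_set finite_Un finite_subset)
  \<comment> \<open>The identity on \<open>B\<close> has two sets of ends. The result keeps
    \<open>zs\<close>; the function is renamed to end in the copy \<open>zs'\<close>, which the cut
    consumes together with \<open>as\<close>.\<close>
  obtain zs' where zs': "length zs' = length (tb B)" "distinct zs'" "set zs' \<inter> ?V = {}"
    by (rule fresh_list[OF fin])
  let ?f = "swap_lists zs zs'" and ?E = "relabel (swap_lists zs zs') E" and ?I = "idg (tb B) zs zs' :: (nat, 't) edge set"
  have dz: "distinct (zs @ zs')" "length zs = length zs'" using ok1 zs' len by auto
  have dz': "distinct (zs' @ zs)" "length zs' = length zs" using dz by auto
  have bf: "bij ?f" by (rule bij_swap_lists[OF dz])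
  have dis: "set zs \<inter> set as = {}" "set as \<inter> cv \<Gamma> = {}" "set as \<inter> cv \<Delta> = {}" "set zs \<inter> cv \<Gamma> = {}"
    "set zs \<inter> cv \<Delta> = {}" "cv \<Gamma> \<inter> cv \<Delta> = {}" "distinct zs" "distinct as" using ok1 ok2 app(4) by auto
  have fz: "set zs' \<inter> set zs = {}" "set zs' \<inter> set as = {}" "set zs' \<inter> cv \<Gamma> = {}" "set zs' \<inter> cv \<Delta> = {}" "set zs' \<inter> verts E = {}"
    using zs'(3) v1 v2 by auto
  have fix_other: "?f v = v" if "v \<in> cv \<Gamma> \<union> set as" for v
    using that dis fz by (intro swap_lists_other dz(2)) auto
  have "map (map_prod id (map ?f)) D1 = D1"
  proof (rule map_idI)
    fix p assume p: "p \<in> set D1"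
    then have "set (snd p) \<subseteq> set (vsD D1)" by (auto simp: vsD_def)
    then have "map ?f (snd p) = snd p" using fix_other v1 by (intro map_idI) auto
    then show "map_prod id (map ?f) p = p" by (cases p) simp
  qed
  moreover have "map ?f (zs @ rev as) = zs' @ rev as"
  proof -
    have "map ?f (rev as) = rev as" using fix_other by (intro map_idI) simp
    then show ?thesis using swap_lists_map(1)[OF dz] by simp
  qed
  ultimately have nd1: "nd (D1 @ [(fmt (A -\<circ> B), zs' @ rev as)]) ?E"
    using nd_relabel[OF D1(2) bf] by simp
  have nd2: "nd [(dual (fmt B), rev zs'), (fmt B, zs)] ?I"
    using nd_ident[OF fmt_formulas[OF ty(2)], of zs zs'] dz len zs' by (simp add: fm_boundary_fmt[OF ty(2)] del: LG_simps)
  have okD2: "distinct (vsD D2)" using nd_okD[OF D2(2)] by (simp add: okD_def)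
  have okD1: "distinct (vsD D1)" using nd_okD[OF D1(2)] by (simp add: okD_def)
  \<comment> \<open>The argument tensored with the identity proves the dual of the implication, with
    \<open>B\<close> as the remaining conclusion.\<close>
  have "nd (D2 @ [(Tensor (fmt A) (dual (fmt B)), as @ rev zs')] @ [(fmt B, zs)]) (F \<union> ?I)"
    by (rule nd_tensor[OF D2(2) nd2]) (use dis fz v2 okD2 zs' in \<open>auto\<close>)
  then have nd3: "nd ((dual (fmt (A -\<circ> B)), rev (zs' @ rev as)) # D2 @ [(fmt B, zs)]) (F \<union> ?I)"
    using nd_move_left[of "[]" D2] by simp
  have pB: "pol (tb B) zs E" using net_pol[OF app(1)] len by (simp add: pol_append)
  have inj: "inj_on ?f X" for X using bf by (meson bij_def inj_on_subset subset_UNIV)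
  have pE: "pol (tb B) zs' ?E" using pol_relabel[OF inj pB] swap_lists_map(1)[OF dz] by simp
  have zE: "set zs \<inter> verts ?E = {}"
  proof -
    have "set zs = ?f ` set zs'" using swap_lists_map(2)[OF dz] by (metis set_map)
    then have "set zs \<inter> verts ?E = ?f ` (set zs' \<inter> verts E)" unfolding verts_relabel using image_Int[of ?f] inj by metis
    then show ?thesis using fz by simp
  qed
  \<comment> \<open>Gluing the link undoes the renaming of the output, so what remains of the cut is
    the gluing along \<open>as\<close>.\<close>
  have hI: "hide (set zs') (?E \<union> ?I) = E"
  proof -
    have "hide (set zs') (?E \<union> ?I) = relabel (swap_lists zs' zs) ?E"
      by (rule hide_idg_swap) (use len zs' dis pE zE fz in auto)
    also have "\<dots> = E" unfolding swap_lists_commute[OF dz] by (rule relabel_swap_swap[OF dz])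
    finally show ?thesis .
  qed
  have zF: "set zs' \<inter> verts F = {}" using ok2 fz by blast
  have H: "hide (set zs') (?E \<union> (F \<union> ?I)) = E \<union> F"
    using hide_Un_disjoint[OF zF, of "?E \<union> ?I"] hI by (simp add: Un_ac)
  have ncE: "no_cycle (set zs') (?E \<union> (F \<union> ?I))"
  proof (rule no_cycle_restrict, rule no_cycle_mono[OF no_cycle_pol[OF pE]])
    show "{e \<in> ?E \<union> (F \<union> ?I). source e \<in> set zs' \<and> target e \<in> set zs'} \<subseteq> ?E"
    proof
      fix x assume x: "x \<in> {e \<in> ?E \<union> (F \<union> ?I). source e \<in> set zs' \<and> target e \<in> set zs'}"
      have "x \<notin> F"
      proof
        assume "x \<in> F"
        then have "source x \<in> verts F" by (simp add: verts_def)
        then show False using x zF by auto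
      qed
      moreover have "x \<notin> ?I"
      proof
        assume "x \<in> ?I"
        then have "source x \<in> set zs \<or> target x \<in> set zs" using len by (auto simp: idg_def)
        then show False using x fz by auto
      qed
      ultimately show "x \<in> ?E" using x by simp
    qed
  qed simp
  \<comment> \<open>Hiding the copy \<open>zs'\<close> first leaves \<open>E \<union> F\<close>,
    whose gluing along \<open>as\<close> is acyclic because both are graphs of terms.\<close>
  have nc: "no_cycle (set as \<union> set zs') (?E \<union> (F \<union> ?I))"
    by (rule no_cycle_UnI[OF ncE]) (simp add: H net_no_cycle[OF app(1,2)])
  have "nd (D1 @ (D2 @ [(fmt B, zs)])) (hide (set (zs' @ rev as)) (?E \<union> (F \<union> ?I)))"
  proof (rule nd_cut[OF nd1 nd3])
    show "distinct (vsD (D2 @ [(fmt B, zs)]) @ vsD D1 @ zs' @ rev as)"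
      using dis fz v1 v2 okD1 okD2 zs' by auto
    show "no_cycle (set (zs' @ rev as)) (?E \<union> (F \<union> ?I))" using nc by (simp add: Un_commute)
  qed
  moreover have "hide (set (zs' @ rev as)) (?E \<union> (F \<union> ?I)) = hide (set as) (E \<union> F)"
    using hide_hide[of "set as" "set zs'" "?E \<union> (F \<union> ?I)"] by (simp add: H Un_commute)
  moreover have "set (D1 @ D2) = ?img ` ran (\<Gamma> ++ \<Delta>)" using D1(1) D2(1) ran_map_add[OF app(3)] by (simp add: image_Un)
  ultimately show ?case by (intro exI[of _ "D1 @ D2"]) simp
next
  case (abs A ys \<Gamma> E t B zs)
  let ?img = "\<lambda>(B, ys :: nat list). (dual (fmt B), rev ys)"
  let ?x = "(dual (fmt A), rev ys)"
  obtain D where D: "set D = insert ?x (?img ` ran \<Gamma>)" "nd (D @ [(fmt B, zs)]) E"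
    using abs.IH by (auto simp: ran_case_nat)
  then obtain P Q where PQ: "D = P @ ?x # Q" by (metis insertI1 split_list)
  have ok: "length ys = length (tb A)" "set ys \<inter> cv \<Gamma> = {}"
    using net_ok[OF abs(1)] ok_ctxt_case_nat[of A ys \<Gamma>] by auto
  then have ne: "set ys \<noteq> {}" by (metis length_0_conv length_tbd_pos less_nat_zero_code set_empty)
  have "nd (P @ ?x # Q @ [(fmt B, zs)]) E" using D(2) PQ by simp
  then have "nd ((P @ Q) @ [?x, (fmt B, zs)]) E" using nd_move_right[of P ?x Q "[(fmt B, zs)]"] by simp
  then have "nd ((P @ Q) @ [(fmt (A -\<circ> B), zs @ rev ys)]) E" using nd_par[of "P @ Q" "dual (fmt A)" "rev ys" "fmt B" zs E] by simp
  moreover have "set (P @ Q) = ?img ` ran \<Gamma>"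
  proof -
    \<comment> \<open>The discharged hypothesis owns a nonempty vertex list disjoint from all
      others, so it occurs exactly once and removing it leaves precisely the remaining
      context.\<close>
    have 1: "?x \<notin> ?img ` ran \<Gamma>"
    proof
      assume "?x \<in> ?img ` ran \<Gamma>"
      then obtain C where "(C, ys) \<in> ran \<Gamma>" by auto
      then have "set ys \<subseteq> cv \<Gamma>" unfolding cv_def by (intro SUP_upper2[of "(C, ys)"]) simp_all
      then show False using ok(2) ne by (simp add: Int_absorb2)
    qed
    have "distinct (vsD D)" using nd_okD[OF D(2)] by (simp add: okD_def)
    then have "set (vsD P) \<inter> set ys = {}" "set (vsD Q) \<inter> set ys = {}" unfolding PQ by auto
    moreover have "set ys \<subseteq> set (vsD M)" if M: "?x \<in> set M" for M
    proof -
      obtain M1 M2 where "M = M1 @ ?x # M2" using split_list[OF M] by blast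
      then show ?thesis by auto
    qed
    ultimately have "?x \<notin> set P" "?x \<notin> set Q" using ne by (metis Int_absorb1)+
    then have 2: "?x \<notin> set (P @ Q)" by simp
    have "insert ?x (set (P @ Q)) = insert ?x (?img ` ran \<Gamma>)" using D(1) PQ by simp
    then show ?thesis using 1 2 by (metis insert_ident)
  qed
  ultimately show ?case by blast
qed

lemma gram_complete:
  assumes "typing \<Sigma> [] t (Atom S)"
  shows "\<exists>w\<in>llg_language LG. map_constants g t \<approx> rho w"
proof -
  have tS: "tb (Atom S) = [True, False]" by (simp add: hS bdual_def)
  obtain E where "net (named (\<lambda>_. []) []) E t (Atom S) [1, 2]"
    using typing_net[OF assms, of "[1, 2]" "\<lambda>_. []"] tS by auto
  moreover have "named (\<lambda>_. []) [] = Map.empty" by (rule HOL.ext) (simp add: named_def)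
  ultimately have net: "net Map.empty E t (Atom S) [1, 2]" by simp
  obtain w where w: "E = {(1, w, 2)}" "map_constants g t \<approx> rho w" using net_word[OF net] hS by auto
  obtain D where D: "set D = {}" "nd (D @ [(fmt (Atom S), [1, 2])]) E"
    using net_nd[OF net] by auto
  then have "D = []" by simp
  then have "nd [(fmt (Atom S), [1, 2])] E" using D(2) by simp
  then obtain \<sigma> where \<sigma>: "derivable LG \<sigma> [Pos (e S)]" "singular \<sigma> = {#}" "place [1, 2] (edges \<sigma>) = E"
    by (auto simp: nd_def)
  have "verts (edges \<sigma>) \<subseteq> {1..2}" using derivable_verts[OF \<sigma>(1)] S by (simp add: dec_e hS bdual_def numeral_2_eq_2)
  \<comment> \<open>The names 1 and 2 are the vertex numbers themselves, so placing leaves the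
    multiword unchanged.\<close>
  moreover have "inits 2 = [1, 2]" by (simp add: inits_def upt_rec)
  ultimately have "edges \<sigma> = E" using place_inits[of "edges \<sigma>" 2] \<sigma>(3) by simp
  then have "w \<in> llg_language LG" using \<sigma>(1,2) w(1) by (auto simp: llg_language_def regular_def)
  then show ?thesis using w(2) by blast
qed

end

section \<open>Phase semantics of linear logic grammars\<close>

type_synonym ('n, 't) elem = "(nat, 't) edge set \<times> (bool \<times> 'n ltype \<times> nat list) set"

lemma fresh_odd:
  assumes "finite (V :: nat set)"
  obtains xs :: "nat list" where "length xs = n" "distinct xs" "set xs \<inter> V = {}" "\<forall>x\<in>set xs. odd x"
proof -
  obtain m where m: "\<forall>v\<in>V. v < m" using assms finite_nat_set_iff_bounded by blast
  have "set (map (\<lambda>i. 2 * i + 1) [m..<m + n]) \<inter> V = {}" using m by fastforce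
  then show ?thesis by (intro that[of "map (\<lambda>i. 2 * i + 1) [m..<m + n]"]) (auto simp: distinct_map inj_on_def)
qed

lemma fresh_even:
  assumes "finite (V :: nat set)"
  obtains xs :: "nat list" where "length xs = n" "distinct xs" "set xs \<inter> V = {}" "\<forall>x\<in>set xs. even x"
proof -
  obtain m where m: "\<forall>v\<in>V. v < m" using assms finite_nat_set_iff_bounded by blast
  have "set (map (\<lambda>i. 2 * i) [m..<m + n]) \<inter> V = {}" using m by fastforce
  then show ?thesis by (intro that[of "map (\<lambda>i. 2 * i) [m..<m + n]"]) (auto simp: distinct_map inj_on_def)
qed

context gram
begin

definition mv :: "(bool \<times> 'n ltype \<times> nat list) set \<Rightarrow> nat set" where
  "mv m = (\<Union>(s, A, ys)\<in>m. set ys)"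

lemma mv_simps [simp]: "mv {} = {}" "mv (insert (s, A, ys) m) = set ys \<union> mv m" "mv (m \<union> n) = mv m \<union> mv n"
  "mv (Pair s ` N) = nv N"
  by (auto simp: mv_def nv_def)

text \<open>The negative entries of \<open>m\<close> are the typed free variables and the positive entry is the result
  type of a term with graph \<open>E\<close>. Variable and result vertices are odd and interface vertices are
  even, so that they never clash.\<close>

definition PP :: "(nat, 't) edge set \<Rightarrow> (bool \<times> 'n ltype \<times> nat list) set \<Rightarrow> bool" where
  "PP E m \<longleftrightarrow> (\<exists>N B zs. m = insert (True, B, zs) (Pair False ` N) \<and> pole N B zs E)"

definition okel :: "boundary \<Rightarrow> nat list \<Rightarrow> (nat, 't) edge set \<Rightarrow> (bool \<times> 'n ltype \<times> nat list) set \<Rightarrow> bool" where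
  "okel X xs E m \<longleftrightarrow> pol X xs E \<and> verts E \<subseteq> set xs \<union> mv m \<and> finite (mv m) \<and> (\<forall>v\<in>mv m. odd v)"

text \<open>Orthogonality for gluing along the interface \<open>xs\<close>: two elements with
  disjoint resources are orthogonal if the glued graph, with the resources of both, lies in the
  pole. The boundary argument fixes the polarity of the elements at \<open>xs\<close>; the tests
  have the opposite one.\<close>

definition orth :: "boundary \<Rightarrow> nat list \<Rightarrow> ('n, 't) elem set \<Rightarrow> ('n, 't) elem set" where
  "orth X xs Q = {(E, m). okel X xs E m \<and>
     (\<forall>F n. (F, n) \<in> Q \<longrightarrow> mv m \<inter> mv n = {} \<longrightarrow> PP (hide (set xs) (E \<union> F)) (m \<union> n))}"

definition okset :: "boundary \<Rightarrow> nat list \<Rightarrow> ('n, 't) elem set \<Rightarrow> bool" where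
  "okset X xs Q \<longleftrightarrow> (\<forall>E m. (E, m) \<in> Q \<longrightarrow> okel X xs E m)"

lemma okset_orth: "okset X xs (orth X xs Q)"
  by (simp add: okset_def orth_def)

lemma orthD: "(E, m) \<in> orth X xs Q \<Longrightarrow> (F, n) \<in> Q \<Longrightarrow> mv m \<inter> mv n = {} \<Longrightarrow> PP (hide (set xs) (E \<union> F)) (m \<union> n)"
  by (simp add: orth_def)

lemma orth_okel: "(E, m) \<in> orth X xs Q \<Longrightarrow> okel X xs E m"
  by (simp add: orth_def)

lemma orthI: "okel X xs E m \<Longrightarrow> (\<And>F n. (F, n) \<in> Q \<Longrightarrow> mv m \<inter> mv n = {} \<Longrightarrow> PP (hide (set xs) (E \<union> F)) (m \<union> n)) \<Longrightarrow>
    (E, m) \<in> orth X xs Q"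
  by (simp add: orth_def)

lemma orth_orth: "okset X xs Q \<Longrightarrow> Q \<subseteq> orth X xs (orth X' xs Q)"
proof
  fix p assume Q: "okset X xs Q" and p: "p \<in> Q"
  obtain E m where Em: "p = (E, m)" by (cases p)
  have "(E, m) \<in> orth X xs (orth X' xs Q)"
  proof (rule orthI)
    show "okel X xs E m" using Q p Em by (simp add: okset_def)
    fix F n assume "(F, n) \<in> orth X' xs Q" "mv m \<inter> mv n = {}"
    then have "PP (hide (set xs) (F \<union> E)) (n \<union> m)" using p Em by (auto intro: orthD)
    then show "PP (hide (set xs) (E \<union> F)) (m \<union> n)" by (simp add: Un_commute)
  qed
  then show "p \<in> orth X xs (orth X' xs Q)" using Em by simp
qed

lemma orth_antimono: "Q \<subseteq> Q' \<Longrightarrow> orth X xs Q' \<subseteq> orth X xs Q"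
  by (auto simp: orth_def)

lemma orth3: "okset X' xs Q \<Longrightarrow> orth X xs (orth X' xs (orth X xs Q)) = orth X xs Q"
  by (rule equalityI[OF orth_antimono[OF orth_orth] orth_orth[OF okset_orth]])

lemma okel_rev: "length X = length xs \<Longrightarrow> okel (bdual X) (rev xs) E m \<longleftrightarrow> okel (map Not X) xs E m"
  by (simp add: okel_def pol_rev)

lemma orth_rev: "length X = length xs \<Longrightarrow> orth (bdual X) (rev xs) Q = orth (map Not X) xs Q"
  by (simp add: orth_def okel_rev)

lemma map_Not_Not [simp]: "map Not (map Not X) = X"
  by (induction X) auto

lemma bdual_Not: "bdual (map Not X) = map Not (bdual X)"
  by (simp add: bdual_def rev_map)

lemma orth_rev': "length X = length xs \<Longrightarrow> orth (map Not (bdual X)) (rev xs) Q = orth X xs Q"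
  using orth_rev[of "map Not X" xs Q] by (simp only: bdual_Not length_map map_Not_Not)

text \<open>Juxtaposition of elements with disjoint resources: the monoid operation of the phase
  space lifted to sets, before biorthogonal closure.\<close>

definition pure :: "('n, 't) elem set \<Rightarrow> ('n, 't) elem set \<Rightarrow> ('n, 't) elem set" where
  "pure Q1 Q2 = {(E \<union> F, m \<union> n) | E m F n. (E, m) \<in> Q1 \<and> (F, n) \<in> Q2 \<and> mv m \<inter> mv n = {}}"

lemma pureI: "(E, m) \<in> Q1 \<Longrightarrow> (F, n) \<in> Q2 \<Longrightarrow> mv m \<inter> mv n = {} \<Longrightarrow> (E \<union> F, m \<union> n) \<in> pure Q1 Q2"
  unfolding pure_def by blast

lemma pureE:
  assumes "(G, p) \<in> pure Q1 Q2"
  obtains E m F n where "G = E \<union> F" "p = m \<union> n" "(E, m) \<in> Q1" "(F, n) \<in> Q2" "mv m \<inter> mv n = {}"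
  using assms unfolding pure_def by blast

lemma even_odd_disjoint: "\<forall>x\<in>set xs. even x \<Longrightarrow> \<forall>v\<in>mv m. odd v \<Longrightarrow> set xs \<inter> mv m = {}"
  by blast

lemma verts_disjoint_aux: "A \<subseteq> B \<union> C \<Longrightarrow> D \<inter> B = {} \<Longrightarrow> D \<inter> C = {} \<Longrightarrow> D \<inter> A = {}"
  by blast

lemma okset_pure:
  assumes "okset X as Q1" "okset Y bs Q2" "length as = length X" "length bs = length Y"
    "\<forall>x\<in>set (as @ bs). even x" "distinct (as @ bs)"
  shows "okset (X @ Y) (as @ bs) (pure Q1 Q2)"
  unfolding okset_def
proof (intro allI impI)
  fix G p assume "(G, p) \<in> pure Q1 Q2"
  then obtain E m F n where q: "G = E \<union> F" "p = m \<union> n" "(E, m) \<in> Q1" "(F, n) \<in> Q2" by (rule pureE)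
  have o1: "okel X as E m" and o2: "okel Y bs F n" using q assms(1,2) by (auto simp: okset_def)
  have ev: "\<forall>x\<in>set as. even x" "\<forall>x\<in>set bs. even x" using assms(5) by auto
  have d: "set as \<inter> set bs = {}" "set bs \<inter> set as = {}" using assms(6) by auto
  have vE: "verts E \<subseteq> set as \<union> mv m" and vF: "verts F \<subseteq> set bs \<union> mv n" using o1 o2 by (auto simp: okel_def)
  have odd: "\<forall>v\<in>mv m. odd v" "\<forall>v\<in>mv n. odd v" using o1 o2 by (auto simp: okel_def)
  have "pol Y bs E" by (rule pol_disjoint[OF verts_disjoint_aux[OF vE d(2) even_odd_disjoint[OF ev(2) odd(1)]]])
  moreover have "pol X as F" by (rule pol_disjoint[OF verts_disjoint_aux[OF vF d(1) even_odd_disjoint[OF ev(1) odd(2)]]])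
  ultimately have "pol (X @ Y) (as @ bs) G" using o1 o2 assms(3) q(1) by (simp add: pol_append okel_def)
  moreover have "verts G \<subseteq> set (as @ bs) \<union> mv p" using vE vF q(1,2) by auto
  moreover have "finite (mv p)" "\<forall>v\<in>mv p. odd v" using o1 o2 q(2) by (auto simp: okel_def)
  ultimately show "okel (X @ Y) (as @ bs) G p" by (simp add: okel_def)
qed

definition posel :: "nat \<Rightarrow> nat list \<Rightarrow> ('n, 't) elem set" where
  "posel n xs = {(idg (tb (Atom (dec n))) zs xs, {(True, Atom (dec n), zs)}) | zs.
     length zs = length xs \<and> distinct zs \<and> (\<forall>z\<in>set zs. odd z)}"

text \<open>Closed under biorthogonality, so that literals denote facts and their negation can be
  read as the orthogonal.\<close>

definition TP :: "nat \<Rightarrow> nat list \<Rightarrow> ('n, 't) elem set" where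
  "TP n xs = orth (map Not (tb (Atom (dec n)))) xs (orth (tb (Atom (dec n))) xs (posel n xs))"

text \<open>\<open>TT A xs\<close> is the set of counterproofs of \<open>A\<close>, with interface vertices \<open>xs\<close>.\<close>

primrec TT :: "nat fm \<Rightarrow> nat list \<Rightarrow> ('n, 't) elem set" where
  "TT (Pos n) xs = TP n xs"
| "TT (Neg n) xs = orth (tb (Atom (dec n))) (rev xs) (TP n (rev xs))"
| "TT (Tensor A B) xs =
     (let as = take (length (fb A)) xs; bs = drop (length (fb A)) xs
      in orth (map Not (fb A @ fb B)) xs (pure (orth (fb A) as (TT A as)) (orth (fb B) bs (TT B bs))))"
| "TT (Par A B) xs =
     (let bs = take (length (fb B)) xs; as = drop (length (fb B)) xs
      in orth (map Not (fb B @ fb A)) xs (orth (fb B @ fb A) xs (pure (TT A as) (TT B bs))))"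

definition okn :: "boundary \<Rightarrow> nat list \<Rightarrow> bool" where
  "okn X xs \<longleftrightarrow> length xs = length X \<and> distinct xs \<and> (\<forall>x\<in>set xs. even x)"

lemma okn_append: "length xs = length X \<Longrightarrow> okn (X @ Y) (xs @ ys) \<longleftrightarrow> okn X xs \<and> okn Y ys \<and> set xs \<inter> set ys = {}"
  by (auto simp: okn_def)

lemma okn_appendE:
  assumes "okn (X @ Y) zs"
  obtains xs ys where "zs = xs @ ys" "okn X xs" "okn Y ys" "set xs \<inter> set ys = {}" "xs = take (length X) zs" "ys = drop (length X) zs"
proof -
  have z: "zs = take (length X) zs @ drop (length X) zs" "length (take (length X) zs) = length X" using assms by (auto simp: okn_def)
  then have "okn X (take (length X) zs) \<and> okn Y (drop (length X) zs) \<and> set (take (length X) zs) \<inter> set (drop (length X) zs) = {}"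
    using okn_append[OF z(2), of Y "drop (length X) zs"] assms by simp
  then show ?thesis using that z(1) by blast
qed

lemma okn_rev: "okn (bdual X) (rev xs) \<longleftrightarrow> okn X xs"
  by (auto simp: okn_def)

lemma okset_TT: "okn (fb A) xs \<Longrightarrow> okset (map Not (fb A)) xs (TT A xs)"
proof (cases A)
  case (Pos n)
  then show ?thesis by (simp add: TP_def okset_orth)
next
  case (Neg n)
  assume ok: "okn (fb A) xs"
  have "okset (tb (Atom (dec n))) (rev xs) (TT A xs)" by (simp add: Neg okset_orth)
  moreover have "okel (tb (Atom (dec n))) (rev xs) E m \<longleftrightarrow> okel (map Not (fb A)) xs E m" for E m
    using okel_rev[of "map Not (tb (Atom (dec n)))" "rev xs" E m] ok
    by (simp add: Neg bdual_Not okn_def del: map_map)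
  ultimately show ?thesis by (simp add: okset_def)
qed (simp_all add: Let_def okset_orth)

text \<open>Negation exchanges proofs and counterproofs; the dual boundary lists the same vertices
  backwards. Closedness is proved at the same time because the case of \<open>Par\<close> has to
  recover the counterproofs of the parts from their orthogonals.\<close>

lemma TT_closed_dual:
  "okn (fb A) xs \<Longrightarrow> TT (dual A) (rev xs) = orth (fb A) xs (TT A xs) \<and> orth (map Not (fb A)) xs (orth (fb A) xs (TT A xs)) = TT A xs"
proof (induction A arbitrary: xs)
  case (Pos n)
  have "orth (map Not (tb (Atom (dec n)))) xs (orth (tb (Atom (dec n))) xs (TP n xs)) = TP n xs"
    unfolding TP_def by (rule orth3) (rule okset_orth)
  then show ?case by simp
next
  case (Neg n)
  let ?X = "tb (Atom (dec n))"
  have l: "length ?X = length (rev xs)" using Neg by (simp add: okn_def)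
  have cl: "orth (map Not ?X) (rev xs) (orth ?X (rev xs) (TP n (rev xs))) = TP n (rev xs)"
    unfolding TP_def by (rule orth3) (rule okset_orth)
  have b: "orth (bdual ?X) xs Q = orth (map Not ?X) (rev xs) Q" "orth (map Not (bdual ?X)) xs Q = orth ?X (rev xs) Q" for Q
    using orth_rev[OF l, of Q] orth_rev'[OF l, of Q] by simp_all
  have f: "fb (Neg n) = bdual ?X" by simp
  show ?case unfolding f b TT.simps dual.simps cl by simp
next
  case (Tensor A B)
  let ?X = "fb A @ fb B"
  obtain as bs where ab: "xs = as @ bs" "okn (fb A) as" "okn (fb B) bs" "set as \<inter> set bs = {}"
      "as = take (length (fb A)) xs" "bs = drop (length (fb A)) xs"
    using okn_appendE[of "fb A" "fb B" xs] Tensor.prems by auto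
  have l: "length as = length (fb A)" "length bs = length (fb B)" "length xs = length ?X"
    using ab(1-3) by (auto simp: okn_def)
  let ?RA = "orth (fb A) as (TT A as)" and ?RB = "orth (fb B) bs (TT B bs)"
  have ok: "okset ?X xs (pure ?RA ?RB)" unfolding ab(1)
    by (rule okset_pure[OF okset_orth okset_orth l(1,2)]) (use ab(1-4) in \<open>auto simp: okn_def\<close>)
  have T1: "TT (Tensor A B) xs = orth (map Not ?X) xs (pure ?RA ?RB)"
    using ab(5,6) by (simp add: Let_def)
  have dA: "TT (dual A) (rev as) = ?RA" and dB: "TT (dual B) (rev bs) = ?RB"
    using Tensor.IH ab(2,3) by blast+
  have tk: "take (length (fb (dual B))) (rev xs) = rev bs" "drop (length (fb (dual B))) (rev xs) = rev as"
    using l ab(1) by simp_all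
  have fX: "fb (dual B) @ fb (dual A) = bdual ?X" by (simp add: fm_boundary_dual bdual_def)
  have lX: "length ?X = length xs" using l by simp
  have "TT (dual (Tensor A B)) (rev xs) = orth (map Not (bdual ?X)) (rev xs) (orth (bdual ?X) (rev xs) (pure ?RA ?RB))"
    unfolding dual.simps TT.simps Let_def tk fX dA dB ..
  also have "\<dots> = orth ?X xs (TT (Tensor A B) xs)" unfolding orth_rev[OF lX] orth_rev'[OF lX] T1 ..
  finally have 1: "TT (dual (Tensor A B)) (rev xs) = orth ?X xs (TT (Tensor A B) xs)" .
  have 2: "orth (map Not ?X) xs (orth ?X xs (TT (Tensor A B) xs)) = TT (Tensor A B) xs"
    unfolding T1 by (rule orth3[OF ok])
  show ?case using 1 2 by simp
next
  case (Par A B)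
  let ?X = "fb B @ fb A"
  obtain bs as where ab: "xs = bs @ as" "okn (fb B) bs" "okn (fb A) as" "set bs \<inter> set as = {}"
      "bs = take (length (fb B)) xs" "as = drop (length (fb B)) xs"
    using okn_appendE[of "fb B" "fb A" xs] Par.prems by auto
  have l: "length as = length (fb A)" "length bs = length (fb B)" "length xs = length ?X"
    using ab(1-3) by (auto simp: okn_def)
  let ?Q = "pure (TT A as) (TT B bs)"
  have com: "pure (TT A as) (TT B bs) = pure (TT B bs) (TT A as)"
    unfolding pure_def by (auto simp: Un_commute Int_commute; metis Un_commute Int_commute)
  have ok: "okset (map Not ?X) xs ?Q"
  proof -
    have "okset (map Not (fb B) @ map Not (fb A)) (bs @ as) (pure (TT B bs) (TT A as))"
      by (rule okset_pure[OF okset_TT[OF ab(2)] okset_TT[OF ab(3)]]) (use ab(1-4) l in \<open>auto simp: okn_def\<close>)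
    then show ?thesis unfolding com ab(1) by simp
  qed
  have T1: "TT (Par A B) xs = orth (map Not ?X) xs (orth ?X xs ?Q)" using ab(5,6) by (simp add: Let_def)
  have lab: "length (fb A) = length as" "length (fb B) = length bs" using l by simp_all
  have dA: "orth (fb (dual A)) (rev as) (TT (dual A) (rev as)) = TT A as"
    unfolding fm_boundary_dual orth_rev[OF lab(1)] conjunct1[OF Par.IH(1)[OF ab(3)]]
    by (rule conjunct2[OF Par.IH(1)[OF ab(3)]])
  have dB: "orth (fb (dual B)) (rev bs) (TT (dual B) (rev bs)) = TT B bs"
    unfolding fm_boundary_dual orth_rev[OF lab(2)] conjunct1[OF Par.IH(2)[OF ab(2)]]
    by (rule conjunct2[OF Par.IH(2)[OF ab(2)]])
  have tk: "take (length (fb (dual A))) (rev xs) = rev as" "drop (length (fb (dual A))) (rev xs) = rev bs"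
    using l ab(1) by simp_all
  have fX: "fb (dual A) @ fb (dual B) = bdual ?X" by (simp add: fm_boundary_dual bdual_def)
  have lX: "length ?X = length xs" using l by simp
  have "TT (dual (Par A B)) (rev xs) = orth (map Not (bdual ?X)) (rev xs) ?Q"
    unfolding dual.simps TT.simps Let_def tk fX dA dB ..
  also have "\<dots> = orth ?X xs ?Q" by (rule orth_rev'[OF lX])
  also have "\<dots> = orth ?X xs (TT (Par A B) xs)" unfolding T1 by (rule orth3[OF ok, symmetric])
  finally have 1: "TT (dual (Par A B)) (rev xs) = orth ?X xs (TT (Par A B) xs)" .
  have 2: "orth (map Not ?X) xs (orth ?X xs (TT (Par A B) xs)) = TT (Par A B) xs"
    unfolding T1 by (rule orth3[OF okset_orth])
  show ?case using 1 2 by simp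
qed

lemmas TT_dual = TT_closed_dual[THEN conjunct1] and TT_closed = TT_closed_dual[THEN conjunct2]

section \<open>Renaming of interface vertices\<close>

text \<open>Variables and results occupy odd vertices, so such a renaming moves the interface
  only.\<close>

definition fixodd :: "(nat \<Rightarrow> nat) \<Rightarrow> bool" where
  "fixodd f \<longleftrightarrow> bij f \<and> (\<forall>v. odd v \<longrightarrow> f v = v)"

lemma fixodd_inv: "fixodd f \<Longrightarrow> fixodd (inv f)"
  unfolding fixodd_def by (metis bij_betw_imp_inj_on bij_imp_bij_inv inv_f_f)

lemma fixodd_inj: "fixodd f \<Longrightarrow> inj_on f V"
  unfolding fixodd_def by (meson bij_def inj_on_subset subset_UNIV)

lemma fixodd_map_inv: "fixodd f \<Longrightarrow> map (inv f) (map f xs) = xs"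
  unfolding fixodd_def by (simp add: bij_def)

lemma fixodd_relabel_inv: "fixodd f \<Longrightarrow> relabel f (relabel (inv f) E) = E"
  unfolding fixodd_def by (simp add: relabel_inv)

lemma okel_relabel:
  assumes f: "fixodd f" and ok: "okel X xs E m"
  shows "okel X (map f xs) (relabel f E) m"
proof -
  have "f ` mv m = id ` mv m" using f ok by (intro image_cong) (auto simp: fixodd_def okel_def)
  moreover have "f ` verts E \<subseteq> f ` (set xs \<union> mv m)" using ok by (intro image_mono) (simp add: okel_def)
  ultimately have "f ` verts E \<subseteq> set (map f xs) \<union> mv m" by (simp add: image_Un)
  then show ?thesis using ok pol_relabel[OF fixodd_inj[OF f], where xs = xs and E = E and X = X] by (simp add: okel_def verts_relabel)
qed

lemma orth_equivariant:
  assumes f: "fixodd f" and Q: "\<And>F n. (F, n) \<in> Q' \<Longrightarrow> (relabel (inv f) F, n) \<in> Q" and ok: "okset Y xs Q"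
    and e: "(E, m) \<in> orth X xs Q"
  shows "(relabel f E, m) \<in> orth X (map f xs) Q'"
proof (rule orthI)
  note okE = orth_okel[OF e]
  show "okel X (map f xs) (relabel f E) m" by (rule okel_relabel[OF f okE])
  fix F n assume F: "(F, n) \<in> Q'" and d: "mv m \<inter> mv n = {}"
  let ?F = "relabel (inv f) F"
  have okF: "okel Y xs ?F n" using Q[OF F] ok by (simp add: okset_def)
  have P: "PP (hide (set xs) (E \<union> ?F)) (m \<union> n)" by (rule orthD[OF e Q[OF F] d])
  have "relabel f (hide (set xs) (E \<union> ?F)) = hide (set (map f xs)) (relabel f E \<union> F)"
    using relabel_hide[OF fixodd_inj[OF f], of "set xs" "E \<union> ?F"] by (simp add: fixodd_relabel_inv[OF f])
  \<comment> \<open>After gluing only odd vertices remain; the renaming fixes them, so membership in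
    the pole is unchanged.\<close>
  moreover have "relabel f (hide (set xs) (E \<union> ?F)) = hide (set xs) (E \<union> ?F)"
  proof (rule relabel_id)
    fix v assume v: "v \<in> verts (hide (set xs) (E \<union> ?F))"
    have "verts (hide (set xs) (E \<union> ?F)) \<subseteq> (verts E \<union> verts ?F) - set xs" using verts_hide[of "set xs" "E \<union> ?F"] by simp
    then have "v \<in> mv m \<union> mv n" using v okE okF unfolding okel_def by blast
    then show "f v = v" using okE okF f by (auto simp: okel_def fixodd_def)
  qed
  ultimately show "PP (hide (set (map f xs)) (relabel f E \<union> F)) (m \<union> n)" using P by simp
qed

lemma okn_map: "fixodd f \<Longrightarrow> okn X xs \<Longrightarrow> okn X (map f xs)"
proof -
  assume f: "fixodd f" and ok: "okn X xs"
  have "even (f x)" if "even x" for x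
  proof (rule ccontr)
    assume "odd (f x)"
    then have "f (f x) = f x" using f by (simp add: fixodd_def)
    then have "f x = x" using f by (metis bij_def fixodd_def inj_eq)
    then show False using \<open>odd (f x)\<close> that by simp
  qed
  then show ?thesis using ok fixodd_inj[OF f, of "set xs"] by (auto simp: okn_def distinct_map)
qed

lemma pure_equivariant:
  assumes "\<And>F n. (F, n) \<in> Q1' \<Longrightarrow> (relabel f F, n) \<in> Q1" "\<And>F n. (F, n) \<in> Q2' \<Longrightarrow> (relabel f F, n) \<in> Q2"
    and "(G, p) \<in> pure Q1' Q2'"
  shows "(relabel f G, p) \<in> pure Q1 Q2"
  using assms(3)
proof (rule pureE)
  fix E m F n assume q: "G = E \<union> F" "p = m \<union> n" "(E, m) \<in> Q1'" "(F, n) \<in> Q2'" "mv m \<inter> mv n = {}"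
  have "(relabel f E \<union> relabel f F, m \<union> n) \<in> pure Q1 Q2" by (rule pureI[OF assms(1)[OF q(3)] assms(2)[OF q(4)] q(5)])
  then show ?thesis using q(1,2) by simp
qed

lemma posel_equivariant:
  assumes f: "fixodd f" and ok: "okn (tb (Atom (dec n))) xs" and F: "(F, m) \<in> posel n xs"
  shows "(relabel f F, m) \<in> posel n (map f xs)"
proof -
  obtain zs where zs: "F = idg (tb (Atom (dec n))) zs xs" "m = {(True, Atom (dec n), zs)}" "length zs = length xs" "distinct zs" "\<forall>z\<in>set zs. odd z"
    using F unfolding posel_def by blast
  have "map f zs = zs" using zs(5) f by (intro map_idI) (simp add: fixodd_def)
  then have "relabel f F = idg (tb (Atom (dec n))) zs (map f xs)"
    unfolding zs(1) using relabel_idg[of zs "tb (Atom (dec n))" xs f] zs(3) ok by (simp add: okn_def)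
  then show ?thesis unfolding posel_def using zs by auto
qed

lemma okset_posel: "okn (tb (Atom (dec n))) xs \<Longrightarrow> okset (map Not (tb (Atom (dec n)))) xs (posel n xs)"
  unfolding okset_def posel_def
proof clarify
  let ?X = "tb (Atom (dec n))"
  fix zs :: "nat list" assume ok: "okn ?X xs" and zs: "length zs = length xs" "distinct zs" "\<forall>z\<in>set zs. odd z"
  have d: "set zs \<inter> set xs = {}" using zs ok by (auto simp: okn_def)
  have l: "length zs = length ?X" "length xs = length ?X" using zs ok by (auto simp: okn_def)
  show "okel (map Not ?X) xs (idg ?X zs xs) {(True, Atom (dec n), zs)}"
    unfolding okel_def using pol_idg(2)[OF l zs(2) _ d] ok zs by (auto simp: okn_def verts_idg[OF l] simp del: tbd.simps ext.simps)
qed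

lemma TP_equivariant:
  assumes f: "fixodd f" and ok: "okn (tb (Atom (dec n))) xs" and F: "(F, m) \<in> TP n xs"
  shows "(relabel f F, m) \<in> TP n (map f xs)"
  unfolding TP_def
proof (rule orth_equivariant[OF f _ okset_orth F[unfolded TP_def]])
  fix F n' assume F: "(F, n') \<in> orth (tb (Atom (dec n))) (map f xs) (posel n (map f xs))"
  have "(relabel (inv f) F, n') \<in> orth (tb (Atom (dec n))) (map (inv f) (map f xs)) (posel n xs)"
  proof (rule orth_equivariant[OF fixodd_inv[OF f] _ okset_posel[OF okn_map[OF f ok]] F])
    fix G k assume "(G, k) \<in> posel n xs"
    then show "(relabel (inv (inv f)) G, k) \<in> posel n (map f xs)"
      using posel_equivariant[OF f ok] f by (simp add: fixodd_def inv_inv_eq)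
  qed
  then show "(relabel (inv f) F, n') \<in> orth (tb (Atom (dec n))) xs (posel n xs)" by (simp only: fixodd_map_inv[OF f])
qed

text \<open>The names of an interface are immaterial. The identity axiom depends on this, as its two
  formulas sit on different vertices.\<close>

lemma TT_equivariant: "fixodd f \<Longrightarrow> okn (fb A) xs \<Longrightarrow> (F, m) \<in> TT A xs \<Longrightarrow> (relabel f F, m) \<in> TT A (map f xs)"
proof (induction A arbitrary: xs F m f)
  case (Pos n)
  then show ?case using TP_equivariant by simp
next
  case (Neg n)
  let ?X = "tb (Atom (dec n))"
  note f = Neg.prems(1)
  have ok: "okn ?X (rev xs)" using Neg.prems(2) okn_rev[of ?X "rev xs"] by simp
  have okT: "okset (map Not ?X) (rev xs) (TP n (rev xs))" by (simp add: TP_def okset_orth)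
  have "(relabel f F, m) \<in> orth ?X (map f (rev xs)) (TP n (map f (rev xs)))"
  proof (rule orth_equivariant[OF f _ okT])
    fix G k assume "(G, k) \<in> TP n (map f (rev xs))"
    then have "(relabel (inv f) G, k) \<in> TP n (map (inv f) (map f (rev xs)))"
      by (rule TP_equivariant[OF fixodd_inv[OF f] okn_map[OF f ok]])
    then show "(relabel (inv f) G, k) \<in> TP n (rev xs)" by (simp only: fixodd_map_inv[OF f])
  qed (use Neg.prems(3) in simp)
  then show ?case by (simp add: rev_map)
next
  case (Tensor A B)
  note f = Tensor.prems(1)
  let ?X = "fb A @ fb B"
  obtain as bs where ab: "xs = as @ bs" "okn (fb A) as" "okn (fb B) bs" "set as \<inter> set bs = {}"
      "as = take (length (fb A)) xs" "bs = drop (length (fb A)) xs"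
    using okn_appendE[of "fb A" "fb B" xs] Tensor.prems(2) by auto
  have l: "length as = length (fb A)" "length bs = length (fb B)"
    using ab(1-3) by (auto simp: okn_def)
  let ?R = "\<lambda>A as. orth (fb A) as (TT A as)"
  have R: "(relabel (inv f) G, k) \<in> ?R C cs"
    if IH: "\<And>xs F m f. fixodd f \<Longrightarrow> okn (fb C) xs \<Longrightarrow> (F, m) \<in> TT C xs \<Longrightarrow> (relabel f F, m) \<in> TT C (map f xs)"
      and cs: "okn (fb C) cs" and G: "(G, k) \<in> ?R C (map f cs)" for C cs G k
  proof -
    have "(relabel (inv f) G, k) \<in> orth (fb C) (map (inv f) (map f cs)) (TT C cs)"
    proof (rule orth_equivariant[OF fixodd_inv[OF f] _ okset_TT[OF okn_map[OF f cs]] G])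
      fix H j assume "(H, j) \<in> TT C cs"
      then show "(relabel (inv (inv f)) H, j) \<in> TT C (map f cs)"
        using IH[OF f cs] f by (simp add: fixodd_def inv_inv_eq)
    qed
    then show ?thesis by (simp only: fixodd_map_inv[OF f])
  qed
  have okp: "okset ?X xs (pure (?R A as) (?R B bs))" unfolding ab(1)
    by (rule okset_pure[OF okset_orth okset_orth l(1,2)]) (use ab(1-4) in \<open>auto simp: okn_def\<close>)
  have "(relabel f F, m) \<in> orth (map Not ?X) (map f xs) (pure (?R A (map f as)) (?R B (map f bs)))"
  proof (rule orth_equivariant[OF f _ okp])
    fix G k assume "(G, k) \<in> pure (?R A (map f as)) (?R B (map f bs))"
    then show "(relabel (inv f) G, k) \<in> pure (?R A as) (?R B bs)"
      by (rule pure_equivariant[rotated 2]) (rule R[OF Tensor.IH(1) ab(2)] R[OF Tensor.IH(2) ab(3)]; assumption)+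
  next
    show "(F, m) \<in> orth (map Not ?X) xs (pure (?R A as) (?R B bs))"
      using Tensor.prems(3) ab(5,6) by (simp add: Let_def)
  qed
  moreover have "take (length (fb A)) (map f xs) = map f as" "drop (length (fb A)) (map f xs) = map f bs"
    using l ab(1) by simp_all
  ultimately show ?case unfolding TT.simps Let_def by simp
next
  case (Par A B)
  note f = Par.prems(1)
  let ?X = "fb B @ fb A"
  obtain bs as where ab: "xs = bs @ as" "okn (fb B) bs" "okn (fb A) as" "set bs \<inter> set as = {}"
      "bs = take (length (fb B)) xs" "as = drop (length (fb B)) xs"
    using okn_appendE[of "fb B" "fb A" xs] Par.prems(2) by auto
  have l: "length as = length (fb A)" "length bs = length (fb B)"
    using ab(1-3) by (auto simp: okn_def)
  have okp: "okset (map Not ?X) ys (pure (TT A as) (TT B bs))" if "ys = bs @ as" "okn (fb B) bs" "okn (fb A) as" "set bs \<inter> set as = {}" for ys bs as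
  proof -
    have com: "pure (TT A as) (TT B bs) = pure (TT B bs) (TT A as)"
      unfolding pure_def by (auto simp: Un_commute Int_commute; metis Un_commute Int_commute)
    have "okset (map Not (fb B) @ map Not (fb A)) (bs @ as) (pure (TT B bs) (TT A as))"
      by (rule okset_pure[OF okset_TT[OF that(2)] okset_TT[OF that(3)]]) (use that in \<open>auto simp: okn_def\<close>)
    then show ?thesis unfolding com that(1) by simp
  qed
  have dm: "set (map f bs) \<inter> set (map f as) = {}"
    using ab(4) image_Int[of f "set bs" "set as"] fixodd_inj[OF f] by simp
  have "(relabel f F, m) \<in> orth (map Not ?X) (map f xs) (orth ?X (map f xs) (pure (TT A (map f as)) (TT B (map f bs))))"
  proof (rule orth_equivariant[OF f _ okset_orth])
    fix G k assume G: "(G, k) \<in> orth ?X (map f xs) (pure (TT A (map f as)) (TT B (map f bs)))"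
    have "(relabel (inv f) G, k) \<in> orth ?X (map (inv f) (map f xs)) (pure (TT A as) (TT B bs))"
    proof (rule orth_equivariant[OF fixodd_inv[OF f] _ okp[OF _ okn_map[OF f ab(2)] okn_map[OF f ab(3)] dm] G])
      show "map f xs = map f bs @ map f as" by (simp add: ab(1))
      fix H j assume "(H, j) \<in> pure (TT A as) (TT B bs)"
      then have "(relabel f H, j) \<in> pure (TT A (map f as)) (TT B (map f bs))"
        by (rule pure_equivariant[rotated 2]) (rule Par.IH(1)[OF f ab(3)] Par.IH(2)[OF f ab(2)]; assumption)+
      then show "(relabel (inv (inv f)) H, j) \<in> pure (TT A (map f as)) (TT B (map f bs))"
        using f by (simp add: fixodd_def inv_inv_eq)
    qed
    then show "(relabel (inv f) G, k) \<in> orth ?X xs (pure (TT A as) (TT B bs))" by (simp only: fixodd_map_inv[OF f])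
  next
    show "(F, m) \<in> orth (map Not ?X) xs (orth ?X xs (pure (TT A as) (TT B bs)))"
      using Par.prems(3) ab(5,6) by (simp add: Let_def)
  qed
  moreover have "take (length (fb B)) (map f xs) = map f bs" "drop (length (fb B)) (map f xs) = map f as"
    using l ab(1) by simp_all
  ultimately show ?case unfolding TT.simps Let_def by simp
qed

end

lemma fixodd_swap_even: "\<lbrakk>distinct (us @ vs); length us = length vs; \<forall>x\<in>set (us @ vs). even x\<rbrakk> \<Longrightarrow>
    bij (swap_lists us vs) \<and> (\<forall>v. odd v \<longrightarrow> swap_lists us vs v = v)"
  by (intro conjI bij_swap_lists allI impI swap_lists_other) auto

context gram
begin

section \<open>Realizers of types are the graphs of terms\<close>

lemma PP_split:
  assumes "PP E (insert (True, A, zs) m)" "(True, A, zs) \<notin> m"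
  shows "\<exists>N. m = Pair False ` N \<and> pole N A zs E"
proof -
  obtain N B ys where N: "insert (True, A, zs) m = insert (True, B, ys) (Pair False ` N)" "pole N B ys E"
    using assms(1) by (auto simp: PP_def)
  have "(True, A, zs) \<in> insert (True, B, ys) (Pair False ` N)" unfolding N(1)[symmetric] by simp
  then have eq: "A = B" "zs = ys" by auto
  moreover have "(True, B, ys) \<notin> Pair False ` N" by auto
  ultimately have "m = Pair False ` N" using N(1) assms(2) by (metis insert_ident)
  then show ?thesis using N(2) eq by blast
qed

lemma Pair_image_remove:
  assumes "insert (False, A, ys) n = insert (True, B, zs) (Pair False ` N)" "(False, A, ys) \<notin> n"
  shows "N = insert (A, ys) (N - {(A, ys)})" "n = insert (True, B, zs) (Pair False ` (N - {(A, ys)}))"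
proof -
  have "(False, A, ys) \<in> insert (True, B, zs) (Pair False ` N)" unfolding assms(1)[symmetric] by simp
  then have "(A, ys) \<in> N" by auto
  then show 1: "N = insert (A, ys) (N - {(A, ys)})" by blast
  have "insert (True, B, zs) (Pair False ` N) = insert (False, A, ys) (insert (True, B, zs) (Pair False ` (N - {(A, ys)})))"
    by (subst 1) (auto simp: image_insert)
  moreover have "(False, A, ys) \<notin> insert (True, B, zs) (Pair False ` (N - {(A, ys)}))" by auto
  ultimately show "n = insert (True, B, zs) (Pair False ` (N - {(A, ys)}))" using assms by (metis insert_ident)
qed

lemma mv_not_mem: "set ys \<inter> mv m = {} \<Longrightarrow> set ys \<noteq> {} \<Longrightarrow> (s, A, ys) \<notin> m"
proof
  assume a: "set ys \<inter> mv m = {}" "set ys \<noteq> {}" "(s, A, ys) \<in> m"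
  then have "set ys \<subseteq> mv m" unfolding mv_def by (intro SUP_upper2[of "(s, A, ys)"]) simp_all
  then show False using a by (simp add: Int_absorb2)
qed

definition oddn :: "boundary \<Rightarrow> nat list \<Rightarrow> bool" where
  "oddn X zs \<longleftrightarrow> length zs = length X \<and> distinct zs \<and> (\<forall>z\<in>set zs. odd z)"

lemma okn_oddn_disjoint: "okn X xs \<Longrightarrow> oddn Y zs \<Longrightarrow> set xs \<inter> set zs = {} \<and> set zs \<inter> set xs = {}"
  by (auto simp: okn_def oddn_def)

lemma pole_rename:
  assumes p: "pole N A us E" and vs: "length vs = length us" "distinct vs" "set vs \<inter> set us = {}" "set vs \<inter> nv N = {}"
  shows "pole N A vs (relabel (swap_lists us vs) E)"
proof -
  note ok = pole_ok[OF p]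
  have d: "distinct (us @ vs)" "length us = length vs" using ok vs by auto
  have "(\<lambda>(A, ys). (A, map (swap_lists us vs) ys)) ` N = (\<lambda>p. p) ` N"
  proof (rule image_cong[OF refl])
    fix q assume q: "q \<in> N"
    obtain B ys where By: "q = (B, ys)" by (cases q)
    have "set ys \<subseteq> nv N" using q unfolding By nv_def by (intro SUP_upper2[of "(B, ys)"]) simp_all
    then have "map (swap_lists us vs) ys = ys" using ok(4) vs(4) by (intro map_idI swap_lists_other[OF d(2)]) blast
    then show "(case q of (A, ys) \<Rightarrow> (A, map (swap_lists us vs) ys)) = q" by (simp add: By)
  qed
  then show ?thesis using pole_relabel[OF p bij_swap_lists[OF d]] swap_lists_map(1)[OF d] by simp
qed

lemma tb_nonempty: "length zs = length (tb A) \<Longrightarrow> set zs \<noteq> {}"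
  by (metis length_0_conv length_tbd_pos less_nat_zero_code set_empty)

abbreviation tests :: "'n ltype \<Rightarrow> nat list \<Rightarrow> ('n, 't) elem set" where "tests A xs \<equiv> TT (fmt A) xs"

text \<open>The link that turns the interface into the result of a term is a counterproof; gluing
  with it reads a term off a realizer.\<close>

definition posT :: "'n ltype \<Rightarrow> bool" where
  "posT A \<longleftrightarrow> (\<forall>xs zs. okn (tb A) xs \<longrightarrow> oddn (tb A) zs \<longrightarrow> (idg (tb A) zs xs, {(True, A, zs)}) \<in> tests A xs)"

text \<open>Variables are realizers; \<open>pole_orth\<close> extends this to all terms.\<close>

definition negR :: "'n ltype \<Rightarrow> bool" where
  "negR A \<longleftrightarrow> (\<forall>xs ys. okn (tb A) xs \<longrightarrow> oddn (tb A) ys \<longrightarrow> (idg (tb A) xs ys, {(False, A, ys)}) \<in> orth (tb A) xs (tests A xs))"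

lemma okset_tests: "A \<in> types (atoms \<Sigma>) \<Longrightarrow> okn (tb A) xs \<Longrightarrow> okset (map Not (tb A)) xs (tests A xs)"
  using okset_TT[of "fmt A" xs] fm_boundary_fmt[of A] by (simp del: LG_simps)

text \<open>A test of \<open>A\<close> becomes a term when it meets a fresh variable of type
  \<open>A\<close>. Putting the given term in place of that variable, by abstraction and
  application, shows that the term passes the test too.\<close>

lemma pole_orth:
  assumes A: "A \<in> types (atoms \<Sigma>)" and neg: "negR A" and xs: "okn (tb A) xs" and p: "pole N A xs E" and odd: "\<forall>v\<in>nv N. odd v"
  shows "(E, Pair False ` N) \<in> orth (tb A) xs (tests A xs)"
proof (rule orthI)
  let ?X = "tb A"
  note ok = pole_ok[OF p]
  show "okel ?X xs E (Pair False ` N)" using ok odd by (simp add: okel_def)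
  fix F n assume F: "(F, n) \<in> tests A xs" and "mv (Pair False ` N) \<inter> mv n = {}"
  then have d: "nv N \<inter> mv n = {}" by simp
  have okF: "okel (map Not ?X) xs F n" using okset_tests[OF A xs] F by (simp add: okset_def)
  have fin: "finite (mv n \<union> nv N)" using okF ok by (simp add: okel_def)
  obtain ys where ys: "length ys = length ?X" "distinct ys" "set ys \<inter> (mv n \<union> nv N) = {}" "\<forall>y\<in>set ys. odd y"
    by (rule fresh_odd[OF fin])
  have oys: "oddn ?X ys" using ys by (simp add: oddn_def)
  have xy: "set xs \<inter> set ys = {}" "set ys \<inter> set xs = {}" using okn_oddn_disjoint[OF xs oys] by auto
  have lx: "length xs = length ?X" "distinct xs" using xs by (auto simp: okn_def)
  have yn: "set ys \<inter> mv n = {}" "set ys \<inter> nv N = {}" using ys(3) by auto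
  let ?I = "idg ?X xs ys :: (nat, 't) edge set"
  have "(?I, {(False, A, ys)}) \<in> orth ?X xs (tests A xs)" using neg xs oys by (simp add: negR_def)
  \<comment> \<open>The test yields a term of some type \<open>B\<close> in which the fresh
    variable, with vertices \<open>ys\<close>, is free.\<close>
  from orthD[OF this F] have "PP (hide (set xs) (?I \<union> F)) (insert (False, A, ys) n)" using yn by simp
  then obtain N0 B zs where N0: "insert (False, A, ys) n = insert (True, B, zs) (Pair False ` N0)" and p0: "pole N0 B zs (hide (set xs) (?I \<union> F))"
    by (auto simp: PP_def)
  have nin: "(False, A, ys) \<notin> n" by (rule mv_not_mem[OF yn(1) tb_nonempty[OF ys(1)]])
  let ?N = "N0 - {(A, ys)}"
  note split = Pair_image_remove[OF N0 nin]
  have mvn: "mv n = set zs \<union> nv ?N" by (subst split(2)) simp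
  let ?G = "hide (set xs) (?I \<union> F)" and ?E = "relabel (swap_lists xs ys) E"
  \<comment> \<open>The abstraction applied to the given term is a beta-redex, but its graph is
    already that of the contractum: the two copies of the interface cancel when hidden.\<close>
  have "pole ?N (A -\<circ> B) (zs @ rev ys) ?G"
    by (rule pole_abs) (use p0 split(1) in auto)
  moreover have pE: "pole N A ys ?E" by (rule pole_rename[OF p]) (use ys xy yn lx in auto)
  moreover have "(nv ?N \<union> set zs) \<inter> nv N = {}" using d mvn by auto
  ultimately have pB: "pole (?N \<union> N) B zs (hide (set ys) (?G \<union> ?E))" by (rule pole_app)
  have xE: "set xs \<inter> verts ?E = {}"
  proof (rule verts_disjoint_aux[OF pole_ok(5)[OF pE] xy(1)])
    show "set xs \<inter> nv N = {}" using ok(4) .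
  qed
  have yF: "set ys \<inter> verts F = {}"
    by (rule verts_disjoint_aux[of _ "set xs" "mv n", OF _ xy(2) yn(1)]) (use okF in \<open>simp add: okel_def\<close>)
  have hE: "hide (set ys) (?E \<union> ?I) = E"
  proof -
    have "hide (set ys) (?E \<union> ?I) = relabel (swap_lists ys xs) ?E"
    proof (rule hide_idg_swap)
      show "set xs \<inter> (set ys \<union> verts ?E) = {}" using xE xy by (simp add: Int_Un_distrib)
      show "pol ?X ys ?E" by (rule pole_ok(7)[OF pE])
    qed (use ys lx in auto)
    also have "\<dots> = E"
    proof -
      have "distinct (xs @ ys)" "length xs = length ys" using lx ys xy by auto
      then show ?thesis using swap_lists_commute[of xs ys] relabel_swap_swap[of xs ys E] by simp
    qed
    finally show ?thesis .
  qed
  have "hide (set ys) (?G \<union> ?E) = hide (set ys \<union> set xs) ((?I \<union> F) \<union> ?E)" by (rule hide_Un_nested[OF xE])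
  also have "\<dots> = hide (set xs) (hide (set ys) (?E \<union> ?I) \<union> F)"
    unfolding hide_Un_nested[OF yF] by (simp add: Un_ac)
  also have "\<dots> = hide (set xs) (E \<union> F)" by (simp add: hE)
  finally have "pole (?N \<union> N) B zs (hide (set xs) (E \<union> F))" using pB by simp
  moreover have "Pair False ` N \<union> n = insert (True, B, zs) (Pair False ` (?N \<union> N))"
    by (subst split(2)) (auto simp: image_Un)
  ultimately show "PP (hide (set xs) (E \<union> F)) (Pair False ` N \<union> n)" unfolding PP_def by blast
qed

text \<open>The link to a fresh result is a test by \<open>posT\<close>. Its outcome is a term graph
  with result vertices \<open>zs\<close>, which is renamed back to \<open>xs\<close>.\<close>

lemma orth_pole:
  assumes A: "A \<in> types (atoms \<Sigma>)" and pos: "posT A" and xs: "okn (tb A) xs" and e: "(E, m) \<in> orth (tb A) xs (tests A xs)"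
  shows "\<exists>N. m = Pair False ` N \<and> pole N A xs E"
proof -
  let ?X = "tb A"
  note ok = orth_okel[OF e]
  have fin: "finite (mv m)" using ok by (simp add: okel_def)
  obtain zs where zs: "length zs = length ?X" "distinct zs" "set zs \<inter> mv m = {}" "\<forall>z\<in>set zs. odd z"
    by (rule fresh_odd[OF fin])
  have ozs: "oddn ?X zs" using zs by (simp add: oddn_def)
  have xz: "set xs \<inter> set zs = {}" "set zs \<inter> set xs = {}" using okn_oddn_disjoint[OF xs ozs] by auto
  have lx: "length xs = length ?X" "distinct xs" using xs by (auto simp: okn_def)
  have "(idg ?X zs xs, {(True, A, zs)}) \<in> tests A xs" using pos xs ozs by (simp add: posT_def)
  from orthD[OF e this] have "PP (hide (set xs) (E \<union> idg ?X zs xs)) (insert (True, A, zs) m)"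
    using zs(3) by (simp add: Int_commute)
  moreover have "(True, A, zs) \<notin> m" by (rule mv_not_mem[OF zs(3) tb_nonempty[OF zs(1)]])
  ultimately obtain N where N: "m = Pair False ` N" "pole N A zs (hide (set xs) (E \<union> idg ?X zs xs))"
    using PP_split by blast
  have "set zs \<inter> verts E = {}"
    by (rule verts_disjoint_aux[of _ "set xs" "mv m", OF _ xz(2) zs(3)]) (use ok in \<open>simp add: okel_def\<close>)
  then have "hide (set xs) (E \<union> idg ?X zs xs) = relabel (swap_lists xs zs) E"
    using lx zs(1,2) xz ok by (intro hide_idg_swap) (auto simp: okel_def)
  then have p: "pole N A zs (relabel (swap_lists xs zs) E)" using N(2) by simp
  have dd: "distinct (xs @ zs)" "length xs = length zs" using lx zs xz by auto
  have "set xs \<inter> nv N = {}" using even_odd_disjoint[of xs m] xs ok N(1) by (simp add: okn_def okel_def)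
  then have "pole N A xs (relabel (swap_lists zs xs) (relabel (swap_lists xs zs) E))"
    using lx zs(1) xz by (intro pole_rename[OF p]) auto
  then have "pole N A xs E" unfolding swap_lists_commute[OF dd] relabel_swap_swap[OF dd] .
  then show ?thesis using N(1) by blast
qed

text \<open>Up to closure, a counterproof of an implication is a realizer of the argument together
  with a counterproof of the result: an argument and a use of the value.\<close>

lemma tests_Limp:
  assumes A: "A \<in> types (atoms \<Sigma>)" and B: "B \<in> types (atoms \<Sigma>)"
    and bs: "okn (tb B) bs" and as: "okn (tb A) as" and d: "set bs \<inter> set as = {}"
  shows "tests (A -\<circ> B) (bs @ rev as) = orth (map Not (tb (A -\<circ> B))) (bs @ rev as)
      (orth (tb (A -\<circ> B)) (bs @ rev as) (pure (orth (tb A) as (tests A as)) (tests B bs)))"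
    and "okset (map Not (tb (A -\<circ> B))) (bs @ rev as) (pure (orth (tb A) as (tests A as)) (tests B bs))"
proof -
  have fA: "fb (fmt A) = tb A" "fb (fmt B) = tb B" "fb (dual (fmt A)) = bdual (tb A)"
    using A B fm_boundary_fmt by (simp_all add: fm_boundary_dual del: LG_simps)
  have l: "length bs = length (tb B)" "length as = length (tb A)" using as bs by (auto simp: okn_def)
  have dA: "TT (dual (fmt A)) (rev as) = orth (tb A) as (tests A as)"
    using TT_dual[of "fmt A" as] as unfolding fA by blast
  have tk: "take (length (tb B)) (bs @ rev as) = bs" "drop (length (tb B)) (bs @ rev as) = rev as" using l by simp_all
  show "tests (A -\<circ> B) (bs @ rev as) = orth (map Not (tb (A -\<circ> B))) (bs @ rev as)
      (orth (tb (A -\<circ> B)) (bs @ rev as) (pure (orth (tb A) as (tests A as)) (tests B bs)))"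
    unfolding fmt.simps TT.simps Let_def fA tk dA ext.simps tbd.simps ..
  have com: "pure Q1 Q2 = pure Q2 Q1" for Q1 Q2
    unfolding pure_def by (auto simp: Un_commute Int_commute; metis Un_commute Int_commute)
  have oA: "okset (map Not (bdual (tb A))) (rev as) (orth (tb A) as (tests A as))"
    using okset_TT[of "dual (fmt A)" "rev as"] as unfolding dA fA okn_rev by blast
  have "okset (map Not (tb B) @ map Not (bdual (tb A))) (bs @ rev as) (pure (tests B bs) (orth (tb A) as (tests A as)))"
    by (rule okset_pure[OF okset_tests[OF B bs] oA]) (use as bs d in \<open>auto simp: okn_def\<close>)
  then show "okset (map Not (tb (A -\<circ> B))) (bs @ rev as) (pure (orth (tb A) as (tests A as)) (tests B bs))"
    unfolding com[of "orth (tb A) as (tests A as)"] by simp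
qed

lemma okn_LimpE:
  assumes "okn (tb (A -\<circ> B)) xs"
  obtains bs as where "xs = bs @ rev as" "okn (tb B) bs" "okn (tb A) as" "set bs \<inter> set as = {}"
proof -
  obtain bs as' where "xs = bs @ as'" "okn (tb B) bs" "okn (bdual (tb A)) as'" "set bs \<inter> set as' = {}"
    using okn_appendE[OF assms[unfolded ext.simps tbd.simps]] by metis
  then show ?thesis using that[of bs "rev as'"] okn_rev[of "tb A" "rev as'"] by simp
qed

lemma oddn_LimpE:
  assumes "oddn (tb (A -\<circ> B)) xs"
  obtains zs ys where "xs = zs @ rev ys" "oddn (tb B) zs" "oddn (tb A) ys" "set zs \<inter> set ys = {}"
proof (rule that)
  let ?n = "length (tb B)"
  show "xs = take ?n xs @ rev (rev (drop ?n xs))" by simp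
  show "oddn (tb B) (take ?n xs)" "oddn (tb A) (rev (drop ?n xs))"
    using assms by (auto simp: oddn_def dest: in_set_takeD in_set_dropD)
  show "set (take ?n xs) \<inter> set (rev (drop ?n xs)) = {}"
    using assms by (simp add: oddn_def set_take_disj_set_drop_if_distinct)
qed

lemma okel_idg:
  assumes "okn X xs" "oddn X zs"
  shows "okel (map Not X) xs (idg X zs xs) {(True, A, zs)}" "okel X xs (idg X xs zs) {(False, A, zs)}"
proof -
  have d: "set xs \<inter> set zs = {}" "set zs \<inter> set xs = {}" using okn_oddn_disjoint[OF assms] by auto
  have l: "length xs = length X" "length zs = length X" "distinct xs" "distinct zs" using assms by (auto simp: okn_def oddn_def)
  show "okel (map Not X) xs (idg X zs xs) {(True, A, zs)}" "okel X xs (idg X xs zs) {(False, A, zs)}"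
    unfolding okel_def using pol_idg(2)[OF l(2,1,4,3) d(2)] pol_idg(1)[OF l d(1)] assms(2) l by (auto simp: oddn_def)
qed

text \<open>Each claim for an implication needs both for its parts. The link to a result is an
  abstraction: it uses a variable of type \<open>A\<close> by \<open>negR A\<close> and a result of
  type \<open>B\<close> by \<open>posT B\<close>. The link from a variable is an application: by
  \<open>posT A\<close> the realizer of the argument is a term, and by \<open>negR B\<close> the
  application realizes \<open>B\<close>.\<close>

lemma posT_negR: "A \<in> types (atoms \<Sigma>) \<Longrightarrow> posT A \<and> negR A"
proof (induction A)
  case (Atom p)
  then have p: "p \<in> atoms \<Sigma>" by (simp add: types_def)
  let ?X = "tb (Atom p)"
  have pos: "posel (e p) xs = {(idg ?X zs xs, {(True, Atom p, zs)}) | zs. length zs = length xs \<and> distinct zs \<and> (\<forall>z\<in>set zs. odd z)}" for xs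
    unfolding posel_def dec_e[OF p] ..
  have T: "tests (Atom p) xs = orth (map Not ?X) xs (orth ?X xs (posel (e p) xs))" for xs
    by (simp add: TP_def dec_e[OF p])
  have okp: "okset (map Not ?X) xs (posel (e p) xs)" if "okn ?X xs" for xs
    using okset_posel[of "e p" xs] that unfolding dec_e[OF p] by blast
  show ?case
  proof
    show "posT (Atom p)" unfolding posT_def
    proof (intro allI impI)
      fix xs zs assume xs: "okn ?X xs" and zs: "oddn ?X zs"
      then have "(idg ?X zs xs, {(True, Atom p, zs)}) \<in> posel (e p) xs" unfolding pos by (auto simp: okn_def oddn_def)
      then show "(idg ?X zs xs, {(True, Atom p, zs)}) \<in> tests (Atom p) xs" unfolding T
        using orth_orth[OF okp[OF xs], of ?X] by blast
    qed
    show "negR (Atom p)" unfolding negR_def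
    proof (intro allI impI)
      fix xs ys assume xs: "okn ?X xs" and ys: "oddn ?X ys"
      \<comment> \<open>Basic tests suffice, as their closure has the same orthogonal. The two links
        glue to a single one, the graph of a variable.\<close>
      have "(idg ?X xs ys, {(False, Atom p, ys)}) \<in> orth ?X xs (posel (e p) xs)"
      proof (rule orthI)
        show "okel ?X xs (idg ?X xs ys) {(False, Atom p, ys)}" by (rule okel_idg(2)[OF xs ys])
        fix F n assume "(F, n) \<in> posel (e p) xs" and d: "mv {(False, Atom p, ys)} \<inter> mv n = {}"
        then obtain zs where zs: "F = idg ?X zs xs" "n = {(True, Atom p, zs)}" "length zs = length xs" "distinct zs" "\<forall>z\<in>set zs. odd z"
          unfolding pos by blast
        have oz: "oddn ?X zs" using zs xs by (simp add: oddn_def okn_def)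
        have dis: "set xs \<inter> set zs = {}" "set zs \<inter> set xs = {}" "set xs \<inter> set ys = {}" "set ys \<inter> set xs = {}"
          using okn_oddn_disjoint[OF xs oz] okn_oddn_disjoint[OF xs ys] by auto
        have yz: "set ys \<inter> set zs = {}" "set zs \<inter> set ys = {}" using d zs(2) by auto
        have l: "length xs = length ?X" "length ys = length ?X" "length zs = length ?X" "distinct xs" "distinct ys"
          using xs ys zs by (auto simp: okn_def oddn_def)
        let ?f = "swap_lists xs zs"
        have d2: "distinct (xs @ zs)" "length xs = length zs" using l zs dis by auto
        have "hide (set xs) (idg ?X xs ys \<union> idg ?X zs xs) = relabel ?f (idg ?X xs ys)"
          by (rule hide_idg_swap) (use l zs dis yz pol_idg(1)[OF l(1,2,4,5) dis(3)] in \<open>auto simp: verts_idg[OF l(1,2)] simp del: tbd.simps ext.simps\<close>)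
        also have "\<dots> = idg ?X zs ys"
        proof -
          have "map ?f ys = ys" using dis yz by (intro map_idI swap_lists_other[OF d2(2)]) auto
          then show ?thesis using relabel_idg[OF l(1,2), of ?f] swap_lists_map(1)[OF d2] by simp
        qed
        finally have h: "hide (set xs) (idg ?X xs ys \<union> F) = idg ?X zs ys" unfolding zs(1) .
        have "pole {(Atom p, ys)} (Atom p) zs (idg ?X zs ys)"
          by (rule pole_var[OF Atom l(2,3)]) (use zs l yz in auto)
        then show "PP (hide (set xs) (idg ?X xs ys \<union> F)) ({(False, Atom p, ys)} \<union> n)"
          unfolding h PP_def zs(2) by (intro exI[of _ "{(Atom p, ys)}"] exI[of _ "Atom p"] exI[of _ zs]) auto
      qed
      then show "(idg ?X xs ys, {(False, Atom p, ys)}) \<in> orth ?X xs (tests (Atom p) xs)"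
        unfolding T orth3[OF okp[OF xs]] .
    qed
  qed
next
  case (Limp A B)
  then have A: "A \<in> types (atoms \<Sigma>)" and B: "B \<in> types (atoms \<Sigma>)" and AB: "A -\<circ> B \<in> types (atoms \<Sigma>)"
    by (simp_all add: types_Limp)
  then have IH: "posT A" "negR A" "posT B" "negR B" using Limp.IH by auto
  let ?X = "tb (A -\<circ> B)"
  show ?case
  proof
    show "posT (A -\<circ> B)" unfolding posT_def
    proof (intro allI impI)
      fix xs zs0 assume xs: "okn ?X xs" and zs0: "oddn ?X zs0"
      obtain bs as where ab: "xs = bs @ rev as" "okn (tb B) bs" "okn (tb A) as" "set bs \<inter> set as = {}" by (rule okn_LimpE[OF xs])
      obtain zs ys where zy: "zs0 = zs @ rev ys" "oddn (tb B) zs" "oddn (tb A) ys" "set zs \<inter> set ys = {}" by (rule oddn_LimpE[OF zs0])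
      have l: "length bs = length (tb B)" "length as = length (tb A)" "length zs = length (tb B)" "length ys = length (tb A)"
        using ab zy by (auto simp: okn_def oddn_def)
      \<comment> \<open>The link of an implication is the union of the links of its parts, with the
        roles of the ends exchanged at the argument.\<close>
      have I: "idg ?X zs0 xs = (idg (tb A) as ys \<union> idg (tb B) zs bs :: (nat, 't) edge set)"
        unfolding ab(1) zy(1) ext.simps tbd.simps idg_append[OF l(3,1)] idg_rev[OF l(4,2)] by (simp add: Un_commute)
      show "(idg ?X zs0 xs, {(True, A -\<circ> B, zs0)}) \<in> tests (A -\<circ> B) xs"
        unfolding ab(1) tests_Limp(1)[OF A B ab(2-4)]
      proof (rule orthI)
        show "okel (map Not ?X) (bs @ rev as) (idg ?X zs0 (bs @ rev as)) {(True, A -\<circ> B, zs0)}"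
          using okel_idg(1)[OF xs zs0] unfolding ab(1) .
        fix E m assume e: "(E, m) \<in> orth ?X (bs @ rev as) (pure (orth (tb A) as (tests A as)) (tests B bs))"
          and d: "mv {(True, A -\<circ> B, zs0)} \<inter> mv m = {}"
        have dm: "set zs \<inter> mv m = {}" "set ys \<inter> mv m = {}" using d zy(1) by auto
        have "(idg (tb A) as ys \<union> idg (tb B) zs bs, {(False, A, ys)} \<union> {(True, B, zs)}) \<in> pure (orth (tb A) as (tests A as)) (tests B bs)"
        proof (rule pureI)
          show "(idg (tb A) as ys, {(False, A, ys)}) \<in> orth (tb A) as (tests A as)" using IH(2) ab(3) zy(3) by (simp add: negR_def)
          show "(idg (tb B) zs bs, {(True, B, zs)}) \<in> tests B bs" using IH(3) ab(2) zy(2) by (simp add: posT_def)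
          show "mv {(False, A, ys)} \<inter> mv {(True, B, zs)} = {}" using zy(4) by auto
        qed
        moreover have "mv m \<inter> mv ({(False, A, ys)} \<union> {(True, B, zs)}) = {}" using dm by auto
        ultimately have "PP (hide (set (bs @ rev as)) (E \<union> (idg (tb A) as ys \<union> idg (tb B) zs bs))) (m \<union> ({(False, A, ys)} \<union> {(True, B, zs)}))"
          by (rule orthD[OF e])
        then have "PP (hide (set xs) (E \<union> idg ?X zs0 xs)) (m \<union> ({(False, A, ys)} \<union> {(True, B, zs)}))"
          unfolding I ab(1)[symmetric] .
        then have P: "PP (hide (set xs) (E \<union> idg ?X zs0 xs)) (insert (True, B, zs) (insert (False, A, ys) m))"
          by (simp add: insert_commute)
        have nB: "(True, B, zs) \<notin> insert (False, A, ys) m" using mv_not_mem[OF dm(1) tb_nonempty[OF l(3)]] by simp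
        obtain N where N: "insert (False, A, ys) m = Pair False ` N" "pole N B zs (hide (set xs) (E \<union> idg ?X zs0 xs))"
          using PP_split[OF P nB] by blast
        have nA: "(False, A, ys) \<notin> m" by (rule mv_not_mem[OF dm(2) tb_nonempty[OF l(4)]])
        have "(A, ys) \<in> N"
        proof -
          have "(False, A, ys) \<in> Pair False ` N" unfolding N(1)[symmetric] by simp
          then show ?thesis by auto
        qed
        then have NN: "N = insert (A, ys) (N - {(A, ys)})" by blast
        have "insert (False, A, ys) m = insert (False, A, ys) (Pair False ` (N - {(A, ys)}))"
          unfolding N(1) by (rule trans[OF arg_cong[OF NN, of "image (Pair False)"] image_insert])
        then have m: "m = Pair False ` (N - {(A, ys)})" using nA by (subst (asm) insert_ident) auto
        have "pole (N - {(A, ys)}) (A -\<circ> B) (zs @ rev ys) (hide (set xs) (E \<union> idg ?X zs0 xs))"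
          by (rule pole_abs) (use N(2) NN in auto)
        then show "PP (hide (set (bs @ rev as)) (idg ?X zs0 (bs @ rev as) \<union> E)) ({(True, A -\<circ> B, zs0)} \<union> m)"
          unfolding PP_def zy(1)[symmetric] ab(1)[symmetric] m by (auto simp: Un_commute)
      qed
    qed
    show "negR (A -\<circ> B)" unfolding negR_def
    proof (intro allI impI)
      fix xs zs0 assume xs: "okn ?X xs" and zs0: "oddn ?X zs0"
      obtain bs as where ab: "xs = bs @ rev as" "okn (tb B) bs" "okn (tb A) as" "set bs \<inter> set as = {}" by (rule okn_LimpE[OF xs])
      have l0: "length xs = length ?X" "length zs0 = length ?X" "distinct xs" "distinct zs0" using xs zs0 by (auto simp: okn_def oddn_def)
      have x0: "set xs \<inter> set zs0 = {}" using okn_oddn_disjoint[OF xs zs0] by blast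
      show "(idg ?X xs zs0, {(False, A -\<circ> B, zs0)}) \<in> orth ?X xs (tests (A -\<circ> B) xs)"
        unfolding ab(1) tests_Limp(1)[OF A B ab(2-4)] orth3[OF tests_Limp(2)[OF A B ab(2-4)]]
      proof (rule orthI)
        show "okel ?X (bs @ rev as) (idg ?X (bs @ rev as) zs0) {(False, A -\<circ> B, zs0)}"
          using okel_idg(2)[OF xs zs0] unfolding ab(1) .
        fix F n assume "(F, n) \<in> pure (orth (tb A) as (tests A as)) (tests B bs)" and d: "mv {(False, A -\<circ> B, zs0)} \<inter> mv n = {}"
        then obtain F1 n1 F2 n2 where q: "F = F1 \<union> F2" "n = n1 \<union> n2" "(F1, n1) \<in> orth (tb A) as (tests A as)" "(F2, n2) \<in> tests B bs" "mv n1 \<inter> mv n2 = {}"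
          by (elim pureE)
        \<comment> \<open>Being a term, the realizer of the argument can be supplied to the variable
          of type \<open>A -\<circ> B\<close>.\<close>
        obtain N1 where N1: "n1 = Pair False ` N1" "pole N1 A as F1" using orth_pole[OF A IH(1) ab(3) q(3)] by blast
        have d1: "set zs0 \<inter> nv N1 = {}" "set zs0 \<inter> mv n2 = {}" "nv N1 \<inter> mv n2 = {}"
          using d q(2,5) N1(1) by (simp_all add: Int_Un_distrib)
        have odd1: "\<forall>v\<in>nv N1. odd v" using orth_okel[OF q(3)] N1(1) by (simp add: okel_def)
        let ?I = "idg ?X xs zs0 :: (nat, 't) edge set"
        have pv: "pole {(A -\<circ> B, zs0)} (A -\<circ> B) (bs @ rev as) ?I"
        proof -
          have "distinct (xs @ zs0)" using l0(3,4) x0 by simp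
          from pole_var[OF AB l0(2,1) this] show ?thesis unfolding ab(1) .
        qed
        have "set bs \<inter> nv N1 = {}" using odd1 ab(2) by (auto simp: okn_def)
        then have pB: "pole ({(A -\<circ> B, zs0)} \<union> N1) B bs (hide (set as) (?I \<union> F1))"
          using d1 by (intro pole_app[OF pv N1(2)]) (simp add: Int_Un_distrib2)
        have "\<forall>v\<in>nv ({(A -\<circ> B, zs0)} \<union> N1). odd v" using odd1 zs0 by (auto simp: oddn_def)
        from pole_orth[OF B IH(4) ab(2) pB this] have o: "(hide (set as) (?I \<union> F1), Pair False ` ({(A -\<circ> B, zs0)} \<union> N1)) \<in> orth (tb B) bs (tests B bs)" .
        have "mv (Pair False ` ({(A -\<circ> B, zs0)} \<union> N1)) \<inter> mv n2 = {}" using d1 by (simp add: Int_Un_distrib2)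
        from orthD[OF o q(4) this] have P: "PP (hide (set bs) (hide (set as) (?I \<union> F1) \<union> F2)) (Pair False ` ({(A -\<circ> B, zs0)} \<union> N1) \<union> n2)" .
        have ok2: "okel (map Not (tb B)) bs F2 n2" using okset_tests[OF B ab(2)] q(4) by (simp add: okset_def)
        have "set as \<inter> mv n2 = {}" using even_odd_disjoint[of as n2] ab(3) ok2 by (simp add: okn_def okel_def)
        moreover have "set as \<inter> set bs = {}" using ab(4) by (simp add: Int_commute)
        moreover have "verts F2 \<subseteq> set bs \<union> mv n2" using ok2 by (simp add: okel_def)
        ultimately have aF: "set as \<inter> verts F2 = {}" using verts_disjoint_aux by metis
        have "hide (set bs) (hide (set as) (?I \<union> F1) \<union> F2) = hide (set (bs @ rev as)) (?I \<union> F)"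
          unfolding hide_Un_nested[OF aF] q(1) by (simp add: Un_assoc)
        moreover have "Pair False ` ({(A -\<circ> B, zs0)} \<union> N1) \<union> n2 = {(False, A -\<circ> B, zs0)} \<union> n" unfolding q(2) N1(1) by auto
        ultimately show "PP (hide (set (bs @ rev as)) (idg ?X (bs @ rev as) zs0 \<union> F)) ({(False, A -\<circ> B, zs0)} \<union> n)"
          using P unfolding ab(1) by simp
      qed
    qed
  qed
qed

lemmas pole_realizes = pole_orth[OF _ conjunct2[OF posT_negR]]
lemmas realizer_pole = orth_pole[OF _ conjunct1[OF posT_negR]]

end

context gram
begin

section \<open>Soundness of derivations in the phase model\<close>

lemma pure_commute: "pure Q1 Q2 = pure Q2 Q1"
  unfolding pure_def by (auto simp: Un_commute Int_commute; metis Un_commute Int_commute)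

lemma pure_assoc: "pure (pure Q1 Q2) Q3 = pure Q1 (pure Q2 Q3)"
proof (intro equalityI subsetI)
  fix x assume "x \<in> pure (pure Q1 Q2) Q3"
  then obtain E1 m1 E2 m2 E3 m3 where q: "x = ((E1 \<union> E2) \<union> E3, (m1 \<union> m2) \<union> m3)" "(E1, m1) \<in> Q1" "(E2, m2) \<in> Q2" "(E3, m3) \<in> Q3"
    "mv m1 \<inter> mv m2 = {}" "mv (m1 \<union> m2) \<inter> mv m3 = {}"
    unfolding pure_def by blast
  have d: "mv m2 \<inter> mv m3 = {}" "mv m1 \<inter> mv (m2 \<union> m3) = {}" using q(5,6) by auto
  have "(E1 \<union> (E2 \<union> E3), m1 \<union> (m2 \<union> m3)) \<in> pure Q1 (pure Q2 Q3)" by (rule pureI[OF q(2) pureI[OF q(3,4) d(1)] d(2)])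
  then show "x \<in> pure Q1 (pure Q2 Q3)" unfolding q(1) by (simp add: Un_assoc)
next
  fix x assume "x \<in> pure Q1 (pure Q2 Q3)"
  then obtain E1 m1 E2 m2 E3 m3 where q: "x = (E1 \<union> (E2 \<union> E3), m1 \<union> (m2 \<union> m3))" "(E1, m1) \<in> Q1" "(E2, m2) \<in> Q2" "(E3, m3) \<in> Q3"
    "mv m2 \<inter> mv m3 = {}" "mv m1 \<inter> mv (m2 \<union> m3) = {}"
    unfolding pure_def by blast
  have d: "mv m1 \<inter> mv m2 = {}" "mv (m1 \<union> m2) \<inter> mv m3 = {}" using q(5,6) by auto
  have "((E1 \<union> E2) \<union> E3, (m1 \<union> m2) \<union> m3) \<in> pure (pure Q1 Q2) Q3" by (rule pureI[OF pureI[OF q(2,3) d(1)] q(4) d(2)])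
  then show "x \<in> pure (pure Q1 Q2) Q3" unfolding q(1) by (simp add: Un_assoc)
qed

lemma pure_unit [simp]: "pure {({}, {})} Q = Q" "pure Q {({}, {})} = Q"
  unfolding pure_def by auto

primrec Tseq :: "(nat fm \<times> nat list) list \<Rightarrow> ('n, 't) elem set" where
  "Tseq [] = {({}, {})}"
| "Tseq (x # D) = pure (TT (fst x) (snd x)) (Tseq D)"

lemma Tseq_append: "Tseq (D @ D') = pure (Tseq D) (Tseq D')"
  by (induction D) (auto simp: pure_assoc)

definition evD :: "(nat fm \<times> nat list) list \<Rightarrow> bool" where
  "evD D \<longleftrightarrow> okD D \<and> (\<forall>x\<in>set (vsD D). even x)"

lemma evD_okn: "evD D \<Longrightarrow> (A, xs) \<in> set D \<Longrightarrow> okn (fb A) xs"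
proof -
  assume ev: "evD D" and A: "(A, xs) \<in> set D"
  then obtain D1 D2 where "D = D1 @ (A, xs) # D2" using split_list by metis
  then show ?thesis using ev by (auto simp: evD_def okD_def okn_def)
qed

lemma evD_append: "evD (D @ D') \<longleftrightarrow> evD D \<and> evD D' \<and> set (vsD D) \<inter> set (vsD D') = {}"
  by (auto simp: evD_def okD_def)

lemma evD_single: "evD [(A, xs)] \<longleftrightarrow> okn (fb A) xs"
  by (auto simp: evD_def okD_def okn_def)

lemma Tseq_ok: "evD D \<Longrightarrow> (F, n) \<in> Tseq D \<Longrightarrow> verts F \<subseteq> set (vsD D) \<union> mv n \<and> finite (mv n) \<and> (\<forall>v\<in>mv n. odd v)"
proof (induction D arbitrary: F n)
  case (Cons x D)
  obtain A xs where x: "x = (A, xs)" by (cases x)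
  obtain E m F' n' where q: "F = E \<union> F'" "n = m \<union> n'" "(E, m) \<in> TT A xs" "(F', n') \<in> Tseq D"
    using Cons.prems(2) unfolding x by (auto elim: pureE)
  have "okn (fb A) xs" using evD_okn[OF Cons.prems(1), of A xs] x by simp
  then have "okel (map Not (fb A)) xs E m" using okset_TT[of A xs] q(3) by (simp add: okset_def)
  moreover have "evD D" using Cons.prems(1) evD_append[of "[x]" D] by simp
  then have "verts F' \<subseteq> set (vsD D) \<union> mv n' \<and> finite (mv n') \<and> (\<forall>v\<in>mv n'. odd v)" using Cons.IH q(4) by blast
  ultimately show ?case unfolding q(1,2) x by (auto simp: okel_def)
qed simp

text \<open>A sequent is refuted by a tuple of counterproofs, one per formula and with disjoint
  resources. A valid graph glued to any such tuple gives the graph of a term that uses exactly the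
  resources of the tuple.\<close>

definition valid :: "(nat fm \<times> nat list) list \<Rightarrow> (nat, 't) edge set \<Rightarrow> bool" where
  "valid D E \<longleftrightarrow> (\<forall>F n. (F, n) \<in> Tseq D \<longrightarrow> PP (hide (set (vsD D)) (E \<union> F)) n)"

lemma valid_cong: "Tseq D = Tseq D' \<Longrightarrow> set (vsD D) = set (vsD D') \<Longrightarrow> valid D E \<longleftrightarrow> valid D' E"
  by (simp add: valid_def)

text \<open>Gluing counterproofs of all formulas but the last turns a valid graph into a proof of
  the last one: half of the adjunction between juxtaposition and orthogonality.\<close>

lemma valid_realizes:
  assumes ev: "evD (D @ [(A, as)])" and v: "valid (D @ [(A, as)]) E" and pE: "pol (fb A) as E"
    and vE: "verts E \<subseteq> set as \<union> set (vsD D)" and F: "(F, n) \<in> Tseq D"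
  shows "(hide (set (vsD D)) (E \<union> F), n) \<in> orth (fb A) as (TT A as)"
proof (rule orthI)
  have evD: "evD D" "okn (fb A) as" and d: "set (vsD D) \<inter> set as = {}" "set as \<inter> set (vsD D) = {}"
    using ev by (auto simp: evD_append evD_single)
  note okF = Tseq_ok[OF evD(1) F]
  have "set as \<inter> mv n = {}" using okF evD(2) by (intro even_odd_disjoint) (auto simp: okn_def)
  then have "pol (fb A) as F" by (rule pol_disjoint[OF verts_disjoint_aux[OF conjunct1[OF okF] d(2)]])
  then have "pol (fb A) as (hide (set (vsD D)) (E \<union> F))" using pE by (intro pol_hide) simp
  moreover have "verts (hide (set (vsD D)) (E \<union> F)) \<subseteq> set as \<union> mv n"
  proof -
    have "verts (hide (set (vsD D)) (E \<union> F)) \<subseteq> (verts E \<union> verts F) - set (vsD D)" using verts_hide[of "set (vsD D)" "E \<union> F"] by simp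
    then show ?thesis using vE conjunct1[OF okF] by blast
  qed
  ultimately show "okel (fb A) as (hide (set (vsD D)) (E \<union> F)) n" using okF by (simp add: okel_def)
  fix F' n' assume F': "(F', n') \<in> TT A as" and dn: "mv n \<inter> mv n' = {}"
  have okF': "okel (map Not (fb A)) as F' n'" using okset_TT[OF evD(2)] F' by (simp add: okset_def)
  have "set (vsD D) \<inter> mv n' = {}" using okF' evD(1) by (intro even_odd_disjoint) (auto simp: okel_def evD_def)
  moreover have "verts F' \<subseteq> set as \<union> mv n'" using okF' by (simp add: okel_def)
  ultimately have vF': "set (vsD D) \<inter> verts F' = {}" using verts_disjoint_aux d(1) by metis
  have "(F \<union> F', n \<union> n') \<in> Tseq (D @ [(A, as)])"
    unfolding Tseq_append using pureI[OF F _ dn, of F' "TT A as"] F' by simp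
  then have "PP (hide (set (vsD (D @ [(A, as)]))) (E \<union> (F \<union> F'))) (n \<union> n')" using v by (simp add: valid_def)
  moreover have "hide (set as) (hide (set (vsD D)) (E \<union> F) \<union> F') = hide (set (vsD (D @ [(A, as)]))) (E \<union> (F \<union> F'))"
    unfolding hide_Un_nested[OF vF'] by (simp add: Un_ac)
  ultimately show "PP (hide (set as) (hide (set (vsD D)) (E \<union> F) \<union> F')) (n \<union> n')" by simp
qed

lemma placed_pol:
  assumes "derivable LG \<sigma> (map fst D)" "okD D"
  shows "pol (sb (map fst D)) (vsD D) (place (vsD D) (edges \<sigma>))" "verts (place (vsD D) (edges \<sigma>)) \<subseteq> set (vsD D)"
proof -
  have l: "length (vsD D) = length (sb (map fst D))" by (rule length_vsD[OF assms(2)])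
  have d: "Lset (sb (map fst D)) (vsD D) \<inter> Rset (sb (map fst D)) (vsD D) = {}"
    using assms(2) by (intro LR_disjoint) (simp add: okD_def)
  then have d': "Rset (sb (map fst D)) (vsD D) \<inter> Lset (sb (map fst D)) (vsD D) = {}" by blast
  note g = gwf_place[OF derivable_gwf[OF assms(1)] l]
  show "pol (sb (map fst D)) (vsD D) (place (vsD D) (edges \<sigma>))" unfolding pol_def
  proof
    show "Lset (sb (map fst D)) (vsD D) \<inter> target ` place (vsD D) (edges \<sigma>) = {}"
      by (rule disj_aux[OF subset_refl g(2) d])
    show "Rset (sb (map fst D)) (vsD D) \<inter> source ` place (vsD D) (edges \<sigma>) = {}"
      by (rule disj_aux[OF subset_refl g(1) d'])
  qed
  show "verts (place (vsD D) (edges \<sigma>)) \<subseteq> set (vsD D)"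
    using verts_place[of "edges \<sigma>" "vsD D"] derivable_verts[OF assms(1)] l by simp
qed

text \<open>Cut is interpreted as gluing instead of being eliminated, so lexicon entries are merely
  further valid sequents. In the rules that combine graphs, both sides are brought to one hiding
  over the union of all graphs involved.\<close>

lemma sound: "derivable LG \<sigma> \<Gamma> \<Longrightarrow> map fst D = \<Gamma> \<Longrightarrow> evD D \<Longrightarrow> valid D (place (vsD D) (edges \<sigma>))"
proof (induction arbitrary: D rule: derivable.induct)
  case (lex \<sigma> \<Gamma>)
  obtain c where c: "c \<in> constants \<Sigma>" "\<sigma> = \<lparr>edges = \<kappa> c, singular = {#}\<rparr>" "\<Gamma> = [fmt (ctype \<Sigma> c)]" using lex(1) by auto
  then obtain xs where D: "D = [(fmt (ctype \<Sigma> c), xs)]" using lex(2) by (auto simp: map_eq_Cons_conv)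
  let ?A = "ctype \<Sigma> c"
  have A: "?A \<in> types (atoms \<Sigma>)" by (rule ctype_types[OF c(1)])
  have xs: "okn (tb ?A) xs" using lex(3) unfolding D evD_single fm_boundary_fmt[OF A] .
  \<comment> \<open>A lexicon entry is the graph of the constant itself, hence of a closed
    term.\<close>
  have "pole {} ?A xs (place xs (\<kappa> c))" by (rule pole_const[OF c(1)]) (use xs in \<open>auto simp: okn_def\<close>)
  from pole_realizes[OF A A xs this] have "(place xs (\<kappa> c), {}) \<in> orth (tb ?A) xs (tests ?A xs)" by simp
  then have "PP (hide (set xs) (place xs (\<kappa> c) \<union> F)) n" if "(F, n) \<in> tests ?A xs" for F n
    using orthD[of "place xs (\<kappa> c)" "{}"] that by fastforce
  then show ?case unfolding valid_def D c(2) by simp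
next
  case (ident A)
  obtain as' zs where D: "D = [(dual A, as'), (A, zs)]" using ident(2) by (auto simp: map_eq_Cons_conv)
  define ys where "ys = rev as'"
  have as': "as' = rev ys" by (simp add: ys_def)
  let ?X = "fb A"
  have "evD ([(dual A, as')] @ [(A, zs)])" using ident(3) D by simp
  then have ok: "okn (fb (dual A)) as'" "okn ?X zs" "set as' \<inter> set zs = {}" unfolding evD_append evD_single by simp_all
  have ys: "okn ?X ys" using ok(1) unfolding as' fm_boundary_dual okn_rev .
  have d: "set zs \<inter> set ys = {}" "set ys \<inter> set zs = {}" using ok(3) as' by auto
  have l: "length zs = length ?X" "length ys = length ?X" "distinct zs" "distinct ys" using ok(2) ys by (auto simp: okn_def)
  have dd: "distinct (zs @ ys)" "length zs = length ys" using l d by auto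
  let ?f = "swap_lists zs ys"
  have fo: "fixodd ?f" unfolding fixodd_def
    by (rule fixodd_swap_even[OF dd]) (use ok(2) ys in \<open>auto simp: okn_def\<close>)
  have pl: "place (zs @ as') (edges (id_mword ?X)) = (idg ?X zs ys :: (nat, 't) edge set)" unfolding as' by (rule place_id_mword[OF l(1,2)])
  show ?case unfolding valid_def
  proof (intro allI impI)
    fix F n assume "(F, n) \<in> Tseq D"
    then obtain F1 n1 F2 n2 where q: "F = F1 \<union> F2" "n = n1 \<union> n2" "(F1, n1) \<in> TT (dual A) as'" "(F2, n2) \<in> TT A zs" "mv n1 \<inter> mv n2 = {}"
      unfolding D by (auto elim!: pureE)
    have o1: "(F1, n1) \<in> orth ?X ys (TT A ys)" using q(3) unfolding as' TT_dual[OF ys] .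
    have ok2: "okel (map Not ?X) zs F2 n2" using okset_TT[OF ok(2)] q(4) by (simp add: okset_def)
    have ok1: "okel ?X ys F1 n1" by (rule orth_okel[OF o1])
    have yF: "set ys \<inter> verts F2 = {}"
    proof (rule verts_disjoint_aux[of _ "set zs" "mv n2", OF _ d(2)])
      show "verts F2 \<subseteq> set zs \<union> mv n2" using ok2 by (simp add: okel_def)
      show "set ys \<inter> mv n2 = {}" using ok2 ys by (intro even_odd_disjoint) (auto simp: okel_def okn_def)
    qed
    have zF: "set zs \<inter> verts F1 = {}"
    proof (rule verts_disjoint_aux[of _ "set ys" "mv n1", OF _ d(1)])
      show "verts F1 \<subseteq> set ys \<union> mv n1" using ok1 by (simp add: okel_def)
      show "set zs \<inter> mv n1 = {}" using ok1 ok(2) by (intro even_odd_disjoint) (auto simp: okel_def okn_def)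
    qed
    \<comment> \<open>Gluing the link carries the counterproof of \<open>A\<close> from
      \<open>zs\<close> to \<open>ys\<close>, where it meets the proof \<open>F1\<close>.\<close>
    have "(relabel ?f F2, n2) \<in> TT A (map ?f zs)" by (rule TT_equivariant[OF fo ok(2) q(4)])
    then have "(relabel ?f F2, n2) \<in> TT A ys" by (simp only: swap_lists_map(1)[OF dd])
    from orthD[OF o1 this q(5)] have P: "PP (hide (set ys) (F1 \<union> relabel ?f F2)) (n1 \<union> n2)" .
    have "hide (set zs) (F2 \<union> idg (map Not ?X) ys zs) = relabel ?f F2"
    proof (rule hide_idg_swap)
      show "pol (map Not ?X) zs F2" using ok2 by (simp add: okel_def)
      show "set ys \<inter> (set zs \<union> verts F2) = {}" using d(2) yF by (simp add: Int_Un_distrib)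
    qed (use l in auto)
    then have h: "hide (set zs) (F2 \<union> idg ?X zs ys) = relabel ?f F2" unfolding idg_Not .
    have "hide (set ys) (F1 \<union> relabel ?f F2) = hide (set ys) (hide (set zs) (F2 \<union> idg ?X zs ys) \<union> F1)" unfolding h by (simp add: Un_commute)
    also have "\<dots> = hide (set ys \<union> set zs) ((F2 \<union> idg ?X zs ys) \<union> F1)" by (rule hide_Un_nested[OF zF])
    also have "\<dots> = hide (set (vsD D)) (place (vsD D) (edges (id_mword ?X)) \<union> F)"
    proof -
      have "set (vsD D) = set ys \<union> set zs" "vsD D = zs @ as'" unfolding D as' by auto
      then show ?thesis unfolding q(1) by (simp add: pl Un_ac del: LG_simps)
    qed
    finally show "PP (hide (set (vsD D)) (place (vsD D) (edges (id_mword ?X)) \<union> F)) n" using P unfolding q(2) by simp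
  qed
next
  case (cut \<sigma> \<Gamma> A \<tau> \<Delta>)
  obtain D1 D2 where D: "D = D1 @ D2" "map fst D1 = \<Gamma>" "map fst D2 = \<Delta>"
    using cut.prems(1) by (auto simp: map_eq_append_conv)
  have evs: "evD D1" "evD D2" "set (vsD D1) \<inter> set (vsD D2) = {}" using cut.prems(2) unfolding D(1) evD_append by auto
  have oks: "okD D1" "okD D2" using evs by (auto simp: evD_def)
  \<comment> \<open>The premises share fresh vertices for the cut formula, even ones like those of
    every interface.\<close>
  obtain as where as: "length as = length (fb A)" "distinct as" "set as \<inter> (set (vsD D1) \<union> set (vsD D2)) = {}" "\<forall>x\<in>set as. even x"
    using fresh_even[of "set (vsD D1) \<union> set (vsD D2)" "length (fb A)"] by auto
  have an: "okn (fb A) as" using as by (simp add: okn_def)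
  have da: "set as \<inter> set (vsD D1) = {}" "set as \<inter> set (vsD D2) = {}" "set (vsD D1) \<inter> set as = {}" "set (vsD D2) \<inter> set as = {}" using as(3) by auto
  have e1: "evD (D1 @ [(A, as)])" using evs(1) an da(3) by (simp add: evD_append evD_single)
  have an': "okn (fb (dual A)) (rev as)" using an by (simp add: fm_boundary_dual okn_rev)
  have e2: "evD ([(dual A, rev as)] @ D2)" unfolding evD_append evD_single using evs(2) an' da(2) by simp
  let ?E = "place (as @ vsD D1) (edges \<sigma>)" and ?F = "place (vsD D2 @ rev as) (edges \<tau>)"
  have v1: "valid (D1 @ [(A, as)]) ?E" using cut.IH(1)[OF _ e1] D(2) by simp
  have v2: "valid ((dual A, rev as) # D2) ?F" using cut.IH(2)[of "(dual A, rev as) # D2"] e2 D(3) by simp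
  have okE: "okD (D1 @ [(A, as)])" "okD ((dual A, rev as) # D2)" using e1 e2 by (auto simp: evD_def)
  have pv1: "pol (fb A @ sb \<Gamma>) (as @ vsD D1) ?E" "verts ?E \<subseteq> set as \<union> set (vsD D1)"
    using placed_pol[of \<sigma> "D1 @ [(A, as)]"] cut.hyps(1) okE(1) D(2) by (simp_all add: seq_boundary_append)
  have vF: "verts ?F \<subseteq> set as \<union> set (vsD D2)"
    using placed_pol(2)[of \<tau> "(dual A, rev as) # D2"] cut.hyps(2) okE(2) D(3) by (simp add: Un_commute)
  have pE: "pol (fb A) as ?E" using pv1(1) as(1) by (simp add: pol_append del: LG_simps)
  have sz: "verts (edges \<sigma>) \<subseteq> {1..length as + length (vsD D1)}" "verts (edges \<tau>) \<subseteq> {1..length (vsD D2) + length as}"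
    using derivable_verts[OF cut.hyps(1)] derivable_verts[OF cut.hyps(2)] as(1) length_vsD[OF oks(1)] length_vsD[OF oks(2)] D(2,3)
    by (simp_all add: seq_boundary_append del: LG_simps)
  have dis: "distinct (vsD D2 @ vsD D1 @ as)" using oks evs(3) as(2) da by (auto simp: okD_def)
  have le: "length (sb \<Delta>) = length (vsD D2)" "length (fb A) = length as" using length_vsD[OF oks(2)] D(3) as(1) by simp_all
  have pl: "place (vsD D) (edges (compose (length (sb \<Delta>)) (length (fb A)) \<tau> \<sigma>)) = hide (set as) (?E \<union> ?F)"
    unfolding le D(1) using place_compose(1)[OF sz dis] by simp
  show ?case unfolding valid_def
  proof (intro allI impI)
    fix F n assume "(F, n) \<in> Tseq D"
    then obtain F1 n1 F2 n2 where q: "F = F1 \<union> F2" "n = n1 \<union> n2" "(F1, n1) \<in> Tseq D1" "(F2, n2) \<in> Tseq D2" "mv n1 \<inter> mv n2 = {}"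
      unfolding D(1) Tseq_append by (elim pureE)
    have "(hide (set (vsD D1)) (?E \<union> F1), n1) \<in> orth (fb A) as (TT A as)" by (rule valid_realizes[OF e1 v1 pE pv1(2) q(3)])
    \<comment> \<open>A proof of \<open>A\<close> is a counterproof of its dual and so completes the
      tuple for the other premise.\<close>
    then have "(hide (set (vsD D1)) (?E \<union> F1), n1) \<in> TT (dual A) (rev as)" unfolding TT_dual[OF an] .
    from pureI[OF this q(4,5)] have "(hide (set (vsD D1)) (?E \<union> F1) \<union> F2, n) \<in> Tseq ((dual A, rev as) # D2)" unfolding q(2) by simp
    then have "PP (hide (set (vsD ((dual A, rev as) # D2))) (?F \<union> (hide (set (vsD D1)) (?E \<union> F1) \<union> F2))) n" using v2 unfolding valid_def by blast
    then have P: "PP (hide (set (vsD D2) \<union> set as) (hide (set (vsD D1)) (?E \<union> F1) \<union> (?F \<union> F2))) n" by (simp add: Un_ac)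
    note o1 = Tseq_ok[OF evs(1) q(3)] and o2 = Tseq_ok[OF evs(2) q(4)]
    have ev: "\<forall>x\<in>set (vsD D1). even x" "\<forall>x\<in>set (vsD D2). even x" using evs by (auto simp: evD_def)
    have 1: "set (vsD D1) \<inter> verts (?F \<union> F2) = {}"
    proof -
      have "set (vsD D1) \<inter> verts ?F = {}" by (rule verts_disjoint_aux[OF vF da(3) evs(3)])
      moreover have "set (vsD D1) \<inter> verts F2 = {}"
        by (rule verts_disjoint_aux[OF conjunct1[OF o2] evs(3) even_odd_disjoint[OF ev(1)]]) (use o2 in blast)
      ultimately show ?thesis by (simp add: Int_Un_distrib)
    qed
    have 2: "set as \<inter> verts (F1 \<union> F2) = {}"
    proof -
      have "set as \<inter> verts F1 = {}"
        by (rule verts_disjoint_aux[OF conjunct1[OF o1] da(1) even_odd_disjoint[OF as(4)]]) (use o1 in blast)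
      moreover have "set as \<inter> verts F2 = {}"
        by (rule verts_disjoint_aux[OF conjunct1[OF o2] da(2) even_odd_disjoint[OF as(4)]]) (use o2 in blast)
      ultimately show ?thesis by (simp add: Int_Un_distrib)
    qed
    have "hide (set (vsD D2) \<union> set as) (hide (set (vsD D1)) (?E \<union> F1) \<union> (?F \<union> F2)) =
        hide (set (vsD D)) (hide (set as) (?E \<union> ?F) \<union> F)"
      unfolding hide_Un_nested[OF 1] q(1) hide_Un_nested[OF 2] D(1) by (simp add: Un_ac)
    then show "PP (hide (set (vsD D)) (place (vsD D) (edges (compose (length (sb \<Delta>)) (length (fb A)) \<tau> \<sigma>)) \<union> F)) n"
      unfolding pl using P by simp
  qed
next
  case (exchange \<sigma> \<Gamma> A B \<Delta>)
  obtain P as bs Q where D: "D = P @ [(B, bs), (A, as)] @ Q" "map fst P = \<Gamma>" "map fst Q = \<Delta>"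
    using exchange.prems(1) by (auto simp: map_eq_append_conv map_eq_Cons_conv)
  let ?D = "P @ [(A, as), (B, bs)] @ Q"
  have ev: "evD ?D" using exchange.prems(2) unfolding D(1) by (auto simp: evD_def okD_def)
  have oks: "okD P" "okD Q" and l: "length as = length (fb A)" "length bs = length (fb B)" using ev by (auto simp: evD_def okD_def)
  have v: "valid ?D (place (vsD ?D) (edges \<sigma>))" using exchange.IH[OF _ ev] D(2,3) by simp
  have "verts (edges \<sigma>) \<subseteq> {1..length (vsD Q) + length bs + length as + length (vsD P)}"
    using derivable_verts[OF exchange.hyps] l length_vsD[OF oks(1)] length_vsD[OF oks(2)] D(2,3)
    by (simp add: seq_boundary_append ac_simps del: LG_simps)
  then have "place (vsD D) (edges (exchange_mword (length (sb \<Delta>)) (length (fb B)) (length (fb A)) \<sigma>)) = place (vsD ?D) (edges \<sigma>)"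
    using place_exchange[of \<sigma> "vsD Q" bs as "vsD P"] l length_vsD[OF oks(2)] D by (simp del: LG_simps)
  moreover have "Tseq D = Tseq ?D" unfolding D(1) Tseq_append Tseq.simps
    using pure_commute[of "TT A as" "TT B bs"] by simp
  then have "valid D E \<longleftrightarrow> valid ?D E" for E by (rule valid_cong) (auto simp: D(1))
  ultimately show ?case using v by simp
next
  case (par \<sigma> \<Gamma> A B)
  obtain D1 xs where D: "D = D1 @ [(Par A B, xs)]" "map fst D1 = \<Gamma>"
    using par.prems(1) by (auto simp: map_eq_append_conv map_eq_Cons_conv)
  have evs: "evD D1" "okn (fb B @ fb A) xs" "set (vsD D1) \<inter> set xs = {}" using par.prems(2) unfolding D(1) evD_append evD_single by auto
  obtain bs as where ab: "xs = bs @ as" "okn (fb B) bs" "okn (fb A) as" "set bs \<inter> set as = {}"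
      "bs = take (length (fb B)) xs" "as = drop (length (fb B)) xs" by (rule okn_appendE[OF evs(2)])
  let ?D = "D1 @ [(A, as), (B, bs)]" and ?X = "fb B @ fb A"
  have ev: "evD ?D" using par.prems(2) unfolding D(1) ab(1) using ab(2,3) by (auto simp: evD_def okD_def okn_def)
  have vs: "vsD ?D = vsD D" unfolding D(1) ab(1) by simp
  let ?E = "place (vsD D) (edges \<sigma>)"
  have v: "valid ?D ?E" using par.IH[OF _ ev] D(2) vs by simp
  have okE: "okD ?D" using ev by (simp add: evD_def)
  have der: "derivable LG \<sigma> (map fst ?D)" using par.hyps D(2) by simp
  have pv2: "verts ?E \<subseteq> set (vsD ?D)" using placed_pol(2)[OF der okE] unfolding vs .
  have "sb (map fst ?D) = fb B @ fb A @ sb \<Gamma>" using D(2) by (simp add: seq_boundary_append del: LG_simps)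
  then have pv1: "pol (fb B @ fb A @ sb \<Gamma>) (vsD ?D) ?E" using placed_pol(1)[OF der okE] unfolding vs by simp
  note pv = pv1 pv2
  have lx: "length xs = length ?X" using evs(2) by (simp add: okn_def)
  have "vsD ?D = xs @ vsD D1" unfolding ab(1) by simp
  then have pE: "pol ?X xs ?E" using pv(1) pol_append[of ?X xs "sb \<Gamma>" "vsD D1" ?E] lx by simp
  have T: "TT (Par A B) xs = orth (map Not ?X) xs (orth ?X xs (pure (TT A as) (TT B bs)))"
    unfolding TT.simps Let_def ab(5,6)[symmetric] ..
  show ?case unfolding valid_def
  proof (intro allI impI)
    fix F n assume "(F, n) \<in> Tseq D"
    then obtain F1 n1 F2 n2 where q: "F = F1 \<union> F2" "n = n1 \<union> n2" "(F1, n1) \<in> Tseq D1" "(F2, n2) \<in> TT (Par A B) xs" "mv n1 \<inter> mv n2 = {}"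
      unfolding D(1) Tseq_append by (auto elim!: pureE simp del: TT.simps)
    note o1 = Tseq_ok[OF evs(1) q(3)]
    have evx: "\<forall>x\<in>set xs. even x" "\<forall>x\<in>set (vsD D1). even x" using evs by (auto simp: okn_def evD_def)
    have xF1: "set xs \<inter> verts F1 = {}"
    proof (rule verts_disjoint_aux[OF conjunct1[OF o1]])
      show "set xs \<inter> set (vsD D1) = {}" using evs(3) by blast
      show "set xs \<inter> mv n1 = {}" using o1 by (intro even_odd_disjoint[OF evx(1)]) blast
    qed
    \<comment> \<open>Once the context is glued, the graph is orthogonal to all pairs of
      counterproofs of \<open>A\<close> and \<open>B\<close>; the counterproofs of the par are
      exactly what is orthogonal to such elements.\<close>
    have o: "(hide (set (vsD D1)) (?E \<union> F1), n1) \<in> orth ?X xs (pure (TT A as) (TT B bs))"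
    proof (rule orthI)
      have "pol ?X xs (hide (set (vsD D1)) (?E \<union> F1))" using pE pol_disjoint[OF xF1] by (intro pol_hide) simp
      moreover have "verts (hide (set (vsD D1)) (?E \<union> F1)) \<subseteq> set xs \<union> mv n1"
      proof -
        have "verts (hide (set (vsD D1)) (?E \<union> F1)) \<subseteq> (verts ?E \<union> verts F1) - set (vsD D1)" using verts_hide[of "set (vsD D1)" "?E \<union> F1"] by simp
        moreover have "set (vsD ?D) = set xs \<union> set (vsD D1)" unfolding vs D(1) by simp
        ultimately show ?thesis using pv(2) conjunct1[OF o1] by blast
      qed
      ultimately show "okel ?X xs (hide (set (vsD D1)) (?E \<union> F1)) n1" using o1 by (simp add: okel_def)
      fix G k assume G: "(G, k) \<in> pure (TT A as) (TT B bs)" and dk: "mv n1 \<inter> mv k = {}"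
      have "(F1 \<union> G, n1 \<union> k) \<in> Tseq ?D" unfolding Tseq_append using pureI[OF q(3) _ dk, of G] G by simp
      then have P: "PP (hide (set (vsD D)) (?E \<union> (F1 \<union> G))) (n1 \<union> k)" using v unfolding valid_def vs by blast
      have "okset (map Not (fb B) @ map Not (fb A)) (bs @ as) (pure (TT B bs) (TT A as))"
        by (rule okset_pure[OF okset_TT[OF ab(2)] okset_TT[OF ab(3)]]) (use ab(1-4) in \<open>auto simp: okn_def\<close>)
      then have okG: "okel (map Not (fb B) @ map Not (fb A)) (bs @ as) G k" using G unfolding pure_commute[of "TT B bs"] by (simp add: okset_def)
      have "set (vsD D1) \<inter> verts G = {}"
      proof (rule verts_disjoint_aux[of _ "set xs" "mv k", OF _ evs(3)])
        show "verts G \<subseteq> set xs \<union> mv k" using okG ab(1) by (simp add: okel_def)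
        show "set (vsD D1) \<inter> mv k = {}" using okG by (intro even_odd_disjoint[OF evx(2)]) (simp add: okel_def)
      qed
      from hide_Un_nested[OF this] have "hide (set xs) (hide (set (vsD D1)) (?E \<union> F1) \<union> G) = hide (set xs \<union> set (vsD D1)) ((?E \<union> F1) \<union> G)" .
      then show "PP (hide (set xs) (hide (set (vsD D1)) (?E \<union> F1) \<union> G)) (n1 \<union> k)"
        using P unfolding D(1) by (simp add: Un_assoc)
    qed
    have q4: "(F2, n2) \<in> orth (map Not ?X) xs (orth ?X xs (pure (TT A as) (TT B bs)))" using q(4) unfolding T .
    have "mv n2 \<inter> mv n1 = {}" using q(5) by blast
    from orthD[OF q4 o this] have P: "PP (hide (set xs) (F2 \<union> hide (set (vsD D1)) (?E \<union> F1))) (n2 \<union> n1)" .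
    have ok2: "okel (map Not ?X) xs F2 n2" by (rule orth_okel[OF q4])
    have "set (vsD D1) \<inter> verts F2 = {}"
    proof (rule verts_disjoint_aux[of _ "set xs" "mv n2", OF _ evs(3)])
      show "verts F2 \<subseteq> set xs \<union> mv n2" using ok2 by (simp add: okel_def)
      show "set (vsD D1) \<inter> mv n2 = {}" using ok2 by (intro even_odd_disjoint[OF evx(2)]) (simp add: okel_def)
    qed
    from hide_Un_nested[OF this] have "hide (set xs) (hide (set (vsD D1)) (?E \<union> F1) \<union> F2) = hide (set xs \<union> set (vsD D1)) ((?E \<union> F1) \<union> F2)" .
    then show "PP (hide (set (vsD D)) (?E \<union> F)) n" using P unfolding D(1) q(1,2) by (simp add: Un_ac)
  qed
next
  case (tensor \<sigma> \<Gamma> A \<tau> B \<Delta>)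
  obtain D1 xs D2 where D: "D = D1 @ [(Tensor A B, xs)] @ D2" "map fst D1 = \<Gamma>" "map fst D2 = \<Delta>"
    using tensor.prems(1) by (auto simp: map_eq_append_conv map_eq_Cons_conv)
  let ?X = "fb A @ fb B"
  have evs: "evD D1" "okn ?X xs" "evD D2" "set (vsD D1) \<inter> set xs = {}" "set (vsD D1) \<inter> set (vsD D2) = {}" "set xs \<inter> set (vsD D2) = {}"
    using tensor.prems(2) unfolding D(1) evD_append evD_single by auto
  obtain as bs where ab: "xs = as @ bs" "okn (fb A) as" "okn (fb B) bs" "set as \<inter> set bs = {}"
      "as = take (length (fb A)) xs" "bs = drop (length (fb A)) xs" by (rule okn_appendE[OF evs(2)])
  have oks: "okD D1" "okD D2" using evs by (auto simp: evD_def)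
  have da: "set (vsD D1) \<inter> set as = {}" "set (vsD D1) \<inter> set bs = {}" "set (vsD D2) \<inter> set as = {}" "set (vsD D2) \<inter> set bs = {}"
      "set bs \<inter> set (vsD D2) = {}" "set (vsD D2) \<inter> set (vsD D1) = {}"
    using evs(4-6) ab(1) by auto
  have l: "length as = length (fb A)" "length bs = length (fb B)" using ab(2,3) by (auto simp: okn_def)
  have e1: "evD (D1 @ [(A, as)])" using evs(1) ab(2) da(1) by (simp add: evD_append evD_single)
  have e2: "evD ([(B, bs)] @ D2)" unfolding evD_append evD_single using evs(3) ab(3) da(5) by simp
  have e2': "evD (D2 @ [(B, bs)])" using evs(3) ab(3) da(4) by (simp add: evD_append evD_single)
  let ?E = "place (as @ vsD D1) (edges \<sigma>)" and ?F = "place (vsD D2 @ bs) (edges \<tau>)"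
  have v1: "valid (D1 @ [(A, as)]) ?E" using tensor.IH(1)[OF _ e1] D(2) by simp
  have "valid ((B, bs) # D2) ?F" using tensor.IH(2)[of "(B, bs) # D2"] e2 D(3) by simp
  moreover have "Tseq (D2 @ [(B, bs)]) = Tseq ((B, bs) # D2)" by (simp add: Tseq_append pure_commute)
  ultimately have v2: "valid (D2 @ [(B, bs)]) ?F" using valid_cong[of "D2 @ [(B, bs)]" "(B, bs) # D2"] by auto
  have okE: "okD (D1 @ [(A, as)])" "okD ((B, bs) # D2)" using e1 e2 by (auto simp: evD_def)
  have pv1: "pol (fb A @ sb \<Gamma>) (as @ vsD D1) ?E" "verts ?E \<subseteq> set as \<union> set (vsD D1)"
    using placed_pol[of \<sigma> "D1 @ [(A, as)]"] tensor.hyps(1) okE(1) D(2) by (simp_all add: seq_boundary_append)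
  have pv2: "pol (sb \<Delta> @ fb B) (vsD D2 @ bs) ?F" "verts ?F \<subseteq> set bs \<union> set (vsD D2)"
    using placed_pol[of \<tau> "(B, bs) # D2"] tensor.hyps(2) okE(2) D(3) by (simp_all add: Un_commute)
  have pE: "pol (fb A) as ?E" using pv1(1) l(1) by (simp add: pol_append del: LG_simps)
  have pF: "pol (fb B) bs ?F" using pv2(1) length_vsD[OF oks(2)] D(3) by (simp add: pol_append del: LG_simps)
  have sz: "verts (edges \<sigma>) \<subseteq> {1..length as + length (vsD D1)}" "verts (edges \<tau>) \<subseteq> {1..length (vsD D2) + length bs}"
    using derivable_verts[OF tensor.hyps(1)] derivable_verts[OF tensor.hyps(2)] l length_vsD[OF oks(1)] length_vsD[OF oks(2)] D(2,3)
    by (simp_all add: seq_boundary_append del: LG_simps)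
  have pl: "place (vsD D) (edges (tensor_mword (length (sb \<Delta>)) (length (fb A)) (length (fb B)) \<sigma> \<tau>)) = ?E \<union> ?F"
    using place_tensor[OF sz] l length_vsD[OF oks(2)] D(3) unfolding D(1) ab(1) by (simp del: LG_simps)
  have T: "TT (Tensor A B) xs = orth (map Not ?X) xs (pure (orth (fb A) as (TT A as)) (orth (fb B) bs (TT B bs)))"
    unfolding TT.simps Let_def ab(5,6)[symmetric] ..
  show ?case unfolding valid_def
  proof (intro allI impI)
    fix F n assume "(F, n) \<in> Tseq D"
    then have "(F, n) \<in> pure (TT (Tensor A B) xs) (pure (Tseq D1) (Tseq D2))"
      unfolding D(1) Tseq_append Tseq.simps fst_conv snd_conv pure_unit
      using pure_assoc[of "Tseq D1"] pure_assoc[of "TT (Tensor A B) xs"] pure_commute[of "Tseq D1" "TT (Tensor A B) xs"] by metis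
    then obtain Fx nx F1 n1 F2 n2 where q: "F = Fx \<union> (F1 \<union> F2)" "n = nx \<union> (n1 \<union> n2)" "(Fx, nx) \<in> TT (Tensor A B) xs"
        "(F1, n1) \<in> Tseq D1" "(F2, n2) \<in> Tseq D2" "mv n1 \<inter> mv n2 = {}" "mv nx \<inter> mv (n1 \<union> n2) = {}"
      by (elim pureE) blast
    let ?H1 = "hide (set (vsD D1)) (?E \<union> F1)" and ?H2 = "hide (set (vsD D2)) (?F \<union> F2)"
    have r1: "(?H1, n1) \<in> orth (fb A) as (TT A as)" by (rule valid_realizes[OF e1 v1 pE pv1(2) q(4)])
    have r2: "(?H2, n2) \<in> orth (fb B) bs (TT B bs)" by (rule valid_realizes[OF e2' v2 pF pv2(2) q(5)])
    have q3: "(Fx, nx) \<in> orth (map Not ?X) xs (pure (orth (fb A) as (TT A as)) (orth (fb B) bs (TT B bs)))" using q(3) unfolding T .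
    \<comment> \<open>The premises become proofs of \<open>A\<close> and \<open>B\<close>, and a
      counterproof of the tensor is orthogonal to their juxtaposition.\<close>
    have P: "PP (hide (set xs) (Fx \<union> (?H1 \<union> ?H2))) (nx \<union> (n1 \<union> n2))" by (rule orthD[OF q3 pureI[OF r1 r2 q(6)] q(7)])
    note o1 = Tseq_ok[OF evs(1) q(4)] and o2 = Tseq_ok[OF evs(3) q(5)]
    have okx: "okel (map Not ?X) xs Fx nx" by (rule orth_okel[OF q3])
    have ev: "\<forall>x\<in>set (vsD D1). even x" "\<forall>x\<in>set (vsD D2). even x" using evs by (auto simp: evD_def)
    have 1: "set (vsD D1) \<inter> verts (?F \<union> F2) = {}"
    proof -
      have "set (vsD D1) \<inter> verts ?F = {}" by (rule verts_disjoint_aux[OF pv2(2) da(2) evs(5)])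
      moreover have "set (vsD D1) \<inter> verts F2 = {}"
        by (rule verts_disjoint_aux[OF conjunct1[OF o2] evs(5) even_odd_disjoint[OF ev(1)]]) (use o2 in blast)
      ultimately show ?thesis by (simp add: Int_Un_distrib)
    qed
    have 2: "set (vsD D2) \<inter> verts (?E \<union> F1) = {}"
    proof -
      have "set (vsD D2) \<inter> verts ?E = {}" by (rule verts_disjoint_aux[OF pv1(2) da(3,6)])
      moreover have "set (vsD D2) \<inter> verts F1 = {}"
        by (rule verts_disjoint_aux[OF conjunct1[OF o1] da(6) even_odd_disjoint[OF ev(2)]]) (use o1 in blast)
      ultimately show ?thesis by (simp add: Int_Un_distrib)
    qed
    have 3: "(set (vsD D1) \<union> set (vsD D2)) \<inter> verts Fx = {}"
    proof (rule verts_disjoint_aux[of _ "set xs" "mv nx"])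
      show "verts Fx \<subseteq> set xs \<union> mv nx" using okx by (simp add: okel_def)
      show "(set (vsD D1) \<union> set (vsD D2)) \<inter> set xs = {}" using evs(4,6) by blast
      show "(set (vsD D1) \<union> set (vsD D2)) \<inter> mv nx = {}"
        using okx even_odd_disjoint[OF ev(1), of nx] even_odd_disjoint[OF ev(2), of nx] by (simp add: okel_def Int_Un_distrib2)
    qed
    have "hide (set xs) (Fx \<union> (?H1 \<union> ?H2)) = hide (set xs) (hide (set (vsD D1) \<union> set (vsD D2)) ((?E \<union> F1) \<union> (?F \<union> F2)) \<union> Fx)"
      unfolding hide_Un2[OF 1 2] by (simp add: Un_commute)
    also have "\<dots> = hide (set (vsD D)) ((?E \<union> ?F) \<union> F)"
      unfolding hide_Un_nested[OF 3] q(1) D(1) by (simp add: Un_ac)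
    finally show "PP (hide (set (vsD D)) (place (vsD D) (edges (tensor_mword (length (sb \<Delta>)) (length (fb A)) (length (fb B)) \<sigma> \<tau>)) \<union> F)) n"
      unfolding pl q(2) using P by simp
  qed
qed

lemma gram_sound:
  assumes "w \<in> llg_language LG"
  shows "w \<in> lists T \<and> (\<exists>t. typing \<Sigma> [] t (Atom S) \<and> map_constants g t \<approx> rho w)"
proof -
  obtain \<sigma> i j where \<sigma>: "derivable LG \<sigma> [Pos (e S)]" "edges \<sigma> = {(i, w, j)}" using assms by (auto simp: llg_language_def)
  \<comment> \<open>Interface names have to be even in the model; any two distinct even numbers
    would serve.\<close>
  let ?A = "Atom S" and ?xs = "[2, 4] :: nat list"
  have A: "?A \<in> types (atoms \<Sigma>)" using S by (simp add: types_def)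
  have tA: "tb ?A = [True, False]" by (simp add: hS bdual_def)
  have xs: "okn (tb ?A) ?xs" unfolding tA by (simp add: okn_def)
  have ev: "evD [(Pos (e S), ?xs)]" unfolding evD_single using xs fm_boundary_fmt[OF A] by simp
  have v: "valid [(Pos (e S), ?xs)] (place ?xs (edges \<sigma>))" using sound[OF \<sigma>(1) _ ev] by simp
  have pv: "pol (tb ?A) ?xs (place ?xs (edges \<sigma>))" "verts (place ?xs (edges \<sigma>)) \<subseteq> set ?xs"
    using placed_pol[of \<sigma> "[(Pos (e S), ?xs)]"] \<sigma>(1) ev fm_boundary_fmt[OF A] by (simp_all add: evD_def del: LG_simps)
  \<comment> \<open>The sequent has no other formula, so the context contributes only the empty
    tuple and no resources; the realizer will be a closed term.\<close>
  have "(hide (set (vsD [])) (place ?xs (edges \<sigma>) \<union> {}), {}) \<in> orth (fb (Pos (e S))) ?xs (TT (Pos (e S)) ?xs)"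
    by (rule valid_realizes) (use ev v pv fm_boundary_fmt[OF A] in \<open>simp_all del: LG_simps\<close>)
  then have "(place ?xs (edges \<sigma>), {}) \<in> orth (tb ?A) ?xs (tests ?A ?xs)" using fm_boundary_fmt[OF A] by (simp del: LG_simps)
  from realizer_pole[OF A A xs this] have "pole {} ?A ?xs (place ?xs (edges \<sigma>))" by auto
  then obtain \<Gamma> t where net: "net \<Gamma> (place ?xs (edges \<sigma>)) t ?A ?xs" "ran \<Gamma> = {}" unfolding pole_def by blast
  have G: "\<Gamma> = Map.empty"
  proof (rule HOL.ext)
    fix x show "\<Gamma> x = None"
    proof (cases "\<Gamma> x")
      case (Some p)
      then have "p \<in> ran \<Gamma>" by (rule ranI)
      then show ?thesis using net(2) by simp
    qed
  qed
  obtain w' where w': "w' \<in> lists T" "place ?xs (edges \<sigma>) = {(2, w', 4)}" "map_constants g t \<approx> rho w'"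
    using net_word[OF net(1)[unfolded G]] hS by auto
  have "w' = w" using w'(2) unfolding \<sigma>(2) place_def by simp
  moreover obtain L where L: "typing \<Sigma> L t ?A" "\<forall>x. map_of L x = None" using net_typing[OF net(1)] G by auto
  have "L = []"
  proof (cases L)
    case (Cons p l)
    then have "map_of L (fst p) = Some (snd p)" by (cases p) simp
    then show ?thesis using L(2) by simp
  qed
  then have "typing \<Sigma> [] t ?A" using L(1) by simp
  ultimately show ?thesis using w' by blast
qed

end

section \<open>The object signature\<close>

lemma ext_str [simp]: "ext (\<lambda>_. Atom Str_O) A = A"
  by (induction A) (auto, metis str_atom.exhaust)

lemma Str_simps [simp]: "atoms (Str T) = {Str_O}" "constants (Str T) = T" "ctype (Str T) c = Atom Str_O -\<circ> Atom Str_O"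
  by (simp_all add: Str_def)

lemma str_types: "A \<in> types {Str_O}"
  by (auto simp: types_def intro: str_atom.exhaust)

lemma inits_2: "inits 2 = [1, 2]"
  by (simp add: inits_def upt_rec)

lemma tbd_str: "tbd (Atom Str_O -\<circ> Atom Str_O) = [True, False]"
  by (simp add: bdual_def)

lemma Lset_pair: "Lset [True, False] [a, b] = {a}" and Rset_pair: "Rset [True, False] [a, b] = {b}"
  using Lset_append[of "[True]" "[a]" "[False]" "[b]"] Rset_append[of "[True]" "[a]" "[False]" "[b]"]
  by (auto simp: Lset_def Rset_def)

lemma matching_single: "w \<in> lists T \<Longrightarrow> matching T {a} {b} {(a, w, b)}"
  unfolding matching_def by auto

text \<open>The edge of a letter prepends the letter to the word of its argument, just as the
  constant does to the argument term.\<close>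

lemma lr_letter:
  assumes "z0 \<noteq> z1" "z0 \<noteq> None" "z1 \<noteq> None"
  shows "lr fl (Atom Str_O -\<circ> Atom Str_O) [z0, z1] {(z0, [a], z1)} (Const a)"
proof -
  let ?e = "{(z0, [a], z1)}"
  have p: "pol [True, False] [z0, z1] ?e" using assms unfolding pol_def Lset_pair Rset_pair by auto
  have L1: "Lset [True] [z] = {z}" "Rset [True] [z] = {}" for z :: "nat option" by (auto simp: Lset_def Rset_def)
  have "(fl \<or> no_cycle {z1} (?e \<union> F)) \<and> lr fl (Atom Str_O) [z0] (hide {z1} (?e \<union> F)) (App (Const a) s)"
    if F: "lr fl (Atom Str_O) [z1] F s" for F s
  proof (intro conjI disjI2)
    have wf: "z1 \<notin> target ` F" "verts F \<subseteq> {None, z1}" using F by (auto simp: wfg_def pol_def L1)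
    \<comment> \<open>Polarity forbids an edge of the argument into \<open>z1\<close>, so a path
      that leaves \<open>z1\<close> never returns to it.\<close>
    have out: "(z1, w, k) \<in> F \<and> k \<noteq> z1" if "(z1, w, k) \<in> ?e \<union> F" for w k
      using that wf(1) assms by force
    show "no_cycle {z1} (?e \<union> F)" unfolding no_cycle_def
    proof (intro ballI allI notI)
      fix k w assume "k \<in> {z1}" "path {z1} (?e \<union> F) k w k"
      then have "path {z1} (?e \<union> F) z1 w z1" by simp
      then show False by (cases rule: path.cases) (use out in blast)+
    qed
    have "pol [True] [z0] F" using wf(2) assms by (intro pol_disjoint) auto
    moreover have "pol [True] [z0] ?e" using p assms by (auto simp: pol_def L1)
    ultimately have "pol [True] [z0] (hide {z1} (?e \<union> F))" by (intro pol_hide pol_Un[THEN iffD2] conjI)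
    then have "wfg [True] [z0] (hide {z1} (?e \<union> F))"
      unfolding wfg_def using verts_hide[of "{z1}" "?e \<union> F"] wf(2) by auto
    moreover have "\<exists>w. hide {z1} (?e \<union> F) = {(z0, w, None)} \<and> App (Const a) s \<approx> word_term w (Var 0)" if fl
    proof -
      obtain w where w: "F = {(z1, w, None)}" "s \<approx> word_term w (Var 0)" using F \<open>fl\<close> by auto
      have "hide {z1} (?e \<union> F) = {(z0, a # w, None)}"
      proof (intro equalityI subsetI)
        fix x assume x: "x \<in> hide {z1} (?e \<union> F)"
        then obtain u v t where uv: "x = (u, v, t)" "path {z1} (?e \<union> F) u v t" "u \<noteq> z1" "t \<noteq> z1" by (auto simp: hide_def)
        from uv(2) show "x \<in> {(z0, a # w, None)}"
        proof (cases rule: path.cases)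
          case single
          then show ?thesis using uv w assms by auto
        next
          case (step v1 k v2)
          then have k: "u = z0" "v1 = [a]" "k = z1" using uv w by auto
          from step(4)[unfolded k] show ?thesis
          proof (cases rule: path.cases)
            case single
            then show ?thesis using uv w step k assms by auto
          next
            case (step v3 k' v4)
            then show ?thesis using uv w assms by auto
          qed
        qed
      next
        fix x assume "x \<in> {(z0, a # w, None :: nat option)}"
        moreover have "path {z1} (?e \<union> F) z0 ([a] @ w) None"
          by (rule path.step[of _ _ z1]) (auto simp: w intro: path.single)
        ultimately show "x \<in> hide {z1} (?e \<union> F)" using assms by (auto simp: hide_def)
      qed
      moreover have "App (Const a) s \<approx> word_term (a # w) (Var 0)" using eqv_appR[OF w(2)] by simp
      ultimately show ?thesis by blast
    qed
    ultimately show "lr fl (Atom Str_O) [z0] (hide {z1} (?e \<union> F)) (App (Const a) s)" by simp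
  qed
  then show ?thesis using p unfolding lr.simps(2) tbd_str by (simp add: wfg_def del: lr.simps)
qed

text \<open>The string signature as its own instance: a letter is its own object term and its graph
  is one labelled edge. The results on graphs of terms thereby apply to object terms.\<close>

lemma str_gnets: "gnets (Str T) (\<lambda>_. Atom Str_O) (\<lambda>a. {(1, [a], 2)}) T Const"
proof
  fix c assume c: "c \<in> constants (Str T)"
  show "matching T (Lset (tbd (ext (\<lambda>_. Atom Str_O) (ctype (Str T) c))) (inits (length (tbd (ext (\<lambda>_. Atom Str_O) (ctype (Str T) c))))))
      (Rset (tbd (ext (\<lambda>_. Atom Str_O) (ctype (Str T) c))) (inits (length (tbd (ext (\<lambda>_. Atom Str_O) (ctype (Str T) c))))))
      {(1, [c], 2)}"
  proof -
    have "length [True, False] = 2" by simp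
    then show ?thesis unfolding ext_str Str_simps tbd_str \<open>length [True, False] = 2\<close> inits_2 Lset_pair Rset_pair
      using c by (intro matching_single) simp
  qed
  show "ctype (Str T) c \<in> types (atoms (Str T))" by (simp add: str_types)
next
  fix c zs fl assume c: "c \<in> constants (Str T)" and l: "length zs = length (tbd (ext (\<lambda>_. Atom Str_O) (ctype (Str T) c)))" and d: "distinct (zs :: nat list)"
  have "length zs = 2" using l unfolding ext_str Str_simps tbd_str by simp
  then obtain z0 z1 where zs: "zs = [z0, z1]" by (auto simp: length_Suc_conv numeral_2_eq_2)
  have "relabel Some (place zs {(1, [c], 2)}) = {(Some z0, [c], Some z1)}" by (simp add: zs place_def)
  then show "lr fl (ext (\<lambda>_. Atom Str_O) (ctype (Str T) c)) (map Some zs) (relabel Some (place zs {(1, [c], 2)})) (Const c)"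
    unfolding ext_str Str_simps using lr_letter[of "Some z0" "Some z1" fl c] d zs by (simp del: lr.simps)
qed simp

text \<open>The lists may overlap, so a single swap is not enough; two swaps by way of a list that
  is fresh for both do it.\<close>

lemma exists_bij_lists:
  fixes us vs :: "nat list"
  assumes "distinct us" "distinct vs" "length us = length vs"
  obtains f where "bij f" "map f us = vs"
proof -
  obtain ws where ws: "length ws = length us" "distinct ws" "set ws \<inter> (set us \<union> set vs) = {}"
    using fresh_list[of "set us \<union> set vs" "length us"] by auto
  have d: "distinct (us @ ws)" "length us = length ws" "distinct (ws @ vs)" "length ws = length vs" using assms ws by auto
  show ?thesis
  proof (rule that)
    show "bij (swap_lists ws vs \<circ> swap_lists us ws)" by (rule bij_comp[OF bij_swap_lists[OF d(1,2)] bij_swap_lists[OF d(3,4)]])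
    have "map (swap_lists ws vs \<circ> swap_lists us ws) us = map (swap_lists ws vs) (map (swap_lists us ws) us)" by simp
    then show "map (swap_lists ws vs \<circ> swap_lists us ws) us = vs" unfolding swap_lists_map(1)[OF d(1,2)] swap_lists_map(1)[OF d(3,4)] .
  qed
qed

text \<open>Supplies the lexicon entry for the image of a constant. The graph is built on the
  vertices \<open>1..n\<close> and moved to any \<open>zs\<close> by a bijection, as nets are stable
  under renaming of vertices.\<close>

lemma object_graph:
  assumes "typing (Str T) [] u A"
  obtains E where "matching T (Lset (tbd A) (inits (length (tbd A)))) (Rset (tbd A) (inits (length (tbd A)))) E"
    "\<And>fl zs. length zs = length (tbd A) \<Longrightarrow> distinct zs \<Longrightarrow> lr fl A (map Some zs) (relabel Some (place zs E)) u"
proof -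
  interpret gnets "Str T" "\<lambda>_. Atom Str_O" "\<lambda>a. {(1, [a], 2)}" T Const by (rule str_gnets)
  let ?n = "length (tbd A)"
  have "named (\<lambda>_. []) [] = Map.empty" by (rule HOL.ext) (simp add: named_def)
  then obtain E where net: "net Map.empty E u A (inits ?n)"
    using typing_net[OF assms, of "inits ?n" "\<lambda>_. []"] by auto
  have "cL Map.empty = {}" "cR Map.empty = {}" by (simp_all add: cL_def cR_def)
  then have m: "matching T (Lset (tbd A) (inits ?n)) (Rset (tbd A) (inits ?n)) E" using net_matching[OF net] by simp
  have v: "verts E \<subseteq> {1..?n}" using net_ok[OF net] by simp
  have "lr fl A (map Some zs) (relabel Some (place zs E)) u" if zs: "length zs = ?n" "distinct zs" for fl zs
  proof -
    obtain f where f: "bij f" "map f (inits ?n) = zs" by (rule exists_bij_lists[of "inits ?n" zs]) (use zs in auto)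
    have "relabel f E = place zs E"
      using relabel_place[of E "inits ?n" f] place_inits[OF v] v f(2) by simp
    then have "net Map.empty (place zs E) u A zs" using net_mapc[OF net f(1)] f(2) by (simp add: mapc_def)
    from net_closed_lr[OF this] show ?thesis by simp
  qed
  then show ?thesis using that m by blast
qed

section \<open>Grammars for the languages with at most the empty word\<close>

text \<open>An integer invariant: identity axioms have sum zero and every rule preserves this, while
  a single positive literal has value one. So no start sequent is derivable from an empty
  lexicon.\<close>

primrec balance :: "'n fm \<Rightarrow> int" where
  "balance (Pos n) = 1"
| "balance (Neg n) = - 1"
| "balance (Tensor A B) = balance A + balance B"
| "balance (Par A B) = balance A + balance B"

lemma balance_dual: "balance (dual A) = - balance A"
  by (induction A) auto

lemma derivable_balance: "derivable G \<sigma> \<Gamma> \<Longrightarrow> lexicon G = {} \<Longrightarrow> sum_list (map balance \<Gamma>) = 0"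
  by (induction rule: derivable.induct) (auto simp: balance_dual)

lemma glue_path_label: "glue_path E u w v \<Longrightarrow> (\<And>u w v. (u, w, v) \<in> E \<Longrightarrow> w = []) \<Longrightarrow> w = []"
  by (induction rule: glue_path.induct) blast+

lemma relabel_label: "(\<And>u w v. (u, w, v) \<in> E \<Longrightarrow> w = []) \<Longrightarrow> (a, w, b) \<in> relabel f E \<Longrightarrow> w = []"
  by (auto elim: relabelE)

text \<open>No rule creates letters: a label in a conclusion is a concatenation of labels from the
  premises.\<close>

lemma derivable_label:
  "derivable G \<sigma> \<Gamma> \<Longrightarrow> (\<And>\<sigma> \<Gamma> u w v. (\<sigma>, \<Gamma>) \<in> lexicon G \<Longrightarrow> (u, w, v) \<in> edges \<sigma> \<Longrightarrow> w = []) \<Longrightarrow>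
    (u, w, v) \<in> edges \<sigma> \<Longrightarrow> w = []"
proof (induction arbitrary: u w v rule: derivable.induct)
  case (lex \<sigma> \<Gamma>)
  then show ?case by blast
next
  case (ident A)
  then show ?case by (auto simp: id_mword_def)
next
  case (cut \<sigma> \<Gamma> A \<tau> \<Delta>)
  let ?n = "length (seq_boundary (lit_boundary G) \<Delta>)" and ?m = "length (fm_boundary (lit_boundary G) A)"
  let ?E = "relabel (cut_node1 ?n ?m) (edges \<sigma>) \<union> relabel (cut_node2 ?n ?m) (edges \<tau>)"
  have 1: "w = []" if "(a, w, b) \<in> relabel (cut_node1 ?n ?m) (edges \<sigma>)" for a w b
    by (rule relabel_label[OF _ that]) (rule cut.IH(1)[OF cut.prems(1)])
  have 2: "w = []" if "(a, w, b) \<in> relabel (cut_node2 ?n ?m) (edges \<tau>)" for a w b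
    by (rule relabel_label[OF _ that]) (rule cut.IH(2)[OF cut.prems(1)])
  have "glue_path ?E (Outer u) w (Outer v)" using cut.prems(2) by (simp add: compose_alt glue_def)
  then show ?case by (rule glue_path_label) (use 1 2 in blast)
next
  case (exchange \<sigma> \<Gamma> A B \<Delta>)
  show ?case
    by (rule relabel_label[OF _ exchange.prems(2)[unfolded exchange_mword_def mword.simps]]) (rule exchange.IH[OF exchange.prems(1)])
next
  case (par \<sigma> \<Gamma> A B)
  then show ?case by blast
next
  case (tensor \<sigma> \<Gamma> A \<tau> B \<Delta>)
  from tensor.prems(2)[unfolded tensor_mword_def mword.simps] show ?case
  proof
    assume "(u, w, v) \<in> relabel (\<lambda>v. if v \<le> length (fm_boundary (lit_boundary G) A) then length (seq_boundary (lit_boundary G) \<Delta>) + v else length (seq_boundary (lit_boundary G) \<Delta>) + length (fm_boundary (lit_boundary G) B) + v) (edges \<sigma>)"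
    then show ?thesis by (rule relabel_label[rotated]) (rule tensor.IH(1)[OF tensor.prems(1)])
  next
    assume "(u, w, v) \<in> relabel (\<lambda>v. if v \<le> length (seq_boundary (lit_boundary G) \<Delta>) then v else length (fm_boundary (lit_boundary G) A) + v) (edges \<tau>)"
    then show ?thesis by (rule relabel_label[rotated]) (rule tensor.IH(2)[OF tensor.prems(1)])
  qed
qed

lemma ends_pair: "left_ends [True, False] = {1}" "right_ends [True, False] = {2}"
  by (auto simp: left_ends_def right_ends_def le_Suc_eq numeral_2_eq_2)

lemma llg_empty_language:
  assumes "finite T"
  shows "\<exists>G :: (nat, 't) llg. is_llg G \<and> alphabet G = T \<and> llg_language G = {}"
proof -
  let ?G = "\<lparr>literals = {0}, lit_boundary = (\<lambda>_. [True, False]), alphabet = T, lexicon = {}, llg_start = 0\<rparr> :: (nat, 't) llg"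
  have "is_llg ?G" using assms by (simp add: is_llg_def ends_pair)
  moreover have "llg_language ?G = {}" by (auto simp: llg_language_def dest: derivable_balance)
  ultimately show ?thesis by (intro exI[of _ ?G]) simp
qed

lemma llg_empty_word:
  assumes "finite T"
  shows "\<exists>G :: (nat, 't) llg. is_llg G \<and> alphabet G = T \<and> llg_language G = {[]}"
proof -
  let ?\<sigma> = "\<lparr>edges = {(1, [], 2)}, singular = {#}\<rparr> :: 't mword"
  let ?G = "\<lparr>literals = {0}, lit_boundary = (\<lambda>_. [True, False]), alphabet = T, lexicon = {(?\<sigma>, [Pos 0])}, llg_start = 0\<rparr> :: (nat, 't) llg"
  have "matching T (Lset [True, False] (inits 2)) (Rset [True, False] (inits 2)) {(1, [], 2)}"
    unfolding inits_2 Lset_pair Rset_pair by (rule matching_single) simp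
  then have "multiword T [True, False] ?\<sigma>" using matching_multiword[of T "[True, False]" "{(1, [], 2)}"] by (simp add: numeral_2_eq_2)
  then have "is_llg ?G" using assms by (simp add: is_llg_def ends_pair formulas_def)
  moreover have "llg_language ?G = {[]}"
  proof (intro equalityI subsetI)
    fix w assume "w \<in> llg_language ?G"
    then obtain \<sigma> i j where \<sigma>: "derivable ?G \<sigma> [Pos 0]" "edges \<sigma> = {(i, w, j)}" by (auto simp: llg_language_def)
    have "w = []" by (rule derivable_label[OF \<sigma>(1), of i w j]) (use \<sigma>(2) in auto)
    then show "w \<in> {[]}" by simp
  next
    fix w :: "'t list" assume "w \<in> {[]}"
    moreover have "derivable ?G ?\<sigma> [Pos 0]" by (rule derivable.lex) simp
    ultimately show "w \<in> llg_language ?G" by (auto simp: llg_language_def regular_def intro!: exI[of _ ?\<sigma>])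
  qed
  ultimately show ?thesis by (intro exI[of _ ?G]) simp
qed

section \<open>The theorem\<close>

text \<open>A type map commutes with implication, so it is determined by its values on
  atoms.\<close>

lemma ext_type_map:
  assumes "signature_map \<Sigma>1 \<Sigma>2 F g" "A \<in> types (atoms \<Sigma>1)"
  shows "ext (\<lambda>p. F (Atom p)) A = F A"
  using assms(2)
proof (induction A)
  case (Limp A B)
  then have "A \<in> types (atoms \<Sigma>1)" "B \<in> types (atoms \<Sigma>1)" by (auto simp: types_def)
  then show ?case using Limp.IH assms(1) by (simp add: signature_map_def)
qed simp

text \<open>Types the image of an abstract term, so that a nonempty word in the language forces the
  start type to be mapped to \<open>O -\<circ> O\<close>.\<close>

lemma typing_map_constants:
  fixes \<Sigma> :: "('n, 'c) signature" and h :: "'n \<Rightarrow> str_atom ltype"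
  assumes "\<And>c. c \<in> constants \<Sigma> \<Longrightarrow> typing (Str T) [] (g c) (ext h (ctype \<Sigma> c))"
  shows "typing \<Sigma> \<Gamma> t A \<Longrightarrow> typing (Str T) (map (map_prod id (ext h)) \<Gamma>) (map_constants g t) (ext h A)"
proof (induction rule: typing.induct)
  case (var A x)
  then show ?case using typing.var[of "ext h A" "Str T" x] by (simp add: str_types)
next
  case (const c)
  then show ?case using assms by simp
next
  case (app \<Gamma> t A B \<Delta> s)
  have "map fst (map (map_prod id (ext h)) M) = map fst M" for M :: "'n ctxt"
    by (induction M) auto
  then have "distinct (map fst (map (map_prod id (ext h)) \<Gamma> @ map (map_prod id (ext h)) \<Delta>))"
    using app.hyps(3) by (simp only: map_append)
  from typing.app[OF app.IH(1)[unfolded ext.simps] app.IH(2) this] show ?case by (simp add: id_def)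
next
  case (abs \<Gamma> A \<Delta> t B)
  have "map (map_prod id (ext h)) (shift_ctxt L) = shift_ctxt (map (map_prod id (ext h)) L)" for L
    by (induction L) (auto simp: shift_ctxt_def)
  then show ?case using abs.IH typing.abs[of "Str T" "map (map_prod id (ext h)) \<Gamma>" "ext h A" "map (map_prod id (ext h)) \<Delta>"]
    by (simp add: id_def)
qed

theorem mainTheorem2:
  fixes T :: "'t set"
    and L :: "'t list set"
    and G :: "('n, 'c, str_atom, 't) acg"
  assumes "finite T"
    and "L \<subseteq> lists T"
    and "string_acg T G"
    and "L = acg_language G"
  shows "\<exists>G' :: (nat, 't) llg. is_llg G' \<and> alphabet G' = T \<and> L = llg_language G'"
proof -
  define \<Sigma> where "\<Sigma> = abstr G"
  define F where "F = type_map G"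
  define g where "g = const_map G"
  define S where "S = acg_start G"
  define h where "h p = F (Atom p)" for p
  have acg: "linear_signature \<Sigma>" "signature_map \<Sigma> (Str T) F g" "S \<in> atoms \<Sigma>" "obj G = Str T"
    using assms(3) by (auto simp: string_acg_def is_acg_def \<Sigma>_def F_def g_def S_def)
  have ty: "ctype \<Sigma> c \<in> types (atoms \<Sigma>)" if "c \<in> constants \<Sigma>" for c
    using acg(1) that by (simp add: linear_signature_def)
  have gtyp: "typing (Str T) [] (g c) (ext h (ctype \<Sigma> c))" if "c \<in> constants \<Sigma>" for c
    using acg(2) that ext_type_map[OF acg(2) ty[OF that]] by (simp add: signature_map_def h_def[abs_def])
  have L: "L = {w \<in> lists T. \<exists>t. typing \<Sigma> [] t (Atom S) \<and> rho w \<approx> map_constants g t}"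
    using assms(4) acg(4) by (simp add: acg_language_def \<Sigma>_def S_def g_def)
  show ?thesis
  proof (cases "h S = Atom Str_O -\<circ> Atom Str_O")
    case False
    have "w = []" if w: "w \<in> L" for w
    proof (rule ccontr)
      assume "w \<noteq> []"
      obtain t where t: "typing \<Sigma> [] t (Atom S)" "rho w \<approx> map_constants g t" using w L by blast
      have "typing (Str T) [] (map_constants g t) (h S)" using typing_map_constants[OF gtyp t(1)] by simp
      then show False using rho_equiv_typed[OF t(2) _ \<open>w \<noteq> []\<close>] False by blast
    qed
    \<comment> \<open>It need not be decided which of the two occurs, since each language has a
      grammar of its own.\<close>
    then have "L = {} \<or> L = {[]}" by blast
    then show ?thesis using llg_empty_language[OF assms(1)] llg_empty_word[OF assms(1)] by metis
  next
    case True
    \<comment> \<open>Bundles what the locale asks of the graph of a constant, so that all graphs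
      can be chosen at once.\<close>
    define P where "P c E \<longleftrightarrow> matching T (Lset (tbd (ext h (ctype \<Sigma> c))) (inits (length (tbd (ext h (ctype \<Sigma> c))))))
        (Rset (tbd (ext h (ctype \<Sigma> c))) (inits (length (tbd (ext h (ctype \<Sigma> c)))))) E \<and>
      (\<forall>fl zs. length zs = length (tbd (ext h (ctype \<Sigma> c))) \<longrightarrow> distinct zs \<longrightarrow>
        lr fl (ext h (ctype \<Sigma> c)) (map Some zs) (relabel Some (place zs E)) (g c))" for c and E :: "(nat, 't) edge set"
    have "\<exists>E. P c E" if "c \<in> constants \<Sigma>" for c
      using object_graph[OF gtyp[OF that]] unfolding P_def by metis
    then have "\<exists>\<kappa>. \<forall>c\<in>constants \<Sigma>. P c (\<kappa> c)" by (intro bchoice ballI)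
    then obtain \<kappa> where \<kappa>: "\<And>c. c \<in> constants \<Sigma> \<Longrightarrow> P c (\<kappa> c)" by blast
    have fin: "finite (atoms \<Sigma>)" "finite (constants \<Sigma>)" using acg(1) by (auto simp: linear_signature_def)
    \<comment> \<open>The atoms come from an arbitrary type while the literals are natural numbers;
      finiteness provides the encoding.\<close>
    obtain e :: "'n \<Rightarrow> nat" where e: "inj_on e (atoms \<Sigma>)" using finite_imp_inj_to_nat_seg[OF fin(1)] by blast
    interpret gram \<Sigma> h \<kappa> T g e S
    proof
      fix c assume c: "c \<in> constants \<Sigma>"
      show "matching T (Lset (tbd (ext h (ctype \<Sigma> c))) (inits (length (tbd (ext h (ctype \<Sigma> c))))))
        (Rset (tbd (ext h (ctype \<Sigma> c))) (inits (length (tbd (ext h (ctype \<Sigma> c)))))) (\<kappa> c)" using \<kappa>[OF c] by (simp add: P_def)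
      show "ctype \<Sigma> c \<in> types (atoms \<Sigma>)" by (rule ty[OF c])
      show "occurrences (g c) x = 0" for x by (rule typing_closed[OF gtyp[OF c]])
      show "lr fl (ext h (ctype \<Sigma> c)) (map Some zs) (relabel Some (place zs (\<kappa> c))) (g c)"
        if "length zs = length (tbd (ext h (ctype \<Sigma> c)))" "distinct zs" for fl zs
        using \<kappa>[OF c] that unfolding P_def by blast
    qed (use fin e acg(3) True assms(1) in auto)
    have "L = llg_language LG"
    proof (intro equalityI subsetI)
      fix w assume "w \<in> L"
      then obtain t where t: "typing \<Sigma> [] t (Atom S)" "rho w \<approx> map_constants g t" using L by blast
      obtain v where v: "v \<in> llg_language LG" "map_constants g t \<approx> rho v" using gram_complete[OF t(1)] by blast
      \<comment> \<open>Completeness finds some word for the same term; confluence identifies it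
        with \<open>w\<close>.\<close>
      have "w = v" by (rule rho_beta_eta_inj[OF eqv_trans[OF t(2) v(2)]])
      then show "w \<in> llg_language LG" using v(1) by simp
    next
      fix w assume "w \<in> llg_language LG"
      then show "w \<in> L" using gram_sound[of w] eqv_sym unfolding L by blast
    qed
    then show ?thesis using is_llg_LG by (intro exI[of _ LG]) simp
  qed
qed

end
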